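(* Let $\mathbf b,\mathbf d$ be connected Hopf monoids in species and $\pi:\mathbf b\twoheadrightarrow\mathbf d$ a surjective morphism of Hopf monoids with $\mathbf d$ commutative, equipped with the filtration data described in the context (filtrations $\mathbf b_{(r)}$, $\mathbf d_{(r)}$ preserved by $\pi$, and complements $\mathbf b^{[r]}$). For $r\ge1$ let $\mathcal I^{(r)}$ be the ideal of the Hopf monoid $\mathbf b\cdot\mathbf d_{(r)}$ generated by $\{b\otimes1_{\mathbf d}-1_{\mathbf b}\otimes\pi(b): b\in\mathbf b_{(r)}^+\}$, and let $\mathbf c^{(r)}:=(\mathbf b\cdot\mathbf d_{(r)})/\mathcal I^{(r)}$ with quotient map $\vartheta_r$. For $r<s$ let $\varsigma^r$ be any linear section of $\vartheta_r$, $\iota:\mathbf b\cdot\mathbf d_{(r)}\hookrightarrow\mathbf b\cdot\mathbf d_{(s)}$ the inclusion, and $\pi^r_s:=\vartheta_s\circ\iota\circ\varsigma^r:\mathbf c^{(r)}\to\mathbf c^{(s)}$. Let $\mathsf{port}_1$ be the isomorphism $\mathbf b\cong\mathbf b\cdot\mathbf d_{(1)}=\mathbf c^{(1)}$, and put $\mathsf{port}_r=\pi^{r-1}_r\circ\cdots\circ\pi^1_2\circ\mathsf{port}_1$, $\mathsf{port}^r_s=\pi^{s-1}_s\circ\cdots\circ\pi^{r}_{r+1}$, and $\mathsf{port}^s=\cdots\circ\pi^{s+1}_{s+2}\circ\pi^s_{s+1}$, where the subspace $\mathbf 1\cdot\mathbf d_{(i)}$ of $\mathbf c^{(i)}$ is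 identified with $\mathbf d_{(i)}$ and hence with a subspecies of $\mathbf d$. Then $\{\mathbf c^{(r)}\}_{r\ge1}$ with these carrying maps comprises an interpolating family of Hopf monoids between $\mathbf b$ and $\mathbf d$: each $\mathbf c^{(r)}$ is a Hopf monoid, all the maps $\mathsf{port}_r,\mathsf{port}^r_s,\mathsf{port}^r$ are well-defined Hopf monoid morphisms with $\mathsf{port}_s=\mathsf{port}^r_s\circ\mathsf{port}_r$, $\mathsf{port}^r=\mathsf{port}^s\circ\mathsf{port}^r_s$, $\mathsf{port}^r_t=\mathsf{port}^s_t\circ\mathsf{port}^r_s$ ($r<s<t$), and $\pi=\mathsf{port}^r\circ\mathsf{port}_r$ for all $r$.
   Context: Work over a field $\Bbbk$ of characteristic $0$; species are functors from finite sets with bijections to finite-dimensional vector spaces, with Cauchy product $(\mathbf p\cdot\mathbf q)[I]=\bigoplus_{S\sqcup T=I}\mathbf p[S]\otimes\mathbf q[T]$, unit $\mathbf 1$, and trivial braiding; (co)monoids, bimonoids and Hopf monoids are taken in this braided monoidal category. Connected means $\mathbf b[\emptyset]\cong\Bbbk$. The Cauchy product $\mathbf b\cdot\mathbf d'$ of Hopf monoids is a Hopf monoid with coordinatewise product and coproduct. For a species $\mathbf p$ let $\mathbf p_{\le n}$ be the part supported on sets of size at most $n$. Standing data: (1) an increasing filtration $\mathbf1\subseteq\mathbf b_{(1)}\subseteq\mathbf b_{(2)}\subseteq\cdots$ of $\mathbf b$ by subcomonoids, and an increasing filtration $\mathbf 1=\mathbf d_{(1)}\subseteq\mathbf d_{(2)}\subseteq\cdots$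 of $\mathbf d$ by Hopf submonoids, each converging to the ambient species (for every $n$ there is $r_0$ with $(\mathbf b_{(r)})_{\le n}\cong\mathbf b_{\le n}$, resp. for $\mathbf d$, for $r>r_0$); writing $\mathbf b_{(r)}=\mathbf 1+\mathbf b_{(r)}^+$, one has $\mathbf b_{(1)}^+=0$; (2) $\pi(\mathbf b_{(r)})\subseteq\mathbf d_{(r)}$ for all $r$; (3) species complements $\mathbf b=\mathbf b^{[r]}+\langle\mathbf b_{(r)}^+\rangle$, where $\langle\mathbf b_{(r)}^+\rangle$ is the ideal of $\mathbf b$ generated by $\mathbf b^+_{(r)}$, are chosen with $\mathbf b^{[r]}\supseteq\mathbf b^{[s]}\supseteq\mathbf 1$ for $r<s$; (4) the antipode of $\mathbf b$ maps each $\mathbf b_{(r)}$ into itself. An interpolating family of Hopf monoids between $\mathbf b$ and $\mathbf d$ (factoring $\pi$) means a family of Hopf monoids $\mathbf c^{(r)}$ (here $\mathbf c^{(r)}$ is, as a species, $\mathbf b^{[r]}\cdot\mathbf d_{(r)}$) together with surjective Hopf morphisms $\mathsf{port}_r:\mathbf b\to\mathbf c^{(r)}$, $\mathsf{port}^r_s:\mathbf c^{(r)}\to\mathbf c^{(s)}$, $\mathsf{port}^r:\mathbf c^{(r)}\to\mathbf d$ satisfying the compositional identities listed in the claim and $\pi=\mathsf{port}^r\circ\mathsf{port}_r$.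
   Formalization: Surjectivity of port_s and port^r_s (part of "interpolating family") is asserted only when d_(s) is the submonoid generated by π(b_(s)); without this it can fail (b=d exponential, b_(2)=1, d_(2)=d). port^r is surjective in all cases. *)

theory Defs
  imports Complex_Main "HOL-Library.Function_Algebras" "HOL-Library.Infinite_Typeclass"
begin

section \<open>Linear algebra\<close>

text \<open>
  A vector space over the field \<open>'k\<close> is a subspace \<open>V\<close> of an ambient space, that is, of a type
  \<open>'v::ab_group_add\<close> with a scalar multiplication \<open>s :: 'k \<Rightarrow> 'v \<Rightarrow> 'v\<close> such that \<open>vector_space s\<close>.
\<close>

definition linear_on ::
    "('k \<Rightarrow> 'v \<Rightarrow> 'v) \<Rightarrow> ('k \<Rightarrow> 'w \<Rightarrow> 'w) \<Rightarrow> 'v set \<Rightarrow> ('v::ab_group_add \<Rightarrow> 'w::ab_group_add) \<Rightarrow> bool" where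
  "linear_on s1 s2 V f \<longleftrightarrow>
     (\<forall>x\<in>V. \<forall>y\<in>V. f (x + y) = f x + f y) \<and> (\<forall>c. \<forall>x\<in>V. f (s1 c x) = s2 c (f x))"

definition bilinear_on ::
    "('k \<Rightarrow> 'v \<Rightarrow> 'v) \<Rightarrow> ('k \<Rightarrow> 'w \<Rightarrow> 'w) \<Rightarrow> ('k \<Rightarrow> 'u \<Rightarrow> 'u) \<Rightarrow> 'v set \<Rightarrow> 'w set \<Rightarrow>
     ('v::ab_group_add \<Rightarrow> 'w::ab_group_add \<Rightarrow> 'u::ab_group_add) \<Rightarrow> bool" where
  "bilinear_on s1 s2 s3 V W F \<longleftrightarrow>
     (\<forall>w\<in>W. linear_on s1 s3 V (\<lambda>v. F v w)) \<and> (\<forall>v\<in>V. linear_on s2 s3 W (F v))"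

definition fscale :: "'k::times \<Rightarrow> ('x \<Rightarrow> 'k) \<Rightarrow> 'x \<Rightarrow> 'k" where
  "fscale c f = (\<lambda>x. c * f x)"

text \<open>
  The quotient of the ambient space by \<open>U\<close>. The class of \<open>v\<close> is encoded by the values at \<open>v\<close> of
  all linear functionals that vanish on \<open>U\<close>. Over a field these functionals separate the cosets
  of \<open>U\<close> (lemma \<open>qclass_eq_iff\<close>), so that \<open>qclass s U ` V\<close> is \<open>V / U\<close> for subspaces \<open>U \<subseteq> V\<close>.
\<close>

definition qclass :: "('k::field \<Rightarrow> 'v::ab_group_add \<Rightarrow> 'v) \<Rightarrow> 'v set \<Rightarrow> 'v \<Rightarrow> ('v \<Rightarrow> 'k) \<Rightarrow> 'k" where
  "qclass s U v =
     (\<lambda>\<phi>. if Vector_Spaces.linear s (*) \<phi> \<and> (\<forall>u\<in>U. \<phi> u = 0) then \<phi> v else 0)"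

text \<open>
  The tensor \<open>v \<otimes> w\<close> is encoded by its values at all bilinear forms on the ambient spaces; thus
  the tensor product of subspaces \<open>V\<close> and \<open>W\<close> is the span of the \<open>v \<otimes> w\<close> with \<open>v \<in> V\<close>, \<open>w \<in> W\<close>.
  Lemma \<open>tensor_lift_sum\<close> is the universal property.
\<close>

type_synonym ('k, 'v, 'w) tensor = "('v \<Rightarrow> 'w \<Rightarrow> 'k) \<Rightarrow> 'k"

definition bilinear_form ::
    "('k::field \<Rightarrow> 'v::ab_group_add \<Rightarrow> 'v) \<Rightarrow> ('k \<Rightarrow> 'w::ab_group_add \<Rightarrow> 'w) \<Rightarrow> ('v \<Rightarrow> 'w \<Rightarrow> 'k) \<Rightarrow> bool" where
  "bilinear_form s1 s2 \<beta> \<longleftrightarrow>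
     (\<forall>w. Vector_Spaces.linear s1 (*) (\<lambda>v. \<beta> v w)) \<and> (\<forall>v. Vector_Spaces.linear s2 (*) (\<beta> v))"

definition tensor ::
    "('k::field \<Rightarrow> 'v::ab_group_add \<Rightarrow> 'v) \<Rightarrow> ('k \<Rightarrow> 'w::ab_group_add \<Rightarrow> 'w) \<Rightarrow> 'v \<Rightarrow> 'w \<Rightarrow> ('k, 'v, 'w) tensor" where
  "tensor s1 s2 v w = (\<lambda>\<beta>. if bilinear_form s1 s2 \<beta> then \<beta> v w else 0)"

definition tensor_space ::
    "('k::field \<Rightarrow> 'v::ab_group_add \<Rightarrow> 'v) \<Rightarrow> ('k \<Rightarrow> 'w::ab_group_add \<Rightarrow> 'w) \<Rightarrow> 'v set \<Rightarrow> 'w set \<Rightarrow>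
     ('k, 'v, 'w) tensor set" where
  "tensor_space s1 s2 V W = module.span fscale {tensor s1 s2 v w | v w. v \<in> V \<and> w \<in> W}"

text \<open>
  The linear map \<open>V \<otimes> W \<rightarrow> U\<close> induced by \<open>F : V \<times> W \<rightarrow> U\<close>, which sends \<open>\<Sum> v\<^sub>i \<otimes> w\<^sub>i\<close> to \<open>\<Sum> F v\<^sub>i w\<^sub>i\<close>.
  For bilinear \<open>F\<close> the result does not depend on the chosen representation.
\<close>

definition tensor_lift ::
    "('k::field \<Rightarrow> 'v::ab_group_add \<Rightarrow> 'v) \<Rightarrow> ('k \<Rightarrow> 'w::ab_group_add \<Rightarrow> 'w) \<Rightarrow> 'v set \<Rightarrow> 'w set \<Rightarrow>
     ('v \<Rightarrow> 'w \<Rightarrow> 'u::ab_group_add) \<Rightarrow> ('k, 'v, 'w) tensor \<Rightarrow> 'u" where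
  "tensor_lift s1 s2 V W F t =
     (let xs = (SOME xs. set xs \<subseteq> V \<times> W \<and> t = (\<Sum>(v, w)\<leftarrow>xs. tensor s1 s2 v w))
      in \<Sum>(v, w)\<leftarrow>xs. F v w)"

lemma vector_space_field: "vector_space ((*) :: 'k::field \<Rightarrow> 'k \<Rightarrow> 'k)"
  by unfold_locales (auto simp: algebra_simps)

lemma separating_functional:
  assumes s: "vector_space s" and U: "module.subspace s U" and v: "v \<notin> U"
  obtains \<phi> where "Vector_Spaces.linear s (*) \<phi>" "\<And>u. u \<in> U \<Longrightarrow> \<phi> u = 0" "\<phi> v = 1"
proof -
  interpret vs: vector_space s by (fact s)
  interpret k: vector_space "(*) :: 'a \<Rightarrow> 'a \<Rightarrow> 'a" by (rule vector_space_field)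
  interpret p: vector_space_pair s "(*) :: 'a \<Rightarrow> 'a \<Rightarrow> 'a" ..
  obtain A where A: "A \<subseteq> U" "vs.independent A" "U \<subseteq> vs.span A"
    using vs.maximal_independent_subset by blast
  have "vs.span A = U" using A U vs.span_subspace by blast
  with v have "vs.independent (insert v A)" using A vs.independent_insertI by blast
  then obtain \<phi> where \<phi>: "Vector_Spaces.linear s (*) \<phi>" "\<forall>x\<in>insert v A. \<phi> x = (if x = v then 1 else 0)"
    using p.linear_independent_extend[of "insert v A" "\<lambda>x. if x = v then 1 else 0"] by blast
  interpret l: Vector_Spaces.linear s "(*)" \<phi> by fact
  have "\<phi> u = 0" if "u \<in> U" for u
  proof -
    have "u \<in> vs.span A" using that A by blast
    moreover have "\<phi> x = 0" if "x \<in> A" for x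
      using that v A \<phi>(2) by auto
    ultimately show ?thesis
      by (rule l.eq_0_on_span[rotated]) auto
  qed
  with \<phi> show ?thesis using that by auto
qed

lemma qclass_eq_iff:
  assumes s: "vector_space s" and U: "module.subspace s U"
  shows "qclass s U v = qclass s U w \<longleftrightarrow> v - w \<in> U"
proof -
  interpret vs: vector_space s by (fact s)
  show ?thesis
  proof
    assume eq: "qclass s U v = qclass s U w"
    show "v - w \<in> U"
    proof (rule ccontr)
      assume "v - w \<notin> U"
      then obtain \<phi> where \<phi>: "Vector_Spaces.linear s (*) \<phi>" "\<And>u. u \<in> U \<Longrightarrow> \<phi> u = 0" "\<phi> (v - w) = 1"
        using separating_functional[OF s U] by blast
      have "\<phi> v = \<phi> w" using fun_cong[OF eq, of \<phi>] \<phi> by (simp add: qclass_def)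
      then show False
        using \<phi>(3) module_hom.diff[of s "(*)" \<phi> v w] \<phi>(1) by (simp add: module_hom_iff_linear)
    qed
  next
    assume "v - w \<in> U"
    then show "qclass s U v = qclass s U w"
      by (auto simp: qclass_def fun_eq_iff simp flip: module_hom_iff_linear dest!: module_hom.diff[of _ _ _ v w])
  qed
qed

lemma linear_projection:
  assumes s: "vector_space s" and V: "module.subspace s V"
  obtains p where "Vector_Spaces.linear s s p" "\<And>v. p v \<in> V" "\<And>v. v \<in> V \<Longrightarrow> p v = v"
proof -
  interpret vs: vector_space s by (fact s)
  interpret p: vector_space_pair s s ..
  have "Vector_Spaces.linear s s id" by (rule vs.linear_id)
  then obtain g where g: "range g \<subseteq> V" "Vector_Spaces.linear s s g" "\<forall>v\<in>V. g (id v) = v"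
    using p.linear_exists_left_inverse_on[of id V] V by (metis UNIV_I image_subset_iff inj_on_id)
  then show ?thesis using that[of g] by auto
qed
lemma bilinear_on_sum_zero:
  assumes s1: "vector_space s1" and s2: "vector_space s2" and s3: "vector_space s3"
    and V: "module.subspace s1 V" and W: "module.subspace s2 W"
    and F: "bilinear_on s1 s2 s3 V W F"
    and xs: "set xs \<subseteq> V \<times> W" "set ys \<subseteq> V \<times> W"
    and eq: "(\<Sum>(v, w)\<leftarrow>xs. tensor s1 s2 v w) = (\<Sum>(v, w)\<leftarrow>ys. tensor s1 s2 v w)"
  shows "(\<Sum>(v, w)\<leftarrow>xs. F v w) = (\<Sum>(v, w)\<leftarrow>ys. F v w)"
proof (rule ccontr)
  interpret v3: vector_space s3 by (fact s3)
  assume "\<not> ?thesis"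
  then have "(\<Sum>(v, w)\<leftarrow>xs. F v w) - (\<Sum>(v, w)\<leftarrow>ys. F v w) \<notin> {0}" by simp
  then obtain \<phi> where \<phi>: "Vector_Spaces.linear s3 (*) \<phi>"
      "\<phi> ((\<Sum>(v, w)\<leftarrow>xs. F v w) - (\<Sum>(v, w)\<leftarrow>ys. F v w)) = 1"
    using separating_functional[OF s3, of "{0}"] v3.subspace_single_0 by metis
  interpret l: Vector_Spaces.linear s3 "(*)" \<phi> by fact
  obtain p where p: "Vector_Spaces.linear s1 s1 p" "\<And>v. p v \<in> V" "\<And>v. v \<in> V \<Longrightarrow> p v = v"
    using linear_projection[OF s1 V] by blast
  obtain q where q: "Vector_Spaces.linear s2 s2 q" "\<And>v. q v \<in> W" "\<And>v. v \<in> W \<Longrightarrow> q v = v"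
    using linear_projection[OF s2 W] by blast
  define \<beta> where "\<beta> v w = \<phi> (F (p v) (q w))" for v w
  have \<beta>: "bilinear_form s1 s2 \<beta>"
    unfolding bilinear_form_def Vector_Spaces.linear_iff
    using F p(2) q(2) s1 s2 vector_space_field
    by (simp add: \<beta>_def bilinear_on_def linear_on_def l.add l.scale
        module_hom.add[OF p(1)[folded module_hom_iff_linear]] module_hom.scale[OF p(1)[folded module_hom_iff_linear]]
        module_hom.add[OF q(1)[folded module_hom_iff_linear]] module_hom.scale[OF q(1)[folded module_hom_iff_linear]])
  have key: "(\<Sum>(v, w)\<leftarrow>zs. tensor s1 s2 v w) \<beta> = \<phi> (\<Sum>(v, w)\<leftarrow>zs. F v w)" if "set zs \<subseteq> V \<times> W" for zs
    using that \<beta> by (induction zs) (auto simp: tensor_def \<beta>_def p q l.add l.zero)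
  show False
    using key[OF xs(1)] key[OF xs(2)] eq \<phi>(2) by (simp add: l.diff)
qed


lemma tensor_lift_sum:
  assumes s1: "vector_space s1" and s2: "vector_space s2" and s3: "vector_space s3"
    and V: "module.subspace s1 V" and W: "module.subspace s2 W"
    and F: "bilinear_on s1 s2 s3 V W F"
    and xs: "set xs \<subseteq> V \<times> W"
  shows "tensor_lift s1 s2 V W F (\<Sum>(v, w)\<leftarrow>xs. tensor s1 s2 v w) = (\<Sum>(v, w)\<leftarrow>xs. F v w)"
proof -
  let ?P = "\<lambda>ys. set ys \<subseteq> V \<times> W \<and> (\<Sum>(v, w)\<leftarrow>xs. tensor s1 s2 v w) = (\<Sum>(v, w)\<leftarrow>ys. tensor s1 s2 v w)"
  have "?P (SOME ys. ?P ys)"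
    by (rule someI[of ?P xs]) (simp add: xs)
  then show ?thesis
    unfolding tensor_lift_def Let_def
    using bilinear_on_sum_zero[OF s1 s2 s3 V W F xs, of "SOME ys. ?P ys"] by metis
qed


section \<open>Species\<close>

text \<open>
  The finite sets are the finite subsets of an infinite type \<open>'l\<close>; a bijection \<open>I \<rightarrow> J\<close> is a function
  \<open>\<sigma>\<close> that is injective on \<open>I\<close> with \<open>\<sigma> ` I = J\<close>, and \<open>act P \<sigma> I\<close> is the linear map \<open>P[\<sigma>] : P[I] \<rightarrow> P[J]\<close>.
\<close>

record ('k, 'l, 'v) species =
  scl :: "'k \<Rightarrow> 'v \<Rightarrow> 'v"
  spc :: "'l set \<Rightarrow> 'v set"
  act :: "('l \<Rightarrow> 'l) \<Rightarrow> 'l set \<Rightarrow> 'v \<Rightarrow> 'v"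

locale species =
  fixes P :: "('k::field, 'l, 'v::ab_group_add, 'z) species_scheme"
  assumes ambient: "vector_space (scl P)"
    and subspace: "finite I \<Longrightarrow> module.subspace (scl P) (spc P I)"
    and finite_dim: "finite I \<Longrightarrow> \<exists>A. finite A \<and> spc P I \<subseteq> module.span (scl P) A"
    and act_closed: "finite I \<Longrightarrow> inj_on \<sigma> I \<Longrightarrow> x \<in> spc P I \<Longrightarrow> act P \<sigma> I x \<in> spc P (\<sigma> ` I)"
    and act_linear: "finite I \<Longrightarrow> inj_on \<sigma> I \<Longrightarrow> linear_on (scl P) (scl P) (spc P I) (act P \<sigma> I)"
    and act_cong: "finite I \<Longrightarrow> inj_on \<sigma> I \<Longrightarrow> (\<And>i. i \<in> I \<Longrightarrow> \<sigma> i = \<tau> i) \<Longrightarrow> x \<in> spc P I \<Longrightarrow>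
      act P \<sigma> I x = act P \<tau> I x"
    and act_id: "finite I \<Longrightarrow> x \<in> spc P I \<Longrightarrow> act P id I x = x"
    and act_comp: "finite I \<Longrightarrow> inj_on \<sigma> I \<Longrightarrow> inj_on \<tau> (\<sigma> ` I) \<Longrightarrow> x \<in> spc P I \<Longrightarrow>
      act P (\<tau> \<circ> \<sigma>) I x = act P \<tau> (\<sigma> ` I) (act P \<sigma> I x)"

definition species_morphism ::
    "('k::field, 'l, 'v::ab_group_add, 'z) species_scheme \<Rightarrow> ('k, 'l, 'w::ab_group_add, 'y) species_scheme \<Rightarrow>
     ('l set \<Rightarrow> 'v \<Rightarrow> 'w) \<Rightarrow> bool" where
  "species_morphism P Q f \<longleftrightarrow> species P \<and> species Q \<and>
     (\<forall>I. finite I \<longrightarrow> f I ` spc P I \<subseteq> spc Q I \<and> linear_on (scl P) (scl Q) (spc P I) (f I)) \<and>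
     (\<forall>I \<sigma>. finite I \<and> inj_on \<sigma> I \<longrightarrow>
        (\<forall>x\<in>spc P I. f (\<sigma> ` I) (act P \<sigma> I x) = act Q \<sigma> I (f I x)))"

definition subspecies ::
    "('k::field, 'l, 'v::ab_group_add, 'z) species_scheme \<Rightarrow> ('l set \<Rightarrow> 'v set) \<Rightarrow> bool" where
  "subspecies P Q \<longleftrightarrow> (\<forall>I. finite I \<longrightarrow> Q I \<subseteq> spc P I) \<and> species (P\<lparr>spc := Q\<rparr>)"

definition cauchy_space ::
    "('k::field \<Rightarrow> 'v::ab_group_add \<Rightarrow> 'v) \<Rightarrow> ('k \<Rightarrow> 'w::ab_group_add \<Rightarrow> 'w) \<Rightarrow>
     ('l set \<Rightarrow> 'v set) \<Rightarrow> ('l set \<Rightarrow> 'w set) \<Rightarrow> 'l set \<Rightarrow> ('l set \<Rightarrow> ('k, 'v, 'w) tensor) set" where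
  "cauchy_space s1 s2 p q I =
     {f. \<forall>S. if S \<subseteq> I then f S \<in> tensor_space s1 s2 (p S) (q (I - S)) else f S = 0}"

definition summand :: "'l set \<Rightarrow> 't \<Rightarrow> 'l set \<Rightarrow> 't::zero" where
  "summand S t = (\<lambda>U. if U = S then t else 0)"


section \<open>Hopf monoids\<close>

text \<open>
  The structure maps are given by their components: the product \<open>mul H S T\<close> on
  \<open>H[S] \<otimes> H[T]\<close> as a bilinear map, the coproduct \<open>cop H S T : H[S \<squnion> T] \<rightarrow> H[S] \<otimes> H[T]\<close>, the unit
  \<open>\<one> \<rightarrow> H\<close> as an element of \<open>H[\<emptyset>]\<close>, and the counit \<open>H \<rightarrow> \<one>\<close> as a functional on \<open>H[\<emptyset>]\<close>.
\<close>

record ('k, 'l, 'v) hopf_data = "('k, 'l, 'v) species" +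
  mul :: "'l set \<Rightarrow> 'l set \<Rightarrow> 'v \<Rightarrow> 'v \<Rightarrow> 'v"
  unt :: 'v
  cop :: "'l set \<Rightarrow> 'l set \<Rightarrow> 'v \<Rightarrow> ('k, 'v, 'v) tensor"
  cnt :: "'v \<Rightarrow> 'k"

abbreviation disj :: "'l set \<Rightarrow> 'l set \<Rightarrow> bool" where
  "disj S T \<equiv> finite S \<and> finite T \<and> S \<inter> T = {}"

text \<open>Sweedler notation: if \<open>cop H S T x = \<Sum> x\<^sub>1 \<otimes> x\<^sub>2\<close>, then \<open>sweedler H S T F x = \<Sum> F x\<^sub>1 x\<^sub>2\<close>.\<close>

definition sweedler ::
    "('k::field, 'l, 'v::ab_group_add, 'z) hopf_data_scheme \<Rightarrow> 'l set \<Rightarrow> 'l set \<Rightarrow>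
     ('v \<Rightarrow> 'v \<Rightarrow> 'u::ab_group_add) \<Rightarrow> 'v \<Rightarrow> 'u" where
  "sweedler H S T F x = tensor_lift (scl H) (scl H) (spc H S) (spc H T) F (cop H S T x)"

locale species_monoid = species H
  for H :: "('k::field, 'l, 'v::ab_group_add, 'z) hopf_data_scheme" +
  assumes mul_closed: "disj S T \<Longrightarrow> x \<in> spc H S \<Longrightarrow> y \<in> spc H T \<Longrightarrow> mul H S T x y \<in> spc H (S \<union> T)"
    and mul_bilinear: "disj S T \<Longrightarrow>
      bilinear_on (scl H) (scl H) (scl H) (spc H S) (spc H T) (mul H S T)"
    and mul_natural: "disj S T \<Longrightarrow> inj_on \<sigma> (S \<union> T) \<Longrightarrow> x \<in> spc H S \<Longrightarrow> y \<in> spc H T \<Longrightarrow>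
      act H \<sigma> (S \<union> T) (mul H S T x y) = mul H (\<sigma> ` S) (\<sigma> ` T) (act H \<sigma> S x) (act H \<sigma> T y)"
    and mul_assoc: "disj R S \<Longrightarrow> disj R T \<Longrightarrow> disj S T \<Longrightarrow>
      x \<in> spc H R \<Longrightarrow> y \<in> spc H S \<Longrightarrow> z \<in> spc H T \<Longrightarrow>
      mul H (R \<union> S) T (mul H R S x y) z = mul H R (S \<union> T) x (mul H S T y z)"
    and unt_closed: "unt H \<in> spc H {}"
    and mul_unt_left: "finite I \<Longrightarrow> x \<in> spc H I \<Longrightarrow> mul H {} I (unt H) x = x"
    and mul_unt_right: "finite I \<Longrightarrow> x \<in> spc H I \<Longrightarrow> mul H I {} x (unt H) = x"

locale species_comonoid = species H
  for H :: "('k::field, 'l, 'v::ab_group_add, 'z) hopf_data_scheme" +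
  assumes cop_closed: "disj S T \<Longrightarrow> x \<in> spc H (S \<union> T) \<Longrightarrow>
      cop H S T x \<in> tensor_space (scl H) (scl H) (spc H S) (spc H T)"
    and cop_linear: "disj S T \<Longrightarrow> linear_on (scl H) fscale (spc H (S \<union> T)) (cop H S T)"
    and cop_natural: "disj S T \<Longrightarrow> inj_on \<sigma> (S \<union> T) \<Longrightarrow> x \<in> spc H (S \<union> T) \<Longrightarrow>
      cop H (\<sigma> ` S) (\<sigma> ` T) (act H \<sigma> (S \<union> T) x) =
        sweedler H S T (\<lambda>x1 x2. tensor (scl H) (scl H) (act H \<sigma> S x1) (act H \<sigma> T x2)) x"
    and cop_coassoc: "disj R S \<Longrightarrow> disj R T \<Longrightarrow> disj S T \<Longrightarrow> x \<in> spc H (R \<union> S \<union> T) \<Longrightarrow>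
      sweedler H (R \<union> S) T (\<lambda>y x3. sweedler H R S
          (\<lambda>x1 x2. tensor (scl H) fscale x1 (tensor (scl H) (scl H) x2 x3)) y) x =
      sweedler H R (S \<union> T) (\<lambda>x1 y. sweedler H S T
          (\<lambda>x2 x3. tensor (scl H) fscale x1 (tensor (scl H) (scl H) x2 x3)) y) x"
    and cnt_linear: "linear_on (scl H) (*) (spc H {}) (cnt H)"
    and cop_cnt_left: "finite I \<Longrightarrow> x \<in> spc H I \<Longrightarrow> sweedler H {} I (\<lambda>x1 x2. scl H (cnt H x1) x2) x = x"
    and cop_cnt_right: "finite I \<Longrightarrow> x \<in> spc H I \<Longrightarrow> sweedler H I {} (\<lambda>x1 x2. scl H (cnt H x2) x1) x = x"

text \<open>
  The compatibility axiom is the component of \<open>\<Delta> \<circ> \<mu> = (\<mu> \<cdot> \<mu>) \<circ> (id \<cdot> \<beta> \<cdot> id) \<circ> (\<Delta> \<cdot> \<Delta>)\<close>,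
  with \<open>\<beta>\<close> the trivial braiding, for two decompositions \<open>S \<squnion> T = S' \<squnion> T'\<close> of the same set.
\<close>

locale species_bimonoid = species_monoid H + species_comonoid H
  for H :: "('k::field, 'l, 'v::ab_group_add, 'z) hopf_data_scheme" +
  assumes cop_mul: "disj S T \<Longrightarrow> disj S' T' \<Longrightarrow> S \<union> T = S' \<union> T' \<Longrightarrow> x \<in> spc H S \<Longrightarrow> y \<in> spc H T \<Longrightarrow>
      cop H S' T' (mul H S T x y) =
        sweedler H (S \<inter> S') (S \<inter> T') (\<lambda>x1 x2. sweedler H (T \<inter> S') (T \<inter> T')
          (\<lambda>y1 y2. tensor (scl H) (scl H)
             (mul H (S \<inter> S') (T \<inter> S') x1 y1) (mul H (S \<inter> T') (T \<inter> T') x2 y2)) y) x"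
    and cop_unt: "cop H {} {} (unt H) = tensor (scl H) (scl H) (unt H) (unt H)"
    and cnt_mul: "x \<in> spc H {} \<Longrightarrow> y \<in> spc H {} \<Longrightarrow> cnt H (mul H {} {} x y) = cnt H x * cnt H y"
    and cnt_unt: "cnt H (unt H) = 1"

definition antipode ::
    "('k::field, 'l, 'v::ab_group_add, 'z) hopf_data_scheme \<Rightarrow> ('l set \<Rightarrow> 'v \<Rightarrow> 'v) \<Rightarrow> bool" where
  "antipode H s \<longleftrightarrow> species_morphism H H s \<and>
     (\<forall>I. finite I \<longrightarrow> (\<forall>x\<in>spc H I.
        (\<Sum>S\<in>Pow I. sweedler H S (I - S) (\<lambda>x1 x2. mul H S (I - S) (s S x1) x2) x) =
          (if I = {} then scl H (cnt H x) (unt H) else 0) \<and>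
        (\<Sum>S\<in>Pow I. sweedler H S (I - S) (\<lambda>x1 x2. mul H S (I - S) x1 (s (I - S) x2)) x) =
          (if I = {} then scl H (cnt H x) (unt H) else 0)))"

definition hopf_monoid :: "('k::field, 'l, 'v::ab_group_add, 'z) hopf_data_scheme \<Rightarrow> bool" where
  "hopf_monoid H \<longleftrightarrow> species_bimonoid H \<and> (\<exists>s. antipode H s)"

definition hopf_morphism ::
    "('k::field, 'l, 'v::ab_group_add, 'z) hopf_data_scheme \<Rightarrow> ('k, 'l, 'w::ab_group_add, 'y) hopf_data_scheme \<Rightarrow>
     ('l set \<Rightarrow> 'v \<Rightarrow> 'w) \<Rightarrow> bool" where
  "hopf_morphism H K f \<longleftrightarrow> hopf_monoid H \<and> hopf_monoid K \<and> species_morphism H K f \<and>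
     (\<forall>S T. disj S T \<longrightarrow> (\<forall>x\<in>spc H S. \<forall>y\<in>spc H T.
        f (S \<union> T) (mul H S T x y) = mul K S T (f S x) (f T y))) \<and>
     f {} (unt H) = unt K \<and>
     (\<forall>S T. disj S T \<longrightarrow> (\<forall>x\<in>spc H (S \<union> T).
        cop K S T (f (S \<union> T) x) =
          sweedler H S T (\<lambda>x1 x2. tensor (scl K) (scl K) (f S x1) (f T x2)) x)) \<and>
     (\<forall>x\<in>spc H {}. cnt K (f {} x) = cnt H x)"

definition connected_species :: "('k::field, 'l, 'v::ab_group_add, 'z) species_scheme \<Rightarrow> bool" where
  "connected_species H \<longleftrightarrow> vector_space.dim (scl H) (spc H {}) = 1"

definition commutative_monoid :: "('k, 'l, 'v, 'z) hopf_data_scheme \<Rightarrow> bool" where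
  "commutative_monoid H \<longleftrightarrow> (\<forall>S T. disj S T \<longrightarrow>
     (\<forall>x\<in>spc H S. \<forall>y\<in>spc H T. mul H S T x y = mul H T S y x))"

definition subcomonoid ::
    "('k::field, 'l, 'v::ab_group_add, 'z) hopf_data_scheme \<Rightarrow> ('l set \<Rightarrow> 'v set) \<Rightarrow> bool" where
  "subcomonoid H P \<longleftrightarrow> subspecies H P \<and> species_comonoid (H\<lparr>spc := P\<rparr>)"

definition submonoid ::
    "('k::field, 'l, 'v::ab_group_add, 'z) hopf_data_scheme \<Rightarrow> ('l set \<Rightarrow> 'v set) \<Rightarrow> bool" where
  "submonoid H P \<longleftrightarrow> subspecies H P \<and> species_monoid (H\<lparr>spc := P\<rparr>)"

definition hopf_submonoid ::
    "('k::field, 'l, 'v::ab_group_add, 'z) hopf_data_scheme \<Rightarrow> ('l set \<Rightarrow> 'v set) \<Rightarrow> bool" where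
  "hopf_submonoid H P \<longleftrightarrow> subspecies H P \<and> hopf_monoid (H\<lparr>spc := P\<rparr>)"

definition submonoid_generated ::
    "('k::field, 'l, 'v::ab_group_add, 'z) hopf_data_scheme \<Rightarrow> ('l set \<Rightarrow> 'v set) \<Rightarrow> 'l set \<Rightarrow> 'v set" where
  "submonoid_generated H G I = \<Inter>{M I | M. submonoid H M \<and> (\<forall>K. finite K \<longrightarrow> G K \<subseteq> M K)}"

definition monoid_ideal ::
    "('k::field, 'l, 'v::ab_group_add, 'z) hopf_data_scheme \<Rightarrow> ('l set \<Rightarrow> 'v set) \<Rightarrow> bool" where
  "monoid_ideal H J \<longleftrightarrow> subspecies H J \<and>
     (\<forall>S T. disj S T \<longrightarrow>
        (\<forall>x\<in>spc H S. \<forall>y\<in>J T. mul H S T x y \<in> J (S \<union> T)) \<and>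
        (\<forall>x\<in>J S. \<forall>y\<in>spc H T. mul H S T x y \<in> J (S \<union> T)))"

definition ideal_generated ::
    "('k::field, 'l, 'v::ab_group_add, 'z) hopf_data_scheme \<Rightarrow> ('l set \<Rightarrow> 'v set) \<Rightarrow> 'l set \<Rightarrow> 'v set" where
  "ideal_generated H G I = \<Inter>{J I | J. monoid_ideal H J \<and> (\<forall>K. finite K \<longrightarrow> G K \<subseteq> J K)}"

definition unit_part :: "('k::field, 'l, 'v::ab_group_add, 'z) hopf_data_scheme \<Rightarrow> 'l set \<Rightarrow> 'v set" where
  "unit_part H I = (if I = {} then module.span (scl H) {unt H} else {0})"

definition positive_part :: "('l set \<Rightarrow> 'v::zero set) \<Rightarrow> 'l set \<Rightarrow> 'v set" where
  "positive_part P I = (if I = {} then {0} else P I)"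


subsection \<open>The Cauchy product of two Hopf monoids\<close>

abbreviation cauchy_scale :: "'k::times \<Rightarrow> ('l set \<Rightarrow> 'b \<Rightarrow> 'k) \<Rightarrow> 'l set \<Rightarrow> 'b \<Rightarrow> 'k" where
  "cauchy_scale c f \<equiv> (\<lambda>S. fscale c (f S))"

abbreviation lift2 ::
    "('k::field, 'l, 'v::ab_group_add, 'z) species_scheme \<Rightarrow> ('k, 'l, 'w::ab_group_add, 'y) species_scheme \<Rightarrow>
     'l set \<Rightarrow> 'l set \<Rightarrow> ('v \<Rightarrow> 'w \<Rightarrow> 'u::ab_group_add) \<Rightarrow> ('k, 'v, 'w) tensor \<Rightarrow> 'u" where
  "lift2 H K S T \<equiv> tensor_lift (scl H) (scl K) (spc H S) (spc K T)"

text \<open>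
  On pure tensors \<open>x \<otimes> y \<in> H[U] \<otimes> K[I - U]\<close> and \<open>x' \<otimes> y' \<in> H[U'] \<otimes> K[J - U']\<close> the product is
  \<open>x x' \<otimes> y y' \<in> H[U \<union> U'] \<otimes> K[(I \<union> J) - (U \<union> U')]\<close>, and the coproduct of
  \<open>x \<otimes> y \<in> H[U] \<otimes> K[(I \<union> J) - U]\<close> is \<open>\<Sum> (x\<^sub>1 \<otimes> y\<^sub>1) \<otimes> (x\<^sub>2 \<otimes> y\<^sub>2)\<close> with \<open>x\<^sub>1 \<otimes> x\<^sub>2 \<in> H[U \<inter> I] \<otimes> H[U \<inter> J]\<close>
  and \<open>y\<^sub>1 \<otimes> y\<^sub>2 \<in> K[I - U] \<otimes> K[J - U]\<close>.
\<close>

definition cauchy ::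
    "('k::field, 'l, 'v::ab_group_add) hopf_data \<Rightarrow> ('k, 'l, 'w::ab_group_add) hopf_data \<Rightarrow>
     ('k, 'l, 'l set \<Rightarrow> ('k, 'v, 'w) tensor) hopf_data" where
  "cauchy H K = \<lparr>
     scl = cauchy_scale,
     spc = cauchy_space (scl H) (scl K) (spc H) (spc K),
     act = (\<lambda>\<sigma> I f U.
       if U \<subseteq> \<sigma> ` I then
         (let S = I \<inter> \<sigma> -` U in lift2 H K S (I - S)
           (\<lambda>x y. tensor (scl H) (scl K) (act H \<sigma> S x) (act K \<sigma> (I - S) y)) (f S))
       else 0),
     mul = (\<lambda>I J f g U.
       if U \<subseteq> I \<union> J then
         lift2 H K (U \<inter> I) (I - U) (\<lambda>x y. lift2 H K (U \<inter> J) (J - U)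
           (\<lambda>x' y'. tensor (scl H) (scl K)
              (mul H (U \<inter> I) (U \<inter> J) x x') (mul K (I - U) (J - U) y y'))
           (g (U \<inter> J))) (f (U \<inter> I))
       else 0),
     unt = summand {} (tensor (scl H) (scl K) (unt H) (unt K)),
     cop = (\<lambda>I J f. \<Sum>U\<in>Pow (I \<union> J). lift2 H K U ((I \<union> J) - U)
       (\<lambda>x y. sweedler H (U \<inter> I) (U \<inter> J) (\<lambda>x1 x2. sweedler K (I - U) (J - U)
          (\<lambda>y1 y2. tensor cauchy_scale cauchy_scale
             (summand (U \<inter> I) (tensor (scl H) (scl K) x1 y1))
             (summand (U \<inter> J) (tensor (scl H) (scl K) x2 y2))) y) x)
       (f U)),
     cnt = (\<lambda>f. lift2 H K {} {} (\<lambda>x y. cnt H x * cnt K y) (f {}))\<rparr>"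


subsection \<open>The quotient of a Hopf monoid by an ideal\<close>

definition representative ::
    "('k::field, 'l, 'v::ab_group_add, 'z) species_scheme \<Rightarrow> ('l set \<Rightarrow> 'v set) \<Rightarrow> 'l set \<Rightarrow> (('v \<Rightarrow> 'k) \<Rightarrow> 'k) \<Rightarrow> 'v" where
  "representative H J I a = (SOME x. x \<in> spc H I \<and> qclass (scl H) (J I) x = a)"

definition quotient ::
    "('k::field, 'l, 'v::ab_group_add) hopf_data \<Rightarrow> ('l set \<Rightarrow> 'v set) \<Rightarrow> ('k, 'l, ('v \<Rightarrow> 'k) \<Rightarrow> 'k) hopf_data" where
  "quotient H J = \<lparr>
     scl = fscale,
     spc = (\<lambda>I. qclass (scl H) (J I) ` spc H I),
     act = (\<lambda>\<sigma> I a. qclass (scl H) (J (\<sigma> ` I)) (act H \<sigma> I (representative H J I a))),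
     mul = (\<lambda>S T a a'. qclass (scl H) (J (S \<union> T))
       (mul H S T (representative H J S a) (representative H J T a'))),
     unt = qclass (scl H) (J {}) (unt H),
     cop = (\<lambda>S T a. sweedler H S T
       (\<lambda>x1 x2. tensor fscale fscale (qclass (scl H) (J S) x1) (qclass (scl H) (J T) x2))
       (representative H J (S \<union> T) a)),
     cnt = (\<lambda>a. cnt H (representative H J {} a))\<rparr>"


section \<open>The interpolating family\<close>

text \<open>
  The subspecies \<open>B r\<close> of \<open>b\<close> and \<open>D r\<close> of \<open>d\<close> are the filtrations, indexed by \<open>r \<ge> 1\<close>, and
  \<open>\<pi>\<close> is the morphism from \<open>b\<close> to \<open>d\<close>. Since all \<open>b \<cdot> d\<^sub>(\<^sub>r\<^sub>)\<close> are subspecies of \<open>b \<cdot> d\<close>,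
  the inclusion of \<open>b \<cdot> d\<^sub>(\<^sub>r\<^sub>)\<close> into \<open>b \<cdot> d\<^sub>(\<^sub>s\<^sub>)\<close> is the identity on elements.
\<close>

definition interp_product ::
    "('k::field, 'l, 'v::ab_group_add) hopf_data \<Rightarrow> ('k, 'l, 'w::ab_group_add) hopf_data \<Rightarrow>
     (nat \<Rightarrow> 'l set \<Rightarrow> 'w set) \<Rightarrow> nat \<Rightarrow> ('k, 'l, 'l set \<Rightarrow> ('k, 'v, 'w) tensor) hopf_data" where
  "interp_product b d D r = cauchy b (d\<lparr>spc := D r\<rparr>)"

definition left_incl ::
    "('k::field, 'l, 'v::ab_group_add) hopf_data \<Rightarrow> ('k, 'l, 'w::ab_group_add) hopf_data \<Rightarrow>
     'l set \<Rightarrow> 'v \<Rightarrow> 'l set \<Rightarrow> ('k, 'v, 'w) tensor" where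
  "left_incl b d I x = summand I (tensor (scl b) (scl d) x (unt d))"

definition right_incl ::
    "('k::field, 'l, 'v::ab_group_add) hopf_data \<Rightarrow> ('k, 'l, 'w::ab_group_add) hopf_data \<Rightarrow>
     'l set \<Rightarrow> 'w \<Rightarrow> 'l set \<Rightarrow> ('k, 'v, 'w) tensor" where
  "right_incl b d I y = summand {} (tensor (scl b) (scl d) (unt b) y)"

definition interp_ideal ::
    "('k::field, 'l, 'v::ab_group_add) hopf_data \<Rightarrow> ('k, 'l, 'w::ab_group_add) hopf_data \<Rightarrow>
     ('l set \<Rightarrow> 'v \<Rightarrow> 'w) \<Rightarrow> (nat \<Rightarrow> 'l set \<Rightarrow> 'v set) \<Rightarrow> (nat \<Rightarrow> 'l set \<Rightarrow> 'w set) \<Rightarrow> nat \<Rightarrow>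
     'l set \<Rightarrow> ('l set \<Rightarrow> ('k, 'v, 'w) tensor) set" where
  "interp_ideal b d \<pi> B D r = ideal_generated (interp_product b d D r)
     (\<lambda>I. {left_incl b d I x - right_incl b d I (\<pi> I x) | x. x \<in> positive_part (B r) I})"

definition interp ::
    "('k::field, 'l, 'v::ab_group_add) hopf_data \<Rightarrow> ('k, 'l, 'w::ab_group_add) hopf_data \<Rightarrow>
     ('l set \<Rightarrow> 'v \<Rightarrow> 'w) \<Rightarrow> (nat \<Rightarrow> 'l set \<Rightarrow> 'v set) \<Rightarrow> (nat \<Rightarrow> 'l set \<Rightarrow> 'w set) \<Rightarrow> nat \<Rightarrow>
     ('k, 'l, (('l set \<Rightarrow> ('k, 'v, 'w) tensor) \<Rightarrow> 'k) \<Rightarrow> 'k) hopf_data" where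
  "interp b d \<pi> B D r = quotient (interp_product b d D r) (interp_ideal b d \<pi> B D r)"

definition interp_proj ::
    "('k::field, 'l, 'v::ab_group_add) hopf_data \<Rightarrow> ('k, 'l, 'w::ab_group_add) hopf_data \<Rightarrow>
     ('l set \<Rightarrow> 'v \<Rightarrow> 'w) \<Rightarrow> (nat \<Rightarrow> 'l set \<Rightarrow> 'v set) \<Rightarrow> (nat \<Rightarrow> 'l set \<Rightarrow> 'w set) \<Rightarrow> nat \<Rightarrow>
     'l set \<Rightarrow> ('l set \<Rightarrow> ('k, 'v, 'w) tensor) \<Rightarrow> (('l set \<Rightarrow> ('k, 'v, 'w) tensor) \<Rightarrow> 'k) \<Rightarrow> 'k" where
  "interp_proj b d \<pi> B D r I = qclass (scl (interp_product b d D r)) (interp_ideal b d \<pi> B D r I)"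

definition linear_section ::
    "('k::field, 'l, 'v::ab_group_add) hopf_data \<Rightarrow> ('k, 'l, 'w::ab_group_add) hopf_data \<Rightarrow>
     ('l set \<Rightarrow> 'v \<Rightarrow> 'w) \<Rightarrow> ('l set \<Rightarrow> 'w \<Rightarrow> 'v) \<Rightarrow> bool" where
  "linear_section P Q \<theta> \<sigma> \<longleftrightarrow> (\<forall>I. finite I \<longrightarrow>
     \<sigma> I ` spc Q I \<subseteq> spc P I \<and> linear_on (scl Q) (scl P) (spc Q I) (\<sigma> I) \<and>
     (\<forall>a\<in>spc Q I. \<theta> I (\<sigma> I a) = a))"

text \<open>
  In the following \<open>\<theta> r\<close> are the projections \<open>b \<cdot> d\<^sub>(\<^sub>r\<^sub>) \<rightarrow> c\<^sup>(\<^sup>r\<^sup>)\<close> and \<open>\<zeta> r\<close> sections of them.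
  \<open>transitions \<theta> \<zeta> r n\<close> is the composite of the \<open>n\<close> successive transition maps from \<open>c\<^sup>(\<^sup>r\<^sup>)\<close> to \<open>c\<^sup>(\<^sup>r\<^sup>+\<^sup>n\<^sup>)\<close>.
\<close>

definition transition ::
    "(nat \<Rightarrow> 'l set \<Rightarrow> 'p \<Rightarrow> 'c) \<Rightarrow> (nat \<Rightarrow> 'l set \<Rightarrow> 'c \<Rightarrow> 'p) \<Rightarrow> nat \<Rightarrow> nat \<Rightarrow> 'l set \<Rightarrow> 'c \<Rightarrow> 'c" where
  "transition \<theta> \<zeta> r s I = \<theta> s I \<circ> \<zeta> r I"

primrec transitions ::
    "(nat \<Rightarrow> 'l set \<Rightarrow> 'p \<Rightarrow> 'c) \<Rightarrow> (nat \<Rightarrow> 'l set \<Rightarrow> 'c \<Rightarrow> 'p) \<Rightarrow> nat \<Rightarrow> nat \<Rightarrow> 'l set \<Rightarrow> 'c \<Rightarrow> 'c" where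
  "transitions \<theta> \<zeta> r 0 I = id"
| "transitions \<theta> \<zeta> r (Suc n) I = transition \<theta> \<zeta> (r + n) (Suc (r + n)) I \<circ> transitions \<theta> \<zeta> r n I"

definition port_between ::
    "(nat \<Rightarrow> 'l set \<Rightarrow> 'p \<Rightarrow> 'c) \<Rightarrow> (nat \<Rightarrow> 'l set \<Rightarrow> 'c \<Rightarrow> 'p) \<Rightarrow> nat \<Rightarrow> nat \<Rightarrow> 'l set \<Rightarrow> 'c \<Rightarrow> 'c" where
  "port_between \<theta> \<zeta> r s = transitions \<theta> \<zeta> r (s - r)"

definition port_from ::
    "('k::field, 'l, 'v::ab_group_add) hopf_data \<Rightarrow> ('k, 'l, 'w::ab_group_add) hopf_data \<Rightarrow>
     (nat \<Rightarrow> 'l set \<Rightarrow> ('l set \<Rightarrow> ('k, 'v, 'w) tensor) \<Rightarrow> 'c) \<Rightarrow>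
     (nat \<Rightarrow> 'l set \<Rightarrow> 'c \<Rightarrow> 'l set \<Rightarrow> ('k, 'v, 'w) tensor) \<Rightarrow> nat \<Rightarrow> 'l set \<Rightarrow> 'v \<Rightarrow> 'c" where
  "port_from b d \<theta> \<zeta> r I = port_between \<theta> \<zeta> 1 r I \<circ> (\<theta> 1 I \<circ> left_incl b d I)"

text \<open>
  The infinite composite \<open>\<cdots> \<circ> \<pi>\<^sup>r\<^sup>+\<^sup>1\<^sub>r\<^sub>+\<^sub>2 \<circ> \<pi>\<^sup>r\<^sub>r\<^sub>+\<^sub>1\<close> sends \<open>a\<close> to \<open>y \<in> d[I]\<close> if from some point on
  the finite composites send \<open>a\<close> to the element of the subspace \<open>\<one> \<cdot> d\<^sub>(\<^sub>i\<^sub>)\<close> of \<open>c\<^sup>(\<^sup>i\<^sup>)\<close>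
  that is identified with \<open>y\<close>.
\<close>

definition port_limit ::
    "('k::field, 'l, 'v::ab_group_add) hopf_data \<Rightarrow> ('k, 'l, 'w::ab_group_add) hopf_data \<Rightarrow>
     (nat \<Rightarrow> 'l set \<Rightarrow> 'w set) \<Rightarrow> (nat \<Rightarrow> 'l set \<Rightarrow> ('l set \<Rightarrow> ('k, 'v, 'w) tensor) \<Rightarrow> 'c) \<Rightarrow>
     (nat \<Rightarrow> 'l set \<Rightarrow> 'c \<Rightarrow> 'l set \<Rightarrow> ('k, 'v, 'w) tensor) \<Rightarrow> nat \<Rightarrow> 'l set \<Rightarrow> 'c \<Rightarrow> 'w \<Rightarrow> bool" where
  "port_limit b d D \<theta> \<zeta> r I a y \<longleftrightarrow>
     (\<forall>\<^sub>F i in sequentially. y \<in> D i I \<and> port_between \<theta> \<zeta> r i I a = \<theta> i I (right_incl b d I y))"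

definition port_to ::
    "('k::field, 'l, 'v::ab_group_add) hopf_data \<Rightarrow> ('k, 'l, 'w::ab_group_add) hopf_data \<Rightarrow>
     (nat \<Rightarrow> 'l set \<Rightarrow> 'w set) \<Rightarrow> (nat \<Rightarrow> 'l set \<Rightarrow> ('l set \<Rightarrow> ('k, 'v, 'w) tensor) \<Rightarrow> 'c) \<Rightarrow>
     (nat \<Rightarrow> 'l set \<Rightarrow> 'c \<Rightarrow> 'l set \<Rightarrow> ('k, 'v, 'w) tensor) \<Rightarrow> nat \<Rightarrow> 'l set \<Rightarrow> 'c \<Rightarrow> 'w" where
  "port_to b d D \<theta> \<zeta> r I a = (THE y. port_limit b d D \<theta> \<zeta> r I a y)"

end

theory Submission
  imports Defs
begin

text \<open>
  A bimonoid whose component at \<open>\<emptyset>\<close> is spanned by the unit has an antipode, defined by recursion on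
  the finite set. So only bimonoids and their morphisms matter, and \<open>c\<^sup>(\<^sup>r\<^sup>)\<close> is one because the
  generators \<open>x \<otimes> 1 - 1 \<otimes> \<pi>(x)\<close> span a coideal, \<open>b\<^sub>(\<^sub>r\<^sub>)\<close> being a subcomonoid.

  Modulo the ideal, a product \<open>u x v \<otimes> y\<close> with \<open>x \<in> b\<^sub>(\<^sub>r\<^sub>)\<^sup>+\<close> equals \<open>u v \<otimes> \<pi>(x) y\<close>, whose left
  factor is smaller; by induction \<open>b\<^sup>[\<^sup>r\<^sup>] \<cdot> d\<^sub>(\<^sub>r\<^sub>)\<close> spans the quotient. It meets the ideal trivially
  because the multiplicative map \<open>\<Phi>(x \<otimes> y) = \<Sum> x\<^sub>1 \<otimes> \<pi>(x\<^sub>2) y\<close> (here commutativity of \<open>d\<close> enters) is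
  unitriangular and sends the ideal into \<open>\<langle>b\<^sub>(\<^sub>r\<^sub>)\<^sup>+\<rangle> \<cdot> d\<close>.

  All carrying maps are induced by morphisms out of \<open>b \<cdot> d\<^sub>(\<^sub>r\<^sub>)\<close>. In each degree \<open>b\<^sub>(\<^sub>i\<^sub>)\<close> is eventually
  everything, so there the infinite composite is \<open>x \<otimes> y \<mapsto> \<pi>(x) y\<close>.
\<close>

section \<open>Linear maps and tensors\<close>

text \<open>The complement \<open>C r\<close> is one of species only: it need not be closed under
  products, and \<open>b\<close> need not be commutative. So rewriting modulo the ideal
  \<open>N\<close> shows that \<open>C r \<cdot> d\<^sub>(\<^sub>r\<^sub>)\<close> spans the
  quotient, but does not show that nothing further collapses. For this \<open>\<Phi>\<close> tests
  membership in \<open>N\<close> through the ideal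
  \<open>J = \<langle>b\<^sub>(\<^sub>r\<^sub>)\<^sup>+\<rangle>\<close> of \<open>b\<close>, for
  which a complement is given. Its target is the whole of \<open>b \<cdot> d\<close>:
  \<open>\<pi>\<close> maps \<open>b\<^sub>(\<^sub>r\<^sub>)\<close> into
  \<open>d\<^sub>(\<^sub>r\<^sub>)\<close>, but not necessarily all of \<open>b\<close>. Only the
  right factor grows, and disjointness of the left factors suffices.

  The encodings shape the rest. A map out of a tensor product refers to the subspaces over which
  representations are chosen, so passing between \<open>b\<^sub>(\<^sub>r\<^sub>)\<close> and
  \<open>b\<close>, or \<open>d\<^sub>(\<^sub>r\<^sub>)\<close> and \<open>d\<close>, is a step of
  its own. Operations on a quotient choose representatives, so identities are proved on classes of
  given elements.

  An infinite composite needs a unique value as well as an eventual one. Uniqueness comes from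
  \<open>x \<otimes> y \<mapsto> \<pi>(x) y\<close>, which kills every \<open>N\<close> and is the
  identity on each copy of \<open>d\<^sub>(\<^sub>i\<^sub>)\<close>.\<close>

lemma vector_space_fscale: "vector_space (fscale :: 'k::field \<Rightarrow> ('x \<Rightarrow> 'k) \<Rightarrow> 'x \<Rightarrow> 'k)"
  by unfold_locales (auto simp: fscale_def fun_eq_iff algebra_simps)

lemma vector_space_cauchy_scale:
  "vector_space (cauchy_scale :: 'k::field \<Rightarrow> ('l set \<Rightarrow> 'x \<Rightarrow> 'k) \<Rightarrow> 'l set \<Rightarrow> 'x \<Rightarrow> 'k)"
  by unfold_locales (auto simp: fscale_def fun_eq_iff algebra_simps)

lemma sum_list_swap:
  "(\<Sum>x\<leftarrow>xs. \<Sum>y\<leftarrow>ys. f x y) = (\<Sum>y\<leftarrow>ys. \<Sum>x\<leftarrow>xs. f x y :: 'a::comm_monoid_add)"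
  by (induction xs) (simp_all add: sum_list_addf)

lemma subspace_sum_list:
  assumes "vector_space s" "module.subspace s V" "\<And>x. x \<in> set xs \<Longrightarrow> f x \<in> V"
  shows "(\<Sum>x\<leftarrow>xs. f x) \<in> V"
proof -
  interpret vector_space s by fact
  show ?thesis using assms(3) by (induction xs) (auto simp: subspace_0[OF assms(2)] subspace_add[OF assms(2)])
qed

lemma linear_onI:
  assumes "\<And>x y. x \<in> V \<Longrightarrow> y \<in> V \<Longrightarrow> f (x + y) = f x + f y" "\<And>c x. x \<in> V \<Longrightarrow> f (s1 c x) = s2 c (f x)"
  shows "linear_on s1 s2 V f"
  using assms by (auto simp: linear_on_def)

lemma linear_on_add: "linear_on s1 s2 V f \<Longrightarrow> x \<in> V \<Longrightarrow> y \<in> V \<Longrightarrow> f (x + y) = f x + f y"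
  by (auto simp: linear_on_def)

lemma linear_on_scl: "linear_on s1 s2 V f \<Longrightarrow> x \<in> V \<Longrightarrow> f (s1 c x) = s2 c (f x)"
  by (auto simp: linear_on_def)

lemma linear_on_zero: "linear_on s1 s2 V f \<Longrightarrow> 0 \<in> V \<Longrightarrow> f 0 = 0"
  using linear_on_add[of s1 s2 V f 0 0] by simp

lemma linear_on_diff:
  assumes "vector_space s1" "module.subspace s1 V" "linear_on s1 s2 V f" "x \<in> V" "y \<in> V"
  shows "f (x - y) = f x - f y"
proof -
  interpret vector_space s1 by fact
  have "x - y \<in> V" using assms subspace_diff by blast
  with linear_on_add[OF assms(3) this assms(5)] show ?thesis by (simp add: algebra_simps)
qed

lemma linear_on_sum_list:
  assumes "vector_space s1" "module.subspace s1 V" "linear_on s1 s2 V f" "\<And>x. x \<in> set xs \<Longrightarrow> g x \<in> V"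
  shows "f (\<Sum>x\<leftarrow>xs. g x) = (\<Sum>x\<leftarrow>xs. f (g x))"
proof -
  interpret vector_space s1 by fact
  show ?thesis using assms(4)
    by (induction xs) (auto simp: linear_on_zero[OF assms(3)] subspace_0[OF assms(2)]
      linear_on_add[OF assms(3)] subspace_sum_list[OF assms(1,2)])
qed

lemma linear_on_sum:
  assumes "vector_space s1" "module.subspace s1 V" "linear_on s1 s2 V f" "\<And>x. x \<in> A \<Longrightarrow> g x \<in> V"
  shows "f (\<Sum>x\<in>A. g x) = (\<Sum>x\<in>A. f (g x))"
proof -
  interpret vector_space s1 by fact
  show ?thesis using assms(4)
    by (induction A rule: infinite_finite_induct) (auto simp: linear_on_zero[OF assms(3)] subspace_0[OF assms(2)]
      linear_on_add[OF assms(3)] subspace_sum[OF assms(2)])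
qed

lemma linear_on_comp:
  assumes "linear_on s1 s2 V f" "\<And>x. x \<in> V \<Longrightarrow> f x \<in> W" "linear_on s2 s3 W g"
  shows "linear_on s1 s3 V (\<lambda>x. g (f x))"
  using assms by (auto simp: linear_on_def)

lemma linear_on_mono: "linear_on s1 s2 V f \<Longrightarrow> W \<subseteq> V \<Longrightarrow> linear_on s1 s2 W f"
  by (auto simp: linear_on_def subset_iff)

lemma linear_on_setsum:
  assumes "vector_space s2" "\<And>a. a \<in> A \<Longrightarrow> linear_on s1 s2 V (f a)"
  shows "linear_on s1 s2 V (\<lambda>x. \<Sum>a\<in>A. f a x)"
proof -
  interpret vector_space s2 by fact
  show ?thesis using assms(2) by (auto simp: linear_on_def sum.distrib[symmetric] scale_sum_right intro!: sum.cong)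
qed

lemma bilinear_onI:
  assumes "\<And>x x' y. x \<in> V \<Longrightarrow> x' \<in> V \<Longrightarrow> y \<in> W \<Longrightarrow> F (x + x') y = F x y + F x' y"
    "\<And>c x y. x \<in> V \<Longrightarrow> y \<in> W \<Longrightarrow> F (s1 c x) y = s3 c (F x y)"
    "\<And>x y y'. x \<in> V \<Longrightarrow> y \<in> W \<Longrightarrow> y' \<in> W \<Longrightarrow> F x (y + y') = F x y + F x y'"
    "\<And>c x y. x \<in> V \<Longrightarrow> y \<in> W \<Longrightarrow> F x (s2 c y) = s3 c (F x y)"
  shows "bilinear_on s1 s2 s3 V W F"
  using assms by (auto simp: bilinear_on_def linear_on_def)

lemma bilinear_on_left: "bilinear_on s1 s2 s3 V W F \<Longrightarrow> y \<in> W \<Longrightarrow> linear_on s1 s3 V (\<lambda>x. F x y)"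
  and bilinear_on_right: "bilinear_on s1 s2 s3 V W F \<Longrightarrow> x \<in> V \<Longrightarrow> linear_on s2 s3 W (F x)"
  by (auto simp: bilinear_on_def)

lemma bilinear_onI':
  assumes "\<And>y. y \<in> W \<Longrightarrow> linear_on s1 s3 V (\<lambda>x. F x y)" "\<And>x. x \<in> V \<Longrightarrow> linear_on s2 s3 W (F x)"
  shows "bilinear_on s1 s2 s3 V W F"
  using assms by (auto simp: bilinear_on_def)

lemma bilinear_on_mono: "bilinear_on s1 s2 s3 V W F \<Longrightarrow> V' \<subseteq> V \<Longrightarrow> W' \<subseteq> W \<Longrightarrow> bilinear_on s1 s2 s3 V' W' F"
  by (auto simp: bilinear_on_def linear_on_def subset_iff)

lemma bilinear_on_comp:
  assumes "bilinear_on t1 t2 s3 V' W' F" "linear_on s1 t1 V f" "linear_on s2 t2 W g"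
    "\<And>x. x \<in> V \<Longrightarrow> f x \<in> V'" "\<And>x. x \<in> W \<Longrightarrow> g x \<in> W'"
  shows "bilinear_on s1 s2 s3 V W (\<lambda>x y. F (f x) (g y))"
  using assms by (auto simp: bilinear_on_def linear_on_def)

lemma bilinear_on_comp_out:
  assumes "bilinear_on s1 s2 s3 V W F" "\<And>x y. x \<in> V \<Longrightarrow> y \<in> W \<Longrightarrow> F x y \<in> U" "linear_on s3 s4 U g"
  shows "bilinear_on s1 s2 s4 V W (\<lambda>x y. g (F x y))"
  using assms by (auto simp: bilinear_on_def linear_on_def)

text \<open>The arguments are unrestricted: the encoding evaluates at forms that are linear on the
  whole ambient spaces and is 0 at all others. Hence \<open>tensor\<close> may be treated as
  bilinear on \<open>UNIV\<close> in compositions.\<close>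

lemma tensor_add_left: "tensor s1 s2 (x + x') y = tensor s1 s2 x y + tensor s1 s2 x' y"
  and tensor_add_right: "tensor s1 s2 x (y + y') = tensor s1 s2 x y + tensor s1 s2 x y'"
  and tensor_scl_left: "tensor s1 s2 (s1 c x) y = fscale c (tensor s1 s2 x y)"
  and tensor_scl_right: "tensor s1 s2 x (s2 c y) = fscale c (tensor s1 s2 x y)"
  by (auto simp: tensor_def bilinear_form_def Vector_Spaces.linear_iff fun_eq_iff fscale_def)

lemma tensor_zero_left: "tensor s1 s2 0 y = 0"
  and tensor_zero_right: "tensor s1 s2 x 0 = 0"
  using tensor_add_left[of s1 s2 0 0 y] tensor_add_right[of s1 s2 x 0 0] by simp_all

lemmas tensor_simps = tensor_add_left tensor_add_right tensor_scl_left tensor_scl_right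
  tensor_zero_left tensor_zero_right

lemma bilinear_on_tensor: "bilinear_on s1 s2 fscale V W (tensor s1 s2)"
  by (rule bilinear_onI) (simp_all add: tensor_simps)

text \<open>
  \<open>tensor_lift\<close> and \<open>sweedler\<close> are sums over a list that is chosen independently of \<open>F\<close>. Hence
  additivity in \<open>F\<close> and exchange of two such sums hold without any linearity assumption.
\<close>

definition tensor_rep ::
    "('k::field \<Rightarrow> 'v::ab_group_add \<Rightarrow> 'v) \<Rightarrow> ('k \<Rightarrow> 'w::ab_group_add \<Rightarrow> 'w) \<Rightarrow> 'v set \<Rightarrow> 'w set \<Rightarrow>
     ('k, 'v, 'w) tensor \<Rightarrow> ('v \<times> 'w) list" where
  "tensor_rep s1 s2 V W t = (SOME xs. set xs \<subseteq> V \<times> W \<and> t = (\<Sum>(v, w)\<leftarrow>xs. tensor s1 s2 v w))"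

lemma tensor_lift_rep: "tensor_lift s1 s2 V W F t = (\<Sum>(v, w)\<leftarrow>tensor_rep s1 s2 V W t. F v w)"
  by (simp add: tensor_lift_def tensor_rep_def)

lemma tensor_lift_plus: "tensor_lift s1 s2 V W (\<lambda>x y. F x y + G x y) t = tensor_lift s1 s2 V W F t + tensor_lift s1 s2 V W G t"
  unfolding tensor_lift_rep by (simp add: sum_list_addf case_prod_unfold)

lemma tensor_lift_0: "tensor_lift s1 s2 V W (\<lambda>x y. 0) t = 0"
  unfolding tensor_lift_rep by (simp add: case_prod_unfold)

lemma sum_list_scl:
  assumes "vector_space s" shows "(\<Sum>x\<leftarrow>xs. s c (f x)) = s c (\<Sum>x\<leftarrow>xs. f x)"
proof -
  interpret vector_space s by fact
  show ?thesis by (induction xs) (auto simp: scale_right_distrib)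
qed

lemma tensor_lift_scl:
  assumes "vector_space s3"
  shows "tensor_lift s1 s2 V W (\<lambda>x y. s3 c (F x y)) t = s3 c (tensor_lift s1 s2 V W F t)"
  unfolding tensor_lift_rep by (simp add: case_prod_unfold sum_list_scl[OF assms])

lemma tensor_lift_swap:
  "tensor_lift s1 s2 V W (\<lambda>x y. tensor_lift s3 s4 X Y (F x y) u) t =
   tensor_lift s3 s4 X Y (\<lambda>x' y'. tensor_lift s1 s2 V W (\<lambda>x y. F x y x' y') t) u"
  unfolding tensor_lift_rep case_prod_unfold by (rule sum_list_swap)

section \<open>The tensor product of two subspaces and its universal property\<close>

locale tens =
  fixes s1 :: "'k::field \<Rightarrow> 'v::ab_group_add \<Rightarrow> 'v" and s2 :: "'k \<Rightarrow> 'w::ab_group_add \<Rightarrow> 'w" and V W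
  assumes s1: "vector_space s1" and s2: "vector_space s2"
    and V: "module.subspace s1 V" and W: "module.subspace s2 W"
begin

abbreviation "TS \<equiv> tensor_space s1 s2 V W"
abbreviation "TL \<equiv> tensor_lift s1 s2 V W"

lemma subspace_TS: "module.subspace fscale TS"
  unfolding tensor_space_def
  by (rule module.subspace_span) (simp add: module_iff_vector_space vector_space_fscale)

lemma TS_tensor: "v \<in> V \<Longrightarrow> w \<in> W \<Longrightarrow> tensor s1 s2 v w \<in> TS"
  unfolding tensor_space_def
  by (rule module.span_base) (auto simp: module_iff_vector_space vector_space_fscale)

lemma TS_iff: "t \<in> TS \<longleftrightarrow> (\<exists>xs. set xs \<subseteq> V \<times> W \<and> t = (\<Sum>(v, w)\<leftarrow>xs. tensor s1 s2 v w))"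
proof
  interpret f: vector_space "fscale :: 'k \<Rightarrow> (('v \<Rightarrow> 'w \<Rightarrow> 'k) \<Rightarrow> 'k) \<Rightarrow> _" by (rule vector_space_fscale)
  interpret v1: vector_space s1 by (rule s1)
  assume "t \<in> TS"
  then show "\<exists>xs. set xs \<subseteq> V \<times> W \<and> t = (\<Sum>(v, w)\<leftarrow>xs. tensor s1 s2 v w)"
    unfolding tensor_space_def
  proof (induction rule: f.span_induct_alt)
    case base
    show ?case by (rule exI[of _ "[]"]) simp
  next
    case (step c x y)
    then obtain v w xs where *: "x = tensor s1 s2 v w" "v \<in> V" "w \<in> W" "set xs \<subseteq> V \<times> W"
      "y = (\<Sum>(v, w)\<leftarrow>xs. tensor s1 s2 v w)" by auto
    \<comment> \<open>The scalar is absorbed into the left factor, so unweighted lists of pure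
      tensors exhaust the span.\<close>
    then show ?case
      by (intro exI[of _ "(s1 c v, w) # xs"]) (auto simp: tensor_simps v1.subspace_scale[OF V])
  qed
next
  assume "\<exists>xs. set xs \<subseteq> V \<times> W \<and> t = (\<Sum>(v, w)\<leftarrow>xs. tensor s1 s2 v w)"
  then show "t \<in> TS"
    by (auto intro!: subspace_sum_list[OF vector_space_fscale subspace_TS] TS_tensor)
qed

lemma tensor_rep:
  assumes "t \<in> TS"
  shows "set (tensor_rep s1 s2 V W t) \<subseteq> V \<times> W" "(\<Sum>(v, w)\<leftarrow>tensor_rep s1 s2 V W t. tensor s1 s2 v w) = t"
  using someI_ex[of "\<lambda>xs. set xs \<subseteq> V \<times> W \<and> t = (\<Sum>(v, w)\<leftarrow>xs. tensor s1 s2 v w)"] assms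
  unfolding TS_iff tensor_rep_def by auto

lemma TL_cong:
  assumes "t \<in> TS" "\<And>v w. v \<in> V \<Longrightarrow> w \<in> W \<Longrightarrow> F v w = G v w"
  shows "TL F t = TL G t"
  unfolding tensor_lift_rep using tensor_rep(1)[OF assms(1)] assms(2)
  by (intro arg_cong[of _ _ sum_list] map_cong) auto

lemma TL_tensor:
  assumes "vector_space s3" "bilinear_on s1 s2 s3 V W F" "v \<in> V" "w \<in> W"
  shows "TL F (tensor s1 s2 v w) = F v w"
  using tensor_lift_sum[OF s1 s2 assms(1) V W assms(2), of "[(v,w)]"] assms by simp

lemma TL_id: "t \<in> TS \<Longrightarrow> TL (tensor s1 s2) t = t"
  unfolding tensor_lift_rep by (rule tensor_rep(2))

text \<open>The list chosen for \<open>t + u\<close> is unrelated to the lists chosen for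
  \<open>t\<close> and \<open>u\<close>. Bilinearity of \<open>F\<close> allows it to be replaced by
  their concatenation, over which the sum splits.\<close>

lemma TL_linear:
  assumes s3: "vector_space s3" and F: "bilinear_on s1 s2 s3 V W F"
  shows "linear_on fscale s3 TS (TL F)"
proof (rule linear_onI)
  fix t u assume "t \<in> TS" "u \<in> TS"
  then obtain xs ys where *: "set xs \<subseteq> V \<times> W" "t = (\<Sum>(v, w)\<leftarrow>xs. tensor s1 s2 v w)"
     "set ys \<subseteq> V \<times> W" "u = (\<Sum>(v, w)\<leftarrow>ys. tensor s1 s2 v w)" unfolding TS_iff by auto
  have "TL F (\<Sum>(v, w)\<leftarrow>xs @ ys. tensor s1 s2 v w) = (\<Sum>(v, w)\<leftarrow>xs @ ys. F v w)"
    by (rule tensor_lift_sum[OF s1 s2 s3 V W F]) (use * in auto)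
  then show "TL F (t + u) = TL F t + TL F u"
    using tensor_lift_sum[OF s1 s2 s3 V W F *(1)] tensor_lift_sum[OF s1 s2 s3 V W F *(3)] * by simp
next
  interpret v1: vector_space s1 by (rule s1)
  fix c t assume "t \<in> TS"
  then obtain xs where *: "set xs \<subseteq> V \<times> W" "t = (\<Sum>(v, w)\<leftarrow>xs. tensor s1 s2 v w)"
    unfolding TS_iff by auto
  let ?ys = "map (\<lambda>(v,w). (s1 c v, w)) xs"
  have ys: "set ?ys \<subseteq> V \<times> W" using *(1) v1.subspace_scale[OF V] by auto
  have "fscale c t = (\<Sum>(v, w)\<leftarrow>?ys. tensor s1 s2 v w)"
    unfolding *(2) map_map sum_list_scl[OF vector_space_fscale, symmetric]
    by (intro arg_cong[of _ _ sum_list] map_cong) (auto simp: tensor_simps)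
  moreover have "(\<Sum>(v, w)\<leftarrow>?ys. F v w) = s3 c (\<Sum>(v, w)\<leftarrow>xs. F v w)"
    unfolding sum_list_scl[OF s3, symmetric] map_map using *(1) linear_on_scl[OF bilinear_on_left[OF F]]
    by (intro arg_cong[of _ _ sum_list] map_cong) auto
  ultimately show "TL F (fscale c t) = s3 c (TL F t)"
    using tensor_lift_sum[OF s1 s2 s3 V W F ys] tensor_lift_sum[OF s1 s2 s3 V W F *(1)] * by simp
qed

lemma TL_closed:
  assumes "t \<in> TS" "vector_space s3" "module.subspace s3 U" "\<And>v w. v \<in> V \<Longrightarrow> w \<in> W \<Longrightarrow> F v w \<in> U"
  shows "TL F t \<in> U"
  unfolding tensor_lift_rep using assms(4) tensor_rep(1)[OF assms(1)]
  by (intro subspace_sum_list[OF assms(2,3)]) auto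

lemma TL_hom:
  assumes "t \<in> TS" "vector_space s3" "module.subspace s3 U" "\<And>v w. v \<in> V \<Longrightarrow> w \<in> W \<Longrightarrow> F v w \<in> U"
    "linear_on s3 s4 U g"
  shows "g (TL F t) = TL (\<lambda>v w. g (F v w)) t"
  unfolding tensor_lift_rep case_prod_unfold using assms(4) tensor_rep(1)[OF assms(1)]
  by (intro linear_on_sum_list[OF assms(2,3,5)]) auto

text \<open>Here the tensor is fixed and the integrand varies. The chosen list depends on
  \<open>t\<close> alone, so linearity in the parameter \<open>z\<close> passes through the sum term
  by term.\<close>

lemma TL_linear_fun:
  assumes "t \<in> TS" "vector_space s3" "\<And>x y. x \<in> V \<Longrightarrow> y \<in> W \<Longrightarrow> linear_on s s3 Z (\<lambda>z. F z x y)"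
  shows "linear_on s s3 Z (\<lambda>z. TL (F z) t)"
proof (rule linear_onI)
  fix z z' assume "z \<in> Z" "z' \<in> Z"
  then have "F (z + z') v w = F z v w + F z' v w" if "v \<in> V" "w \<in> W" for v w
    using linear_on_add[OF assms(3)[OF that]] by blast
  then show "TL (F (z + z')) t = TL (F z) t + TL (F z') t"
    unfolding tensor_lift_plus[symmetric] using assms(1) by (intro TL_cong)
next
  fix c z assume "z \<in> Z"
  then have "F (s c z) v w = s3 c (F z v w)" if "v \<in> V" "w \<in> W" for v w
    using linear_on_scl[OF assms(3)[OF that]] by blast
  then show "TL (F (s c z)) t = s3 c (TL (F z) t)"
    unfolding tensor_lift_scl[OF assms(2), symmetric] using assms(1) by (intro TL_cong)
qed

lemma TS_induct [consumes 1, case_names zero tensor]: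
  assumes "t \<in> TS" "P 0" "\<And>t v w. t \<in> TS \<Longrightarrow> P t \<Longrightarrow> v \<in> V \<Longrightarrow> w \<in> W \<Longrightarrow> P (tensor s1 s2 v w + t)"
  shows "P t"
proof -
  obtain xs where xs: "set xs \<subseteq> V \<times> W" "t = (\<Sum>(v, w)\<leftarrow>xs. tensor s1 s2 v w)"
    using assms(1) unfolding TS_iff by auto
  from xs(1) show ?thesis unfolding xs(2)
  proof (induction xs)
    case (Cons z xs)
    have "(\<Sum>(v, w)\<leftarrow>xs. tensor s1 s2 v w) \<in> TS" using Cons.prems unfolding TS_iff by auto
    moreover obtain v w where z: "z = (v, w)" by (cases z)
    ultimately have "P (tensor s1 s2 v w + (\<Sum>(v, w)\<leftarrow>xs. tensor s1 s2 v w))"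
      using Cons by (intro assms(3)) auto
    then show ?case by (simp only: z list.map sum_list.Cons prod.case)
  qed (use assms in simp)
qed

lemma TL_sum_list:
  assumes "vector_space s3" "bilinear_on s1 s2 s3 V W F" "set xs \<subseteq> V \<times> W"
  shows "TL F (\<Sum>(v, w)\<leftarrow>xs. tensor s1 s2 v w) = (\<Sum>(v, w)\<leftarrow>xs. F v w)"
  by (rule tensor_lift_sum[OF s1 s2 assms(1) V W assms(2,3)])

end

lemma tensor_space_mono: "V \<subseteq> V' \<Longrightarrow> W \<subseteq> W' \<Longrightarrow> tensor_space s1 s2 V W \<subseteq> tensor_space s1 s2 V' W'"
  unfolding tensor_space_def
  by (rule module.span_mono) (auto simp: module_iff_vector_space vector_space_fscale)

text \<open>The chosen list depends on the subspaces, but a list over the smaller ones is also a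
  list over the larger ones, and bilinearity makes the value depend on the tensor only. Through
  this, subobjects that share the structure maps of the ambient object can be compared with
  it.\<close>

lemma tensor_lift_mono:
  assumes "tens s1 s2 V W" "tens s1 s2 V' W'" "V \<subseteq> V'" "W \<subseteq> W'" "t \<in> tensor_space s1 s2 V W"
    "vector_space s3" "bilinear_on s1 s2 s3 V' W' F"
  shows "tensor_lift s1 s2 V' W' F t = tensor_lift s1 s2 V W F t"
proof -
  interpret a: tens s1 s2 V W by fact
  interpret b: tens s1 s2 V' W' by fact
  obtain xs where xs: "set xs \<subseteq> V \<times> W" "t = (\<Sum>(v, w)\<leftarrow>xs. tensor s1 s2 v w)"
    using assms(5) unfolding a.TS_iff by auto
  then have "set xs \<subseteq> V' \<times> W'" using assms by auto
  then show ?thesis unfolding xs(2)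
    using a.TL_sum_list[OF assms(6) bilinear_on_mono[OF assms(7,3,4)] xs(1)] b.TL_sum_list[OF assms(6,7)] by simp
qed

text \<open>The projection of \<open>C + J\<close> onto \<open>C\<close> along \<open>J\<close>,
  tensored with the identity of \<open>W\<close>, fixes \<open>t\<close> as an element of
  \<open>C \<otimes> W\<close> and kills it as an element of \<open>J \<otimes> W\<close>.\<close>

lemma tensor_space_disjoint:
  assumes s1: "vector_space s1" and s2: "vector_space s2" and C: "module.subspace s1 C" and J: "module.subspace s1 J"
    and W: "module.subspace s2 W" and CJ: "C \<inter> J = {0}"
    and t: "t \<in> tensor_space s1 s2 C W" "t \<in> tensor_space s1 s2 J W"
  shows "t = 0"
proof -
  interpret v1: vector_space s1 by (rule s1)
  interpret c: tens s1 s2 C W using assms by (simp add: tens_def)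
  interpret j: tens s1 s2 J W using assms by (simp add: tens_def)
  let ?V = "{x + y | x y. x \<in> C \<and> y \<in> J}"
  have V: "module.subspace s1 ?V" using v1.subspace_sums[OF C J] .
  interpret v: tens s1 s2 ?V W using assms V by (simp add: tens_def)
  \<comment> \<open>Unique by \<open>CJ\<close>. Since \<open>p\<close> is meaningful only on the
    sum \<open>?V\<close>, its lift is taken over \<open>?V\<close> and then compared with the lifts
    over \<open>C\<close> and over \<open>J\<close>.\<close>
  define p where "p v = (THE x. x \<in> C \<and> v - x \<in> J)" for v
  have p: "p (x + y) = x" if "x \<in> C" "y \<in> J" for x y
    unfolding p_def
  proof (rule the_equality)
    fix x' assume x': "x' \<in> C \<and> x + y - x' \<in> J"
    then have "x + y - x' - y \<in> J" using that J v1.subspace_diff by blast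
    moreover have "x + y - x' - y = x - x'" by simp
    moreover have "x - x' \<in> C" using x' that C v1.subspace_diff by blast
    ultimately have "x - x' \<in> C \<inter> J" by simp
    then show "x' = x" using CJ by simp
  qed (use that in auto)
  have p_lin: "linear_on s1 s1 ?V p"
  proof (rule linear_onI)
    fix v w assume "v \<in> ?V" "w \<in> ?V"
    then obtain x y x' y' where *: "v = x + y" "w = x' + y'" "x \<in> C" "y \<in> J" "x' \<in> C" "y' \<in> J" by blast
    have "p ((x + x') + (y + y')) = x + x'" using * C J by (intro p v1.subspace_add)
    moreover have "v + w = (x + x') + (y + y')" using * by simp
    ultimately show "p (v + w) = p v + p w" using * p by metis
  next
    fix c v assume "v \<in> ?V"
    then obtain x y where *: "v = x + y" "x \<in> C" "y \<in> J" by blast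
    have "p (s1 c x + s1 c y) = s1 c x" using * C J by (intro p v1.subspace_scale)
    then show "p (s1 c v) = s1 c (p v)" using * p by (simp add: v1.scale_right_distrib)
  qed
  have CV: "C \<subseteq> ?V" proof
    fix x assume "x \<in> C"
    then show "x \<in> ?V" using v1.subspace_0[OF J] by (intro CollectI exI[of _ x] exI[of _ 0]) simp
  qed
  have JV: "J \<subseteq> ?V" proof
    fix x assume "x \<in> J"
    then show "x \<in> ?V" using v1.subspace_0[OF C] by (intro CollectI exI[of _ 0] exI[of _ x]) simp
  qed
  have bil: "bilinear_on s1 s2 fscale ?V W (\<lambda>x y. tensor s1 s2 (p x) y)"
    by (rule bilinear_on_comp[OF bilinear_on_tensor p_lin, where W' = UNIV and g = "\<lambda>x. x" and V' = UNIV]) (auto simp: linear_on_def)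
  have pC: "p x = x" if "x \<in> C" for x using p[OF that v1.subspace_0[OF J]] by simp
  have pJ: "p x = 0" if "x \<in> J" for x using p[OF v1.subspace_0[OF C] that] by simp
  have "v.TL (\<lambda>x y. tensor s1 s2 (p x) y) t = c.TL (\<lambda>x y. tensor s1 s2 (p x) y) t"
    by (rule tensor_lift_mono[OF c.tens_axioms v.tens_axioms CV _ t(1) vector_space_fscale bil]) simp
  also have "\<dots> = c.TL (tensor s1 s2) t" by (rule c.TL_cong[OF t(1)]) (simp add: pC)
  also have "\<dots> = t" by (rule c.TL_id[OF t(1)])
  finally have 1: "v.TL (\<lambda>x y. tensor s1 s2 (p x) y) t = t" .
  have "v.TL (\<lambda>x y. tensor s1 s2 (p x) y) t = j.TL (\<lambda>x y. tensor s1 s2 (p x) y) t"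
    by (rule tensor_lift_mono[OF j.tens_axioms v.tens_axioms JV _ t(2) vector_space_fscale bil]) simp
  also have "\<dots> = j.TL (\<lambda>x y. 0) t" by (rule j.TL_cong[OF t(2)]) (simp add: pJ tensor_simps)
  also have "\<dots> = 0" by (rule tensor_lift_0)
  finally show ?thesis using 1 by simp
qed

section \<open>Species, monoids and comonoids\<close>

sublocale species \<subseteq> amb: vector_space "scl P"
  by (rule ambient)

context species
begin

lemma spc_0: "finite I \<Longrightarrow> 0 \<in> spc P I"
  and spc_add: "finite I \<Longrightarrow> x \<in> spc P I \<Longrightarrow> y \<in> spc P I \<Longrightarrow> x + y \<in> spc P I"
  and spc_scl: "finite I \<Longrightarrow> x \<in> spc P I \<Longrightarrow> scl P c x \<in> spc P I"
  and spc_neg: "finite I \<Longrightarrow> x \<in> spc P I \<Longrightarrow> - x \<in> spc P I"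
  and spc_diff: "finite I \<Longrightarrow> x \<in> spc P I \<Longrightarrow> y \<in> spc P I \<Longrightarrow> x - y \<in> spc P I"
  and spc_sum: "finite I \<Longrightarrow> (\<And>a. a \<in> A \<Longrightarrow> f a \<in> spc P I) \<Longrightarrow> (\<Sum>a\<in>A. f a) \<in> spc P I"
  by (simp_all add: subspace amb.subspace_0 amb.subspace_add amb.subspace_scale amb.subspace_neg amb.subspace_diff
    amb.subspace_sum)

lemma act_0: "finite I \<Longrightarrow> inj_on \<sigma> I \<Longrightarrow> act P \<sigma> I 0 = 0"
  by (rule linear_on_zero[OF act_linear spc_0])

end

lemma tens_species: "species H \<Longrightarrow> species K \<Longrightarrow> finite S \<Longrightarrow> finite T \<Longrightarrow> tens (scl H) (scl K) (spc H S) (spc K T)"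
  by (auto simp: tens_def species.ambient species.subspace)

lemma subspeciesI:
  assumes "species P" "\<And>I. finite I \<Longrightarrow> Q I \<subseteq> spc P I" "\<And>I. finite I \<Longrightarrow> module.subspace (scl P) (Q I)"
    "\<And>I \<sigma> x. finite I \<Longrightarrow> inj_on \<sigma> I \<Longrightarrow> x \<in> Q I \<Longrightarrow> act P \<sigma> I x \<in> Q (\<sigma> ` I)"
  shows "subspecies P Q"
proof -
  interpret species P by fact
  show ?thesis
    unfolding subspecies_def species_def
  proof (intro conjI allI impI)
    show "act (P\<lparr>spc := Q\<rparr>) \<sigma> I x = act (P\<lparr>spc := Q\<rparr>) \<tau> I x"
      if "finite I" "inj_on \<sigma> I" "\<forall>i. i \<in> I \<longrightarrow> \<sigma> i = \<tau> i" "x \<in> spc (P\<lparr>spc := Q\<rparr>) I" for I \<sigma> \<tau> x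
      using act_cong[OF that(1,2), of \<tau> x] assms(2)[OF that(1)] that(3,4) by auto
    show "\<exists>A. finite A \<and> spc (P\<lparr>spc := Q\<rparr>) I \<subseteq> module.span (scl (P\<lparr>spc := Q\<rparr>)) A" if "finite I" for I
      using finite_dim[OF that] assms(2)[OF that] by auto
    show "linear_on (scl (P\<lparr>spc := Q\<rparr>)) (scl (P\<lparr>spc := Q\<rparr>)) (spc (P\<lparr>spc := Q\<rparr>) I) (act (P\<lparr>spc := Q\<rparr>) \<sigma> I)"
      if "finite I" "inj_on \<sigma> I" for I \<sigma>
      using linear_on_mono[OF act_linear[OF that]] assms(2)[OF that(1)] by simp
  qed (use assms in \<open>simp_all add: ambient subset_iff act_id act_comp\<close>)
qed

lemma subspeciesD:
  assumes "subspecies P Q"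
  shows "finite I \<Longrightarrow> Q I \<subseteq> spc P I" "finite I \<Longrightarrow> module.subspace (scl P) (Q I)"
    "finite I \<Longrightarrow> inj_on \<sigma> I \<Longrightarrow> x \<in> Q I \<Longrightarrow> act P \<sigma> I x \<in> Q (\<sigma> ` I)"
  using assms species.subspace[of "P\<lparr>spc := Q\<rparr>" I] species.act_closed[of "P\<lparr>spc := Q\<rparr>" I \<sigma> x]
  by (auto simp: subspecies_def)

context species_monoid
begin

lemma mul_linear_left: "disj S T \<Longrightarrow> y \<in> spc H T \<Longrightarrow> linear_on (scl H) (scl H) (spc H S) (\<lambda>x. mul H S T x y)"
  and mul_linear_right: "disj S T \<Longrightarrow> x \<in> spc H S \<Longrightarrow> linear_on (scl H) (scl H) (spc H T) (mul H S T x)"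
  using mul_bilinear[of S T] by (auto simp: bilinear_on_def)

lemma mul_0_left: "disj S T \<Longrightarrow> y \<in> spc H T \<Longrightarrow> mul H S T 0 y = 0"
  and mul_0_right: "disj S T \<Longrightarrow> x \<in> spc H S \<Longrightarrow> mul H S T x 0 = 0"
  using linear_on_zero[OF mul_linear_left] linear_on_zero[OF mul_linear_right] spc_0 by auto

end

lemma sweedler_plus: "sweedler H S T (\<lambda>x y. F x y + G x y) t = sweedler H S T F t + sweedler H S T G t"
  by (simp add: sweedler_def tensor_lift_plus)

lemma sweedler_0: "sweedler H S T (\<lambda>x y. 0) t = 0"
  by (simp add: sweedler_def tensor_lift_0)

lemma sweedler_setsum: "sweedler H S T (\<lambda>x y. \<Sum>a\<in>A. F a x y) t = (\<Sum>a\<in>A. sweedler H S T (F a) t)"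
  by (induction A rule: infinite_finite_induct) (simp_all add: sweedler_0 sweedler_plus)

lemma sweedler_swap:
  "sweedler H S T (\<lambda>x y. sweedler K S' T' (F x y) u) t =
   sweedler K S' T' (\<lambda>x' y'. sweedler H S T (\<lambda>x y. F x y x' y') t) u"
  unfolding sweedler_def by (rule tensor_lift_swap)

text \<open>Linearity in each of three arguments, packaged as bilinearity in the two adjacent pairs
  because nested Sweedler sums consume it in that form.\<close>

definition trilinear_on where
  "trilinear_on s1 s2 s3 s4 U V W F \<longleftrightarrow>
     (\<forall>w\<in>W. bilinear_on s1 s2 s4 U V (\<lambda>x y. F x y w)) \<and> (\<forall>u\<in>U. bilinear_on s2 s3 s4 V W (F u))"

section \<open>Calculus with Sweedler sums\<close>

context species_comonoid
begin

lemma tens: "disj S T \<Longrightarrow> tens (scl H) (scl H) (spc H S) (spc H T)"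
  using tens_species[OF species_axioms species_axioms] by blast

lemma sweedler_cong:
  assumes "disj S T" "x \<in> spc H (S \<union> T)" "\<And>x1 x2. x1 \<in> spc H S \<Longrightarrow> x2 \<in> spc H T \<Longrightarrow> F x1 x2 = G x1 x2"
  shows "sweedler H S T F x = sweedler H S T G x"
  unfolding sweedler_def using assms by (intro tens.TL_cong[OF tens cop_closed])

lemma sweedler_linear:
  assumes "disj S T" "vector_space s3" "bilinear_on (scl H) (scl H) s3 (spc H S) (spc H T) F"
  shows "linear_on (scl H) s3 (spc H (S \<union> T)) (sweedler H S T F)"
  unfolding sweedler_def
  by (rule linear_on_comp[OF cop_linear cop_closed tens.TL_linear[OF tens]]) (use assms in auto)

lemma sweedler_linear_fun:
  assumes "disj S T" "t \<in> spc H (S \<union> T)" "vector_space s3"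
    "\<And>x y. x \<in> spc H S \<Longrightarrow> y \<in> spc H T \<Longrightarrow> linear_on s s3 Z (\<lambda>z. F z x y)"
  shows "linear_on s s3 Z (\<lambda>z. sweedler H S T (F z) t)"
  unfolding sweedler_def
  by (rule tens.TL_linear_fun[OF tens cop_closed]) (use assms in auto)

lemma sweedler_closed:
  assumes "disj S T" "t \<in> spc H (S \<union> T)" "vector_space s3" "module.subspace s3 U"
    "\<And>x y. x \<in> spc H S \<Longrightarrow> y \<in> spc H T \<Longrightarrow> F x y \<in> U"
  shows "sweedler H S T F t \<in> U"
  unfolding sweedler_def
  by (rule tens.TL_closed[OF tens cop_closed]) (use assms in auto)

lemma sweedler_hom:
  assumes "disj S T" "t \<in> spc H (S \<union> T)" "vector_space s3" "module.subspace s3 U"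
    "\<And>x y. x \<in> spc H S \<Longrightarrow> y \<in> spc H T \<Longrightarrow> F x y \<in> U" "linear_on s3 s4 U g"
  shows "g (sweedler H S T F t) = sweedler H S T (\<lambda>x y. g (F x y)) t"
  unfolding sweedler_def
  by (rule tens.TL_hom[OF tens cop_closed]) (use assms in auto)

text \<open>Replaces the tensor sign under a Sweedler sum by a bilinear map. The coproduct of an
  image is usually known as such a sum of tensors, and this turns it into a rule for arbitrary
  Sweedler sums over the image; \<open>f\<close> and \<open>g\<close> may be any functions with
  values in \<open>V\<close> and \<open>W\<close>.\<close>

lemma lift_sweedler:
  assumes st: "disj S T" "t \<in> spc H (S \<union> T)" and s4: "vector_space s4" and VW: "tens s1 s2 V W"
    and F: "bilinear_on s1 s2 s4 V W F"
    and fg: "\<And>x y. x \<in> spc H S \<Longrightarrow> y \<in> spc H T \<Longrightarrow> f x y \<in> V" "\<And>x y. x \<in> spc H S \<Longrightarrow> y \<in> spc H T \<Longrightarrow> g x y \<in> W"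
  shows "tensor_lift s1 s2 V W F (sweedler H S T (\<lambda>x y. tensor s1 s2 (f x y) (g x y)) t) =
    sweedler H S T (\<lambda>x y. F (f x y) (g x y)) t"
proof -
  interpret t: tens s1 s2 V W by fact
  have "t.TL F (sweedler H S T (\<lambda>x y. tensor s1 s2 (f x y) (g x y)) t) =
    sweedler H S T (\<lambda>x y. t.TL F (tensor s1 s2 (f x y) (g x y))) t"
    by (rule sweedler_hom[OF st vector_space_fscale t.subspace_TS _ t.TL_linear[OF s4 F]])
      (use fg in \<open>auto intro: t.TS_tensor\<close>)
  also have "\<dots> = sweedler H S T (\<lambda>x y. F (f x y) (g x y)) t"
    by (rule sweedler_cong[OF st]) (use fg t.TL_tensor[OF s4 F] in auto)
  finally show ?thesis .
qed

lemma sweedler_tensor: "disj S T \<Longrightarrow> t \<in> spc H (S \<union> T) \<Longrightarrow> sweedler H S T (tensor (scl H) (scl H)) t = cop H S T t"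
  unfolding sweedler_def by (rule tens.TL_id[OF tens cop_closed]) auto

lemma sweedler_natural:
  assumes st: "disj S T" "x \<in> spc H (S \<union> T)" and \<sigma>: "inj_on \<sigma> (S \<union> T)" and s3: "vector_space s3"
    and F: "bilinear_on (scl H) (scl H) s3 (spc H (\<sigma> ` S)) (spc H (\<sigma> ` T)) F"
  shows "sweedler H (\<sigma> ` S) (\<sigma> ` T) F (act H \<sigma> (S \<union> T) x) =
    sweedler H S T (\<lambda>x1 x2. F (act H \<sigma> S x1) (act H \<sigma> T x2)) x"
proof -
  have [simp]: "inj_on \<sigma> S" "inj_on \<sigma> T" using \<sigma> by (auto simp: inj_on_Un)
  have d: "disj (\<sigma> ` S) (\<sigma> ` T)" using st \<sigma> by (auto simp: inj_on_def)
  show ?thesis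
    unfolding sweedler_def[of H "\<sigma> ` S"] cop_natural[OF st(1) \<sigma> st(2)]
    using st by (intro lift_sweedler[OF st s3 tens[OF d] F] act_closed) auto
qed

lemma bilinear_tensor_lift:
  assumes s4: "vector_space s4" and t: "tens s2 s3 V W" and F: "trilinear_on s1 s2 s3 s4 U V W F"
  shows "bilinear_on s1 fscale s4 U (tensor_space s2 s3 V W) (\<lambda>x t. tensor_lift s2 s3 V W (F x) t)"
  using F
  by (intro bilinear_onI' tens.TL_linear[OF t s4] tens.TL_linear_fun[OF t _ s4])
    (auto simp: trilinear_on_def bilinear_on_def)

text \<open>The axiom is the case of the universal trilinear map into the threefold tensor product.
  The general case follows by applying the linear map \<open>?L\<close> that \<open>F\<close>
  induces there to both sides.\<close>

lemma sweedler_coassoc: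
  assumes d: "disj R S" "disj R T" "disj S T" and x: "x \<in> spc H (R \<union> S \<union> T)" and s4: "vector_space s4"
    and F: "trilinear_on (scl H) (scl H) (scl H) s4 (spc H R) (spc H S) (spc H T) F"
  shows "sweedler H (R \<union> S) T (\<lambda>y x3. sweedler H R S (\<lambda>x1 x2. F x1 x2 x3) y) x =
    sweedler H R (S \<union> T) (\<lambda>x1 y. sweedler H S T (\<lambda>x2 x3. F x1 x2 x3) y) x"
proof -
  note t = tens[OF d(3)]
  let ?TS = "tensor_space (scl H) (scl H) (spc H S) (spc H T)"
  have d': "disj (R \<union> S) T" "disj R (S \<union> T)" using d by auto
  have t2: "tens (scl H) fscale (spc H R) ?TS"
    using d by (auto simp: tens_def ambient subspace vector_space_fscale tens.subspace_TS[OF t])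
  have tt: "tensor (scl H) fscale x1 (tensor (scl H) (scl H) x2 x3) \<in> tensor_space (scl H) fscale (spc H R) ?TS"
    if "x1 \<in> spc H R" "x2 \<in> spc H S" "x3 \<in> spc H T" for x1 x2 x3
    using that by (intro tens.TS_tensor[OF t2] tens.TS_tensor[OF t])
  let ?L = "tensor_lift (scl H) fscale (spc H R) ?TS (\<lambda>x t. tensor_lift (scl H) (scl H) (spc H S) (spc H T) (F x) t)"
  note bil = bilinear_tensor_lift[OF s4 t F]
  have L: "?L (tensor (scl H) fscale x1 (tensor (scl H) (scl H) x2 x3)) = F x1 x2 x3"
    if "x1 \<in> spc H R" "x2 \<in> spc H S" "x3 \<in> spc H T" for x1 x2 x3
    using that F by (simp add: tens.TL_tensor[OF t2 s4 bil] tens.TS_tensor[OF t] tens.TL_tensor[OF t s4] trilinear_on_def)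
  note hom = sweedler_hom[OF _ _ vector_space_fscale tens.subspace_TS[OF t2] _ tens.TL_linear[OF t2 s4 bil]]
  note clo = sweedler_closed[OF _ _ vector_space_fscale tens.subspace_TS[OF t2]]
  have "?L (sweedler H (R \<union> S) T (\<lambda>y x3. sweedler H R S
          (\<lambda>x1 x2. tensor (scl H) fscale x1 (tensor (scl H) (scl H) x2 x3)) y) x) =
    sweedler H (R \<union> S) T (\<lambda>y x3. ?L (sweedler H R S
          (\<lambda>x1 x2. tensor (scl H) fscale x1 (tensor (scl H) (scl H) x2 x3)) y)) x"
    using d d' x tt by (intro hom clo) auto
  also have "\<dots> = sweedler H (R \<union> S) T (\<lambda>y x3. sweedler H R S (\<lambda>x1 x2. F x1 x2 x3) y) x"
  proof (rule sweedler_cong[OF d'(1) x])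
    fix y x3 assume y: "y \<in> spc H (R \<union> S)" and x3: "x3 \<in> spc H T"
    have "?L (sweedler H R S (\<lambda>x1 x2. tensor (scl H) fscale x1 (tensor (scl H) (scl H) x2 x3)) y) =
      sweedler H R S (\<lambda>x1 x2. ?L (tensor (scl H) fscale x1 (tensor (scl H) (scl H) x2 x3))) y"
      using d y tt x3 by (intro hom) auto
    also have "\<dots> = sweedler H R S (\<lambda>x1 x2. F x1 x2 x3) y"
      using d y L x3 by (intro sweedler_cong) auto
    finally show "?L (sweedler H R S (\<lambda>x1 x2. tensor (scl H) fscale x1 (tensor (scl H) (scl H) x2 x3)) y) =
      sweedler H R S (\<lambda>x1 x2. F x1 x2 x3) y" .
  qed
  finally have 1: "?L (sweedler H (R \<union> S) T (\<lambda>y x3. sweedler H R S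
          (\<lambda>x1 x2. tensor (scl H) fscale x1 (tensor (scl H) (scl H) x2 x3)) y) x) =
    sweedler H (R \<union> S) T (\<lambda>y x3. sweedler H R S (\<lambda>x1 x2. F x1 x2 x3) y) x" .
  have x': "x \<in> spc H (R \<union> (S \<union> T))" using x by (simp add: Un_assoc)
  have "?L (sweedler H R (S \<union> T) (\<lambda>x1 y. sweedler H S T
          (\<lambda>x2 x3. tensor (scl H) fscale x1 (tensor (scl H) (scl H) x2 x3)) y) x) =
    sweedler H R (S \<union> T) (\<lambda>x1 y. ?L (sweedler H S T
          (\<lambda>x2 x3. tensor (scl H) fscale x1 (tensor (scl H) (scl H) x2 x3)) y)) x"
    using d d' x' tt by (intro hom clo) auto
  also have "\<dots> = sweedler H R (S \<union> T) (\<lambda>x1 y. sweedler H S T (\<lambda>x2 x3. F x1 x2 x3) y) x"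
  proof (rule sweedler_cong[OF d'(2) x'])
    fix x1 y assume y: "y \<in> spc H (S \<union> T)" and x1: "x1 \<in> spc H R"
    have "?L (sweedler H S T (\<lambda>x2 x3. tensor (scl H) fscale x1 (tensor (scl H) (scl H) x2 x3)) y) =
      sweedler H S T (\<lambda>x2 x3. ?L (tensor (scl H) fscale x1 (tensor (scl H) (scl H) x2 x3))) y"
      using d y tt x1 by (intro hom) auto
    also have "\<dots> = sweedler H S T (\<lambda>x2 x3. F x1 x2 x3) y"
      using d y L x1 by (intro sweedler_cong) auto
    finally show "?L (sweedler H S T (\<lambda>x2 x3. tensor (scl H) fscale x1 (tensor (scl H) (scl H) x2 x3)) y) =
      sweedler H S T (\<lambda>x2 x3. F x1 x2 x3) y" .
  qed
  finally show ?thesis using 1 cop_coassoc[OF d x] by simp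
qed

lemma sweedler_cnt_left:
  assumes "finite I" "x \<in> spc H I" "linear_on (scl H) s3 (spc H I) g"
  shows "sweedler H {} I (\<lambda>x1 x2. g (scl H (cnt H x1) x2)) x = g x"
  using sweedler_hom[of "{}" I x "scl H" "spc H I" "\<lambda>x1 x2. scl H (cnt H x1) x2" s3 g] assms
  by (simp add: cop_cnt_left ambient subspace spc_scl)

lemma sweedler_cnt_right:
  assumes "finite I" "x \<in> spc H I" "linear_on (scl H) s3 (spc H I) g"
  shows "sweedler H I {} (\<lambda>x1 x2. g (scl H (cnt H x2) x1)) x = g x"
  using sweedler_hom[of I "{}" x "scl H" "spc H I" "\<lambda>x1 x2. scl H (cnt H x2) x1" s3 g] assms
  by (simp add: cop_cnt_right ambient subspace spc_scl)

end

context species_bimonoid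
begin

text \<open>As for coassociativity, the axiom is the universal case, with \<open>tensor\<close> in
  the place of \<open>F\<close>; the map induced by \<open>F\<close> is moved through the two nested
  sums.\<close>

lemma sweedler_mul:
  assumes d: "disj S T" "disj S' T'" "S \<union> T = S' \<union> T'" and x: "x \<in> spc H S" and y: "y \<in> spc H T"
    and s3: "vector_space s3" and F: "bilinear_on (scl H) (scl H) s3 (spc H S') (spc H T') F"
  shows "sweedler H S' T' F (mul H S T x y) =
    sweedler H (S \<inter> S') (S \<inter> T') (\<lambda>x1 x2. sweedler H (T \<inter> S') (T \<inter> T')
          (\<lambda>y1 y2. F (mul H (S \<inter> S') (T \<inter> S') x1 y1) (mul H (S \<inter> T') (T \<inter> T') x2 y2)) y) x"
proof -
  note t = tens[OF d(2)]
  have [simp]: "S \<inter> S' \<union> S \<inter> T' = S" "T \<inter> S' \<union> T \<inter> T' = T" using d by auto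
  have dS: "disj (S \<inter> S') (S \<inter> T')" "disj (T \<inter> S') (T \<inter> T')" using d by auto
  have m1: "mul H (S \<inter> S') (T \<inter> S') x y \<in> spc H S'" if "x \<in> spc H (S \<inter> S')" "y \<in> spc H (T \<inter> S')" for x y
  proof -
    have "S \<inter> S' \<union> T \<inter> S' = S'" using d by auto
    then show ?thesis using mul_closed[of "S \<inter> S'" "T \<inter> S'" x y] d that by auto
  qed
  have m2: "mul H (S \<inter> T') (T \<inter> T') x y \<in> spc H T'" if "x \<in> spc H (S \<inter> T')" "y \<in> spc H (T \<inter> T')" for x y
  proof -
    have "S \<inter> T' \<union> T \<inter> T' = T'" using d by auto
    then show ?thesis using mul_closed[of "S \<inter> T'" "T \<inter> T'" x y] d that by auto
  qed
  have "sweedler H S' T' F (mul H S T x y) = tensor_lift (scl H) (scl H) (spc H S') (spc H T') F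
    (sweedler H (S \<inter> S') (S \<inter> T') (\<lambda>x1 x2. sweedler H (T \<inter> S') (T \<inter> T')
          (\<lambda>y1 y2. tensor (scl H) (scl H) (mul H (S \<inter> S') (T \<inter> S') x1 y1) (mul H (S \<inter> T') (T \<inter> T') x2 y2)) y) x)"
    unfolding sweedler_def[of H S'] cop_mul[OF d x y] ..
  also have "\<dots> = sweedler H (S \<inter> S') (S \<inter> T') (\<lambda>x1 x2. tensor_lift (scl H) (scl H) (spc H S') (spc H T') F (sweedler H (T \<inter> S') (T \<inter> T')
          (\<lambda>y1 y2. tensor (scl H) (scl H) (mul H (S \<inter> S') (T \<inter> S') x1 y1) (mul H (S \<inter> T') (T \<inter> T') x2 y2)) y)) x"
    using x y m1 m2 dS by (intro sweedler_hom[OF _ _ vector_space_fscale tens.subspace_TS[OF t] _ tens.TL_linear[OF t s3 F]]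
       sweedler_closed[OF _ _ vector_space_fscale tens.subspace_TS[OF t]] tens.TS_tensor[OF t]) auto
  also have "\<dots> = sweedler H (S \<inter> S') (S \<inter> T') (\<lambda>x1 x2. sweedler H (T \<inter> S') (T \<inter> T')
          (\<lambda>y1 y2. F (mul H (S \<inter> S') (T \<inter> S') x1 y1) (mul H (S \<inter> T') (T \<inter> T') x2 y2)) y) x"
    using x y m1 m2 dS by (intro sweedler_cong lift_sweedler[OF _ _ s3 t F]) auto
  finally show ?thesis .
qed

lemma sweedler_unt:
  assumes "vector_space s3" "bilinear_on (scl H) (scl H) s3 (spc H {}) (spc H {}) F"
  shows "sweedler H {} {} F (unt H) = F (unt H) (unt H)"
  unfolding sweedler_def cop_unt by (rule tens.TL_tensor[OF tens assms]) (auto simp: unt_closed)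

end

text \<open>Unit and counit are mutually inverse on \<open>H[\<emptyset>]\<close>, the counit of the
  unit being 1 in a bimonoid. In this form connectedness passes to products, subobjects and images
  without computing dimensions.\<close>

definition connected_unit :: "('k::field, 'l, 'v::ab_group_add, 'z) hopf_data_scheme \<Rightarrow> bool" where
  "connected_unit H \<longleftrightarrow> (\<forall>x\<in>spc H {}. x = scl H (cnt H x) (unt H))"

context species_bimonoid
begin

text \<open>The counit sends the unit to 1, so the unit is nonzero and spans the one-dimensional
  space; the counit then reads off the coefficient.\<close>

lemma connected_unitI:
  assumes "connected_species H"
  shows "connected_unit H"
proof -
  have 0: "unt H \<noteq> 0"
    using cnt_unt linear_on_zero[OF cnt_linear] spc_0 by force
  obtain A where A: "A \<subseteq> spc H {}" "amb.independent A" "spc H {} \<subseteq> amb.span A" "card A = amb.dim (spc H {})"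
    using amb.basis_exists by metis
  then have "card A = 1" using assms by (simp add: connected_species_def)
  then obtain b where b: "A = {b}" by (auto simp: card_1_singleton_iff)
  show ?thesis
    unfolding connected_unit_def
  proof
    fix x assume x: "x \<in> spc H {}"
    obtain k where k: "x = scl H k b" using A(3) b x by (auto simp: amb.span_singleton)
    obtain l where l: "unt H = scl H l b" using A(3) b unt_closed by (auto simp: amb.span_singleton)
    have "l \<noteq> 0" using 0 l by auto
    then have *: "x = scl H (k / l) (unt H)" by (simp add: k l)
    have "cnt H x = k / l"
      by (subst *) (simp add: linear_on_scl[OF cnt_linear] unt_closed cnt_unt)
    then show "x = scl H (cnt H x) (unt H)" using * by simp
  qed
qed

text \<open>The Sweedler factor in \<open>H[\<emptyset>]\<close> is \<open>cnt H x1\<close> times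
  the unit. Moving this scalar to the other factor leaves the counit axiom.\<close>

lemma sweedler_connected_left:
  assumes c: "connected_unit H" and I: "finite I" "x \<in> spc H I" and s3: "vector_space s3"
    and F: "bilinear_on (scl H) (scl H) s3 (spc H {}) (spc H I) F"
  shows "sweedler H {} I F x = F (unt H) x"
proof -
  have "sweedler H {} I F x = sweedler H {} I (\<lambda>x1 x2. F (unt H) (scl H (cnt H x1) x2)) x"
  proof (rule sweedler_cong)
    fix x1 x2 assume x1: "x1 \<in> spc H {}" and x2: "x2 \<in> spc H I"
    have "F x1 x2 = F (scl H (cnt H x1) (unt H)) x2" using c x1 by (simp add: connected_unit_def)
    also have "\<dots> = F (unt H) (scl H (cnt H x1) x2)"
      by (simp add: linear_on_scl[OF bilinear_on_left[OF F x2]] linear_on_scl[OF bilinear_on_right[OF F]] x2 unt_closed)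
    finally show "F x1 x2 = F (unt H) (scl H (cnt H x1) x2)" .
  qed (use I in auto)
  also have "\<dots> = F (unt H) x"
    by (rule sweedler_cnt_left[OF I bilinear_on_right[OF F unt_closed]])
  finally show ?thesis .
qed

lemma sweedler_connected_right:
  assumes c: "connected_unit H" and I: "finite I" "x \<in> spc H I" and s3: "vector_space s3"
    and F: "bilinear_on (scl H) (scl H) s3 (spc H I) (spc H {}) F"
  shows "sweedler H I {} F x = F x (unt H)"
proof -
  have "sweedler H I {} F x = sweedler H I {} (\<lambda>x1 x2. F (scl H (cnt H x2) x1) (unt H)) x"
  proof (rule sweedler_cong)
    fix x1 x2 assume x1: "x1 \<in> spc H I" and x2: "x2 \<in> spc H {}"
    have "F x1 x2 = F x1 (scl H (cnt H x2) (unt H))" using c x2 by (simp add: connected_unit_def)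
    also have "\<dots> = F (scl H (cnt H x2) x1) (unt H)"
      by (simp add: linear_on_scl[OF bilinear_on_left[OF F]] linear_on_scl[OF bilinear_on_right[OF F]] x1 unt_closed)
    finally show "F x1 x2 = F (scl H (cnt H x2) x1) (unt H)" .
  qed (use I in auto)
  also have "\<dots> = F x (unt H)"
    by (rule sweedler_cnt_right[OF I bilinear_on_left[OF F unt_closed]])
  finally show ?thesis .
qed

end

section \<open>Antipodes of connected bimonoids\<close>

definition conv ::
    "('k::field, 'l, 'v::ab_group_add, 'z) hopf_data_scheme \<Rightarrow> ('l set \<Rightarrow> 'v \<Rightarrow> 'v) \<Rightarrow> ('l set \<Rightarrow> 'v \<Rightarrow> 'v) \<Rightarrow>
     'l set \<Rightarrow> 'v \<Rightarrow> 'v" where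
  "conv H f g I x = (\<Sum>S\<in>Pow I. sweedler H S (I - S) (\<lambda>x1 x2. mul H S (I - S) (f S x1) (g (I - S) x2)) x)"

definition conv_unit :: "('k::field, 'l, 'v::ab_group_add, 'z) hopf_data_scheme \<Rightarrow> 'l set \<Rightarrow> 'v \<Rightarrow> 'v" where
  "conv_unit H I x = (if I = {} then scl H (cnt H x) (unt H) else 0)"

text \<open>Families of linear endomorphisms, with no naturality. They carry the convolution product
  with unit \<open>conv_unit\<close>; an antipode is a natural two-sided inverse of the identity,
  and its naturality is a separate induction.\<close>

definition endo :: "('k::field, 'l, 'v::ab_group_add, 'z) species_scheme \<Rightarrow> ('l set \<Rightarrow> 'v \<Rightarrow> 'v) \<Rightarrow> bool" where
  "endo H f \<longleftrightarrow> (\<forall>I. finite I \<longrightarrow> (\<forall>x\<in>spc H I. f I x \<in> spc H I) \<and> linear_on (scl H) (scl H) (spc H I) (f I))"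

text \<open>Both sides run over the decompositions of \<open>I\<close> into three parts, with
  \<open>R\<close> and \<open>T\<close> the first two and \<open>S = R \<union> T\<close>. These
  index the terms of the two bracketings of a triple convolution.\<close>

lemma sum_Pow_Pow:
  assumes "finite I"
  shows "(\<Sum>S\<in>Pow I. \<Sum>R\<in>Pow S. f R (S - R)) = (\<Sum>R\<in>Pow I. \<Sum>T\<in>Pow (I - R). f R T :: 'a::comm_monoid_add)"
proof -
  have "(\<Sum>S\<in>Pow I. \<Sum>R\<in>Pow S. f R (S - R)) = (\<Sum>(S, R)\<in>Sigma (Pow I) Pow. f R (S - R))"
    using assms by (intro sum.Sigma) (auto intro: finite_subset)
  also have "\<dots> = (\<Sum>(R, T)\<in>Sigma (Pow I) (\<lambda>R. Pow (I - R)). f R T)"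
    by (rule sum.reindex_bij_witness[of _ "\<lambda>(R, T). (R \<union> T, R)" "\<lambda>(S, R). (R, S - R)"]) auto
  also have "\<dots> = (\<Sum>R\<in>Pow I. \<Sum>T\<in>Pow (I - R). f R T)"
    using assms by (intro sum.Sigma[symmetric]) auto
  finally show ?thesis .
qed

context species_bimonoid
begin

lemma disj_Diff: "finite I \<Longrightarrow> S \<subseteq> I \<Longrightarrow> disj S (I - S) \<and> S \<union> (I - S) = I"
  by (auto intro: finite_subset)

lemma bilinear_mul_endo:
  assumes "disj S T" "endo H f" "endo H g"
  shows "bilinear_on (scl H) (scl H) (scl H) (spc H S) (spc H T) (\<lambda>x y. mul H S T (f S x) (g T y))"
  using assms by (intro bilinear_on_comp[OF mul_bilinear]) (auto simp: endo_def)

lemma conv_endo: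
  assumes "endo H f" "endo H g"
  shows "endo H (conv H f g)"
  unfolding endo_def
proof (intro allI impI conjI ballI)
  fix I :: "'l set" assume I: "finite I"
  show "linear_on (scl H) (scl H) (spc H I) (conv H f g I)"
    unfolding conv_def
  proof (rule linear_on_setsum[OF ambient])
    fix S assume "S \<in> Pow I"
    then have S: "disj S (I - S)" "S \<union> (I - S) = I" using disj_Diff[OF I] by auto
    show "linear_on (scl H) (scl H) (spc H I) (sweedler H S (I - S) (\<lambda>x1 x2. mul H S (I - S) (f S x1) (g (I - S) x2)))"
      using sweedler_linear[OF S(1) ambient bilinear_mul_endo[OF S(1) assms]] S(2) by simp
  qed
  show "conv H f g I x \<in> spc H I" if x: "x \<in> spc H I" for x
    unfolding conv_def
  proof (rule spc_sum[OF I])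
    fix S assume "S \<in> Pow I"
    then have S: "disj S (I - S)" "S \<union> (I - S) = I" using disj_Diff[OF I] by auto
    show "sweedler H S (I - S) (\<lambda>x1 x2. mul H S (I - S) (f S x1) (g (I - S) x2)) x \<in> spc H I"
      using assms x S mul_closed[OF S(1)]
      by (intro sweedler_closed[OF S(1) _ ambient subspace[OF I]]) (auto simp: endo_def)
  qed
qed

lemma conv_assoc:
  assumes e: "endo H f" "endo H g" "endo H h" and I: "finite I" and x: "x \<in> spc H I"
  shows "conv H (conv H f g) h I x = conv H f (conv H g h) I x"
proof -
  have eD: "k S y \<in> spc H S" "linear_on (scl H) (scl H) (spc H S) (k S)"
    if "endo H k" "finite S" "y \<in> spc H S" for k S y
    using that by (auto simp: endo_def)
  \<comment> \<open>The term of the decomposition of \<open>I\<close> into \<open>R\<close>,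
    \<open>S\<close> and the rest, with the coproduct bracketed to the right and the product to the
    left. Thus the first half of the proof changes the coproduct by coassociativity, and the second
    half the product by associativity.\<close>
  define A where "A R S = sweedler H R (I - R) (\<lambda>x1 y. sweedler H S (I - R - S)
       (\<lambda>x2 x3. mul H (R \<union> S) (I - R - S) (mul H R S (f R x1) (g S x2)) (h (I - R - S) x3)) y) x" for R S
  have "conv H (conv H f g) h I x = (\<Sum>S\<in>Pow I. \<Sum>R\<in>Pow S. A R (S - R))"
    unfolding conv_def[of H "conv H f g"]
  proof (rule sum.cong[OF refl])
    fix S assume "S \<in> Pow I"
    then have S: "disj S (I - S)" "S \<union> (I - S) = I" using disj_Diff[OF I] by auto
    have "sweedler H S (I - S) (\<lambda>x1 x2. mul H S (I - S) (conv H f g S x1) (h (I - S) x2)) x =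
      sweedler H S (I - S) (\<lambda>x1 x2. \<Sum>R\<in>Pow S. sweedler H R (S - R)
         (\<lambda>x11 x12. mul H S (I - S) (mul H R (S - R) (f R x11) (g (S - R) x12)) (h (I - S) x2)) x1) x"
    proof (rule sweedler_cong[OF S(1)])
      fix x1 x2 assume x1: "x1 \<in> spc H S" and x2: "x2 \<in> spc H (I - S)"
      have R: "disj R (S - R)" "R \<union> (S - R) = S" if "R \<in> Pow S" for R
        using that disj_Diff[of S R] S(1) by auto
      have hx: "h (I - S) x2 \<in> spc H (I - S)" using eD(1)[OF e(3) _ x2] S by auto
      have m: "mul H R (S - R) (f R x11) (g (S - R) x12) \<in> spc H S"
        if "R \<in> Pow S" "x11 \<in> spc H R" "x12 \<in> spc H (S - R)" for R x11 x12
        using mul_closed[OF R(1)[OF that(1)] eD(1)[OF e(1) _ that(2)] eD(1)[OF e(2) _ that(3)]] R[OF that(1)] by simp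
      have lin: "linear_on (scl H) (scl H) (spc H S) (\<lambda>z. mul H S (I - S) z (h (I - S) x2))"
        by (rule mul_linear_left[OF S(1) hx])
      have sc: "sweedler H R (S - R) (\<lambda>x11 x12. mul H R (S - R) (f R x11) (g (S - R) x12)) x1 \<in> spc H S" if "R \<in> Pow S" for R
        using R[OF that] x1 S(1) m[OF that] subspace[of S] by (intro sweedler_closed[OF _ _ ambient]) auto
      have "mul H S (I - S) (conv H f g S x1) (h (I - S) x2) =
        (\<Sum>R\<in>Pow S. mul H S (I - S) (sweedler H R (S - R) (\<lambda>x11 x12. mul H R (S - R) (f R x11) (g (S - R) x12)) x1) (h (I - S) x2))"
        unfolding conv_def using S(1) sc by (intro linear_on_sum[OF ambient subspace lin]) auto
      also have "\<dots> = (\<Sum>R\<in>Pow S. sweedler H R (S - R)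
         (\<lambda>x11 x12. mul H S (I - S) (mul H R (S - R) (f R x11) (g (S - R) x12)) (h (I - S) x2)) x1)"
        using R x1 S(1) m by (intro sum.cong[OF refl] sweedler_hom[OF _ _ ambient subspace _ lin]) auto
      finally show "mul H S (I - S) (conv H f g S x1) (h (I - S) x2) = (\<Sum>R\<in>Pow S. sweedler H R (S - R)
         (\<lambda>x11 x12. mul H S (I - S) (mul H R (S - R) (f R x11) (g (S - R) x12)) (h (I - S) x2)) x1)" .
    qed (use S x in auto)
    also have "\<dots> = (\<Sum>R\<in>Pow S. A R (S - R))"
      unfolding sweedler_setsum
    proof (rule sum.cong[OF refl])
      fix R assume R': "R \<in> Pow S"
      have R: "disj R (S - R)" "R \<union> (S - R) = S" "disj R (I - S)" "disj (S - R) (I - S)"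
        "I - R - (S - R) = I - S" "R \<union> (S - R) \<union> (I - S) = I" "S - R \<union> (I - S) = I - R"
        using R' S by (auto intro: finite_subset)
      have "sweedler H (R \<union> (S - R)) (I - S) (\<lambda>x1 x2. sweedler H R (S - R)
        (\<lambda>x11 x12. mul H S (I - S) (mul H R (S - R) (f R x11) (g (S - R) x12)) (h (I - S) x2)) x1) x =
        sweedler H R ((S - R) \<union> (I - S)) (\<lambda>x1 y. sweedler H (S - R) (I - S)
          (\<lambda>x2 x3. mul H S (I - S) (mul H R (S - R) (f R x1) (g (S - R) x2)) (h (I - S) x3)) y) x"
      proof (rule sweedler_coassoc[OF R(1,3,4) _ ambient])
        have m: "mul H R (S - R) x y \<in> spc H S" if "x \<in> spc H R" "y \<in> spc H (S - R)" for x y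
          using mul_closed[OF R(1) that] R(2) by simp
        show "trilinear_on (scl H) (scl H) (scl H) (scl H) (spc H R) (spc H (S - R)) (spc H (I - S))
           (\<lambda>x1 x2 x3. mul H S (I - S) (mul H R (S - R) (f R x1) (g (S - R) x2)) (h (I - S) x3))"
          unfolding trilinear_on_def
        proof (intro conjI ballI)
          fix w assume w: "w \<in> spc H (I - S)"
          have hw: "h (I - S) w \<in> spc H (I - S)" using eD(1)[OF e(3) _ w] S by auto
          show "bilinear_on (scl H) (scl H) (scl H) (spc H R) (spc H (S - R))
            (\<lambda>x y. mul H S (I - S) (mul H R (S - R) (f R x) (g (S - R) y)) (h (I - S) w))"
            by (rule bilinear_on_comp_out[OF bilinear_mul_endo[OF R(1) e(1,2)] m mul_linear_left[OF S(1) hw]])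
              (use R(1) e(1,2) in \<open>auto simp: endo_def\<close>)
        next
          fix u assume u: "u \<in> spc H R"
          show "bilinear_on (scl H) (scl H) (scl H) (spc H (S - R)) (spc H (I - S))
            (\<lambda>x y. mul H S (I - S) (mul H R (S - R) (f R u) (g (S - R) x)) (h (I - S) y))"
          proof (rule bilinear_on_comp[OF mul_bilinear[OF S(1)]])
            show "linear_on (scl H) (scl H) (spc H (S - R)) (\<lambda>x. mul H R (S - R) (f R u) (g (S - R) x))"
              using R(1) e u by (intro linear_on_comp[OF _ _ mul_linear_right[OF R(1)]]) (auto simp: endo_def)
          qed (use S(1) R(1) e u in \<open>auto simp: endo_def intro!: m\<close>)
        qed
      qed (use x R in simp)
      then show "sweedler H S (I - S) (\<lambda>x1 x2. sweedler H R (S - R)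
        (\<lambda>x11 x12. mul H S (I - S) (mul H R (S - R) (f R x11) (g (S - R) x12)) (h (I - S) x2)) x1) x = A R (S - R)"
        by (simp only: A_def R(2,5,7))
    qed
    finally show "sweedler H S (I - S) (\<lambda>x1 x2. mul H S (I - S) (conv H f g S x1) (h (I - S) x2)) x = (\<Sum>R\<in>Pow S. A R (S - R))" .
  qed
  also have "\<dots> = (\<Sum>R\<in>Pow I. \<Sum>T\<in>Pow (I - R). A R T)" by (rule sum_Pow_Pow[OF I])
  also have "\<dots> = conv H f (conv H g h) I x"
    unfolding conv_def[of H f]
  proof (rule sum.cong[OF refl])
    fix R assume "R \<in> Pow I"
    then have R: "disj R (I - R)" "R \<union> (I - R) = I" using disj_Diff[OF I] by auto
    have T: "disj T (I - R - T)" "T \<union> (I - R - T) = I - R" "disj R T" "disj R (I - R - T)" if "T \<in> Pow (I - R)" for T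
      using that R I by (auto intro: finite_subset)
    have "sweedler H R (I - R) (\<lambda>x1 x2. mul H R (I - R) (f R x1) (conv H g h (I - R) x2)) x =
      sweedler H R (I - R) (\<lambda>x1 y. \<Sum>T\<in>Pow (I - R). sweedler H T (I - R - T)
       (\<lambda>x2 x3. mul H (R \<union> T) (I - R - T) (mul H R T (f R x1) (g T x2)) (h (I - R - T) x3)) y) x"
    proof (rule sweedler_cong[OF R(1)])
      fix x1 x2 assume x1: "x1 \<in> spc H R" and x2: "x2 \<in> spc H (I - R)"
      have fx: "f R x1 \<in> spc H R" using eD(1)[OF e(1) _ x1] R by auto
      have m: "mul H T (I - R - T) (g T x11) (h (I - R - T) x12) \<in> spc H (I - R)"
        if "T \<in> Pow (I - R)" "x11 \<in> spc H T" "x12 \<in> spc H (I - R - T)" for T x11 x12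
        using mul_closed[OF T(1)[OF that(1)] eD(1)[OF e(2) _ that(2)] eD(1)[OF e(3) _ that(3)]] T[OF that(1)] by simp
      note lin = mul_linear_right[OF R(1) fx]
      have sc: "sweedler H T (I - R - T) (\<lambda>x11 x12. mul H T (I - R - T) (g T x11) (h (I - R - T) x12)) x2 \<in> spc H (I - R)" if "T \<in> Pow (I - R)" for T
        using T[OF that] x2 R(1) m[OF that] subspace[of "I - R"] by (intro sweedler_closed[OF _ _ ambient]) auto
      have "mul H R (I - R) (f R x1) (conv H g h (I - R) x2) =
        (\<Sum>T\<in>Pow (I - R). mul H R (I - R) (f R x1) (sweedler H T (I - R - T) (\<lambda>x11 x12. mul H T (I - R - T) (g T x11) (h (I - R - T) x12)) x2))"
        unfolding conv_def using R(1) sc by (intro linear_on_sum[OF ambient subspace lin]) auto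
      also have "\<dots> = (\<Sum>T\<in>Pow (I - R). sweedler H T (I - R - T)
         (\<lambda>x2 x3. mul H R (I - R) (f R x1) (mul H T (I - R - T) (g T x2) (h (I - R - T) x3))) x2)"
        using T x2 R(1) m by (intro sum.cong[OF refl] sweedler_hom[OF _ _ ambient subspace _ lin]) auto
      also have "\<dots> = (\<Sum>T\<in>Pow (I - R). sweedler H T (I - R - T)
       (\<lambda>x2 x3. mul H (R \<union> T) (I - R - T) (mul H R T (f R x1) (g T x2)) (h (I - R - T) x3)) x2)"
        using T x2 eD(1)[OF e(2)] eD(1)[OF e(3)] fx mul_assoc
        by (intro sum.cong[OF refl] sweedler_cong) auto
      finally show "mul H R (I - R) (f R x1) (conv H g h (I - R) x2) = (\<Sum>T\<in>Pow (I - R). sweedler H T (I - R - T)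
       (\<lambda>x2 x3. mul H (R \<union> T) (I - R - T) (mul H R T (f R x1) (g T x2)) (h (I - R - T) x3)) x2)" .
    qed (use R x in auto)
    then show "(\<Sum>T\<in>Pow (I - R). A R T) = sweedler H R (I - R) (\<lambda>x1 x2. mul H R (I - R) (f R x1) (conv H g h (I - R) x2)) x"
      unfolding A_def sweedler_setsum by simp
  qed
  finally show ?thesis .
qed

lemma endo_unit: "endo H (conv_unit H)"
  unfolding endo_def conv_unit_def using cnt_linear
  by (auto simp: linear_on_def spc_0 spc_scl unt_closed amb.scale_left_distrib)

lemma endo_id: "endo H (\<lambda>I x. x)"
  by (auto simp: endo_def linear_on_def)

lemma conv_unit_left:
  assumes f: "endo H f" and I: "finite I" and x: "x \<in> spc H I"
  shows "conv H (conv_unit H) f I x = f I x"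
proof -
  have *: "sweedler H S (I - S) (\<lambda>x1 x2. mul H S (I - S) (conv_unit H S x1) (f (I - S) x2)) x = 0"
    if "S \<in> Pow I - {{}}" for S
  proof -
    have S: "disj S (I - S)" "S \<union> (I - S) = I" "S \<noteq> {}" using that disj_Diff[OF I] by auto
    have "sweedler H S (I - S) (\<lambda>x1 x2. mul H S (I - S) (conv_unit H S x1) (f (I - S) x2)) x = sweedler H S (I - S) (\<lambda>x1 x2. 0) x"
      using S x f by (intro sweedler_cong) (auto simp: conv_unit_def endo_def intro!: mul_0_left)
    then show ?thesis by (simp add: sweedler_0)
  qed
  have "conv H (conv_unit H) f I x = sweedler H {} I (\<lambda>x1 x2. mul H {} I (conv_unit H {} x1) (f I x2)) x"
    unfolding conv_def by (subst sum.remove[of _ "{}"]) (use I * in auto)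
  also have "\<dots> = sweedler H {} I (\<lambda>x1 x2. f I (scl H (cnt H x1) x2)) x"
    using I x f linear_on_scl[OF mul_linear_left[of "{}" I]]
    by (intro sweedler_cong) (auto simp: conv_unit_def endo_def unt_closed mul_unt_left linear_on_scl)
  also have "\<dots> = f I x" using f I by (intro sweedler_cnt_left[OF I x]) (auto simp: endo_def)
  finally show ?thesis .
qed

lemma conv_unit_right:
  assumes f: "endo H f" and I: "finite I" and x: "x \<in> spc H I"
  shows "conv H f (conv_unit H) I x = f I x"
proof -
  have *: "sweedler H S (I - S) (\<lambda>x1 x2. mul H S (I - S) (f S x1) (conv_unit H (I - S) x2)) x = 0"
    if "S \<in> Pow I - {I}" for S
  proof -
    have S: "disj S (I - S)" "S \<union> (I - S) = I" "I - S \<noteq> {}" using that disj_Diff[OF I] by auto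
    have "sweedler H S (I - S) (\<lambda>x1 x2. mul H S (I - S) (f S x1) (conv_unit H (I - S) x2)) x = sweedler H S (I - S) (\<lambda>x1 x2. 0) x"
      using S x f by (intro sweedler_cong) (auto simp: conv_unit_def endo_def intro!: mul_0_right)
    then show ?thesis by (simp add: sweedler_0)
  qed
  have "conv H f (conv_unit H) I x = sweedler H I {} (\<lambda>x1 x2. mul H I {} (f I x1) (conv_unit H {} x2)) x"
    unfolding conv_def by (subst sum.remove[of _ I]) (use I * in auto)
  also have "\<dots> = sweedler H I {} (\<lambda>x1 x2. f I (scl H (cnt H x2) x1)) x"
    using I x f linear_on_scl[OF mul_linear_right[of I "{}"]]
    by (intro sweedler_cong) (auto simp: conv_unit_def endo_def unt_closed mul_unt_right linear_on_scl)
  also have "\<dots> = f I x" using f I by (intro sweedler_cnt_right[OF I x]) (auto simp: endo_def)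
  finally show ?thesis .
qed

text \<open>For \<open>S = I\<close> the second Sweedler factor lies in
  \<open>H[\<emptyset>]\<close>, which the unit spans, so that this summand is \<open>f I x\<close>.
  The others involve \<open>f\<close> on proper subsets only; hence an equation for
  \<open>conv H f id\<close> can be solved, and its solution compared, by recursion on
  \<open>I\<close>.\<close>

lemma conv_id_split:
  assumes c: "connected_unit H" and f: "endo H f" and I: "finite I" and x: "x \<in> spc H I"
  shows "conv H f (\<lambda>I x. x) I x = f I x +
    (\<Sum>S\<in>Pow I - {I}. sweedler H S (I - S) (\<lambda>x1 x2. mul H S (I - S) (f S x1) x2) x)"
proof -
  have "sweedler H I {} (\<lambda>x1 x2. mul H I {} (f I x1) x2) x = mul H I {} (f I x) (unt H)"
    using I by (intro sweedler_connected_right[OF c I x ambient] bilinear_mul_endo[OF _ f endo_id]) auto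
  also have "\<dots> = f I x" using f I x by (intro mul_unt_right) (auto simp: endo_def)
  finally show ?thesis unfolding conv_def by (subst sum.remove[of _ I]) (use I in auto)
qed

text \<open>The solution of "convolution with the identity gives \<open>conv_unit\<close>" as read
  off from \<open>conv_id_split\<close>. On the empty set connectedness turns that equation into
  \<open>f = id\<close>.\<close>

definition rec_antipode :: "'l set \<Rightarrow> 'v \<Rightarrow> 'v" where
  "rec_antipode = wfrec finite_psubset (\<lambda>s I x. if I = {} then x else
     - (\<Sum>S\<in>Pow I - {I}. sweedler H S (I - S) (\<lambda>x1 x2. mul H S (I - S) (s S x1) x2) x))"

lemma rec_antipode_simps:
  assumes "finite I"
  shows "rec_antipode I x = (if I = {} then x else
     - (\<Sum>S\<in>Pow I - {I}. sweedler H S (I - S) (\<lambda>x1 x2. mul H S (I - S) (rec_antipode S x1) x2) x))"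
proof -
  have "cut rec_antipode finite_psubset I S = rec_antipode S" if "S \<in> Pow I - {I}" for S
    using that assms by (intro cut_apply) (auto simp: finite_psubset_def)
  then show ?thesis
    by (subst def_wfrec[OF rec_antipode_def[THEN eq_reflection] wf_finite_psubset]) (auto intro!: sum.cong)
qed

lemma rec_antipode_endo_aux:
  "finite I \<Longrightarrow> (\<forall>x\<in>spc H I. rec_antipode I x \<in> spc H I) \<and> linear_on (scl H) (scl H) (spc H I) (rec_antipode I)"
proof (induction I rule: finite_psubset_induct)
  case (psubset I)
  show ?case
  proof (cases "I = {}")
    case True
    then show ?thesis by (simp add: rec_antipode_simps linear_on_def)
  next
    case False
    have S: "disj S (I - S)" "S \<union> (I - S) = I" "S \<subset> I" if "S \<in> Pow I - {I}" for S
      using that disj_Diff[OF psubset.hyps, of S] by auto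
    have "sweedler H S (I - S) (\<lambda>x1 x2. mul H S (I - S) (rec_antipode S x1) x2) x \<in> spc H I"
      if "S \<in> Pow I - {I}" "x \<in> spc H I" for S x
      using S[OF that(1)] that(2) psubset mul_closed[OF S(1)[OF that(1)]]
      by (intro sweedler_closed[OF _ _ ambient subspace]) auto
    moreover have "linear_on (scl H) (scl H) (spc H I) (sweedler H S (I - S) (\<lambda>x1 x2. mul H S (I - S) (rec_antipode S x1) x2))"
      if "S \<in> Pow I - {I}" for S
    proof -
      have "bilinear_on (scl H) (scl H) (scl H) (spc H S) (spc H (I - S)) (\<lambda>x1 x2. mul H S (I - S) (rec_antipode S x1) x2)"
        using S[OF that] psubset.IH[of S]
        by (intro bilinear_on_comp[OF mul_bilinear, where g = "\<lambda>x. x"]) (auto simp: linear_on_def)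
      then show ?thesis using sweedler_linear[OF S(1)[OF that] ambient] S(2)[OF that] by simp
    qed
    then have "linear_on (scl H) (scl H) (spc H I) (\<lambda>x. \<Sum>S\<in>Pow I - {I}. sweedler H S (I - S) (\<lambda>x1 x2. mul H S (I - S) (rec_antipode S x1) x2) x)"
      by (intro linear_on_setsum ambient)
    ultimately show ?thesis using False psubset.hyps
      by (auto simp: rec_antipode_simps[OF psubset.hyps] linear_on_def intro!: spc_sum spc_neg)
  qed
qed

lemma rec_antipode_endo: "endo H rec_antipode"
  using rec_antipode_endo_aux by (simp add: endo_def)

text \<open>The bijection permutes the summands of the recursion, taking the one for
  \<open>S\<close> to the one for its image; each is natural by the induction hypothesis on
  \<open>S\<close> and naturality of product and coproduct.\<close>

lemma rec_antipode_natural: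
  "finite I \<Longrightarrow> inj_on \<sigma> I \<Longrightarrow> x \<in> spc H I \<Longrightarrow> rec_antipode (\<sigma> ` I) (act H \<sigma> I x) = act H \<sigma> I (rec_antipode I x)"
proof (induction I arbitrary: x rule: finite_psubset_induct)
  case (psubset I)
  note I = psubset.hyps
  show ?case
  proof (cases "I = {}")
    case True
    then show ?thesis by (simp add: rec_antipode_simps)
  next
    case False
    note eD = rec_antipode_endo[unfolded endo_def, rule_format]
    have S: "disj S (I - S)" "S \<union> (I - S) = I" "S \<subset> I" "inj_on \<sigma> (S \<union> (I - S))"
        "\<sigma> ` I - \<sigma> ` S = \<sigma> ` (I - S)" "disj (\<sigma> ` S) (\<sigma> ` (I - S))" "inj_on \<sigma> S" if "S \<in> Pow I - {I}" for S
    proof -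
      show *: "disj S (I - S)" "S \<union> (I - S) = I" "S \<subset> I" using that disj_Diff[OF I, of S] by auto
      then show "inj_on \<sigma> (S \<union> (I - S))" using psubset.prems by simp
      show "\<sigma> ` I - \<sigma> ` S = \<sigma> ` (I - S)" using that psubset.prems inj_on_image_set_diff[of \<sigma> I I S] by auto
      show "inj_on \<sigma> S" using that psubset.prems inj_on_subset by blast
      show "disj (\<sigma> ` S) (\<sigma> ` (I - S))" using * psubset.prems by (auto simp: inj_on_def)
    qed
    have cl: "mul H S (I - S) (rec_antipode S x1) x2 \<in> spc H I"
      if "S \<in> Pow I - {I}" "x1 \<in> spc H S" "x2 \<in> spc H (I - S)" for S x1 x2
      using mul_closed[of S "I - S" "rec_antipode S x1" x2] S[OF that(1)] eD[of S] that by auto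
    have sc: "sweedler H S (I - S) (\<lambda>x1 x2. mul H S (I - S) (rec_antipode S x1) x2) x \<in> spc H I" if "S \<in> Pow I - {I}" for S
      by (rule sweedler_closed[OF S(1)[OF that] _ ambient subspace[OF I] cl[OF that]])
        (simp_all only: S(2)[OF that] psubset.prems(2))
    have im: "Pow (\<sigma> ` I) - {\<sigma> ` I} = (`) \<sigma> ` (Pow I - {I})"
      using psubset.prems(1) by (auto simp: image_Pow_surj[symmetric] inj_on_image_eq_iff)
    have inj: "inj_on ((`) \<sigma>) (Pow I - {I})"
      using psubset.prems(1) by (meson Diff_subset inj_on_image_Pow inj_on_subset)
    have "rec_antipode (\<sigma> ` I) (act H \<sigma> I x) = - (\<Sum>S\<in>Pow I - {I}. sweedler H (\<sigma> ` S) (\<sigma> ` I - \<sigma> ` S)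
       (\<lambda>x1 x2. mul H (\<sigma> ` S) (\<sigma> ` I - \<sigma> ` S) (rec_antipode (\<sigma> ` S) x1) x2) (act H \<sigma> I x))"
      using False I by (subst rec_antipode_simps) (auto simp: im sum.reindex[OF inj])
    also have "\<dots> = - (\<Sum>S\<in>Pow I - {I}. act H \<sigma> I (sweedler H S (I - S) (\<lambda>x1 x2. mul H S (I - S) (rec_antipode S x1) x2) x))"
    proof (intro arg_cong[of _ _ uminus] sum.cong refl)
      fix S assume S': "S \<in> Pow I - {I}"
      note S = S[OF S']
      have "sweedler H (\<sigma> ` S) (\<sigma> ` (I - S)) (\<lambda>x1 x2. mul H (\<sigma> ` S) (\<sigma> ` (I - S)) (rec_antipode (\<sigma> ` S) x1) x2) (act H \<sigma> (S \<union> (I - S)) x)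
        = sweedler H S (I - S) (\<lambda>x1 x2. mul H (\<sigma> ` S) (\<sigma> ` (I - S)) (rec_antipode (\<sigma> ` S) (act H \<sigma> S x1)) (act H \<sigma> (I - S) x2)) x"
        by (rule sweedler_natural[OF S(1) _ S(4) ambient bilinear_mul_endo[OF S(6) rec_antipode_endo endo_id]])
          (simp only: S(2) psubset.prems(2))
      also have "\<dots> = sweedler H S (I - S) (\<lambda>x1 x2. act H \<sigma> I (mul H S (I - S) (rec_antipode S x1) x2)) x"
        using S psubset.IH[of S] psubset.prems(2) eD[of S] mul_natural[OF S(1,4)] by (intro sweedler_cong) auto
      also have "\<dots> = act H \<sigma> I (sweedler H S (I - S) (\<lambda>x1 x2. mul H S (I - S) (rec_antipode S x1) x2) x)"
        using S psubset.prems cl[OF S']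
        by (intro sweedler_hom[OF _ _ ambient subspace[OF I] _ act_linear[OF I psubset.prems(1)], symmetric]) auto
      finally show "sweedler H (\<sigma> ` S) (\<sigma> ` I - \<sigma> ` S)
         (\<lambda>x1 x2. mul H (\<sigma> ` S) (\<sigma> ` I - \<sigma> ` S) (rec_antipode (\<sigma> ` S) x1) x2) (act H \<sigma> I x) =
         act H \<sigma> I (sweedler H S (I - S) (\<lambda>x1 x2. mul H S (I - S) (rec_antipode S x1) x2) x)"
        using S by simp
    qed
    also have "\<dots> = - act H \<sigma> I (\<Sum>S\<in>Pow I - {I}. sweedler H S (I - S) (\<lambda>x1 x2. mul H S (I - S) (rec_antipode S x1) x2) x)"
      by (intro arg_cong[of _ _ uminus] linear_on_sum[OF ambient subspace[OF I] act_linear[OF I psubset.prems(1)], symmetric] sc)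
    also have "\<dots> = act H \<sigma> I (- (\<Sum>S\<in>Pow I - {I}. sweedler H S (I - S) (\<lambda>x1 x2. mul H S (I - S) (rec_antipode S x1) x2) x))"
    proof -
      let ?y = "\<Sum>S\<in>Pow I - {I}. sweedler H S (I - S) (\<lambda>x1 x2. mul H S (I - S) (rec_antipode S x1) x2) x"
      have "?y \<in> spc H I"
        by (intro spc_sum[OF I] sc)
      then show ?thesis
        using linear_on_diff[OF ambient subspace[OF I] act_linear[OF I psubset.prems(1)] spc_0[OF I], of ?y] act_0[OF I psubset.prems(1)] by simp
    qed
    also have "\<dots> = act H \<sigma> I (rec_antipode I x)"
      using False by (simp add: rec_antipode_simps[OF I])
    finally show ?thesis .
  qed
qed

lemma rec_antipode_left:
  assumes c: "connected_unit H" and I: "finite I" and x: "x \<in> spc H I"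
  shows "conv H rec_antipode (\<lambda>I x. x) I x = conv_unit H I x"
  unfolding conv_id_split[OF c rec_antipode_endo I x]
  using c x by (auto simp: rec_antipode_simps[OF I] conv_unit_def connected_unit_def)

text \<open>
  Cancellation turns the left antipode \<open>s\<close> into a right one, since
  \<open>(id * s) * id = id * (s * id) = id\<close> for the convolution product.
\<close>

lemma conv_id_cancel:
  assumes c: "connected_unit H" and f: "endo H f" and g: "endo H g"
    and eq: "\<And>I x. finite I \<Longrightarrow> x \<in> spc H I \<Longrightarrow> conv H f (\<lambda>I x. x) I x = conv H g (\<lambda>I x. x) I x"
  shows "finite I \<Longrightarrow> x \<in> spc H I \<Longrightarrow> f I x = g I x"
proof (induction I arbitrary: x rule: finite_psubset_induct)
  case (psubset I)
  note I = psubset.hyps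
  have "(\<Sum>S\<in>Pow I - {I}. sweedler H S (I - S) (\<lambda>x1 x2. mul H S (I - S) (f S x1) x2) x) =
    (\<Sum>S\<in>Pow I - {I}. sweedler H S (I - S) (\<lambda>x1 x2. mul H S (I - S) (g S x1) x2) x)"
  proof (rule sum.cong[OF refl])
    fix S assume "S \<in> Pow I - {I}"
    then have S: "disj S (I - S)" "S \<union> (I - S) = I" "S \<subset> I" using disj_Diff[OF I, of S] by auto
    show "sweedler H S (I - S) (\<lambda>x1 x2. mul H S (I - S) (f S x1) x2) x = sweedler H S (I - S) (\<lambda>x1 x2. mul H S (I - S) (g S x1) x2) x"
      using S psubset.prems psubset.IH by (intro sweedler_cong) auto
  qed
  then show ?case
    using eq[OF I psubset.prems] by (simp add: conv_id_split[OF c _ I psubset.prems] f g)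
qed

lemma rec_antipode_right:
  assumes c: "connected_unit H" and I: "finite I" and x: "x \<in> spc H I"
  shows "conv H (\<lambda>I x. x) rec_antipode I x = conv_unit H I x"
proof (rule conv_id_cancel[OF c conv_endo[OF endo_id rec_antipode_endo] endo_unit _ I x])
  fix I x assume I: "finite I" and x: "x \<in> spc H I"
  have "conv H (conv H (\<lambda>I x. x) rec_antipode) (\<lambda>I x. x) I x = conv H (\<lambda>I x. x) (conv H rec_antipode (\<lambda>I x. x)) I x"
    by (rule conv_assoc[OF endo_id rec_antipode_endo endo_id I x])
  also have "\<dots> = conv H (\<lambda>I x. x) (conv_unit H) I x"
    unfolding conv_def[of H "\<lambda>I x. x"]
  proof (rule sum.cong[OF refl])
    fix S assume "S \<in> Pow I"
    then have S: "disj S (I - S)" "S \<union> (I - S) = I" using disj_Diff[OF I, of S] by auto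
    show "sweedler H S (I - S) (\<lambda>x1 x2. mul H S (I - S) x1 (conv H rec_antipode (\<lambda>I x. x) (I - S) x2)) x =
      sweedler H S (I - S) (\<lambda>x1 x2. mul H S (I - S) x1 (conv_unit H (I - S) x2)) x"
      using S x by (intro sweedler_cong) (auto simp: rec_antipode_left[OF c])
  qed
  also have "\<dots> = conv H (conv_unit H) (\<lambda>I x. x) I x"
    by (simp add: conv_unit_right[OF endo_id I x] conv_unit_left[OF endo_id I x])
  finally show "conv H (conv H (\<lambda>I x. x) rec_antipode) (\<lambda>I x. x) I x = conv H (conv_unit H) (\<lambda>I x. x) I x" .
qed

theorem connected_hopf_monoid:
  assumes c: "connected_unit H"
  shows "hopf_monoid H"
proof -
  have "antipode H rec_antipode"
    unfolding antipode_def species_morphism_def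
    using rec_antipode_left[OF c] rec_antipode_right[OF c] rec_antipode_endo rec_antipode_natural species_axioms
    by (simp add: conv_def conv_unit_def endo_def image_subset_iff)
  then show ?thesis using species_bimonoid_axioms by (auto simp: hopf_monoid_def)
qed

end

section \<open>The Cauchy product of two bimonoids\<close>

lemma summand_add: "summand S (t + t') = summand S t + summand S t'"
  and summand_0: "summand S 0 = 0"
  and summand_scl: "summand S (fscale c (t :: 'x \<Rightarrow> 'k::field)) = cauchy_scale c (summand S t)"
  by (auto simp: summand_def fun_eq_iff fscale_def)

lemma summand_same: "summand S t S = t"
  and summand_other: "U \<noteq> S \<Longrightarrow> summand S t U = 0"
  by (auto simp: summand_def)

lemma linear_on_eval: "linear_on cauchy_scale fscale V (\<lambda>f. f U)"
  by (auto simp: linear_on_def)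

lemma linear_on_component:
  assumes "\<And>U. linear_on s fscale V (\<lambda>f. F f U)"
  shows "linear_on s cauchy_scale V (F :: _ \<Rightarrow> 'l set \<Rightarrow> 'x \<Rightarrow> 'k::field)"
  using assms by (auto simp: linear_on_def fun_eq_iff)

lemma linear_on_const_0: "vector_space s2 \<Longrightarrow> linear_on s1 s2 V (\<lambda>x. 0)"
  by (simp add: linear_on_def module.scale_zero_right module_iff_vector_space)

lemma fun_sum_apply: "(\<Sum>a\<in>X. g a) y = (\<Sum>a\<in>X. g a y)"
  by (induction X rule: infinite_finite_induct) auto

text \<open>As rewrite rules, both are eta-contracted and turn every \<open>f + g\<close> and \<open>0\<close> into an abstraction.\<close>

declare plus_fun_apply [simp del] zero_fun_apply [simp del]

locale species_pair = H: species H + K: species K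
  for H :: "('k::field, 'l, 'v::ab_group_add) hopf_data" and K :: "('k, 'l, 'w::ab_group_add) hopf_data"
begin

abbreviation "A \<equiv> cauchy H K"
abbreviation "cs \<equiv> (cauchy_scale :: 'k \<Rightarrow> ('l set \<Rightarrow> ('k, 'v, 'w) tensor) \<Rightarrow> _)"

text \<open>The tensor of \<open>x\<close> and \<open>y\<close> in the summand indexed by the degree
  \<open>U\<close> of \<open>x\<close>. The total set \<open>I\<close> is not recorded:
  \<open>y\<close> is meant to have degree \<open>I - U\<close>. So the same term also denotes an
  element of a product with a smaller or larger right factor.\<close>

definition pure :: "'l set \<Rightarrow> 'v \<Rightarrow> 'w \<Rightarrow> 'l set \<Rightarrow> ('k, 'v, 'w) tensor" where
  "pure U x y = summand U (tensor (scl H) (scl K) x y)"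

lemma pure_simps:
  "pure U (x + x') y = pure U x y + pure U x' y" "pure U x (y + y') = pure U x y + pure U x y'"
  "pure U (scl H c x) y = cs c (pure U x y)" "pure U x (scl K c y) = cs c (pure U x y)"
  "pure U 0 y = 0" "pure U x 0 = 0"
  unfolding pure_def by (simp_all add: tensor_simps summand_add summand_0 summand_scl)

lemma scl_A: "scl A = cs" by (simp add: cauchy_def)
lemma spc_A: "spc A = cauchy_space (scl H) (scl K) (spc H) (spc K)" by (simp add: cauchy_def)

sublocale cs: vector_space cs
  by (rule vector_space_cauchy_scale)

lemma tens_HK: "finite S \<Longrightarrow> finite T \<Longrightarrow> tens (scl H) (scl K) (spc H S) (spc K T)"
  by (rule tens_species[OF H.species_axioms K.species_axioms])

lemma subspace_A: "finite I \<Longrightarrow> module.subspace cs (spc A I)"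
  unfolding cs.subspace_def spc_A cauchy_space_def
proof (intro conjI ballI allI)
  assume I: "finite I"
  have f: "finite S" if "S \<subseteq> I" for S using I that finite_subset by blast
  note sub = tens.subspace_TS[OF tens_HK, unfolded module.subspace_def[OF vector_space_fscale[folded module_iff_vector_space]]]
  show "0 \<in> {f. \<forall>S. if S \<subseteq> I then f S \<in> tensor_space (scl H) (scl K) (spc H S) (spc K (I - S)) else f S = 0}"
    using sub I f by (auto simp: zero_fun_apply)
  show "x + y \<in> {f. \<forall>S. if S \<subseteq> I then f S \<in> tensor_space (scl H) (scl K) (spc H S) (spc K (I - S)) else f S = 0}"
    if "x \<in> {f. \<forall>S. if S \<subseteq> I then f S \<in> tensor_space (scl H) (scl K) (spc H S) (spc K (I - S)) else f S = 0}"
       "y \<in> {f. \<forall>S. if S \<subseteq> I then f S \<in> tensor_space (scl H) (scl K) (spc H S) (spc K (I - S)) else f S = 0}" for x y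
    using that sub[OF f] I by (auto split: if_splits simp: plus_fun_apply)
  show "cs c x \<in> {f. \<forall>S. if S \<subseteq> I then f S \<in> tensor_space (scl H) (scl K) (spc H S) (spc K (I - S)) else f S = 0}"
    if "x \<in> {f. \<forall>S. if S \<subseteq> I then f S \<in> tensor_space (scl H) (scl K) (spc H S) (spc K (I - S)) else f S = 0}" for c x
    using that sub[OF f] I by (auto split: if_splits simp: fscale_def fun_eq_iff zero_fun_apply)
qed

lemma summand_closed: "finite I \<Longrightarrow> U \<subseteq> I \<Longrightarrow> t \<in> tensor_space (scl H) (scl K) (spc H U) (spc K (I - U)) \<Longrightarrow> summand U t \<in> spc A I"
  unfolding spc_A cauchy_space_def summand_def
  using module.subspace_0[OF _ tens.subspace_TS[OF tens_HK[OF finite_subset[of _ I] finite_Diff[of I]]]] vector_space_fscale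
  by (auto simp: module_iff_vector_space)

lemma component_closed: "f \<in> spc A I \<Longrightarrow> U \<subseteq> I \<Longrightarrow> f U \<in> tensor_space (scl H) (scl K) (spc H U) (spc K (I - U))"
  by (auto simp: spc_A cauchy_space_def split: if_splits)

lemma component_0: "f \<in> spc A I \<Longrightarrow> \<not> U \<subseteq> I \<Longrightarrow> f U = 0"
  by (auto simp: spc_A cauchy_space_def split: if_splits)

lemma pure_closed: "finite I \<Longrightarrow> U \<subseteq> I \<Longrightarrow> x \<in> spc H U \<Longrightarrow> y \<in> spc K (I - U) \<Longrightarrow> pure U x y \<in> spc A I"
  unfolding pure_def by (intro summand_closed tens.TS_tensor[OF tens_HK]) (auto intro: finite_subset)

lemma decompose: "finite I \<Longrightarrow> f \<in> spc A I \<Longrightarrow> f = (\<Sum>U\<in>Pow I. summand U (f U))"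
proof (rule ext)
  fix W assume *: "finite I" "f \<in> spc A I"
  have "(\<Sum>U\<in>Pow I. summand U (f U)) W = (\<Sum>U\<in>Pow I. summand U (f U) W)"
    by (rule fun_sum_apply)
  also have "\<dots> = (\<Sum>U\<in>Pow I. if W = U then f W else 0)"
    by (intro sum.cong) (auto simp: summand_def)
  also have "\<dots> = f W" using * by (auto simp: component_0)
  finally show "f W = (\<Sum>U\<in>Pow I. summand U (f U)) W" ..
qed

text \<open>The set \<open>X\<close> bounds the support of \<open>f\<close>, so that only pure
  tensors with left degree in \<open>X\<close> have to be treated. The triangularity arguments below
  rest on this control of left degrees.\<close>

lemma A_induct_supp [consumes 2, case_names supp zero add pure]:
  assumes I: "finite I" and f: "f \<in> spc A I" and supp: "\<And>U. U \<notin> X \<Longrightarrow> f U = 0"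
    and 0: "P 0" and add: "\<And>f g. f \<in> spc A I \<Longrightarrow> g \<in> spc A I \<Longrightarrow> P f \<Longrightarrow> P g \<Longrightarrow> P (f + g)"
    and p: "\<And>U x y. U \<in> X \<Longrightarrow> U \<subseteq> I \<Longrightarrow> x \<in> spc H U \<Longrightarrow> y \<in> spc K (I - U) \<Longrightarrow> P (pure U x y)"
  shows "P f"
proof -
  have 1: "summand U t \<in> spc A I \<and> P (summand U t)"
    if U: "U \<subseteq> I" "U \<in> X" and t: "t \<in> tensor_space (scl H) (scl K) (spc H U) (spc K (I - U))" for U t
  proof -
    interpret t: tens "scl H" "scl K" "spc H U" "spc K (I - U)"
      using I U by (intro tens_HK) (auto intro: finite_subset)
    from t have "P (summand U t)"
    proof (induction rule: t.TS_induct)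
      case (tensor t v w)
      have "P (pure U v w + summand U t)"
        using tensor U I by (intro add p pure_closed summand_closed) auto
      then show ?case by (simp add: pure_def summand_add)
    qed (simp add: 0 summand_0)
    then show ?thesis using summand_closed[OF I U(1) t] by blast
  qed
  have 2: "summand U (f U) \<in> spc A I \<and> P (summand U (f U))" if "U \<subseteq> I" for U
  proof (cases "U \<in> X")
    case False
    then show ?thesis using supp[of U] 0 cs.subspace_0[OF subspace_A[OF I]] by (simp add: summand_0)
  qed (use that 1 component_closed[OF f] in blast)
  have "(\<Sum>U\<in>Y. summand U (f U)) \<in> spc A I \<and> P (\<Sum>U\<in>Y. summand U (f U))" if "finite Y" "Y \<subseteq> Pow I" for Y
    using that
  proof (induction Y)
    case (insert U Y)
    then show ?case using 2[of U] subspace_A[OF I]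
      by (auto intro!: add cs.subspace_add)
  qed (use 0 subspace_A[OF I] cs.subspace_0 in auto)
  from this[of "Pow I"] show ?thesis using decompose[OF I f] I by simp
qed

lemma A_induct [consumes 2, case_names zero add pure]:
  assumes "finite I" "f \<in> spc A I" "P 0" "\<And>f g. f \<in> spc A I \<Longrightarrow> g \<in> spc A I \<Longrightarrow> P f \<Longrightarrow> P g \<Longrightarrow> P (f + g)"
    and "\<And>U x y. U \<subseteq> I \<Longrightarrow> x \<in> spc H U \<Longrightarrow> y \<in> spc K (I - U) \<Longrightarrow> P (pure U x y)"
  shows "P f"
  using assms by (induction rule: A_induct_supp[where X = UNIV]) auto

lemma A_eqI:
  assumes I: "finite I" and F: "linear_on cs s (spc A I) F" and G: "linear_on cs s (spc A I) G"
    and p: "\<And>U x y. U \<subseteq> I \<Longrightarrow> x \<in> spc H U \<Longrightarrow> y \<in> spc K (I - U) \<Longrightarrow> F (pure U x y) = G (pure U x y)"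
    and f: "f \<in> spc A I"
  shows "F f = G f"
  using I f
proof (induction rule: A_induct)
  case zero
  then show ?case using linear_on_zero[OF F] linear_on_zero[OF G] cs.subspace_0 subspace_A[OF I] by simp
qed (auto simp: p linear_on_add[OF F] linear_on_add[OF G])

lemma A_closedI:
  assumes I: "finite I" and F: "linear_on cs s (spc A I) F" and s: "vector_space s" and V: "module.subspace s V"
    and p: "\<And>U x y. U \<subseteq> I \<Longrightarrow> x \<in> spc H U \<Longrightarrow> y \<in> spc K (I - U) \<Longrightarrow> F (pure U x y) \<in> V"
    and f: "f \<in> spc A I"
  shows "F f \<in> V"
proof -
  interpret vector_space s by fact
  show ?thesis
    using I f
  proof (induction rule: A_induct)
    case zero
    then show ?case using linear_on_zero[OF F] cs.subspace_0 subspace_A[OF I] subspace_0[OF V] by simp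
  qed (auto simp: p linear_on_add[OF F] subspace_add[OF V])
qed

lemma linear_on_component_lift:
  assumes "finite I" "U \<subseteq> I" "vector_space s" "bilinear_on (scl H) (scl K) s (spc H U) (spc K (I - U)) F"
  shows "linear_on cs s (spc A I) (\<lambda>f. lift2 H K U (I - U) F (f U))"
  using assms
  by (intro linear_on_comp[OF linear_on_eval component_closed tens.TL_linear[OF tens_HK]]) (auto intro: finite_subset)

lemma lift_pure:
  assumes "finite I" "U \<subseteq> I" "V \<subseteq> I" "vector_space s" "bilinear_on (scl H) (scl K) s (spc H V) (spc K (I - V)) F"
    "x \<in> spc H U" "y \<in> spc K (I - U)"
  shows "lift2 H K V (I - V) F (pure U x y V) = (if V = U then F x y else 0)"
proof -
  interpret t: tens "scl H" "scl K" "spc H V" "spc K (I - V)"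
    using assms by (intro tens_HK) (auto intro: finite_subset)
  show ?thesis
    using t.TL_tensor[OF assms(4,5)] assms(6,7) linear_on_zero[OF t.TL_linear[OF assms(4,5)]]
      module.subspace_0[OF _ t.subspace_TS] vector_space_fscale
    by (auto simp: pure_def summand_same summand_other module_iff_vector_space)
qed

subsection \<open>Underlying species\<close>

lemma act_linear_aux:
  assumes "finite I" "inj_on \<sigma> I" "S \<subseteq> I"
  shows "bilinear_on (scl H) (scl K) fscale (spc H S) (spc K (I - S))
     (\<lambda>x y. tensor (scl H) (scl K) (act H \<sigma> S x) (act K \<sigma> (I - S) y))"
  using assms
  by (intro bilinear_on_comp[OF bilinear_on_tensor[where V = UNIV and W = UNIV] H.act_linear K.act_linear])
    (auto intro: finite_subset inj_on_subset)

lemma A_act_linear: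
  assumes I: "finite I" and \<sigma>: "inj_on \<sigma> I"
  shows "linear_on cs cs (spc A I) (act A \<sigma> I)"
proof (rule linear_on_component)
  fix U
  show "linear_on cs fscale (spc A I) (\<lambda>f. act A \<sigma> I f U)"
  proof (cases "U \<subseteq> \<sigma> ` I")
    case True
    then show ?thesis
      using linear_on_component_lift[OF I Int_lower1 vector_space_fscale act_linear_aux[OF I \<sigma> Int_lower1]]
      by (simp add: cauchy_def Let_def)
  qed (simp add: cauchy_def linear_on_const_0[OF vector_space_fscale])
qed

lemma act_pure:
  assumes I: "finite I" and \<sigma>: "inj_on \<sigma> I" and U: "U \<subseteq> I" and x: "x \<in> spc H U" and y: "y \<in> spc K (I - U)"
  shows "act A \<sigma> I (pure U x y) = pure (\<sigma> ` U) (act H \<sigma> U x) (act K \<sigma> (I - U) y)"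
proof (rule ext)
  fix W
  show "act A \<sigma> I (pure U x y) W = pure (\<sigma> ` U) (act H \<sigma> U x) (act K \<sigma> (I - U) y) W"
  proof (cases "W \<subseteq> \<sigma> ` I")
    case True
    have *: "I \<inter> \<sigma> -` W = U \<longleftrightarrow> W = \<sigma> ` U"
    proof
      assume "I \<inter> \<sigma> -` W = U"
      then show "W = \<sigma> ` U" using True by auto
    qed (use U \<sigma> in \<open>auto simp: inj_on_def\<close>)
    have "act A \<sigma> I (pure U x y) W = (if I \<inter> \<sigma> -` W = U then
       tensor (scl H) (scl K) (act H \<sigma> (I \<inter> \<sigma> -` W) x) (act K \<sigma> (I - (I \<inter> \<sigma> -` W)) y) else 0)"
      using True lift_pure[OF I U Int_lower1 vector_space_fscale act_linear_aux[OF I \<sigma> Int_lower1] x y, of "\<sigma> -` W"]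
      by (simp add: cauchy_def Let_def)
    then show ?thesis by (cases "I \<inter> \<sigma> -` W = U") (simp_all add: * pure_def summand_def)
  next
    case False
    then have "W \<noteq> \<sigma> ` U" using U by auto
    then show ?thesis using False by (simp add: cauchy_def pure_def summand_other)
  qed
qed

lemma A_act_closed:
  assumes I: "finite I" and \<sigma>: "inj_on \<sigma> I" and f: "f \<in> spc A I"
  shows "act A \<sigma> I f \<in> spc A (\<sigma> ` I)"
proof (rule A_closedI[OF I A_act_linear[OF I \<sigma>] vector_space_cauchy_scale subspace_A _ f])
  fix U x y assume U: "U \<subseteq> I" and xy: "x \<in> spc H U" "y \<in> spc K (I - U)"
  have "finite U" "inj_on \<sigma> U" "inj_on \<sigma> (I - U)" "\<sigma> ` I - \<sigma> ` U = \<sigma> ` (I - U)"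
    using U I \<sigma> by (auto intro: finite_subset inj_on_subset simp: inj_on_image_set_diff[of \<sigma> I])
  then show "act A \<sigma> I (pure U x y) \<in> spc A (\<sigma> ` I)"
    unfolding act_pure[OF I \<sigma> U xy] using U I xy
    by (intro pure_closed) (auto intro: H.act_closed K.act_closed)
qed (use I in auto)

lemma A_finite_dim:
  assumes I: "finite I"
  shows "\<exists>X. finite X \<and> spc A I \<subseteq> module.span cs X"
proof -
  have fin: "finite U" if "U \<subseteq> I" for U using I that finite_subset by blast
  obtain X where X: "\<And>U. U \<subseteq> I \<Longrightarrow> finite (X U) \<and> spc H U \<subseteq> H.amb.span (X U)"
    using H.finite_dim[OF fin] by metis
  obtain Y where Y: "\<And>U. U \<subseteq> I \<Longrightarrow> finite (Y U) \<and> spc K (I - U) \<subseteq> K.amb.span (Y U)"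
    using K.finite_dim[OF fin[OF Diff_subset]] by metis
  let ?Z = "\<Union>U\<in>Pow I. (\<lambda>(x, y). pure U x y) ` (X U \<times> Y U)"
  have "finite ?Z" using I X Y by (intro finite_UN_I) auto
  moreover have "spc A I \<subseteq> cs.span ?Z"
  proof
    fix f assume "f \<in> spc A I"
    with I show "f \<in> cs.span ?Z"
    proof (induction rule: A_induct)
      case (pure U x y)
      have 2: "pure U x' y' \<in> cs.span ?Z" if x': "x' \<in> X U" and y': "y' \<in> K.amb.span (Y U)" for x' y'
        using y'
      proof (induction rule: K.amb.span_induct_alt)
        case (step c z w)
        then have "pure U x' z \<in> cs.span ?Z" using x' pure(1) by (intro cs.span_base) auto
        then show ?case using step by (simp add: pure_simps cs.span_add cs.span_scale)
      qed (simp add: pure_simps cs.span_zero)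
      have "x \<in> H.amb.span (X U)" using X pure by blast
      then show ?case
      proof (induction rule: H.amb.span_induct_alt)
        case (step c z w)
        then have "pure U z y \<in> cs.span ?Z" using Y[OF pure(1)] pure(3) by (intro 2) auto
        then show ?case using step by (simp add: pure_simps cs.span_add cs.span_scale)
      qed (simp add: pure_simps cs.span_zero)
    qed (auto intro: cs.span_zero cs.span_add)
  qed
  ultimately show ?thesis by blast
qed

lemma A_species: "species A"
proof (rule species.intro)
  show "vector_space (scl A)" unfolding scl_A by (rule vector_space_cauchy_scale)
next
  fix I :: "'l set" assume I: "finite I"
  show "module.subspace (scl A) (spc A I)" unfolding scl_A by (rule subspace_A[OF I])
  show "\<exists>X. finite X \<and> spc A I \<subseteq> module.span (scl A) X" unfolding scl_A by (rule A_finite_dim[OF I])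
  show "act A id I f = f" if "f \<in> spc A I" for f
  proof (rule A_eqI[OF I A_act_linear[OF I] _ _ that])
    fix U x y assume U: "U \<subseteq> I" and xy: "x \<in> spc H U" "y \<in> spc K (I - U)"
    show "act A id I (pure U x y) = pure U x y"
      using I U xy H.act_id[of U x] K.act_id[of "I - U" y] finite_subset[OF U I] by (subst act_pure) auto
  qed (auto simp: linear_on_def)
next
  fix I :: "'l set" and \<sigma> :: "'l \<Rightarrow> 'l" and f assume I: "finite I" and \<sigma>: "inj_on \<sigma> I" and f: "f \<in> spc A I"
  show "act A \<sigma> I f \<in> spc A (\<sigma> ` I)" by (rule A_act_closed[OF I \<sigma> f])
next
  fix I :: "'l set" and \<sigma> :: "'l \<Rightarrow> 'l" assume I: "finite I" and \<sigma>: "inj_on \<sigma> I"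
  show "linear_on (scl A) (scl A) (spc A I) (act A \<sigma> I)" unfolding scl_A by (rule A_act_linear[OF I \<sigma>])
next
  fix I :: "'l set" and \<sigma> \<tau> :: "'l \<Rightarrow> 'l" and f assume I: "finite I" and \<sigma>: "inj_on \<sigma> I" and eq: "\<And>i. i \<in> I \<Longrightarrow> \<sigma> i = \<tau> i"
    and f: "f \<in> spc A I"
  have \<tau>: "inj_on \<tau> I" using \<sigma> eq by (simp add: inj_on_def)
  show "act A \<sigma> I f = act A \<tau> I f"
  proof (rule A_eqI[OF I A_act_linear[OF I \<sigma>] A_act_linear[OF I \<tau>] _ f])
    fix U x y assume U: "U \<subseteq> I" and xy: "x \<in> spc H U" "y \<in> spc K (I - U)"
    have "\<sigma> ` U = \<tau> ` U" using U eq by (intro image_cong) auto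
    moreover have "act H \<sigma> U x = act H \<tau> U x"
      by (rule H.act_cong) (use U I \<sigma> eq xy in \<open>auto intro: finite_subset inj_on_subset\<close>)
    moreover have "act K \<sigma> (I - U) y = act K \<tau> (I - U) y"
      by (rule K.act_cong) (use U I \<sigma> eq xy in \<open>auto intro: finite_subset inj_on_subset\<close>)
    ultimately show "act A \<sigma> I (pure U x y) = act A \<tau> I (pure U x y)"
      unfolding act_pure[OF I \<sigma> U xy] act_pure[OF I \<tau> U xy] by simp
  qed
next
  fix I :: "'l set" and \<sigma> \<tau> :: "'l \<Rightarrow> 'l" and f assume I: "finite I" and \<sigma>: "inj_on \<sigma> I" and \<tau>: "inj_on \<tau> (\<sigma> ` I)"
    and f: "f \<in> spc A I"
  have \<sigma>\<tau>: "inj_on (\<tau> \<circ> \<sigma>) I" using \<sigma> \<tau> by (rule comp_inj_on)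
  have fI: "finite (\<sigma> ` I)" using I by simp
  show "act A (\<tau> \<circ> \<sigma>) I f = act A \<tau> (\<sigma> ` I) (act A \<sigma> I f)"
  proof (rule A_eqI[OF I A_act_linear[OF I \<sigma>\<tau>] linear_on_comp[OF A_act_linear[OF I \<sigma>] A_act_closed[OF I \<sigma>] A_act_linear[OF fI \<tau>]] _ f])
    fix U x y assume U: "U \<subseteq> I" and xy: "x \<in> spc H U" "y \<in> spc K (I - U)"
    have *: "finite U" "inj_on \<sigma> U" "inj_on \<sigma> (I - U)" "\<sigma> ` I - \<sigma> ` U = \<sigma> ` (I - U)" "inj_on \<tau> (\<sigma> ` U)" "inj_on \<tau> (\<sigma> ` (I - U))"
      using U I \<sigma> \<tau> by (auto intro: finite_subset inj_on_subset simp: inj_on_image_set_diff[of \<sigma> I])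
    have c: "act H \<sigma> U x \<in> spc H (\<sigma> ` U)" "act K \<sigma> (I - U) y \<in> spc K (\<sigma> ` I - \<sigma> ` U)"
      using * I xy H.act_closed[of U \<sigma> x] K.act_closed[of "I - U" \<sigma> y] by auto
    show "act A (\<tau> \<circ> \<sigma>) I (pure U x y) = act A \<tau> (\<sigma> ` I) (act A \<sigma> I (pure U x y))"
      unfolding act_pure[OF I \<sigma>\<tau> U xy] act_pure[OF I \<sigma> U xy] act_pure[OF fI \<tau> image_mono[OF U] c]
      using * I xy H.act_comp[of U \<sigma> \<tau> x] K.act_comp[of "I - U" \<sigma> \<tau> y] by (simp add: image_comp)
  qed
qed

end

subsection \<open>Product\<close>

locale bimonoid_pair = species_pair H K + H: species_bimonoid H + K: species_bimonoid K
  for H :: "('k::field, 'l, 'v::ab_group_add) hopf_data" and K :: "('k, 'l, 'w::ab_group_add) hopf_data"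
begin

lemma mul_component_linear:
  assumes d: "disj I J" and U: "U \<subseteq> I \<union> J"
  shows "x \<in> spc H (U \<inter> I) \<Longrightarrow> y \<in> spc K (I - U) \<Longrightarrow> bilinear_on (scl H) (scl K) fscale (spc H (U \<inter> J)) (spc K (J - U))
      (\<lambda>x' y'. tensor (scl H) (scl K) (mul H (U \<inter> I) (U \<inter> J) x x') (mul K (I - U) (J - U) y y'))"
    "x' \<in> spc H (U \<inter> J) \<Longrightarrow> y' \<in> spc K (J - U) \<Longrightarrow> bilinear_on (scl H) (scl K) fscale (spc H (U \<inter> I)) (spc K (I - U))
      (\<lambda>x y. tensor (scl H) (scl K) (mul H (U \<inter> I) (U \<inter> J) x x') (mul K (I - U) (J - U) y y'))"
proof -
  have d': "disj (U \<inter> I) (U \<inter> J)" "disj (I - U) (J - U)" using d by auto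
  show "x \<in> spc H (U \<inter> I) \<Longrightarrow> y \<in> spc K (I - U) \<Longrightarrow> bilinear_on (scl H) (scl K) fscale (spc H (U \<inter> J)) (spc K (J - U))
      (\<lambda>x' y'. tensor (scl H) (scl K) (mul H (U \<inter> I) (U \<inter> J) x x') (mul K (I - U) (J - U) y y'))"
    by (rule bilinear_on_comp[OF bilinear_on_tensor[where V = UNIV and W = UNIV] H.mul_linear_right[OF d'(1)] K.mul_linear_right[OF d'(2)]]) auto
  show "x' \<in> spc H (U \<inter> J) \<Longrightarrow> y' \<in> spc K (J - U) \<Longrightarrow> bilinear_on (scl H) (scl K) fscale (spc H (U \<inter> I)) (spc K (I - U))
      (\<lambda>x y. tensor (scl H) (scl K) (mul H (U \<inter> I) (U \<inter> J) x x') (mul K (I - U) (J - U) y y'))"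
    by (rule bilinear_on_comp[OF bilinear_on_tensor[where V = UNIV and W = UNIV] H.mul_linear_left[OF d'(1)] K.mul_linear_left[OF d'(2)]]) auto
qed

lemma mul_component_bilinear:
  assumes d: "disj I J" and U: "U \<subseteq> I \<union> J" and g: "g \<in> spc A J"
  shows "bilinear_on (scl H) (scl K) fscale (spc H (U \<inter> I)) (spc K (I - U))
     (\<lambda>x y. lift2 H K (U \<inter> J) (J - U)
           (\<lambda>x' y'. tensor (scl H) (scl K) (mul H (U \<inter> I) (U \<inter> J) x x') (mul K (I - U) (J - U) y y')) (g (U \<inter> J)))"
proof -
  have e: "J - U \<inter> J = J - U" by auto
  have gU: "g (U \<inter> J) \<in> tensor_space (scl H) (scl K) (spc H (U \<inter> J)) (spc K (J - U))"
    using component_closed[OF g, of "U \<inter> J"] e by simp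
  have t: "tens (scl H) (scl K) (spc H (U \<inter> J)) (spc K (J - U))" using d by (intro tens_HK) auto
  show ?thesis
    by (intro bilinear_onI' tens.TL_linear_fun[OF t gU vector_space_fscale])
      (auto intro: bilinear_on_left[OF mul_component_linear(2)[OF d U]] bilinear_on_right[OF mul_component_linear(2)[OF d U]])
qed

lemma A_mul_bilinear:
  assumes d: "disj I J"
  shows "bilinear_on cs cs cs (spc A I) (spc A J) (mul A I J)"
proof (intro bilinear_onI' linear_on_component)
  have e: "I - U \<inter> I = I - U" "J - U \<inter> J = J - U" for U by auto
  fix U
  show "linear_on cs fscale (spc A I) (\<lambda>f. mul A I J f g U)" if g: "g \<in> spc A J" for g
  proof (cases "U \<subseteq> I \<union> J")
    case True
    then show ?thesis
      using linear_on_component_lift[of I "U \<inter> I", OF _ Int_lower2 vector_space_fscale, unfolded e, OF _ mul_component_bilinear[OF d True g]] d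
      by (simp add: cauchy_def)
  qed (simp add: cauchy_def linear_on_const_0[OF vector_space_fscale])
  show "linear_on cs fscale (spc A J) (\<lambda>g. mul A I J f g U)" if f: "f \<in> spc A I" for f
  proof (cases "U \<subseteq> I \<union> J")
    case True
    have fU: "f (U \<inter> I) \<in> tensor_space (scl H) (scl K) (spc H (U \<inter> I)) (spc K (I - U))"
      using component_closed[OF f, of "U \<inter> I"] e by simp
    have t: "tens (scl H) (scl K) (spc H (U \<inter> I)) (spc K (I - U))" using d by (intro tens_HK) auto
    have "linear_on cs fscale (spc A J) (\<lambda>g. lift2 H K (U \<inter> I) (I - U) (\<lambda>x y. lift2 H K (U \<inter> J) (J - U)
           (\<lambda>x' y'. tensor (scl H) (scl K) (mul H (U \<inter> I) (U \<inter> J) x x') (mul K (I - U) (J - U) y y')) (g (U \<inter> J))) (f (U \<inter> I)))"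
      using d linear_on_component_lift[of J "U \<inter> J", OF _ Int_lower2 vector_space_fscale, unfolded e, OF _ mul_component_linear(1)[OF d True]]
      by (intro tens.TL_linear_fun[OF t fU vector_space_fscale]) auto
    then show ?thesis using True by (simp add: cauchy_def)
  qed (simp add: cauchy_def linear_on_const_0[OF vector_space_fscale])
qed

text \<open>The component of a product at \<open>W\<close> sees only the components of the factors
  at \<open>W \<inter> I\<close> and \<open>W \<inter> J\<close>. As \<open>I\<close> and
  \<open>J\<close> are disjoint, these are \<open>U\<close> and \<open>V\<close> for
  \<open>W = U \<union> V\<close> and for no other \<open>W\<close>.\<close>

lemma mul_pure:
  assumes d: "disj I J" and U: "U \<subseteq> I" "V \<subseteq> J" and x: "x \<in> spc H U" "y \<in> spc K (I - U)" "x' \<in> spc H V" "y' \<in> spc K (J - V)"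
  shows "mul A I J (pure U x y) (pure V x' y') = pure (U \<union> V) (mul H U V x x') (mul K (I - U) (J - V) y y')"
proof (rule ext)
  fix W
  have e: "I - U \<inter> I = I - U" "J - U \<inter> J = J - U" for U by auto
  show "mul A I J (pure U x y) (pure V x' y') W = pure (U \<union> V) (mul H U V x x') (mul K (I - U) (J - V) y y') W"
  proof (cases "W \<subseteq> I \<union> J")
    case True
    have g: "pure V x' y' \<in> spc A J" using d U x by (intro pure_closed) auto
    have "mul A I J (pure U x y) (pure V x' y') W =
      (if W \<inter> I = U then lift2 H K (W \<inter> J) (J - W) (\<lambda>x' y'. tensor (scl H) (scl K) (mul H (W \<inter> I) (W \<inter> J) x x')
         (mul K (I - W) (J - W) y y')) (pure V x' y' (W \<inter> J)) else 0)"
      using True lift_pure[of I U "W \<inter> I", OF _ U(1) Int_lower2 vector_space_fscale, unfolded e, OF _ mul_component_bilinear[OF d True g] x(1,2)] d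
      by (simp add: cauchy_def)
    also have "\<dots> = (if W \<inter> I = U \<and> W \<inter> J = V then tensor (scl H) (scl K) (mul H U V x x') (mul K (I - U) (J - V) y y') else 0)"
    proof (cases "W \<inter> I = U")
      case WI: True
      then have iw: "I - W = I - U" by auto
      show ?thesis
      proof (cases "W \<inter> J = V")
        case WJ: True
        then have jw: "J - W = J - V" by auto
        show ?thesis
          using lift_pure[of J V "W \<inter> J", OF _ U(2) Int_lower2 vector_space_fscale, unfolded e, OF _ mul_component_linear(1)[OF d True] x(3,4), of x y] d x WI WJ iw jw
          by simp
      next
        case WJ: False
        show ?thesis
          using lift_pure[of J V "W \<inter> J", OF _ U(2) Int_lower2 vector_space_fscale, unfolded e, OF _ mul_component_linear(1)[OF d True] x(3,4), of x y] d x WI WJ iw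
          by simp
      qed
    qed simp
    also have "W \<inter> I = U \<and> W \<inter> J = V \<longleftrightarrow> W = U \<union> V" using True U d by auto
    finally show ?thesis by (simp add: pure_def summand_def)
  next
    case False
    then have "W \<noteq> U \<union> V" using U by auto
    then show ?thesis using False by (simp add: cauchy_def pure_def summand_other)
  qed
qed

lemma Diff_Un_disj: "disj I J \<Longrightarrow> U \<subseteq> I \<Longrightarrow> V \<subseteq> J \<Longrightarrow> (I \<union> J) - (U \<union> V) = (I - U) \<union> (J - V)"
  by auto

lemma disj_parts: "disj I J \<Longrightarrow> U \<subseteq> I \<Longrightarrow> V \<subseteq> J \<Longrightarrow> disj U V"
  "disj I J \<Longrightarrow> U \<subseteq> I \<Longrightarrow> V \<subseteq> J \<Longrightarrow> disj (I - U) (J - V)"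
  by (auto intro: finite_subset)

lemma mul_parts_closed:
  assumes "disj I J" "U \<subseteq> I" "V \<subseteq> J" "x \<in> spc H U" "y \<in> spc K (I - U)" "x' \<in> spc H V" "y' \<in> spc K (J - V)"
  shows "mul H U V x x' \<in> spc H (U \<union> V)" "mul K (I - U) (J - V) y y' \<in> spc K ((I \<union> J) - (U \<union> V))"
  using H.mul_closed[OF disj_parts(1)[OF assms(1-3)] assms(4,6)] K.mul_closed[OF disj_parts(2)[OF assms(1-3)] assms(5,7)]
    Diff_Un_disj[OF assms(1-3)] by auto

lemmas A_mul_linear_left = bilinear_on_left[OF A_mul_bilinear]
lemmas A_mul_linear_right = bilinear_on_right[OF A_mul_bilinear]

lemma A_mul_closed:
  assumes d: "disj I J" and f: "f \<in> spc A I" and g: "g \<in> spc A J"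
  shows "mul A I J f g \<in> spc A (I \<union> J)"
proof -
  have fin: "finite I" "finite J" "finite (I \<union> J)" using d by auto
  show ?thesis
  proof (rule A_closedI[OF fin(1) A_mul_linear_left[OF d g] vector_space_cauchy_scale subspace_A[OF fin(3)] _ f])
    fix U x y assume 1: "U \<subseteq> I" "x \<in> spc H U" "y \<in> spc K (I - U)"
    show "mul A I J (pure U x y) g \<in> spc A (I \<union> J)"
    proof (rule A_closedI[OF fin(2) A_mul_linear_right[OF d pure_closed[OF fin(1) 1]] vector_space_cauchy_scale subspace_A[OF fin(3)] _ g])
      fix V x' y' assume 2: "V \<subseteq> J" "x' \<in> spc H V" "y' \<in> spc K (J - V)"
      show "mul A I J (pure U x y) (pure V x' y') \<in> spc A (I \<union> J)"
        unfolding mul_pure[OF d 1(1) 2(1) 1(2,3) 2(2,3)]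
        using 1(1) 2(1) by (intro pure_closed[OF fin(3)] mul_parts_closed[OF d 1(1) 2(1) 1(2,3) 2(2,3)]) auto
    qed
  qed
qed

lemma A_eqI2:
  assumes I: "finite I" and J: "finite J" and F: "bilinear_on cs cs s (spc A I) (spc A J) F" and G: "bilinear_on cs cs s (spc A I) (spc A J) G"
    and p: "\<And>U x y V x' y'. U \<subseteq> I \<Longrightarrow> x \<in> spc H U \<Longrightarrow> y \<in> spc K (I - U) \<Longrightarrow> V \<subseteq> J \<Longrightarrow> x' \<in> spc H V \<Longrightarrow> y' \<in> spc K (J - V)
      \<Longrightarrow> F (pure U x y) (pure V x' y') = G (pure U x y) (pure V x' y')"
    and f: "f \<in> spc A I" and g: "g \<in> spc A J"
  shows "F f g = G f g"
proof (rule A_eqI[OF I bilinear_on_left[OF F g] bilinear_on_left[OF G g] _ f])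
  fix U x y assume 1: "U \<subseteq> I" "x \<in> spc H U" "y \<in> spc K (I - U)"
  note pc = pure_closed[OF I 1]
  show "F (pure U x y) g = G (pure U x y) g"
    by (rule A_eqI[OF J bilinear_on_right[OF F pc] bilinear_on_right[OF G pc] _ g]) (rule p[OF 1])
qed

lemma A_mul_assoc:
  assumes d: "disj I J" "disj I L" "disj J L" and f: "f \<in> spc A I" and g: "g \<in> spc A J" and h: "h \<in> spc A L"
  shows "mul A (I \<union> J) L (mul A I J f g) h = mul A I (J \<union> L) f (mul A J L g h)"
proof -
  have fin: "finite I" "finite J" "finite L" using d by auto
  have d': "disj (I \<union> J) L" "disj I (J \<union> L)" using d by auto
  show ?thesis
  proof (rule A_eqI2[OF fin(1,2) _ _ _ f g])
    show "bilinear_on cs cs cs (spc A I) (spc A J) (\<lambda>f g. mul A (I \<union> J) L (mul A I J f g) h)"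
      by (rule bilinear_on_comp_out[OF A_mul_bilinear[OF d(1)] A_mul_closed[OF d(1)] A_mul_linear_left[OF d'(1) h]])
    show "bilinear_on cs cs cs (spc A I) (spc A J) (\<lambda>f g. mul A I (J \<union> L) f (mul A J L g h))"
      by (rule bilinear_on_comp[OF A_mul_bilinear[OF d'(2)] _ A_mul_linear_left[OF d(3) h] _ A_mul_closed[OF d(3) _ h]])
        (auto simp: linear_on_def)
    fix U x y V x' y'
    assume 1: "U \<subseteq> I" "x \<in> spc H U" "y \<in> spc K (I - U)" and 2: "V \<subseteq> J" "x' \<in> spc H V" "y' \<in> spc K (J - V)"
    have p1: "pure U x y \<in> spc A I" and p2: "pure V x' y' \<in> spc A J" using 1 2 fin by (auto intro!: pure_closed)
    show "mul A (I \<union> J) L (mul A I J (pure U x y) (pure V x' y')) h = mul A I (J \<union> L) (pure U x y) (mul A J L (pure V x' y') h)"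
    proof (rule A_eqI[OF fin(3) A_mul_linear_right[OF d'(1) A_mul_closed[OF d(1) p1 p2]]
          linear_on_comp[OF A_mul_linear_right[OF d(3) p2] A_mul_closed[OF d(3) p2] A_mul_linear_right[OF d'(2) p1]] _ h])
      fix W x'' y'' assume 3: "W \<subseteq> L" "x'' \<in> spc H W" "y'' \<in> spc K (L - W)"
      note m1 = mul_parts_closed[OF d(1) 1(1) 2(1) 1(2,3) 2(2,3)] and m2 = mul_parts_closed[OF d(3) 2(1) 3(1) 2(2,3) 3(2,3)]
      have h: "disj U V" "disj U W" "disj V W" "disj (I - U) (J - V)" "disj (I - U) (L - W)" "disj (J - V) (L - W)"
        by (rule disj_parts(1)[OF d(1) 1(1) 2(1)] disj_parts(1)[OF d(2) 1(1) 3(1)] disj_parts(1)[OF d(3) 2(1) 3(1)]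
          disj_parts(2)[OF d(1) 1(1) 2(1)] disj_parts(2)[OF d(2) 1(1) 3(1)] disj_parts(2)[OF d(3) 2(1) 3(1)])+
      have "mul A (I \<union> J) L (mul A I J (pure U x y) (pure V x' y')) (pure W x'' y'') =
        pure (U \<union> V \<union> W) (mul H (U \<union> V) W (mul H U V x x') x'') (mul K ((I - U) \<union> (J - V)) (L - W) (mul K (I - U) (J - V) y y') y'')"
        using 1(1) 2(1) Diff_Un_disj[OF d(1) 1(1) 2(1)]
        by (simp only: mul_pure[OF d(1) 1(1) 2(1) 1(2,3) 2(2,3)] mul_pure[OF d'(1) Un_mono[OF 1(1) 2(1)] 3(1) m1 3(2,3)])
      moreover have "mul A I (J \<union> L) (pure U x y) (mul A J L (pure V x' y') (pure W x'' y'')) =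
        pure (U \<union> (V \<union> W)) (mul H U (V \<union> W) x (mul H V W x' x'')) (mul K (I - U) ((J - V) \<union> (L - W)) y (mul K (J - V) (L - W) y' y''))"
        using Diff_Un_disj[OF d(3) 2(1) 3(1)]
        by (simp only: mul_pure[OF d(3) 2(1) 3(1) 2(2,3) 3(2,3)] mul_pure[OF d'(2) 1(1) Un_mono[OF 2(1) 3(1)] 1(2,3) m2])
      ultimately show "mul A (I \<union> J) L (mul A I J (pure U x y) (pure V x' y')) (pure W x'' y'') =
         mul A I (J \<union> L) (pure U x y) (mul A J L (pure V x' y') (pure W x'' y''))"
        using H.mul_assoc[OF h(1-3) 1(2) 2(2) 3(2)] K.mul_assoc[OF h(4-6) 1(3) 2(3) 3(3)] by (simp add: Un_assoc)
    qed
  qed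
qed

lemma unt_A: "unt A = pure {} (unt H) (unt K)"
  by (simp add: cauchy_def pure_def)

lemma A_species_monoid: "species_monoid A"
proof (intro species_monoid.intro species_monoid_axioms.intro A_species)
  fix S T :: "'l set"
  assume d: "disj S T"
  show "bilinear_on (scl A) (scl A) (scl A) (spc A S) (spc A T) (mul A S T)"
    unfolding scl_A by (rule A_mul_bilinear[OF d])
  show "mul A S T x y \<in> spc A (S \<union> T)" if "x \<in> spc A S" "y \<in> spc A T" for x y
    by (rule A_mul_closed[OF d that])
  fix \<sigma> :: "'l \<Rightarrow> 'l" and f g assume \<sigma>: "inj_on \<sigma> (S \<union> T)" and f: "f \<in> spc A S" and g: "g \<in> spc A T"
  have fin: "finite S" "finite T" "finite (S \<union> T)" and inj: "inj_on \<sigma> S" "inj_on \<sigma> T" using d \<sigma> by (auto simp: inj_on_Un)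
  have d': "disj (\<sigma> ` S) (\<sigma> ` T)" using d \<sigma> by (auto simp: inj_on_def)
  show "act A \<sigma> (S \<union> T) (mul A S T f g) = mul A (\<sigma> ` S) (\<sigma> ` T) (act A \<sigma> S f) (act A \<sigma> T g)"
  proof (rule A_eqI2[OF fin(1,2) _ _ _ f g])
    show "bilinear_on cs cs cs (spc A S) (spc A T) (\<lambda>f g. act A \<sigma> (S \<union> T) (mul A S T f g))"
      by (rule bilinear_on_comp_out[OF A_mul_bilinear[OF d] A_mul_closed[OF d] A_act_linear[OF fin(3) \<sigma>]])
    show "bilinear_on cs cs cs (spc A S) (spc A T) (\<lambda>f g. mul A (\<sigma> ` S) (\<sigma> ` T) (act A \<sigma> S f) (act A \<sigma> T g))"
      by (rule bilinear_on_comp[OF A_mul_bilinear[OF d'] A_act_linear[OF fin(1) inj(1)] A_act_linear[OF fin(2) inj(2)]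
           A_act_closed[OF fin(1) inj(1)] A_act_closed[OF fin(2) inj(2)]])
    fix U x y V x' y'
    assume 1: "U \<subseteq> S" "x \<in> spc H U" "y \<in> spc K (S - U)" and 2: "V \<subseteq> T" "x' \<in> spc H V" "y' \<in> spc K (T - V)"
    note m = mul_parts_closed[OF d 1(1) 2(1) 1(2,3) 2(2,3)]
    have h: "disj U V" "disj (S - U) (T - V)" by (rule disj_parts[OF d 1(1) 2(1)])+
    have eq: "\<sigma> ` S - \<sigma> ` U = \<sigma> ` (S - U)" "\<sigma> ` T - \<sigma> ` V = \<sigma> ` (T - V)"
      using 1(1) 2(1) inj by (auto simp: inj_on_image_set_diff[of \<sigma> S] inj_on_image_set_diff[of \<sigma> T])
    have i: "inj_on \<sigma> U" "inj_on \<sigma> V" "inj_on \<sigma> (S - U)" "inj_on \<sigma> (T - V)" "inj_on \<sigma> (U \<union> V)" "inj_on \<sigma> ((S - U) \<union> (T - V))"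
      by (rule inj_on_subset[OF \<sigma>], use 1(1) 2(1) in blast)+
    have c: "act H \<sigma> U x \<in> spc H (\<sigma> ` U)" "act K \<sigma> (S - U) y \<in> spc K (\<sigma> ` S - \<sigma> ` U)"
       "act H \<sigma> V x' \<in> spc H (\<sigma> ` V)" "act K \<sigma> (T - V) y' \<in> spc K (\<sigma> ` T - \<sigma> ` V)"
      unfolding eq using 1 2 h i by (auto intro: H.act_closed K.act_closed)
    show "act A \<sigma> (S \<union> T) (mul A S T (pure U x y) (pure V x' y')) = mul A (\<sigma> ` S) (\<sigma> ` T) (act A \<sigma> S (pure U x y)) (act A \<sigma> T (pure V x' y'))"
      unfolding mul_pure[OF d 1(1) 2(1) 1(2,3) 2(2,3)] act_pure[OF fin(3) \<sigma> Un_mono[OF 1(1) 2(1)] m]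
        act_pure[OF fin(1) inj(1) 1] act_pure[OF fin(2) inj(2) 2] mul_pure[OF d' image_mono[OF 1(1)] image_mono[OF 2(1)] c]
        Diff_Un_disj[OF d 1(1) 2(1)] H.mul_natural[OF h(1) i(5) 1(2) 2(2)] K.mul_natural[OF h(2) i(6) 1(3) 2(3)] eq image_Un ..
  qed
next
  show u: "unt A \<in> spc A {}" unfolding unt_A by (rule pure_closed) (auto simp: H.unt_closed K.unt_closed)
  fix I :: "'l set" and f assume I: "finite I" and f: "f \<in> spc A I"
  have d: "disj {} I" "disj I {}" using I by auto
  show "mul A {} I (unt A) f = f"
  proof (rule A_eqI[OF I A_mul_linear_right[OF d(1) u] _ _ f])
    fix U x y assume 1: "U \<subseteq> I" "x \<in> spc H U" "y \<in> spc K (I - U)"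
    show "mul A {} I (unt A) (pure U x y) = pure U x y"
      unfolding unt_A using 1 I finite_subset[OF 1(1) I]
      by (subst mul_pure) (auto simp: H.unt_closed K.unt_closed H.mul_unt_left K.mul_unt_left)
  qed (simp add: linear_on_def)
  show "mul A I {} f (unt A) = f"
  proof (rule A_eqI[OF I A_mul_linear_left[OF d(2) u] _ _ f])
    fix U x y assume 1: "U \<subseteq> I" "x \<in> spc H U" "y \<in> spc K (I - U)"
    show "mul A I {} (pure U x y) (unt A) = pure U x y"
      unfolding unt_A using 1 I finite_subset[OF 1(1) I]
      by (subst mul_pure) (auto simp: H.unt_closed K.unt_closed H.mul_unt_right K.mul_unt_right)
  qed (simp add: linear_on_def)
qed (rule A_mul_assoc)

end

subsection \<open>Coproduct\<close>

context bimonoid_pair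
begin

lemmas tensor_cs_simps = tensor_simps tensor_scl_left[of cs] tensor_scl_right[of _ cs]

text \<open>The coproducts of \<open>x\<close> in \<open>H\<close> and of \<open>y\<close> in
  \<open>K\<close> expanded together, as in the coproduct of \<open>x \<otimes> y\<close>. The
  structural laws of the two factors are first combined for this double sum and then transferred to
  the product.\<close>

definition sw2 ::
  "'l set \<Rightarrow> 'l set \<Rightarrow> 'l set \<Rightarrow> 'l set \<Rightarrow> ('v \<Rightarrow> 'v \<Rightarrow> 'w \<Rightarrow> 'w \<Rightarrow> 'u::ab_group_add) \<Rightarrow> 'v \<Rightarrow> 'w \<Rightarrow> 'u" where
  "sw2 P Q P' Q' T x y = sweedler H P Q (\<lambda>x1 x2. sweedler K P' Q' (T x1 x2) y) x"

text \<open>Bilinear in the pair of \<open>H\<close> arguments and in the pair of \<open>K\<close>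
  arguments, with the other pair held fixed: the form in which the two nested sums of
  \<open>sw2\<close> use linearity in each argument.\<close>

definition quad_on ::
  "('k \<Rightarrow> 'u \<Rightarrow> 'u) \<Rightarrow> 'l set \<Rightarrow> 'l set \<Rightarrow> 'l set \<Rightarrow> 'l set \<Rightarrow> ('v \<Rightarrow> 'v \<Rightarrow> 'w \<Rightarrow> 'w \<Rightarrow> 'u::ab_group_add) \<Rightarrow> bool" where
  "quad_on s P Q P' Q' T \<longleftrightarrow>
     (\<forall>y1\<in>spc K P'. \<forall>y2\<in>spc K Q'. bilinear_on (scl H) (scl H) s (spc H P) (spc H Q) (\<lambda>x1 x2. T x1 x2 y1 y2)) \<and>
     (\<forall>x1\<in>spc H P. \<forall>x2\<in>spc H Q. bilinear_on (scl K) (scl K) s (spc K P') (spc K Q') (T x1 x2))"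

lemma sw2_cong:
  assumes "disj P Q" "disj P' Q'" "x \<in> spc H (P \<union> Q)" "y \<in> spc K (P' \<union> Q')"
    "\<And>x1 x2 y1 y2. x1 \<in> spc H P \<Longrightarrow> x2 \<in> spc H Q \<Longrightarrow> y1 \<in> spc K P' \<Longrightarrow> y2 \<in> spc K Q' \<Longrightarrow> T x1 x2 y1 y2 = T' x1 x2 y1 y2"
  shows "sw2 P Q P' Q' T x y = sw2 P Q P' Q' T' x y"
  unfolding sw2_def using assms by (intro H.sweedler_cong K.sweedler_cong) auto

lemma sw2_closed:
  assumes "disj P Q" "disj P' Q'" "x \<in> spc H (P \<union> Q)" "y \<in> spc K (P' \<union> Q')" "vector_space s" "module.subspace s V"
    "\<And>x1 x2 y1 y2. x1 \<in> spc H P \<Longrightarrow> x2 \<in> spc H Q \<Longrightarrow> y1 \<in> spc K P' \<Longrightarrow> y2 \<in> spc K Q' \<Longrightarrow> T x1 x2 y1 y2 \<in> V"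
  shows "sw2 P Q P' Q' T x y \<in> V"
  unfolding sw2_def using assms(7)
  by (intro H.sweedler_closed[OF assms(1,3,5,6)] K.sweedler_closed[OF assms(2,4,5,6)])

lemma sw2_hom:
  assumes d: "disj P Q" "disj P' Q'" and xy: "x \<in> spc H (P \<union> Q)" "y \<in> spc K (P' \<union> Q')"
    and s: "vector_space s" "module.subspace s V"
    and T: "\<And>x1 x2 y1 y2. x1 \<in> spc H P \<Longrightarrow> x2 \<in> spc H Q \<Longrightarrow> y1 \<in> spc K P' \<Longrightarrow> y2 \<in> spc K Q' \<Longrightarrow> T x1 x2 y1 y2 \<in> V"
    and g: "linear_on s s' V g"
  shows "g (sw2 P Q P' Q' T x y) = sw2 P Q P' Q' (\<lambda>x1 x2 y1 y2. g (T x1 x2 y1 y2)) x y"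
proof -
  have "g (sw2 P Q P' Q' T x y) = sweedler H P Q (\<lambda>x1 x2. g (sweedler K P' Q' (T x1 x2) y)) x"
    unfolding sw2_def using T
    by (intro H.sweedler_hom[OF d(1) xy(1) s _ g] K.sweedler_closed[OF d(2) xy(2) s])
  also have "\<dots> = sw2 P Q P' Q' (\<lambda>x1 x2 y1 y2. g (T x1 x2 y1 y2)) x y"
    unfolding sw2_def using T
    by (intro H.sweedler_cong[OF d(1) xy(1)] K.sweedler_hom[OF d(2) xy(2) s _ g])
  finally show ?thesis .
qed

lemma quad_onD:
  assumes "quad_on s P Q P' Q' T"
  shows "y1 \<in> spc K P' \<Longrightarrow> y2 \<in> spc K Q' \<Longrightarrow> bilinear_on (scl H) (scl H) s (spc H P) (spc H Q) (\<lambda>x1 x2. T x1 x2 y1 y2)"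
    "x1 \<in> spc H P \<Longrightarrow> x2 \<in> spc H Q \<Longrightarrow> bilinear_on (scl K) (scl K) s (spc K P') (spc K Q') (T x1 x2)"
  using assms by (auto simp: quad_on_def)

lemma sweedler_K_bilinear:
  assumes "disj P' Q'" "vector_space s" "quad_on s P Q P' Q' T" "y \<in> spc K (P' \<union> Q')"
  shows "bilinear_on (scl H) (scl H) s (spc H P) (spc H Q) (\<lambda>x1 x2. sweedler K P' Q' (T x1 x2) y)"
  by (intro bilinear_onI' K.sweedler_linear_fun[OF assms(1,4,2)] bilinear_on_left[OF quad_onD(1)[OF assms(3)]]
      bilinear_on_right[OF quad_onD(1)[OF assms(3)]])

lemma sw2_bilinear:
  assumes d: "disj P Q" "disj P' Q'" and s: "vector_space s" and T: "quad_on s P Q P' Q' T"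
  shows "bilinear_on (scl H) (scl K) s (spc H (P \<union> Q)) (spc K (P' \<union> Q')) (sw2 P Q P' Q' T)"
  unfolding sw2_def
  by (intro bilinear_onI' H.sweedler_linear[OF d(1) s] sweedler_K_bilinear[OF d(2) s T] H.sweedler_linear_fun[OF d(1) _ s]
      K.sweedler_linear[OF d(2) s] quad_onD(2)[OF T])

lemma sw2_natural:
  assumes d: "disj P Q" "disj P' Q'" and xy: "x \<in> spc H (P \<union> Q)" "y \<in> spc K (P' \<union> Q')"
    and \<sigma>: "inj_on \<sigma> (P \<union> Q)" "inj_on \<sigma> (P' \<union> Q')" and s: "vector_space s"
    and T: "quad_on s (\<sigma> ` P) (\<sigma> ` Q) (\<sigma> ` P') (\<sigma> ` Q') T"
  shows "sw2 (\<sigma> ` P) (\<sigma> ` Q) (\<sigma> ` P') (\<sigma> ` Q') T (act H \<sigma> (P \<union> Q) x) (act K \<sigma> (P' \<union> Q') y) =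
    sw2 P Q P' Q' (\<lambda>x1 x2 y1 y2. T (act H \<sigma> P x1) (act H \<sigma> Q x2) (act K \<sigma> P' y1) (act K \<sigma> Q' y2)) x y"
proof -
  have d': "disj (\<sigma> ` P') (\<sigma> ` Q')" using d inj_on_image_Int[OF \<sigma>(2), of P' Q'] by auto
  have i: "inj_on \<sigma> P" "inj_on \<sigma> Q" using \<sigma> by (auto simp: inj_on_Un)
  have y': "act K \<sigma> (P' \<union> Q') y \<in> spc K (\<sigma> ` P' \<union> \<sigma> ` Q')"
    using K.act_closed[OF _ \<sigma>(2) xy(2)] d by (simp add: image_Un)
  have "sw2 (\<sigma> ` P) (\<sigma> ` Q) (\<sigma> ` P') (\<sigma> ` Q') T (act H \<sigma> (P \<union> Q) x) (act K \<sigma> (P' \<union> Q') y) =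
    sweedler H P Q (\<lambda>x1 x2. sweedler K (\<sigma> ` P') (\<sigma> ` Q') (T (act H \<sigma> P x1) (act H \<sigma> Q x2)) (act K \<sigma> (P' \<union> Q') y)) x"
    unfolding sw2_def
    by (rule H.sweedler_natural[OF d(1) xy(1) \<sigma>(1) s sweedler_K_bilinear[OF d' s T y']])
  also have "\<dots> = sw2 P Q P' Q' (\<lambda>x1 x2 y1 y2. T (act H \<sigma> P x1) (act H \<sigma> Q x2) (act K \<sigma> P' y1) (act K \<sigma> Q' y2)) x y"
    unfolding sw2_def using d i
    by (intro H.sweedler_cong[OF d(1) xy(1)] K.sweedler_natural[OF d(2) xy(2) \<sigma>(2) s] quad_onD(2)[OF T] H.act_closed) auto
  finally show ?thesis .
qed

text \<open>After an exchange of the two inner sums all sums over \<open>H\<close> stand outside all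
  sums over \<open>K\<close>, and each group is handled by the coassociativity of its own factor.
  The exchange introduces no sign, since the braiding is trivial.\<close>

lemma sw2_coassoc:
  assumes d: "disj P1 P2" "disj P1 P3" "disj P2 P3" "disj Q1 Q2" "disj Q1 Q3" "disj Q2 Q3"
    and xy: "x \<in> spc H (P1 \<union> P2 \<union> P3)" "y \<in> spc K (Q1 \<union> Q2 \<union> Q3)" and s: "vector_space s"
    and TH: "\<And>y1 y2 y3. trilinear_on (scl H) (scl H) (scl H) s (spc H P1) (spc H P2) (spc H P3) (\<lambda>x1 x2 x3. T x1 x2 x3 y1 y2 y3)"
    and TK: "\<And>x1 x2 x3. trilinear_on (scl K) (scl K) (scl K) s (spc K Q1) (spc K Q2) (spc K Q3) (T x1 x2 x3)"
  shows "sw2 (P1 \<union> P2) P3 (Q1 \<union> Q2) Q3 (\<lambda>x12 x3 y12 y3. sw2 P1 P2 Q1 Q2 (\<lambda>x1 x2 y1 y2. T x1 x2 x3 y1 y2 y3) x12 y12) x y =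
    sw2 P1 (P2 \<union> P3) Q1 (Q2 \<union> Q3) (\<lambda>x1 x23 y1 y23. sw2 P2 P3 Q2 Q3 (\<lambda>x2 x3 y2 y3. T x1 x2 x3 y1 y2 y3) x23 y23) x y"
proof -
  have d': "disj (P1 \<union> P2) P3" "disj P1 (P2 \<union> P3)" "disj (Q1 \<union> Q2) Q3" "disj Q1 (Q2 \<union> Q3)" using d by auto
  have xy': "x \<in> spc H (P1 \<union> (P2 \<union> P3))" using xy by (simp add: Un_assoc)
  have tri: "trilinear_on (scl H) (scl H) (scl H) s (spc H P1) (spc H P2) (spc H P3)
     (\<lambda>x1 x2 x3. sweedler K (Q1 \<union> Q2) Q3 (\<lambda>y12 y3. sweedler K Q1 Q2 (\<lambda>y1 y2. T x1 x2 x3 y1 y2 y3) y12) y)"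
    unfolding trilinear_on_def using TH
    by (intro conjI ballI bilinear_onI' K.sweedler_linear_fun[OF d'(3) xy(2) s] K.sweedler_linear_fun[OF d(4) _ s])
      (auto simp: trilinear_on_def bilinear_on_def)
  have "sw2 (P1 \<union> P2) P3 (Q1 \<union> Q2) Q3 (\<lambda>x12 x3 y12 y3. sw2 P1 P2 Q1 Q2 (\<lambda>x1 x2 y1 y2. T x1 x2 x3 y1 y2 y3) x12 y12) x y =
    sweedler H (P1 \<union> P2) P3 (\<lambda>x12 x3. sweedler H P1 P2 (\<lambda>x1 x2. sweedler K (Q1 \<union> Q2) Q3 (\<lambda>y12 y3. sweedler K Q1 Q2 (\<lambda>y1 y2. T x1 x2 x3 y1 y2 y3) y12) y) x12) x"
    unfolding sw2_def by (subst (2) sweedler_swap) (rule refl)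
  also have "\<dots> = sweedler H P1 (P2 \<union> P3) (\<lambda>x1 x23. sweedler H P2 P3 (\<lambda>x2 x3. sweedler K (Q1 \<union> Q2) Q3 (\<lambda>y12 y3. sweedler K Q1 Q2 (\<lambda>y1 y2. T x1 x2 x3 y1 y2 y3) y12) y) x23) x"
    by (rule H.sweedler_coassoc[OF d(1-3) xy(1) s tri])
  also have "\<dots> = sweedler H P1 (P2 \<union> P3) (\<lambda>x1 x23. sweedler H P2 P3 (\<lambda>x2 x3. sweedler K Q1 (Q2 \<union> Q3) (\<lambda>y1 y23. sweedler K Q2 Q3 (\<lambda>y2 y3. T x1 x2 x3 y1 y2 y3) y23) y) x23) x"
    by (subst K.sweedler_coassoc[OF d(4-6) xy(2) s TK]) (rule refl)
  also have "\<dots> = sw2 P1 (P2 \<union> P3) Q1 (Q2 \<union> Q3) (\<lambda>x1 x23 y1 y23. sw2 P2 P3 Q2 Q3 (\<lambda>x2 x3 y2 y3. T x1 x2 x3 y1 y2 y3) x23 y23) x y"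
    unfolding sw2_def by (subst (2) sweedler_swap) (rule refl)
  finally show ?thesis .
qed

text \<open>The two bimonoid axioms are applied one after the other, to the sum over
  \<open>H\<close> and then inside it to the sum over \<open>K\<close>. A last exchange of sums
  pairs the Sweedler factors of \<open>x\<close> with those of \<open>y\<close>, and those of
  \<open>x'\<close> with those of \<open>y'\<close>.\<close>

lemma sw2_mul:
  assumes d: "disj U V" "disj P Q" "U \<union> V = P \<union> Q" "disj U' V'" "disj P' Q'" "U' \<union> V' = P' \<union> Q'"
    and x: "x \<in> spc H U" "x' \<in> spc H V" and y: "y \<in> spc K U'" "y' \<in> spc K V'" and s: "vector_space s"
    and T: "quad_on s P Q P' Q' T"
  shows "sw2 P Q P' Q' T (mul H U V x x') (mul K U' V' y y') =
    sw2 (U \<inter> P) (U \<inter> Q) (U' \<inter> P') (U' \<inter> Q') (\<lambda>x1 x2 y1 y2. sw2 (V \<inter> P) (V \<inter> Q) (V' \<inter> P') (V' \<inter> Q') (\<lambda>x1' x2' y1' y2'.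
      T (mul H (U \<inter> P) (V \<inter> P) x1 x1') (mul H (U \<inter> Q) (V \<inter> Q) x2 x2')
        (mul K (U' \<inter> P') (V' \<inter> P') y1 y1') (mul K (U' \<inter> Q') (V' \<inter> Q') y2 y2')) x' y') x y"
proof -
  have m: "mul K U' V' y y' \<in> spc K (P' \<union> Q')" using K.mul_closed[OF d(4) y] d(6) by simp
  have e: "U \<inter> P \<union> U \<inter> Q = U" "V \<inter> P \<union> V \<inter> Q = V" "U \<inter> P \<union> V \<inter> P = P" "U \<inter> Q \<union> V \<inter> Q = Q" using d by auto
  have dd: "disj (U \<inter> P) (U \<inter> Q)" "disj (V \<inter> P) (V \<inter> Q)" "disj (U \<inter> P) (V \<inter> P)" "disj (U \<inter> Q) (V \<inter> Q)" using d by auto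
  have "sw2 P Q P' Q' T (mul H U V x x') (mul K U' V' y y') =
    sweedler H (U \<inter> P) (U \<inter> Q) (\<lambda>x1 x2. sweedler H (V \<inter> P) (V \<inter> Q) (\<lambda>x1' x2'. sweedler K P' Q'
       (T (mul H (U \<inter> P) (V \<inter> P) x1 x1') (mul H (U \<inter> Q) (V \<inter> Q) x2 x2')) (mul K U' V' y y')) x') x"
    unfolding sw2_def by (rule H.sweedler_mul[OF d(1-3) x s sweedler_K_bilinear[OF d(5) s T m]])
  also have "\<dots> = sweedler H (U \<inter> P) (U \<inter> Q) (\<lambda>x1 x2. sweedler H (V \<inter> P) (V \<inter> Q) (\<lambda>x1' x2'.
      sweedler K (U' \<inter> P') (U' \<inter> Q') (\<lambda>y1 y2. sweedler K (V' \<inter> P') (V' \<inter> Q') (\<lambda>y1' y2'.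
       T (mul H (U \<inter> P) (V \<inter> P) x1 x1') (mul H (U \<inter> Q) (V \<inter> Q) x2 x2')
        (mul K (U' \<inter> P') (V' \<inter> P') y1 y1') (mul K (U' \<inter> Q') (V' \<inter> Q') y2 y2')) y') y) x') x"
  proof (intro H.sweedler_cong dd K.sweedler_mul[OF d(4-6) y s] quad_onD(2)[OF T])
    show "mul H (U \<inter> P) (V \<inter> P) x1 x1' \<in> spc H P" if "x1 \<in> spc H (U \<inter> P)" "x1' \<in> spc H (V \<inter> P)" for x1 x1'
      using H.mul_closed[OF dd(3) that] e by simp
    show "mul H (U \<inter> Q) (V \<inter> Q) x1 x1' \<in> spc H Q" if "x1 \<in> spc H (U \<inter> Q)" "x1' \<in> spc H (V \<inter> Q)" for x1 x1'
      using H.mul_closed[OF dd(4) that] e by simp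
  qed (use e x in auto)
  also have "\<dots> = sw2 (U \<inter> P) (U \<inter> Q) (U' \<inter> P') (U' \<inter> Q') (\<lambda>x1 x2 y1 y2. sw2 (V \<inter> P) (V \<inter> Q) (V' \<inter> P') (V' \<inter> Q') (\<lambda>x1' x2' y1' y2'.
      T (mul H (U \<inter> P) (V \<inter> P) x1 x1') (mul H (U \<inter> Q) (V \<inter> Q) x2 x2')
        (mul K (U' \<inter> P') (V' \<inter> P') y1 y1') (mul K (U' \<inter> Q') (V' \<inter> Q') y2 y2')) x' y') x y"
    unfolding sw2_def by (subst (2) sweedler_swap) (rule refl)
  finally show ?thesis .
qed

lemma parts:
  assumes "disj I J" "U \<subseteq> I \<union> J"
  shows "disj (U \<inter> I) (U \<inter> J)" "disj (I - U) (J - U)" "(U \<inter> I) \<union> (U \<inter> J) = U" "(I - U) \<union> (J - U) = (I \<union> J) - U"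
  using assms by auto

lemma parts_closed:
  assumes "finite I"
  shows "x \<in> spc H (U \<inter> I) \<Longrightarrow> y \<in> spc K (I - U) \<Longrightarrow> pure (U \<inter> I) x y \<in> spc A I"
  using pure_closed[OF assms Int_lower2, of x U y] by (simp add: Diff_Int)

lemma pure_linear: "linear_on (scl H) cs V (\<lambda>x. pure U x y)" "linear_on (scl K) cs W (pure U x)"
  by (simp_all add: linear_on_def pure_simps)

lemma quad_pure:
  assumes d: "disj I J" and F: "bilinear_on cs cs s (spc A I) (spc A J) F"
  shows "quad_on s (U \<inter> I) (U \<inter> J) (I - U) (J - U) (\<lambda>x1 x2 y1 y2. F (pure (U \<inter> I) x1 y1) (pure (U \<inter> J) x2 y2))"
  unfolding quad_on_def using d
  by (intro conjI ballI bilinear_on_comp[OF F] pure_linear) (auto intro: parts_closed)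

lemma tens_A: "disj I J \<Longrightarrow> tens cs cs (spc A I) (spc A J)"
  by (auto simp: tens_def subspace_A cs.vector_space_axioms)

abbreviation "cop_part I J U \<equiv> sw2 (U \<inter> I) (U \<inter> J) (I - U) (J - U)
  (\<lambda>x1 x2 y1 y2. tensor cs cs (pure (U \<inter> I) x1 y1) (pure (U \<inter> J) x2 y2))"

lemma cop_A: "cop A I J f = (\<Sum>U\<in>Pow (I \<union> J). lift2 H K U ((I \<union> J) - U) (cop_part I J U) (f U))"
  by (simp add: cauchy_def sw2_def[abs_def] pure_def)

lemma cop_part_bilinear:
  assumes "disj I J" "U \<subseteq> I \<union> J"
  shows "bilinear_on (scl H) (scl K) fscale (spc H U) (spc K ((I \<union> J) - U)) (cop_part I J U)"
  using sw2_bilinear[OF parts(1,2)[OF assms] vector_space_fscale quad_pure[OF assms(1) bilinear_on_tensor]]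
  unfolding parts(3,4)[OF assms] .

lemma A_cop_linear:
  assumes d: "disj I J"
  shows "linear_on cs fscale (spc A (I \<union> J)) (cop A I J)"
  unfolding cop_A
  by (intro linear_on_setsum[OF vector_space_fscale] linear_on_component_lift[OF _ _ vector_space_fscale] cop_part_bilinear[OF d])
   (use d in auto)

lemma cop_pure:
  assumes d: "disj I J" and U: "U \<subseteq> I \<union> J" and xy: "x \<in> spc H U" "y \<in> spc K ((I \<union> J) - U)"
  shows "cop A I J (pure U x y) = cop_part I J U x y"
proof -
  have fin: "finite (I \<union> J)" using d by simp
  have "cop A I J (pure U x y) = (\<Sum>V\<in>Pow (I \<union> J). if V = U then cop_part I J V x y else 0)"
    unfolding cop_A
  proof (rule sum.cong[OF refl])
    fix V assume "V \<in> Pow (I \<union> J)"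
    then have V: "V \<subseteq> I \<union> J" by simp
    show "lift2 H K V (I \<union> J - V) (cop_part I J V) (pure U x y V) = (if V = U then cop_part I J V x y else 0)"
      by (rule lift_pure[OF fin U V vector_space_fscale cop_part_bilinear[OF d V] xy])
  qed
  then show ?thesis using fin U by simp
qed

lemma A_cop_closed:
  assumes d: "disj I J" and f: "f \<in> spc A (I \<union> J)"
  shows "cop A I J f \<in> tensor_space cs cs (spc A I) (spc A J)"
proof (rule A_closedI[OF _ A_cop_linear[OF d] vector_space_fscale tens.subspace_TS[OF tens_A[OF d]] _ f])
  fix U x y assume 1: "U \<subseteq> I \<union> J" "x \<in> spc H U" "y \<in> spc K (I \<union> J - U)"
  show "cop A I J (pure U x y) \<in> tensor_space cs cs (spc A I) (spc A J)"
    unfolding cop_pure[OF d 1] using 1(2,3) d parts(3,4)[OF d 1(1)]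
    by (intro sw2_closed[OF parts(1,2)[OF d 1(1)] _ _ vector_space_fscale tens.subspace_TS[OF tens_A[OF d]]]
       tens.TS_tensor[OF tens_A[OF d]] parts_closed) simp_all
qed (use d in simp)

lemma A_sweedler_linear:
  assumes "disj I J" "vector_space s3" "bilinear_on cs cs s3 (spc A I) (spc A J) F"
  shows "linear_on cs s3 (spc A (I \<union> J)) (sweedler A I J F)"
  unfolding sweedler_def scl_A
  by (rule linear_on_comp[OF A_cop_linear A_cop_closed tens.TL_linear[OF tens_A]]) (use assms in auto)

lemma A_sweedler_linear_fun:
  assumes "disj I J" "f \<in> spc A (I \<union> J)" "vector_space s3"
    "\<And>x y. x \<in> spc A I \<Longrightarrow> y \<in> spc A J \<Longrightarrow> linear_on s s3 Z (\<lambda>z. F z x y)"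
  shows "linear_on s s3 Z (\<lambda>z. sweedler A I J (F z) f)"
  unfolding sweedler_def scl_A
  by (rule tens.TL_linear_fun[OF tens_A A_cop_closed]) (use assms in auto)

text \<open>On a pure tensor only the summand \<open>U\<close> of the coproduct contributes. Every
  identity about coproducts in the product is reduced to the two factors through this
  formula.\<close>

lemma sweedler_pure:
  assumes d: "disj I J" and U: "U \<subseteq> I \<union> J" and xy: "x \<in> spc H U" "y \<in> spc K ((I \<union> J) - U)"
    and s: "vector_space s" and F: "bilinear_on cs cs s (spc A I) (spc A J) F"
  shows "sweedler A I J F (pure U x y) =
    sw2 (U \<inter> I) (U \<inter> J) (I - U) (J - U) (\<lambda>x1 x2 y1 y2. F (pure (U \<inter> I) x1 y1) (pure (U \<inter> J) x2 y2)) x y"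
proof -
  interpret t: tens cs cs "spc A I" "spc A J" by (rule tens_A[OF d])
  note p = parts(1,2)[OF d U]
  have xy': "x \<in> spc H (U \<inter> I \<union> U \<inter> J)" "y \<in> spc K ((I - U) \<union> (J - U))" unfolding parts(3,4)[OF d U] by (rule xy)+
  have fin: "finite I" "finite J" using d by auto
  have "sweedler A I J F (pure U x y) = t.TL F (cop_part I J U x y)"
    unfolding sweedler_def scl_A cop_pure[OF d U xy] ..
  also have "\<dots> = sw2 (U \<inter> I) (U \<inter> J) (I - U) (J - U) (\<lambda>x1 x2 y1 y2. t.TL F (tensor cs cs (pure (U \<inter> I) x1 y1) (pure (U \<inter> J) x2 y2))) x y"
    using fin by (intro sw2_hom[OF p xy' vector_space_fscale t.subspace_TS _ t.TL_linear[OF s F]] t.TS_tensor parts_closed)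
  also have "\<dots> = sw2 (U \<inter> I) (U \<inter> J) (I - U) (J - U) (\<lambda>x1 x2 y1 y2. F (pure (U \<inter> I) x1 y1) (pure (U \<inter> J) x2 y2)) x y"
    using fin by (intro sw2_cong[OF p xy'] t.TL_tensor[OF s F] parts_closed)
  finally show ?thesis .
qed

lemma A_cop_natural:
  assumes d: "disj I J" and \<sigma>: "inj_on \<sigma> (I \<union> J)" and f: "f \<in> spc A (I \<union> J)"
  shows "cop A (\<sigma> ` I) (\<sigma> ` J) (act A \<sigma> (I \<union> J) f) =
    sweedler A I J (\<lambda>f1 f2. tensor cs cs (act A \<sigma> I f1) (act A \<sigma> J f2)) f"
proof -
  have fin: "finite I" "finite J" "finite (I \<union> J)" using d by auto
  have inj: "inj_on \<sigma> I" "inj_on \<sigma> J" using \<sigma> by (auto simp: inj_on_Un)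
  have d': "disj (\<sigma> ` I) (\<sigma> ` J)" using d \<sigma> by (auto simp: inj_on_def)
  have un: "\<sigma> ` (I \<union> J) = \<sigma> ` I \<union> \<sigma> ` J" by (rule image_Un)
  have F: "bilinear_on cs cs fscale (spc A I) (spc A J) (\<lambda>f1 f2. tensor cs cs (act A \<sigma> I f1) (act A \<sigma> J f2))"
    by (rule bilinear_on_comp[OF bilinear_on_tensor[where V = UNIV and W = UNIV] A_act_linear[OF fin(1) inj(1)] A_act_linear[OF fin(2) inj(2)]]) auto
  show ?thesis
  proof (rule A_eqI[OF fin(3) linear_on_comp[OF A_act_linear[OF fin(3) \<sigma>] A_act_closed[OF fin(3) \<sigma>, unfolded un] A_cop_linear[OF d']]
       A_sweedler_linear[OF d vector_space_fscale F] _ f])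
    fix U x y assume 1: "U \<subseteq> I \<union> J" "x \<in> spc H U" "y \<in> spc K (I \<union> J - U)"
    note p = parts[OF d 1(1)]
    have i: "inj_on \<sigma> U" "inj_on \<sigma> (I \<union> J - U)" by (rule inj_on_subset[OF \<sigma>], use 1(1) in blast)+
    have eq: "\<sigma> ` U \<inter> \<sigma> ` I = \<sigma> ` (U \<inter> I)" "\<sigma> ` U \<inter> \<sigma> ` J = \<sigma> ` (U \<inter> J)"
      "\<sigma> ` I - \<sigma> ` U = \<sigma> ` (I - U)" "\<sigma> ` J - \<sigma> ` U = \<sigma> ` (J - U)"
      "\<sigma> ` I \<union> \<sigma> ` J - \<sigma> ` U = \<sigma> ` (I \<union> J - U)"
      using \<sigma> 1(1) by (auto simp: inj_on_def)
    have fU: "finite U" using 1(1) fin(3) finite_subset by blast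
    have c: "act H \<sigma> U x \<in> spc H (\<sigma> ` U)" "act K \<sigma> (I \<union> J - U) y \<in> spc K (\<sigma> ` I \<union> \<sigma> ` J - \<sigma> ` U)"
      unfolding eq using fin fU 1 i by (auto intro: H.act_closed K.act_closed)
    have su: "\<sigma> ` U \<subseteq> \<sigma> ` I \<union> \<sigma> ` J" using 1(1) by auto
    have xy: "x \<in> spc H (U \<inter> I \<union> U \<inter> J)" "y \<in> spc K ((I - U) \<union> (J - U))" unfolding p by (rule 1)+
    have q: "quad_on fscale (\<sigma> ` (U \<inter> I)) (\<sigma> ` (U \<inter> J)) (\<sigma> ` (I - U)) (\<sigma> ` (J - U))
       (\<lambda>x1 x2 y1 y2. tensor cs cs (pure (\<sigma> ` (U \<inter> I)) x1 y1) (pure (\<sigma> ` (U \<inter> J)) x2 y2))"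
      using quad_pure[OF d' bilinear_on_tensor, of "\<sigma> ` U"] unfolding eq .
    have "cop A (\<sigma> ` I) (\<sigma> ` J) (act A \<sigma> (I \<union> J) (pure U x y)) =
      sw2 (\<sigma> ` (U \<inter> I)) (\<sigma> ` (U \<inter> J)) (\<sigma> ` (I - U)) (\<sigma> ` (J - U))
       (\<lambda>x1 x2 y1 y2. tensor cs cs (pure (\<sigma> ` (U \<inter> I)) x1 y1) (pure (\<sigma> ` (U \<inter> J)) x2 y2))
       (act H \<sigma> U x) (act K \<sigma> (I \<union> J - U) y)"
      unfolding act_pure[OF fin(3) \<sigma> 1] cop_pure[OF d' su c] eq ..
    also have "\<dots> = sw2 (U \<inter> I) (U \<inter> J) (I - U) (J - U)
       (\<lambda>x1 x2 y1 y2. tensor cs cs (pure (\<sigma> ` (U \<inter> I)) (act H \<sigma> (U \<inter> I) x1) (act K \<sigma> (I - U) y1))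
          (pure (\<sigma> ` (U \<inter> J)) (act H \<sigma> (U \<inter> J) x2) (act K \<sigma> (J - U) y2))) x y"
      using sw2_natural[OF p(1,2) xy _ _ vector_space_fscale q] unfolding p using i by blast
    also have "\<dots> = sw2 (U \<inter> I) (U \<inter> J) (I - U) (J - U)
       (\<lambda>x1 x2 y1 y2. tensor cs cs (act A \<sigma> I (pure (U \<inter> I) x1 y1)) (act A \<sigma> J (pure (U \<inter> J) x2 y2))) x y"
    proof (rule sw2_cong[OF p(1,2) xy])
      have e: "I - U \<inter> I = I - U" "J - U \<inter> J = J - U" by auto
      fix x1 x2 y1 y2 assume h: "x1 \<in> spc H (U \<inter> I)" "x2 \<in> spc H (U \<inter> J)" "y1 \<in> spc K (I - U)" "y2 \<in> spc K (J - U)"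
      show "tensor cs cs (pure (\<sigma> ` (U \<inter> I)) (act H \<sigma> (U \<inter> I) x1) (act K \<sigma> (I - U) y1))
          (pure (\<sigma> ` (U \<inter> J)) (act H \<sigma> (U \<inter> J) x2) (act K \<sigma> (J - U) y2)) =
        tensor cs cs (act A \<sigma> I (pure (U \<inter> I) x1 y1)) (act A \<sigma> J (pure (U \<inter> J) x2 y2))"
        using act_pure[OF fin(1) inj(1) Int_lower2[of U], unfolded e, OF h(1,3)] act_pure[OF fin(2) inj(2) Int_lower2[of U], unfolded e, OF h(2,4)]
        by simp
    qed
    also have "\<dots> = sweedler A I J (\<lambda>f1 f2. tensor cs cs (act A \<sigma> I f1) (act A \<sigma> J f2)) (pure U x y)"
      by (rule sweedler_pure[OF d 1 vector_space_fscale F, symmetric])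
    finally show "cop A (\<sigma> ` I) (\<sigma> ` J) (act A \<sigma> (I \<union> J) (pure U x y)) =
      sweedler A I J (\<lambda>f1 f2. tensor cs cs (act A \<sigma> I f1) (act A \<sigma> J f2)) (pure U x y)" .
  qed
qed

lemma A_cop_coassoc:
  assumes d: "disj I J" "disj I L" "disj J L" and f: "f \<in> spc A (I \<union> J \<union> L)"
  shows "sweedler A (I \<union> J) L (\<lambda>g h. sweedler A I J (\<lambda>f1 f2. tensor cs fscale f1 (tensor cs cs f2 h)) g) f =
    sweedler A I (J \<union> L) (\<lambda>f1 g. sweedler A J L (\<lambda>f2 h. tensor cs fscale f1 (tensor cs cs f2 h)) g) f"
proof -
  have fin: "finite I" "finite J" "finite L" "finite (I \<union> J \<union> L)" "finite (I \<union> J)" "finite (J \<union> L)" using d by auto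
  have d': "disj (I \<union> J) L" "disj I (J \<union> L)" using d by auto
  have un: "I \<union> (J \<union> L) = I \<union> J \<union> L" by auto
  note vs = vector_space_fscale
  have b1: "bilinear_on cs cs fscale (spc A I) (spc A J) (\<lambda>f1 f2. tensor cs fscale f1 (tensor cs cs f2 h))" for h
    by (rule bilinear_onI) (simp_all add: tensor_cs_simps)
  have b2: "bilinear_on cs cs fscale (spc A J) (spc A L) (\<lambda>f2 h. tensor cs fscale f1 (tensor cs cs f2 h))" for f1
    by (rule bilinear_onI) (simp_all add: tensor_cs_simps)
  have F1: "bilinear_on cs cs fscale (spc A (I \<union> J)) (spc A L) (\<lambda>g h. sweedler A I J (\<lambda>f1 f2. tensor cs fscale f1 (tensor cs cs f2 h)) g)"
    by (intro bilinear_onI' A_sweedler_linear[OF d(1) vs] A_sweedler_linear_fun[OF d(1) _ vs] b1) (auto simp: linear_on_def tensor_cs_simps)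
  have F2: "bilinear_on cs cs fscale (spc A I) (spc A (J \<union> L)) (\<lambda>f1 g. sweedler A J L (\<lambda>f2 h. tensor cs fscale f1 (tensor cs cs f2 h)) g)"
    by (intro bilinear_onI' A_sweedler_linear[OF d(3) vs] A_sweedler_linear_fun[OF d(3) _ vs] b2) (auto simp: linear_on_def tensor_cs_simps)
  show ?thesis
  proof (rule A_eqI[OF fin(4) A_sweedler_linear[OF d'(1) vs F1] A_sweedler_linear[OF d'(2) vs F2, unfolded un] _ f])
    fix U x y assume 1: "U \<subseteq> I \<union> J \<union> L" "x \<in> spc H U" "y \<in> spc K (I \<union> J \<union> L - U)"
    note u1 = 1[folded un]
    let ?T = "\<lambda>x1 x2 x3 y1 y2 y3. tensor cs fscale (pure (U \<inter> I) x1 y1) (tensor cs cs (pure (U \<inter> J) x2 y2) (pure (U \<inter> L) x3 y3))"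
    have e1: "U \<inter> (I \<union> J) \<subseteq> I \<union> J" "U \<inter> (J \<union> L) \<subseteq> J \<union> L" by auto
    have e2: "I \<union> J - U \<inter> (I \<union> J) = I \<union> J - U" "J \<union> L - U \<inter> (J \<union> L) = J \<union> L - U"
      "U \<inter> (I \<union> J) \<inter> I = U \<inter> I" "U \<inter> (I \<union> J) \<inter> J = U \<inter> J" "I - U \<inter> (I \<union> J) = I - U" "J - U \<inter> (I \<union> J) = J - U"
      "U \<inter> (J \<union> L) \<inter> J = U \<inter> J" "U \<inter> (J \<union> L) \<inter> L = U \<inter> L" "J - U \<inter> (J \<union> L) = J - U" "L - U \<inter> (J \<union> L) = L - U"
      by auto
    have p1: "disj (U \<inter> (I \<union> J)) (U \<inter> L)" "disj (I \<union> J - U) (L - U)" "U \<inter> (I \<union> J) \<union> U \<inter> L = U" "(I \<union> J - U) \<union> (L - U) = I \<union> J \<union> L - U"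
      by (rule parts[OF d'(1) 1(1)])+
    have p2: "disj (U \<inter> I) (U \<inter> (J \<union> L))" "disj (I - U) (J \<union> L - U)" "U \<inter> I \<union> U \<inter> (J \<union> L) = U" "(I - U) \<union> (J \<union> L - U) = I \<union> J \<union> L - U"
      using parts[OF d'(2) u1(1)] unfolding un .
    have q: "U \<inter> I \<union> U \<inter> J = U \<inter> (I \<union> J)" "(I - U) \<union> (J - U) = I \<union> J - U" "U \<inter> J \<union> U \<inter> L = U \<inter> (J \<union> L)" "(J - U) \<union> (L - U) = J \<union> L - U"
      by auto
    have "sweedler A (I \<union> J) L (\<lambda>g h. sweedler A I J (\<lambda>f1 f2. tensor cs fscale f1 (tensor cs cs f2 h)) g) (pure U x y) =
      sw2 (U \<inter> (I \<union> J)) (U \<inter> L) (I \<union> J - U) (L - U) (\<lambda>x12 x3 y12 y3. sweedler A I J (\<lambda>f1 f2. tensor cs fscale f1 (tensor cs cs f2 (pure (U \<inter> L) x3 y3))) (pure (U \<inter> (I \<union> J)) x12 y12)) x y"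
      by (rule sweedler_pure[OF d'(1) 1 vs F1])
    also have "\<dots> = sw2 (U \<inter> (I \<union> J)) (U \<inter> L) (I \<union> J - U) (L - U) (\<lambda>x12 x3 y12 y3. sw2 (U \<inter> I) (U \<inter> J) (I - U) (J - U) (\<lambda>x1 x2 y1 y2. ?T x1 x2 x3 y1 y2 y3) x12 y12) x y"
    proof (rule sw2_cong[OF p1(1,2)])
      fix x12 x3 y12 y3 assume h: "x12 \<in> spc H (U \<inter> (I \<union> J))" "y12 \<in> spc K (I \<union> J - U)"
      show "sweedler A I J (\<lambda>f1 f2. tensor cs fscale f1 (tensor cs cs f2 (pure (U \<inter> L) x3 y3))) (pure (U \<inter> (I \<union> J)) x12 y12) =
         sw2 (U \<inter> I) (U \<inter> J) (I - U) (J - U) (\<lambda>x1 x2 y1 y2. ?T x1 x2 x3 y1 y2 y3) x12 y12"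
        using sweedler_pure[OF d(1) e1(1), unfolded e2, OF h vs b1] .
    qed (simp_all only: p1 1)
    also have "\<dots> = sw2 (U \<inter> I) (U \<inter> (J \<union> L)) (I - U) (J \<union> L - U) (\<lambda>x1 x23 y1 y23. sw2 (U \<inter> J) (U \<inter> L) (J - U) (L - U) (\<lambda>x2 x3 y2 y3. ?T x1 x2 x3 y1 y2 y3) x23 y23) x y"
    proof (rule sw2_coassoc[of "U \<inter> I" "U \<inter> J" "U \<inter> L" "I - U" "J - U" "L - U" x y fscale ?T, unfolded q p1(3,4), OF _ _ _ _ _ _ 1(2,3) vs])
      show "trilinear_on (scl H) (scl H) (scl H) fscale (spc H (U \<inter> I)) (spc H (U \<inter> J)) (spc H (U \<inter> L)) (\<lambda>x1 x2 x3. ?T x1 x2 x3 y1 y2 y3)" for y1 y2 y3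
        by (simp add: trilinear_on_def bilinear_on_def linear_on_def tensor_cs_simps pure_simps)
      show "trilinear_on (scl K) (scl K) (scl K) fscale (spc K (I - U)) (spc K (J - U)) (spc K (L - U)) (?T x1 x2 x3)" for x1 x2 x3
        by (simp add: trilinear_on_def bilinear_on_def linear_on_def tensor_cs_simps pure_simps)
    qed (use d in auto)
    also have "\<dots> = sw2 (U \<inter> I) (U \<inter> (J \<union> L)) (I - U) (J \<union> L - U) (\<lambda>x1 x23 y1 y23. sweedler A J L (\<lambda>f2 h. tensor cs fscale (pure (U \<inter> I) x1 y1) (tensor cs cs f2 h)) (pure (U \<inter> (J \<union> L)) x23 y23)) x y"
    proof (rule sw2_cong[OF p2(1,2)])
      fix x1 x23 y1 y23 assume h: "x23 \<in> spc H (U \<inter> (J \<union> L))" "y23 \<in> spc K (J \<union> L - U)"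
      show "sw2 (U \<inter> J) (U \<inter> L) (J - U) (L - U) (\<lambda>x2 x3 y2 y3. ?T x1 x2 x3 y1 y2 y3) x23 y23 =
        sweedler A J L (\<lambda>f2 h. tensor cs fscale (pure (U \<inter> I) x1 y1) (tensor cs cs f2 h)) (pure (U \<inter> (J \<union> L)) x23 y23)"
        using sweedler_pure[OF d(3) e1(2), unfolded e2, OF h vs b2, symmetric] .
    qed (simp_all only: p2 1)
    also have "\<dots> = sweedler A I (J \<union> L) (\<lambda>f1 g. sweedler A J L (\<lambda>f2 h. tensor cs fscale f1 (tensor cs cs f2 h)) g) (pure U x y)"
      by (rule sweedler_pure[OF d'(2) u1 vs F2, symmetric])
    finally show "sweedler A (I \<union> J) L (\<lambda>g h. sweedler A I J (\<lambda>f1 f2. tensor cs fscale f1 (tensor cs cs f2 h)) g) (pure U x y) =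
      sweedler A I (J \<union> L) (\<lambda>f1 g. sweedler A J L (\<lambda>f2 h. tensor cs fscale f1 (tensor cs cs f2 h)) g) (pure U x y)" .
  qed
qed

lemma cnt_bilinear: "bilinear_on (scl H) (scl K) (*) (spc H {}) (spc K {}) (\<lambda>x y. cnt H x * cnt K y)"
  using H.cnt_linear K.cnt_linear by (auto simp: bilinear_on_def linear_on_def algebra_simps)

lemma A_cnt_linear: "linear_on cs (*) (spc A {}) (cnt A)"
  using linear_on_component_lift[of "{}" "{}" "(*)" "\<lambda>x y. cnt H x * cnt K y"] cnt_bilinear
  by (simp add: cauchy_def vector_space_field)

lemma cnt_pure: "x \<in> spc H {} \<Longrightarrow> y \<in> spc K {} \<Longrightarrow> cnt A (pure {} x y) = cnt H x * cnt K y"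
  using lift_pure[of "{}" "{}" "{}" "(*)" "\<lambda>x y. cnt H x * cnt K y" x y] cnt_bilinear
  by (simp add: cauchy_def vector_space_field)

lemma A_cop_cnt_left:
  assumes I: "finite I" and f: "f \<in> spc A I"
  shows "sweedler A {} I (\<lambda>f1 f2. cs (cnt A f1) f2) f = f"
proof -
  have d: "disj {} I" using I by auto
  note vs = vector_space_cauchy_scale
  have F: "bilinear_on cs cs cs (spc A {}) (spc A I) (\<lambda>f1 f2. cs (cnt A f1) f2)"
    using A_cnt_linear by (auto simp: bilinear_on_def linear_on_def cs.scale_left_distrib cs.scale_right_distrib mult.commute)
  show ?thesis
  proof (rule A_eqI[OF I _ _ _ f])
    show "linear_on cs cs (spc A I) (sweedler A {} I (\<lambda>f1 f2. cs (cnt A f1) f2))"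
      using A_sweedler_linear[OF d vs F] by simp
    show "linear_on cs cs (spc A I) (\<lambda>f. f)" by (simp add: linear_on_def)
    fix U x y assume 1: "U \<subseteq> I" "x \<in> spc H U" "y \<in> spc K (I - U)"
    have fU: "finite U" "finite (I - U)" using 1 I finite_subset by auto
    have dU: "disj {} U" "disj {} (I - U)" using fU by auto
    have "sweedler A {} I (\<lambda>f1 f2. cs (cnt A f1) f2) (pure U x y) =
       sw2 {} U {} (I - U) (\<lambda>x1 x2 y1 y2. cs (cnt A (pure {} x1 y1)) (pure U x2 y2)) x y"
      using sweedler_pure[OF d _ _ _ vs F, of U x y] 1 by (simp add: Int_absorb2)
    also have "\<dots> = sw2 {} U {} (I - U) (\<lambda>x1 x2 y1 y2. pure U (scl H (cnt H x1) x2) (scl K (cnt K y1) y2)) x y"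
      using 1 by (intro sw2_cong dU) (auto simp: cnt_pure pure_simps mult.commute)
    also have "\<dots> = sweedler H {} U (\<lambda>x1 x2. pure U (scl H (cnt H x1) x2) y) x"
      unfolding sw2_def using 1 by (intro H.sweedler_cong dU K.sweedler_cnt_left[OF fU(2) _ pure_linear(2)]) auto
    also have "\<dots> = pure U x y"
      by (rule H.sweedler_cnt_left[OF fU(1) 1(2) pure_linear(1)])
    finally show "sweedler A {} I (\<lambda>f1 f2. cs (cnt A f1) f2) (pure U x y) = pure U x y" .
  qed
qed

lemma A_cop_cnt_right:
  assumes I: "finite I" and f: "f \<in> spc A I"
  shows "sweedler A I {} (\<lambda>f1 f2. cs (cnt A f2) f1) f = f"
proof -
  have d: "disj I {}" using I by auto
  note vs = vector_space_cauchy_scale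
  have F: "bilinear_on cs cs cs (spc A I) (spc A {}) (\<lambda>f1 f2. cs (cnt A f2) f1)"
    using A_cnt_linear by (auto simp: bilinear_on_def linear_on_def cs.scale_left_distrib cs.scale_right_distrib mult.commute)
  show ?thesis
  proof (rule A_eqI[OF I _ _ _ f])
    show "linear_on cs cs (spc A I) (sweedler A I {} (\<lambda>f1 f2. cs (cnt A f2) f1))"
      using A_sweedler_linear[OF d vs F] by simp
    show "linear_on cs cs (spc A I) (\<lambda>f. f)" by (simp add: linear_on_def)
    fix U x y assume 1: "U \<subseteq> I" "x \<in> spc H U" "y \<in> spc K (I - U)"
    have fU: "finite U" "finite (I - U)" using 1 I finite_subset by auto
    have dU: "disj U {}" "disj (I - U) {}" using fU by auto
    have "sweedler A I {} (\<lambda>f1 f2. cs (cnt A f2) f1) (pure U x y) =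
       sw2 U {} (I - U) {} (\<lambda>x1 x2 y1 y2. cs (cnt A (pure {} x2 y2)) (pure U x1 y1)) x y"
      using sweedler_pure[OF d _ _ _ vs F, of U x y] 1 by (simp add: Int_absorb2)
    also have "\<dots> = sw2 U {} (I - U) {} (\<lambda>x1 x2 y1 y2. pure U (scl H (cnt H x2) x1) (scl K (cnt K y2) y1)) x y"
      using 1 by (intro sw2_cong dU) (auto simp: cnt_pure pure_simps mult.commute)
    also have "\<dots> = sweedler H U {} (\<lambda>x1 x2. pure U (scl H (cnt H x2) x1) y) x"
      unfolding sw2_def using 1 by (intro H.sweedler_cong dU K.sweedler_cnt_right[OF fU(2) _ pure_linear(2)]) auto
    also have "\<dots> = pure U x y"
      by (rule H.sweedler_cnt_right[OF fU(1) 1(2) pure_linear(1)])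
    finally show "sweedler A I {} (\<lambda>f1 f2. cs (cnt A f2) f1) (pure U x y) = pure U x y" .
  qed
qed

lemma A_species_comonoid: "species_comonoid A"
  by (intro species_comonoid.intro species_comonoid_axioms.intro A_species; unfold scl_A)
    (rule A_cop_closed A_cop_linear A_cop_natural A_cop_coassoc A_cnt_linear A_cop_cnt_left A_cop_cnt_right; assumption)+

text \<open>On pure tensors both sides become the double sum of \<open>sw2_mul\<close>. The
  remaining work is to match the degrees, since cutting by \<open>S'\<close> and \<open>T'\<close>
  may be done before or after cutting into left and right factors.\<close>

lemma A_cop_mul:
  assumes d: "disj S T" "disj S' T'" "S \<union> T = S' \<union> T'" and f: "f \<in> spc A S" and g: "g \<in> spc A T"
  shows "cop A S' T' (mul A S T f g) =
    sweedler A (S \<inter> S') (S \<inter> T') (\<lambda>f1 f2. sweedler A (T \<inter> S') (T \<inter> T')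
      (\<lambda>g1 g2. tensor cs cs (mul A (S \<inter> S') (T \<inter> S') f1 g1) (mul A (S \<inter> T') (T \<inter> T') f2 g2)) g) f"
proof -
  note vs = vector_space_fscale
  have fin: "finite S" "finite T" using d by auto
  have dp: "disj (S \<inter> S') (S \<inter> T')" "disj (T \<inter> S') (T \<inter> T')" "disj (S \<inter> S') (T \<inter> S')" "disj (S \<inter> T') (T \<inter> T')" using d by auto
  have un: "S \<inter> S' \<union> S \<inter> T' = S" "T \<inter> S' \<union> T \<inter> T' = T" using d by auto
  let ?T = "\<lambda>f1 f2 g1 g2. tensor cs cs (mul A (S \<inter> S') (T \<inter> S') f1 g1) (mul A (S \<inter> T') (T \<inter> T') f2 g2)"
  have b1: "bilinear_on cs cs fscale (spc A (T \<inter> S')) (spc A (T \<inter> T')) (?T f1 f2)"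
    if "f1 \<in> spc A (S \<inter> S')" "f2 \<in> spc A (S \<inter> T')" for f1 f2
    by (rule bilinear_on_comp[OF bilinear_on_tensor[where V = UNIV and W = UNIV] A_mul_linear_right[OF dp(3) that(1)] A_mul_linear_right[OF dp(4) that(2)]]) auto
  have b2: "bilinear_on cs cs fscale (spc A (S \<inter> S')) (spc A (S \<inter> T')) (\<lambda>f1 f2. ?T f1 f2 g1 g2)"
    if "g1 \<in> spc A (T \<inter> S')" "g2 \<in> spc A (T \<inter> T')" for g1 g2
    by (rule bilinear_on_comp[OF bilinear_on_tensor[where V = UNIV and W = UNIV] A_mul_linear_left[OF dp(3) that(1)] A_mul_linear_left[OF dp(4) that(2)]]) auto
  have b3: "bilinear_on cs cs fscale (spc A (S \<inter> S')) (spc A (S \<inter> T')) (\<lambda>f1 f2. sweedler A (T \<inter> S') (T \<inter> T') (?T f1 f2) g)"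
    if g: "g \<in> spc A T" for g
    using g by (intro bilinear_onI' A_sweedler_linear_fun[OF dp(2) _ vs] bilinear_on_left[OF b2] bilinear_on_right[OF b2]) (simp_all add: un)
  show ?thesis
  proof (rule A_eqI2[where F = "\<lambda>f g. cop A S' T' (mul A S T f g)" and s = fscale and
      G = "\<lambda>f g. sweedler A (S \<inter> S') (S \<inter> T') (\<lambda>f1 f2. sweedler A (T \<inter> S') (T \<inter> T') (?T f1 f2) g) f", OF fin _ _ _ f g])
    show "bilinear_on cs cs fscale (spc A S) (spc A T) (\<lambda>f g. cop A S' T' (mul A S T f g))"
      by (rule bilinear_on_comp_out[OF A_mul_bilinear[OF d(1)] A_mul_closed[OF d(1)] A_cop_linear[OF d(2), folded d(3)]])
    show "bilinear_on cs cs fscale (spc A S) (spc A T) (\<lambda>f g. sweedler A (S \<inter> S') (S \<inter> T') (\<lambda>f1 f2. sweedler A (T \<inter> S') (T \<inter> T') (?T f1 f2) g) f)"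
    proof (rule bilinear_onI')
      show "linear_on cs fscale (spc A S) (\<lambda>f. sweedler A (S \<inter> S') (S \<inter> T') (\<lambda>f1 f2. sweedler A (T \<inter> S') (T \<inter> T') (?T f1 f2) g) f)"
        if "g \<in> spc A T" for g
        using A_sweedler_linear[OF dp(1) vs b3[OF that]] unfolding un .
      show "linear_on cs fscale (spc A T) (\<lambda>g. sweedler A (S \<inter> S') (S \<inter> T') (\<lambda>f1 f2. sweedler A (T \<inter> S') (T \<inter> T') (?T f1 f2) g) f)"
        if "f \<in> spc A S" for f
        using that A_sweedler_linear[OF dp(2) vs b1] unfolding un
        by (intro A_sweedler_linear_fun[OF dp(1) _ vs]) (simp_all add: un)
    qed
    fix U x y V x' y'
    assume 1: "U \<subseteq> S" "x \<in> spc H U" "y \<in> spc K (S - U)" and 2: "V \<subseteq> T" "x' \<in> spc H V" "y' \<in> spc K (T - V)"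
    have UV: "U \<union> V \<subseteq> S' \<union> T'" using 1 2 d by auto
    note m = mul_parts_closed[OF d(1) 1(1) 2(1) 1(2,3) 2(2,3), unfolded d(3)]
    have dd: "disj U V" "disj (S - U) (T - V)" by (rule disj_parts[OF d(1) 1(1) 2(1)])+
    note p = parts[OF d(2) UV]
    \<comment> \<open>Cutting \<open>U \<union> V\<close> by the new decomposition and then
      intersecting with \<open>U\<close> or \<open>V\<close> is the same as cutting \<open>U\<close>
      or \<open>V\<close> directly; likewise for the complements, which are the degrees of the right
      factors.\<close>
    have e: "U \<inter> ((U \<union> V) \<inter> S') = U \<inter> S'" "U \<inter> ((U \<union> V) \<inter> T') = U \<inter> T'" "V \<inter> ((U \<union> V) \<inter> S') = V \<inter> S'" "V \<inter> ((U \<union> V) \<inter> T') = V \<inter> T'"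
      "(S - U) \<inter> (S' - (U \<union> V)) = S \<inter> S' - U" "(S - U) \<inter> (T' - (U \<union> V)) = S \<inter> T' - U"
      "(T - V) \<inter> (S' - (U \<union> V)) = T \<inter> S' - V" "(T - V) \<inter> (T' - (U \<union> V)) = T \<inter> T' - V"
      "(S - U) \<union> (T - V) = (S' - (U \<union> V)) \<union> (T' - (U \<union> V))"
      using d 1(1) 2(1) by auto
    have e': "U \<inter> (S \<inter> S') = U \<inter> S'" "U \<inter> (S \<inter> T') = U \<inter> T'" "V \<inter> (T \<inter> S') = V \<inter> S'" "V \<inter> (T \<inter> T') = V \<inter> T'"
      using 1(1) 2(1) by auto
    have e'': "S \<inter> S' - U \<inter> S' = S \<inter> S' - U" "S \<inter> T' - U \<inter> T' = S \<inter> T' - U" "T \<inter> S' - V \<inter> S' = T \<inter> S' - V" "T \<inter> T' - V \<inter> T' = T \<inter> T' - V"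
      "(U \<union> V) \<inter> S' = U \<inter> S' \<union> V \<inter> S'" "(U \<union> V) \<inter> T' = U \<inter> T' \<union> V \<inter> T'"
      by auto
    have sub: "U \<subseteq> S \<inter> S' \<union> S \<inter> T'" "V \<subseteq> T \<inter> S' \<union> T \<inter> T'" using un 1(1) 2(1) by auto
    have sub': "U \<inter> S' \<subseteq> S \<inter> S'" "U \<inter> T' \<subseteq> S \<inter> T'" "V \<inter> S' \<subseteq> T \<inter> S'" "V \<inter> T' \<subseteq> T \<inter> T'" using 1(1) 2(1) by auto
    have "cop A S' T' (mul A S T (pure U x y) (pure V x' y')) =
      cop_part S' T' (U \<union> V) (mul H U V x x') (mul K (S - U) (T - V) y y')"
      unfolding mul_pure[OF d(1) 1(1) 2(1) 1(2,3) 2(2,3)] by (rule cop_pure[OF d(2) UV m])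
    also have "\<dots> = sw2 (U \<inter> S') (U \<inter> T') (S \<inter> S' - U) (S \<inter> T' - U) (\<lambda>x1 x2 y1 y2.
        sw2 (V \<inter> S') (V \<inter> T') (T \<inter> S' - V) (T \<inter> T' - V) (\<lambda>x1' x2' y1' y2'. tensor cs cs
           (pure ((U \<union> V) \<inter> S') (mul H (U \<inter> S') (V \<inter> S') x1 x1') (mul K (S \<inter> S' - U) (T \<inter> S' - V) y1 y1'))
           (pure ((U \<union> V) \<inter> T') (mul H (U \<inter> T') (V \<inter> T') x2 x2') (mul K (S \<inter> T' - U) (T \<inter> T' - V) y2 y2'))) x' y') x y"
      using sw2_mul[OF dd(1) p(1) p(3)[symmetric] dd(2) p(2) e(9) 1(2) 2(2) 1(3) 2(3) vs quad_pure[OF d(2) bilinear_on_tensor]]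
      unfolding e(1-8) .
    also have "\<dots> = sw2 (U \<inter> S') (U \<inter> T') (S \<inter> S' - U) (S \<inter> T' - U) (\<lambda>x1 x2 y1 y2.
        sw2 (V \<inter> S') (V \<inter> T') (T \<inter> S' - V) (T \<inter> T' - V) (\<lambda>x1' x2' y1' y2'.
          ?T (pure (U \<inter> S') x1 y1) (pure (U \<inter> T') x2 y2) (pure (V \<inter> S') x1' y1') (pure (V \<inter> T') x2' y2')) x' y') x y"
    proof (intro sw2_cong)
      fix x1 x2 y1 y2 x1' x2' y1' y2'
      assume h: "x1 \<in> spc H (U \<inter> S')" "x2 \<in> spc H (U \<inter> T')" "y1 \<in> spc K (S \<inter> S' - U)" "y2 \<in> spc K (S \<inter> T' - U)"
        "x1' \<in> spc H (V \<inter> S')" "x2' \<in> spc H (V \<inter> T')" "y1' \<in> spc K (T \<inter> S' - V)" "y2' \<in> spc K (T \<inter> T' - V)"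
      show "tensor cs cs
           (pure ((U \<union> V) \<inter> S') (mul H (U \<inter> S') (V \<inter> S') x1 x1') (mul K (S \<inter> S' - U) (T \<inter> S' - V) y1 y1'))
           (pure ((U \<union> V) \<inter> T') (mul H (U \<inter> T') (V \<inter> T') x2 x2') (mul K (S \<inter> T' - U) (T \<inter> T' - V) y2 y2')) =
         ?T (pure (U \<inter> S') x1 y1) (pure (U \<inter> T') x2 y2) (pure (V \<inter> S') x1' y1') (pure (V \<inter> T') x2' y2')"
        using mul_pure[OF dp(3) sub'(1,3), unfolded e'', OF h(1,3,5,7)] mul_pure[OF dp(4) sub'(2,4), unfolded e'', OF h(2,4,6,8)]
        unfolding e''(5,6) by simp
    next
      show "x \<in> spc H (U \<inter> S' \<union> U \<inter> T')" "y \<in> spc K ((S \<inter> S' - U) \<union> (S \<inter> T' - U))"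
        using parts(3,4)[OF dp(1) sub(1), unfolded e' un] 1 by simp_all
      show "x' \<in> spc H (V \<inter> S' \<union> V \<inter> T')" "y' \<in> spc K ((T \<inter> S' - V) \<union> (T \<inter> T' - V))"
        using parts(3,4)[OF dp(2) sub(2), unfolded e' un] 2 by simp_all
    qed (use d 1(1) 2(1) fin in \<open>auto intro: finite_subset\<close>)
    also have "\<dots> = sw2 (U \<inter> S') (U \<inter> T') (S \<inter> S' - U) (S \<inter> T' - U) (\<lambda>x1 x2 y1 y2.
        sweedler A (T \<inter> S') (T \<inter> T') (?T (pure (U \<inter> S') x1 y1) (pure (U \<inter> T') x2 y2)) (pure V x' y')) x y"
    proof (rule sw2_cong)
      fix x1 x2 y1 y2
      assume h: "x1 \<in> spc H (U \<inter> S')" "x2 \<in> spc H (U \<inter> T')" "y1 \<in> spc K (S \<inter> S' - U)" "y2 \<in> spc K (S \<inter> T' - U)"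
      have pc: "pure (U \<inter> S') x1 y1 \<in> spc A (S \<inter> S')" "pure (U \<inter> T') x2 y2 \<in> spc A (S \<inter> T')"
        using h dp e'' sub' by (auto intro!: pure_closed)
      show "sw2 (V \<inter> S') (V \<inter> T') (T \<inter> S' - V) (T \<inter> T' - V) (\<lambda>x1' x2' y1' y2'.
          ?T (pure (U \<inter> S') x1 y1) (pure (U \<inter> T') x2 y2) (pure (V \<inter> S') x1' y1') (pure (V \<inter> T') x2' y2')) x' y' =
        sweedler A (T \<inter> S') (T \<inter> T') (?T (pure (U \<inter> S') x1 y1) (pure (U \<inter> T') x2 y2)) (pure V x' y')"
        using sweedler_pure[OF dp(2) sub(2), unfolded un e', OF 2(2,3) vs b1[OF pc]] by simp
    next
      show "x \<in> spc H (U \<inter> S' \<union> U \<inter> T')" "y \<in> spc K ((S \<inter> S' - U) \<union> (S \<inter> T' - U))"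
        using parts(3,4)[OF dp(1) sub(1), unfolded e' un] 1 by simp_all
    qed (use d 1(1) 2(1) fin in \<open>auto intro: finite_subset\<close>)
    also have "\<dots> = sweedler A (S \<inter> S') (S \<inter> T') (\<lambda>f1 f2. sweedler A (T \<inter> S') (T \<inter> T') (?T f1 f2) (pure V x' y')) (pure U x y)"
      using sweedler_pure[OF dp(1) sub(1), unfolded un e', OF 1(2,3) vs b3[OF pure_closed[OF fin(2) 2]], symmetric] .
    finally show "cop A S' T' (mul A S T (pure U x y) (pure V x' y')) =
      sweedler A (S \<inter> S') (S \<inter> T') (\<lambda>f1 f2. sweedler A (T \<inter> S') (T \<inter> T') (?T f1 f2) (pure V x' y')) (pure U x y)" .
  qed
qed

theorem A_bimonoid: "species_bimonoid A"
proof (intro species_bimonoid.intro species_bimonoid_axioms.intro A_species_monoid A_species_comonoid; (unfold scl_A)?)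
  show "cop A {} {} (unt A) = tensor cs cs (unt A) (unt A)"
  proof -
    have q: "quad_on fscale {} {} {} {} (\<lambda>x1 x2 y1 y2. tensor cs cs (pure {} x1 y1) (pure {} x2 y2))"
      using quad_pure[of "{}" "{}", OF _ bilinear_on_tensor, of "{}"] by simp
    have "cop A {} {} (unt A) = sw2 {} {} {} {} (\<lambda>x1 x2 y1 y2. tensor cs cs (pure {} x1 y1) (pure {} x2 y2)) (unt H) (unt K)"
      unfolding unt_A using cop_pure[of "{}" "{}" "{}" "unt H" "unt K"] H.unt_closed K.unt_closed by simp
    also have "\<dots> = tensor cs cs (unt A) (unt A)"
      unfolding sw2_def unt_A
      using H.sweedler_unt[OF vector_space_fscale sweedler_K_bilinear[OF _ vector_space_fscale q, of "unt K"]]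
        K.sweedler_unt[OF vector_space_fscale quad_onD(2)[OF q H.unt_closed H.unt_closed]] K.unt_closed by simp
    finally show ?thesis .
  qed
  show "cnt A (unt A) = 1"
    unfolding unt_A by (simp add: cnt_pure H.unt_closed K.unt_closed H.cnt_unt K.cnt_unt)
  show "cnt A (mul A {} {} f g) = cnt A f * cnt A g" if f: "f \<in> spc A {}" and g: "g \<in> spc A {}" for f g
  proof (rule A_eqI2[of "{}" "{}", OF _ _ _ _ _ f g])
    have d: "disj {} {}" by simp
    show "bilinear_on cs cs (*) (spc A {}) (spc A {}) (\<lambda>f g. cnt A (mul A {} {} f g))"
      using bilinear_on_comp_out[OF A_mul_bilinear[OF d] A_mul_closed[OF d]] A_cnt_linear by simp
    show "bilinear_on cs cs (*) (spc A {}) (spc A {}) (\<lambda>f g. cnt A f * cnt A g)"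
      using A_cnt_linear by (auto simp: bilinear_on_def linear_on_def algebra_simps)
    fix U x y V x' y' assume 1: "U \<subseteq> {}" "x \<in> spc H U" "y \<in> spc K ({} - U)" "V \<subseteq> {}" "x' \<in> spc H V" "y' \<in> spc K ({} - V)"
    then have [simp]: "U = {}" "V = {}" by auto
    show "cnt A (mul A {} {} (pure U x y) (pure V x' y')) = cnt A (pure U x y) * cnt A (pure V x' y')"
      using 1 mul_pure[OF d, of "{}" "{}" x y x' y'] H.mul_closed[OF d, of x x'] K.mul_closed[OF d, of y y']
      by (simp add: cnt_pure H.cnt_mul K.cnt_mul)
  qed auto
qed (rule A_cop_mul)

lemma A_connected:
  assumes c: "connected_unit H" "connected_unit K"
  shows "connected_unit A"
  unfolding connected_unit_def scl_A
proof
  fix f assume f: "f \<in> spc A {}"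
  show "f = cs (cnt A f) (unt A)"
  proof (rule A_eqI[of "{}", OF _ _ _ _ f])
    show "linear_on cs cs (spc A {}) (\<lambda>f. cs (cnt A f) (unt A))"
      using A_cnt_linear by (auto simp: linear_on_def cs.scale_left_distrib)
    fix U x y assume 1: "U \<subseteq> {}" "x \<in> spc H U" "y \<in> spc K ({} - U)"
    then have [simp]: "U = {}" by auto
    have "pure {} x y = pure {} (scl H (cnt H x) (unt H)) (scl K (cnt K y) (unt K))"
      using c 1 by (simp add: connected_unit_def)
    also have "\<dots> = cs (cnt H x * cnt K y) (pure {} (unt H) (unt K))"
      by (simp add: pure_simps mult.commute)
    also have "\<dots> = cs (cnt A (pure {} x y)) (unt A)"
      using 1 by (simp add: cnt_pure unt_A)
    finally show "pure U x y = cs (cnt A (pure U x y)) (unt A)"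
      by simp
  qed (auto simp: linear_on_def)
qed

end

section \<open>Morphisms and ideals\<close>

text \<open>Kept separate from morphisms of bimonoids because the triangular map
  \<open>\<Phi>\<close> serves only to locate an ideal, for which compatibility with products is
  what matters.\<close>

locale monoid_hom = H: species_monoid H + K: species_monoid K
  for H :: "('k::field, 'l, 'v::ab_group_add) hopf_data" and K :: "('k, 'l, 'w::ab_group_add) hopf_data" +
  fixes f :: "'l set \<Rightarrow> 'v \<Rightarrow> 'w"
  assumes closed: "finite I \<Longrightarrow> x \<in> spc H I \<Longrightarrow> f I x \<in> spc K I"
    and linear: "finite I \<Longrightarrow> linear_on (scl H) (scl K) (spc H I) (f I)"
    and natural: "finite I \<Longrightarrow> inj_on \<sigma> I \<Longrightarrow> x \<in> spc H I \<Longrightarrow> f (\<sigma> ` I) (act H \<sigma> I x) = act K \<sigma> I (f I x)"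
    and mul: "disj S T \<Longrightarrow> x \<in> spc H S \<Longrightarrow> y \<in> spc H T \<Longrightarrow> f (S \<union> T) (mul H S T x y) = mul K S T (f S x) (f T y)"
    and unt: "f {} (unt H) = unt K"

locale bimonoid_hom = monoid_hom H K f + H: species_bimonoid H + K: species_bimonoid K for H K f +
  assumes cop: "disj S T \<Longrightarrow> x \<in> spc H (S \<union> T) \<Longrightarrow> cop K S T (f (S \<union> T) x) =
      sweedler H S T (\<lambda>x1 x2. tensor (scl K) (scl K) (f S x1) (f T x2)) x"
    and cnt: "x \<in> spc H {} \<Longrightarrow> cnt K (f {} x) = cnt H x"
begin

lemma sweedler:
  assumes "disj S T" "x \<in> spc H (S \<union> T)" "vector_space s" "bilinear_on (scl K) (scl K) s (spc K S) (spc K T) F"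
  shows "sweedler K S T F (f (S \<union> T) x) = sweedler H S T (\<lambda>x1 x2. F (f S x1) (f T x2)) x"
  unfolding sweedler_def[of K] cop[OF assms(1,2)] using assms
  by (intro H.lift_sweedler K.tens closed) auto

lemma bilinear:
  assumes "disj S T" "bilinear_on (scl K) (scl K) s (spc K S) (spc K T) F"
  shows "bilinear_on (scl H) (scl H) s (spc H S) (spc H T) (\<lambda>x1 x2. F (f S x1) (f T x2))"
  using assms by (intro bilinear_on_comp[OF assms(2)] linear closed) auto

end

lemma bimonoid_hom_of_hopf_morphism:
  assumes "hopf_morphism H K f"
  shows "bimonoid_hom H K f"
proof -
  have H: "species_bimonoid H" and K: "species_bimonoid K" using assms by (auto simp: hopf_morphism_def hopf_monoid_def)
  interpret H: species_bimonoid H by (rule H)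
  interpret K: species_bimonoid K by (rule K)
  show ?thesis
    by unfold_locales (use assms in \<open>auto simp: hopf_morphism_def species_morphism_def\<close>)
qed

lemma hopf_morphism_of_bimonoid_hom:
  assumes "bimonoid_hom H K f" "hopf_monoid H" "hopf_monoid K"
  shows "hopf_morphism H K f"
proof -
  interpret bimonoid_hom H K f by fact
  show ?thesis
    using assms(2,3) H.species_axioms K.species_axioms closed linear natural mul unt cop cnt
    by (auto simp: hopf_morphism_def species_morphism_def)
qed

lemma bimonoid_hom_comp:
  assumes "bimonoid_hom H K f" "bimonoid_hom K L g"
  shows "bimonoid_hom H L (\<lambda>I x. g I (f I x))"
proof -
  interpret f: bimonoid_hom H K f by fact
  interpret g: bimonoid_hom K L g by fact
  show ?thesis
  proof
    show "linear_on (scl H) (scl L) (spc H I) (\<lambda>x. g I (f I x))" if "finite I" for I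
      using that by (intro linear_on_comp[OF f.linear f.closed g.linear])
    fix S T x assume st: "disj S T" "x \<in> spc H (S \<union> T)"
    have "cop L S T (g (S \<union> T) (f (S \<union> T) x)) = sweedler K S T (\<lambda>x1 x2. tensor (scl L) (scl L) (g S x1) (g T x2)) (f (S \<union> T) x)"
      using st by (intro g.cop f.closed) auto
    also have "\<dots> = sweedler H S T (\<lambda>x1 x2. tensor (scl L) (scl L) (g S (f S x1)) (g T (f T x2))) x"
      by (rule f.sweedler[OF st vector_space_fscale g.bilinear[OF st(1) bilinear_on_tensor]])
    finally show "cop L S T (g (S \<union> T) (f (S \<union> T) x)) = sweedler H S T (\<lambda>x1 x2. tensor (scl L) (scl L) (g S (f S x1)) (g T (f T x2))) x" .
  qed (auto simp: f.closed g.closed f.natural g.natural f.mul g.mul f.unt g.unt f.cnt g.cnt f.H.unt_closed)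
qed

text \<open>The carrying maps arise from choices and have closed forms only on elements of
  \<open>spc\<close> over finite sets, which is all that a morphism sees.\<close>

lemma bimonoid_hom_cong:
  assumes "bimonoid_hom H K f" "\<And>I x. finite I \<Longrightarrow> x \<in> spc H I \<Longrightarrow> g I x = f I x"
  shows "bimonoid_hom H K g"
proof -
  interpret bimonoid_hom H K f by fact
  show ?thesis
  proof
    show "linear_on (scl H) (scl K) (spc H I) (g I)" if "finite I" for I
      using linear[OF that] assms(2)[OF that] that by (auto simp: linear_on_def H.spc_add H.spc_scl)
    fix S T x assume st: "disj S T" "x \<in> spc H (S \<union> T)"
    have "cop K S T (g (S \<union> T) x) = sweedler H S T (\<lambda>x1 x2. tensor (scl K) (scl K) (f S x1) (f T x2)) x"
      using st assms(2)[of "S \<union> T" x] cop[OF st] by simp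
    also have "\<dots> = sweedler H S T (\<lambda>x1 x2. tensor (scl K) (scl K) (g S x1) (g T x2)) x"
      using st assms(2) by (intro H.sweedler_cong) auto
    finally show "cop K S T (g (S \<union> T) x) = sweedler H S T (\<lambda>x1 x2. tensor (scl K) (scl K) (g S x1) (g T x2)) x" .
  qed (use assms(2) in \<open>auto simp: closed natural mul unt cnt H.unt_closed H.act_closed H.mul_closed\<close>)
qed

text \<open>Because \<open>Q\<close> is the image of \<open>q\<close>, the single equation
  \<open>g I (q I x) = h I x\<close> determines \<open>g\<close> and forces linearity and
  compatibility with all operations. Maps defined by sections or by limits become morphisms in this
  way.\<close>

lemma bimonoid_hom_factor:
  assumes "bimonoid_hom H Q q" "\<And>I. finite I \<Longrightarrow> spc Q I = q I ` spc H I"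
    and "bimonoid_hom H R h" "\<And>I x. finite I \<Longrightarrow> x \<in> spc H I \<Longrightarrow> g I (q I x) = h I x"
  shows "bimonoid_hom Q R g"
proof -
  interpret q: bimonoid_hom H Q q by fact
  interpret h: bimonoid_hom H R h by fact
  note gq = assms(4)
  have lin: "linear_on (scl Q) (scl R) (spc Q I) (g I)" if I: "finite I" for I
  proof (rule linear_onI)
    fix a b assume "a \<in> spc Q I" "b \<in> spc Q I"
    then obtain x y where xy: "a = q I x" "b = q I y" "x \<in> spc H I" "y \<in> spc H I" using assms(2)[OF I] by auto
    have "g I (q I (x + y)) = g I (q I x) + g I (q I y)"
      using xy I by (simp add: gq q.H.spc_add linear_on_add[OF h.linear])
    then show "g I (a + b) = g I a + g I b" using xy I by (simp add: linear_on_add[OF q.linear])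
  next
    fix c a assume "a \<in> spc Q I"
    then obtain x where x: "a = q I x" "x \<in> spc H I" using assms(2)[OF I] by auto
    have "g I (q I (scl H c x)) = scl R c (g I (q I x))"
      using x I by (simp add: gq q.H.spc_scl linear_on_scl[OF h.linear])
    then show "g I (scl Q c a) = scl R c (g I a)" using x I by (simp add: linear_on_scl[OF q.linear])
  qed
  have clo: "g I a \<in> spc R I" if "finite I" "a \<in> spc Q I" for I a
    using that assms(2)[OF that(1)] h.closed gq by auto
  show ?thesis
  proof
    show "g (\<sigma> ` I) (act Q \<sigma> I a) = act R \<sigma> I (g I a)" if "finite I" "inj_on \<sigma> I" "a \<in> spc Q I" for I \<sigma> a
      using that assms(2)[OF that(1)] by (auto simp: q.natural[symmetric] gq h.natural q.H.act_closed)
    show "g (S \<union> T) (mul Q S T a b) = mul R S T (g S a) (g T b)" if st: "disj S T" "a \<in> spc Q S" "b \<in> spc Q T" for S T a b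
    proof -
      obtain x y where "a = q S x" "b = q T y" "x \<in> spc H S" "y \<in> spc H T" using st assms(2)[of S] assms(2)[of T] by auto
      with st(1) show ?thesis by (simp add: q.mul[symmetric] gq h.mul q.H.mul_closed)
    qed
    show "g {} (unt Q) = unt R" using gq[of "{}" "unt H"] q.H.unt_closed q.unt h.unt by simp
    fix S T :: "'b set" and a assume st: "disj S T" and a: "a \<in> spc Q (S \<union> T)"
    obtain x where x: "a = q (S \<union> T) x" "x \<in> spc H (S \<union> T)" using a st assms(2)[of "S \<union> T"] by auto
    have bil: "bilinear_on (scl Q) (scl Q) fscale (spc Q S) (spc Q T) (\<lambda>x1 x2. tensor (scl R) (scl R) (g S x1) (g T x2))"
      using st by (intro bilinear_on_comp[OF bilinear_on_tensor[where V = UNIV and W = UNIV] lin lin]) auto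
    have "cop R S T (g (S \<union> T) a) = sweedler H S T (\<lambda>x1 x2. tensor (scl R) (scl R) (h S x1) (h T x2)) x"
      using x st by (simp add: gq h.cop)
    also have "\<dots> = sweedler H S T (\<lambda>x1 x2. tensor (scl R) (scl R) (g S (q S x1)) (g T (q T x2))) x"
      using st x gq by (intro q.H.sweedler_cong) auto
    also have "\<dots> = sweedler Q S T (\<lambda>x1 x2. tensor (scl R) (scl R) (g S x1) (g T x2)) a"
      unfolding x by (rule q.sweedler[OF st x(2) vector_space_fscale bil, symmetric])
    finally show "cop R S T (g (S \<union> T) a) = sweedler Q S T (\<lambda>x1 x2. tensor (scl R) (scl R) (g S x1) (g T x2)) a" .
  next
    show "cnt R (g {} a) = cnt Q a" if "a \<in> spc Q {}" for a
      using that assms(2)[of "{}"] by (auto simp: gq q.cnt h.cnt)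
  qed (rule clo lin; assumption)+
qed

section \<open>Ideals and generated ideals\<close>

lemma monoid_idealI:
  assumes "species_monoid H" "\<And>I. finite I \<Longrightarrow> J I \<subseteq> spc H I" "\<And>I. finite I \<Longrightarrow> module.subspace (scl H) (J I)"
    "\<And>I \<sigma> x. finite I \<Longrightarrow> inj_on \<sigma> I \<Longrightarrow> x \<in> J I \<Longrightarrow> act H \<sigma> I x \<in> J (\<sigma> ` I)"
    "\<And>S T x y. disj S T \<Longrightarrow> x \<in> spc H S \<Longrightarrow> y \<in> J T \<Longrightarrow> mul H S T x y \<in> J (S \<union> T)"
    "\<And>S T x y. disj S T \<Longrightarrow> x \<in> J S \<Longrightarrow> y \<in> spc H T \<Longrightarrow> mul H S T x y \<in> J (S \<union> T)"
  shows "monoid_ideal H J"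
  using assms species_monoid.axioms(1)[OF assms(1)]
  unfolding monoid_ideal_def by (auto intro!: subspeciesI)

lemma monoid_idealD:
  assumes "monoid_ideal H J"
  shows "finite I \<Longrightarrow> J I \<subseteq> spc H I" "finite I \<Longrightarrow> module.subspace (scl H) (J I)"
    "finite I \<Longrightarrow> inj_on \<sigma> I \<Longrightarrow> x \<in> J I \<Longrightarrow> act H \<sigma> I x \<in> J (\<sigma> ` I)"
    "disj S T \<Longrightarrow> x \<in> spc H S \<Longrightarrow> y \<in> J T \<Longrightarrow> mul H S T x y \<in> J (S \<union> T)"
    "disj S T \<Longrightarrow> x \<in> J S \<Longrightarrow> y \<in> spc H T \<Longrightarrow> mul H S T x y \<in> J (S \<union> T)"
  using assms subspeciesD[of H J] unfolding monoid_ideal_def by auto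

text \<open>The largest ideal takes part in the intersection that defines a generated ideal and
  keeps it inside \<open>spc H\<close>.\<close>

lemma (in species_monoid) monoid_ideal_spc: "monoid_ideal H (spc H)"
  by (rule monoid_idealI[OF species_monoid_axioms]) (auto simp: subspace act_closed mul_closed)

lemma ideal_generated_least:
  assumes "monoid_ideal H J" "\<And>I. finite I \<Longrightarrow> G I \<subseteq> J I"
  shows "ideal_generated H G I \<subseteq> J I"
  using assms unfolding ideal_generated_def by blast

lemma ideal_generated_base: "finite I \<Longrightarrow> G I \<subseteq> ideal_generated H G I"
  unfolding ideal_generated_def by blast

lemma (in species_monoid) monoid_ideal_generated:
  assumes "\<And>I. finite I \<Longrightarrow> G I \<subseteq> spc H I"
  shows "monoid_ideal H (ideal_generated H G)"
proof (rule monoid_idealI[OF species_monoid_axioms])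
  note mem = ideal_generated_def[of H G]
  show sub: "ideal_generated H G I \<subseteq> spc H I" if "finite I" for I
    by (rule ideal_generated_least[OF monoid_ideal_spc assms])
  show "module.subspace (scl H) (ideal_generated H G I)" if "finite I" for I
    unfolding mem using that by (intro amb.subspace_Inter) (auto dest: monoid_idealD(2))
  show "act H \<sigma> I x \<in> ideal_generated H G (\<sigma> ` I)" if "finite I" "inj_on \<sigma> I" "x \<in> ideal_generated H G I" for I \<sigma> x
    using that unfolding mem by (auto dest: monoid_idealD(3))
  show "mul H S T x y \<in> ideal_generated H G (S \<union> T)" if "disj S T" "x \<in> spc H S" "y \<in> ideal_generated H G T" for S T x y
    using that(3) monoid_idealD(4)[OF _ that(1,2)] unfolding mem by auto
  show "mul H S T x y \<in> ideal_generated H G (S \<union> T)" if "disj S T" "x \<in> ideal_generated H G S" "y \<in> spc H T" for S T x y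
    using that(2) monoid_idealD(5)[OF _ that(1) _ that(3)] unfolding mem by auto
qed

text \<open>The usual way to prove a property of all elements of a generated ideal: when the
  property reads "the image under \<open>f\<close> lies in an ideal", it cuts out an ideal, so the
  generators are enough.\<close>

lemma (in monoid_hom) monoid_ideal_preimage:
  assumes J: "monoid_ideal K J"
  shows "monoid_ideal H (\<lambda>I. {x\<in>spc H I. f I x \<in> J I})"
proof (rule monoid_idealI[OF H.species_monoid_axioms])
  note JD = monoid_idealD[OF J]
  fix I :: "'l set" assume I: "finite I"
  show "module.subspace (scl H) {x \<in> spc H I. f I x \<in> J I}"
    unfolding H.amb.subspace_def using I JD(2)[OF I]
    by (auto simp: H.spc_0 H.spc_add H.spc_scl linear_on_zero[OF linear] linear_on_add[OF linear] linear_on_scl[OF linear]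
       K.amb.subspace_0 K.amb.subspace_add K.amb.subspace_scale)
next
  note JD = monoid_idealD[OF J]
  show "act H \<sigma> I x \<in> {x \<in> spc H (\<sigma> ` I). f (\<sigma> ` I) x \<in> J (\<sigma> ` I)}" if "finite I" "inj_on \<sigma> I" "x \<in> {x \<in> spc H I. f I x \<in> J I}" for I \<sigma> x
    using that JD(3) by (auto simp: H.act_closed natural)
  show "mul H S T x y \<in> {x \<in> spc H (S \<union> T). f (S \<union> T) x \<in> J (S \<union> T)}" if "disj S T" "x \<in> spc H S" "y \<in> {x \<in> spc H T. f T x \<in> J T}" for S T x y
    using that JD(4)[OF that(1), of "f S x" "f T y"] by (auto simp: H.mul_closed mul closed)
  show "mul H S T x y \<in> {x \<in> spc H (S \<union> T). f (S \<union> T) x \<in> J (S \<union> T)}" if "disj S T" "x \<in> {x \<in> spc H S. f S x \<in> J S}" "y \<in> spc H T" for S T x y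
    using that JD(5)[OF that(1), of "f S x" "f T y"] by (auto simp: H.mul_closed mul closed)
qed auto

lemma (in species_monoid) monoid_ideal_zero: "monoid_ideal H (\<lambda>I. {0})"
  by (rule monoid_idealI[OF species_monoid_axioms]) (auto simp: spc_0 act_0 mul_0_left mul_0_right amb.subspace_single_0)

section \<open>Images and quotients of bimonoids\<close>

text \<open>Every element of \<open>Q\<close> is some \<open>q I x\<close>, so each axiom of
  \<open>Q\<close> is the image of the same axiom of \<open>H\<close>. The compatibility hypotheses
  contain the well-definedness of the operations of \<open>Q\<close>, which is thereby all that has
  to be checked for a quotient.\<close>

lemma bimonoid_image:
  fixes H :: "('k::field, 'l, 'v::ab_group_add) hopf_data" and Q :: "('k, 'l, 'w::ab_group_add) hopf_data"
  assumes "species_bimonoid H" and vs: "vector_space (scl Q)"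
    and spc: "\<And>I. finite I \<Longrightarrow> spc Q I = q I ` spc H I"
    and lin: "\<And>I. finite I \<Longrightarrow> linear_on (scl H) (scl Q) (spc H I) (q I)"
    and act: "\<And>I \<sigma> x. finite I \<Longrightarrow> inj_on \<sigma> I \<Longrightarrow> x \<in> spc H I \<Longrightarrow> act Q \<sigma> I (q I x) = q (\<sigma> ` I) (act H \<sigma> I x)"
    and mul: "\<And>S T x y. disj S T \<Longrightarrow> x \<in> spc H S \<Longrightarrow> y \<in> spc H T \<Longrightarrow> mul Q S T (q S x) (q T y) = q (S \<union> T) (mul H S T x y)"
    and unt: "unt Q = q {} (unt H)"
    and cop: "\<And>S T x. disj S T \<Longrightarrow> x \<in> spc H (S \<union> T) \<Longrightarrow> cop Q S T (q (S \<union> T) x) =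
      sweedler H S T (\<lambda>x1 x2. tensor (scl Q) (scl Q) (q S x1) (q T x2)) x"
    and cnt: "\<And>x. x \<in> spc H {} \<Longrightarrow> cnt Q (q {} x) = cnt H x"
  shows "bimonoid_hom H Q q"
proof -
  interpret H: species_bimonoid H by fact
  interpret vs: vector_space "scl Q" by fact
  have ex: "\<exists>x\<in>spc H I. a = q I x" if "finite I" "a \<in> spc Q I" for I a using spc that by auto
  have clo: "q I x \<in> spc Q I" if "finite I" "x \<in> spc H I" for I x using spc that by auto
  have linear_q: "linear_on (scl Q) s (spc Q I) g"
    if "finite I" "linear_on (scl H) s (spc H I) (\<lambda>x. g (q I x))" for I g and s :: "'k \<Rightarrow> 'y::ab_group_add \<Rightarrow> 'y"
    using that spc[OF that(1)]
    by (auto simp: linear_on_def linear_on_add[OF lin[OF that(1)], symmetric] linear_on_scl[OF lin[OF that(1)], symmetric])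
  have linear_act: "linear_on (scl Q) (scl Q) (spc Q I) (act Q \<sigma> I)" if "finite I" "inj_on \<sigma> I" for I \<sigma>
  proof (rule linear_q[OF that(1)])
    have "linear_on (scl H) (scl Q) (spc H I) (\<lambda>x. q (\<sigma> ` I) (act H \<sigma> I x))"
      using that by (intro linear_on_comp[OF H.act_linear H.act_closed lin]) auto
    then show "linear_on (scl H) (scl Q) (spc H I) (\<lambda>x. act Q \<sigma> I (q I x))"
      using that by (simp add: linear_on_def act H.spc_add H.spc_scl)
  qed
  have sub: "module.subspace (scl Q) (spc Q I)" if I: "finite I" for I
    unfolding vs.subspace_def
  proof (intro conjI ballI allI)
    show "0 \<in> spc Q I" using clo[OF I H.spc_0[OF I]] linear_on_zero[OF lin[OF I] H.spc_0[OF I]] by simp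
    show "a + b \<in> spc Q I" if ab: "a \<in> spc Q I" "b \<in> spc Q I" for a b
    proof -
      obtain x y where "a = q I x" "b = q I y" "x \<in> spc H I" "y \<in> spc H I" using ab spc[OF I] by auto
      then show ?thesis using clo[OF I H.spc_add[OF I]] linear_on_add[OF lin[OF I], symmetric] by simp
    qed
    show "scl Q c a \<in> spc Q I" if ab: "a \<in> spc Q I" for c a
    proof -
      obtain x where "a = q I x" "x \<in> spc H I" using ab spc[OF I] by auto
      then show ?thesis using clo[OF I H.spc_scl[OF I]] linear_on_scl[OF lin[OF I], symmetric] by simp
    qed
  qed
  have mul_bil: "bilinear_on (scl Q) (scl Q) (scl Q) (spc Q S) (spc Q T) (mul Q S T)" if st: "disj S T" for S T
  proof (rule bilinear_onI')
    have fin: "finite S" "finite T" "finite (S \<union> T)" using st by auto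
    fix b assume "b \<in> spc Q T"
    then obtain y where y: "b = q T y" "y \<in> spc H T" using spc[OF fin(2)] by auto
    have "linear_on (scl H) (scl Q) (spc H S) (\<lambda>x. q (S \<union> T) (mul H S T x y))"
      using y H.mul_closed[OF st] by (intro linear_on_comp[OF H.mul_linear_left[OF st] _ lin[OF fin(3)]]) auto
    then show "linear_on (scl Q) (scl Q) (spc Q S) (\<lambda>a. mul Q S T a b)"
      using y fin by (intro linear_q) (auto simp: linear_on_def mul[OF st] H.spc_add H.spc_scl)
  next
    have fin: "finite S" "finite T" "finite (S \<union> T)" using st by auto
    fix a assume "a \<in> spc Q S"
    then obtain x where x: "a = q S x" "x \<in> spc H S" using spc[OF fin(1)] by auto
    have "linear_on (scl H) (scl Q) (spc H T) (\<lambda>y. q (S \<union> T) (mul H S T x y))"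
      using x H.mul_closed[OF st] by (intro linear_on_comp[OF H.mul_linear_right[OF st] _ lin[OF fin(3)]]) auto
    then show "linear_on (scl Q) (scl Q) (spc Q T) (mul Q S T a)"
      using x fin by (intro linear_q) (auto simp: linear_on_def mul[OF st] H.spc_add H.spc_scl)
  qed
  have sp: "species Q"
  proof (rule species.intro)
    fix I :: "'l set" assume I: "finite I"
    show "module.subspace (scl Q) (spc Q I)" by (rule sub[OF I])
    obtain A where A: "finite A" "spc H I \<subseteq> H.amb.span A" using H.finite_dim[OF I] by auto
    \<comment> \<open>A finite set whose span contains \<open>spc H I\<close> may itself leave
      \<open>spc H I\<close>, where nothing is known about \<open>q\<close>. A maximal independent
      subset of \<open>spc H I\<close> is again finite and spans it from within.\<close>
    have "\<exists>A\<subseteq>spc H I. finite A \<and> H.amb.span A = spc H I"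
    proof -
      obtain B where B: "B \<subseteq> spc H I" "H.amb.independent B" "spc H I \<subseteq> H.amb.span B"
        using H.amb.maximal_independent_subset by blast
      then have "finite B" using H.amb.independent_span_bound[OF A(1)] A(2) by blast
      then show ?thesis using B H.amb.span_minimal[OF B(1) H.subspace[OF I]] by blast
    qed
    then obtain B where B: "B \<subseteq> spc H I" "finite B" "H.amb.span B = spc H I" by blast
    have "spc Q I \<subseteq> vs.span (q I ` B)"
    proof
      fix a assume "a \<in> spc Q I"
      then obtain x where x: "a = q I x" "x \<in> spc H I" using spc[OF I] by auto
      have "x \<in> spc H I \<and> q I x \<in> vs.span (q I ` B)"
        using x(2)[folded B(3)]
      proof (induction rule: H.amb.span_induct_alt)
        case base
        then show ?case using linear_on_zero[OF lin[OF I] H.spc_0[OF I]] by (simp add: H.spc_0[OF I] vs.span_zero)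
      next
        case (step c z w)
        then have z: "z \<in> spc H I" "q I z \<in> vs.span (q I ` B)" using B by (auto intro: vs.span_base)
        then show ?case using step
          by (simp add: linear_on_add[OF lin[OF I]] linear_on_scl[OF lin[OF I]] H.spc_add I H.spc_scl vs.span_add vs.span_scale)
      qed
      then show "a \<in> vs.span (q I ` B)" using x by simp
    qed
    then show "\<exists>A. finite A \<and> spc Q I \<subseteq> vs.span A" using B(2) by blast
    show "act Q id I a = a" if "a \<in> spc Q I" for a
      using ex[OF I that] I by (auto simp: act H.act_id)
    fix \<sigma> :: "'l \<Rightarrow> 'l" assume \<sigma>: "inj_on \<sigma> I"
    show "linear_on (scl Q) (scl Q) (spc Q I) (act Q \<sigma> I)" by (rule linear_act[OF I \<sigma>])
    show "act Q \<sigma> I a \<in> spc Q (\<sigma> ` I)" if "a \<in> spc Q I" for a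
      using ex[OF I that] I \<sigma> by (auto simp: act intro!: clo H.act_closed)
    show "act Q \<sigma> I a = act Q \<tau> I a" if h: "\<And>i. i \<in> I \<Longrightarrow> \<sigma> i = \<tau> i" "a \<in> spc Q I" for \<tau> a
    proof -
      obtain x where x: "a = q I x" "x \<in> spc H I" using ex[OF I h(2)] by auto
      have "inj_on \<tau> I" "\<sigma> ` I = \<tau> ` I" using \<sigma> h(1) by (auto simp: inj_on_def image_def)
      then show ?thesis using x H.act_cong[OF I \<sigma> h(1) x(2)] by (simp add: act I \<sigma>)
    qed
    show "act Q (\<tau> \<circ> \<sigma>) I a = act Q \<tau> (\<sigma> ` I) (act Q \<sigma> I a)" if "inj_on \<tau> (\<sigma> ` I)" "a \<in> spc Q I" for \<tau> a
      using ex[OF I that(2)] comp_inj_on[OF \<sigma> that(1)] H.act_comp[OF I \<sigma> that(1)] H.act_closed[OF I \<sigma>]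
      by (auto simp: act I \<sigma> that(1) image_image act[OF finite_imageI[OF I] that(1)])
  qed fact
  interpret Q: species Q by (rule sp)
  have mon: "species_monoid Q"
  proof (intro species_monoid.intro species_monoid_axioms.intro sp)
    fix S T :: "'l set" assume st: "disj S T"
    show "bilinear_on (scl Q) (scl Q) (scl Q) (spc Q S) (spc Q T) (mul Q S T)" by (rule mul_bil[OF st])
    fix a b assume "a \<in> spc Q S" "b \<in> spc Q T"
    then obtain x y where xy: "a = q S x" "b = q T y" "x \<in> spc H S" "y \<in> spc H T" using spc[of S] spc[of T] st by auto
    show "mul Q S T a b \<in> spc Q (S \<union> T)" using xy st by (auto simp: mul intro!: clo H.mul_closed)
    fix \<sigma> :: "'l \<Rightarrow> 'l" assume \<sigma>: "inj_on \<sigma> (S \<union> T)"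
    have d': "disj (\<sigma> ` S) (\<sigma> ` T)" "inj_on \<sigma> S" "inj_on \<sigma> T"
      using st \<sigma> inj_on_image_Int[OF \<sigma>, of S T] by (auto simp: inj_on_Un)
    show "act Q \<sigma> (S \<union> T) (mul Q S T a b) = mul Q (\<sigma> ` S) (\<sigma> ` T) (act Q \<sigma> S a) (act Q \<sigma> T b)"
      using xy st d' \<sigma> by (simp add: mul act H.mul_closed H.act_closed H.mul_natural image_Un)
  next
    fix R S T :: "'l set" and a b c assume d: "disj R S" "disj R T" "disj S T" and "a \<in> spc Q R" "b \<in> spc Q S" "c \<in> spc Q T"
    then obtain x y z where xyz: "a = q R x" "b = q S y" "c = q T z" "x \<in> spc H R" "y \<in> spc H S" "z \<in> spc H T" using spc[of R] spc[of S] spc[of T] d by auto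
    have d': "disj (R \<union> S) T" "disj R (S \<union> T)" using d by auto
    show "mul Q (R \<union> S) T (mul Q R S a b) c = mul Q R (S \<union> T) a (mul Q S T b c)"
      using mul[OF d'(1) H.mul_closed[OF d(1) xyz(4,5)] xyz(6)] mul[OF d'(2) xyz(4) H.mul_closed[OF d(3) xyz(5,6)]]
        H.mul_assoc[OF d xyz(4-6)] mul[OF d(1) xyz(4,5)] mul[OF d(3) xyz(5,6)] xyz(1-3) by (simp add: Un_assoc)
  next
    show "unt Q \<in> spc Q {}" unfolding unt by (rule clo) (auto simp: H.unt_closed)
    fix I :: "'l set" and a assume I: "finite I" and "a \<in> spc Q I"
    then obtain x where x: "a = q I x" "x \<in> spc H I" using spc[OF I] by auto
    show "mul Q {} I (unt Q) a = a" using mul[of "{}" I "unt H" x] I x by (simp add: unt H.unt_closed H.mul_unt_left)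
    show "mul Q I {} a (unt Q) = a" using mul[of I "{}" x "unt H"] I x by (simp add: unt H.unt_closed H.mul_unt_right)
  qed
  interpret Q: species_monoid Q by (rule mon)
  have tens: "tens (scl Q) (scl Q) (spc Q S) (spc Q T)" if "disj S T" for S T
    using tens_species[OF sp sp] that by auto
  have sweedler: "sweedler Q S T F (q (S \<union> T) x) = sweedler H S T (\<lambda>x1 x2. F (q S x1) (q T x2)) x"
    if "disj S T" "x \<in> spc H (S \<union> T)" "vector_space s" "bilinear_on (scl Q) (scl Q) s (spc Q S) (spc Q T) F"
    for S T x F and s :: "'k \<Rightarrow> 'y::ab_group_add \<Rightarrow> 'y"
    unfolding sweedler_def[of Q] cop[OF that(1,2)] using that
    by (intro H.lift_sweedler tens clo) auto
  have cop_lin: "linear_on (scl Q) fscale (spc Q (S \<union> T)) (cop Q S T)" if st: "disj S T" for S T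
  proof (rule linear_q)
    have "bilinear_on (scl H) (scl H) fscale (spc H S) (spc H T) (\<lambda>x1 x2. tensor (scl Q) (scl Q) (q S x1) (q T x2))"
      using st by (intro bilinear_on_comp[OF bilinear_on_tensor[where V = UNIV and W = UNIV]] lin) auto
    from H.sweedler_linear[OF st vector_space_fscale this]
    show "linear_on (scl H) fscale (spc H (S \<union> T)) (\<lambda>x. cop Q S T (q (S \<union> T) x))"
      using st by (simp add: linear_on_def cop H.spc_add H.spc_scl)
  qed (use st in auto)
  have cop_clo: "cop Q S T a \<in> tensor_space (scl Q) (scl Q) (spc Q S) (spc Q T)" if st: "disj S T" and a: "a \<in> spc Q (S \<union> T)" for S T a
  proof -
    obtain x where x: "a = q (S \<union> T) x" "x \<in> spc H (S \<union> T)" using spc[of "S \<union> T"] st a by auto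
    show ?thesis unfolding x cop[OF st x(2)] using st x clo
      by (intro H.sweedler_closed[OF st x(2) vector_space_fscale tens.subspace_TS[OF tens[OF st]]] tens.TS_tensor[OF tens[OF st]]) auto
  qed
  have sw_lin: "linear_on (scl Q) s (spc Q (S \<union> T)) (sweedler Q S T F)"
    if "disj S T" "vector_space s" "bilinear_on (scl Q) (scl Q) s (spc Q S) (spc Q T) F" for S T F and s :: "'k \<Rightarrow> 'y::ab_group_add \<Rightarrow> 'y"
    unfolding sweedler_def
    by (rule linear_on_comp[OF cop_lin cop_clo tens.TL_linear[OF tens]]) (use that in auto)
  have sw_lin_fun: "linear_on s' s Z (\<lambda>z. sweedler Q S T (F z) a)"
    if "disj S T" "a \<in> spc Q (S \<union> T)" "vector_space s" "\<And>x y. x \<in> spc Q S \<Longrightarrow> y \<in> spc Q T \<Longrightarrow> linear_on s' s Z (\<lambda>z. F z x y)"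
    for S T F a Z and s :: "'k \<Rightarrow> 'y::ab_group_add \<Rightarrow> 'y" and s' :: "'k \<Rightarrow> 'x::ab_group_add \<Rightarrow> 'x"
    unfolding sweedler_def
    by (rule tens.TL_linear_fun[OF tens cop_clo]) (use that in auto)
  have cnt_lin: "linear_on (scl Q) (*) (spc Q {}) (cnt Q)"
    using H.cnt_linear by (intro linear_q) (auto simp: linear_on_def cnt H.spc_add H.spc_scl)
  have com: "species_comonoid Q"
  proof (intro species_comonoid.intro species_comonoid_axioms.intro sp)
    fix S T :: "'l set" and \<sigma> :: "'l \<Rightarrow> 'l" and a assume st: "disj S T" and \<sigma>: "inj_on \<sigma> (S \<union> T)" and "a \<in> spc Q (S \<union> T)"
    then obtain x where x: "a = q (S \<union> T) x" "x \<in> spc H (S \<union> T)" using spc[of "S \<union> T"] st by auto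
    have d': "disj (\<sigma> ` S) (\<sigma> ` T)" "inj_on \<sigma> S" "inj_on \<sigma> T"
      using st \<sigma> inj_on_image_Int[OF \<sigma>, of S T] by (auto simp: inj_on_Un)
    have b1: "bilinear_on (scl H) (scl H) fscale (spc H (\<sigma> ` S)) (spc H (\<sigma> ` T)) (\<lambda>x1 x2. tensor (scl Q) (scl Q) (q (\<sigma> ` S) x1) (q (\<sigma> ` T) x2))"
      using st by (intro bilinear_on_comp[OF bilinear_on_tensor[where V = UNIV and W = UNIV]] lin) auto
    have b2: "bilinear_on (scl Q) (scl Q) fscale (spc Q S) (spc Q T) (\<lambda>x1 x2. tensor (scl Q) (scl Q) (act Q \<sigma> S x1) (act Q \<sigma> T x2))"
      using st d' by (intro bilinear_on_comp[OF bilinear_on_tensor[where V = UNIV and W = UNIV]] linear_act) auto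
    have ax: "act H \<sigma> (S \<union> T) x \<in> spc H (\<sigma> ` S \<union> \<sigma> ` T)" using H.act_closed[OF _ \<sigma> x(2)] st by (simp add: image_Un)
    have "cop Q (\<sigma> ` S) (\<sigma> ` T) (act Q \<sigma> (S \<union> T) a) =
      sweedler H (\<sigma> ` S) (\<sigma> ` T) (\<lambda>x1 x2. tensor (scl Q) (scl Q) (q (\<sigma> ` S) x1) (q (\<sigma> ` T) x2)) (act H \<sigma> (S \<union> T) x)"
      using x st \<sigma> cop[OF d'(1) ax] act[OF _ \<sigma> x(2)] by (simp add: image_Un)
    also have "\<dots> = sweedler H S T (\<lambda>x1 x2. tensor (scl Q) (scl Q) (q (\<sigma> ` S) (act H \<sigma> S x1)) (q (\<sigma> ` T) (act H \<sigma> T x2))) x"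
      by (rule H.sweedler_natural[OF st x(2) \<sigma> vector_space_fscale b1])
    also have "\<dots> = sweedler H S T (\<lambda>x1 x2. tensor (scl Q) (scl Q) (act Q \<sigma> S (q S x1)) (act Q \<sigma> T (q T x2))) x"
      using st x d' by (intro H.sweedler_cong) (auto simp: act)
    also have "\<dots> = sweedler Q S T (\<lambda>x1 x2. tensor (scl Q) (scl Q) (act Q \<sigma> S x1) (act Q \<sigma> T x2)) a"
      unfolding x by (rule sweedler[OF st x(2) vector_space_fscale b2, symmetric])
    finally show "cop Q (\<sigma> ` S) (\<sigma> ` T) (act Q \<sigma> (S \<union> T) a) =
      sweedler Q S T (\<lambda>x1 x2. tensor (scl Q) (scl Q) (act Q \<sigma> S x1) (act Q \<sigma> T x2)) a" .
  next
    fix R S T :: "'l set" and a assume d: "disj R S" "disj R T" "disj S T" and "a \<in> spc Q (R \<union> S \<union> T)"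
    then obtain x where x: "a = q (R \<union> S \<union> T) x" "x \<in> spc H (R \<union> S \<union> T)" using spc[of "R \<union> S \<union> T"] d by auto
    have d': "disj (R \<union> S) T" "disj R (S \<union> T)" using d by auto
    have un: "R \<union> (S \<union> T) = R \<union> S \<union> T" by auto
    note vf = vector_space_fscale
    let ?F = "\<lambda>x1 x2 x3. tensor (scl Q) fscale x1 (tensor (scl Q) (scl Q) x2 x3)"
    have F: "bilinear_on (scl Q) (scl Q) fscale V W (\<lambda>x1 x2. ?F x1 x2 x3)" "bilinear_on (scl Q) (scl Q) fscale V W (\<lambda>x2 x3. ?F x1 x2 x3)"
      "linear_on (scl Q) fscale V (\<lambda>x1. ?F x1 x2 x3)" "linear_on (scl Q) fscale V (\<lambda>x3. ?F x1 x2 x3)" for V W x1 x2 x3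
      by (auto simp: bilinear_on_def linear_on_def tensor_simps)
    have b1: "bilinear_on (scl Q) (scl Q) fscale (spc Q (R \<union> S)) (spc Q T) (\<lambda>y x3. sweedler Q R S (\<lambda>x1 x2. ?F x1 x2 x3) y)"
      by (intro bilinear_onI' sw_lin[OF d(1) vf] sw_lin_fun[OF d(1) _ vf] F)
    have b2: "bilinear_on (scl Q) (scl Q) fscale (spc Q R) (spc Q (S \<union> T)) (\<lambda>x1 y. sweedler Q S T (\<lambda>x2 x3. ?F x1 x2 x3) y)"
      by (intro bilinear_onI' sw_lin[OF d(3) vf] sw_lin_fun[OF d(3) _ vf] F)
    have tri: "trilinear_on (scl H) (scl H) (scl H) fscale (spc H R) (spc H S) (spc H T) (\<lambda>x1 x2 x3. ?F (q R x1) (q S x2) (q T x3))"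
      using d lin by (auto simp: trilinear_on_def bilinear_on_def linear_on_def tensor_simps)
    have "sweedler Q (R \<union> S) T (\<lambda>y x3. sweedler Q R S (\<lambda>x1 x2. ?F x1 x2 x3) y) a =
      sweedler H (R \<union> S) T (\<lambda>y x3. sweedler Q R S (\<lambda>x1 x2. ?F x1 x2 (q T x3)) (q (R \<union> S) y)) x"
      unfolding x by (rule sweedler[OF d'(1) x(2) vf b1])
    also have "\<dots> = sweedler H (R \<union> S) T (\<lambda>y x3. sweedler H R S (\<lambda>x1 x2. ?F (q R x1) (q S x2) (q T x3)) y) x"
      by (intro H.sweedler_cong[OF d'(1) x(2)] sweedler[OF d(1) _ vf] F)
    also have "\<dots> = sweedler H R (S \<union> T) (\<lambda>x1 y. sweedler H S T (\<lambda>x2 x3. ?F (q R x1) (q S x2) (q T x3)) y) x"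
      by (rule H.sweedler_coassoc[OF d x(2) vf tri])
    also have "\<dots> = sweedler H R (S \<union> T) (\<lambda>x1 y. sweedler Q S T (\<lambda>x2 x3. ?F (q R x1) x2 x3) (q (S \<union> T) y)) x"
      using x un by (intro H.sweedler_cong[OF d'(2)] sweedler[OF d(3) _ vf, symmetric] F) auto
    also have "\<dots> = sweedler Q R (S \<union> T) (\<lambda>x1 y. sweedler Q S T (\<lambda>x2 x3. ?F x1 x2 x3) y) a"
      unfolding x using sweedler[OF d'(2) x(2)[folded un] vf b2] unfolding un by simp
    finally show "sweedler Q (R \<union> S) T (\<lambda>y x3. sweedler Q R S (\<lambda>x1 x2. ?F x1 x2 x3) y) a =
      sweedler Q R (S \<union> T) (\<lambda>x1 y. sweedler Q S T (\<lambda>x2 x3. ?F x1 x2 x3) y) a" .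
  next
    fix I :: "'l set" and a assume I: "finite I" and a: "a \<in> spc Q I"
    obtain x where x: "a = q I x" "x \<in> spc H I" using spc[OF I] a by auto
    have b1: "bilinear_on (scl Q) (scl Q) (scl Q) (spc Q {}) (spc Q I) (\<lambda>x1 x2. scl Q (cnt Q x1) x2)"
      using cnt_lin by (auto simp: bilinear_on_def linear_on_def vs.scale_left_distrib vs.scale_right_distrib mult.commute)
    have b2: "bilinear_on (scl Q) (scl Q) (scl Q) (spc Q I) (spc Q {}) (\<lambda>x1 x2. scl Q (cnt Q x2) x1)"
      using cnt_lin by (auto simp: bilinear_on_def linear_on_def vs.scale_left_distrib vs.scale_right_distrib mult.commute)
    have "sweedler Q {} I (\<lambda>x1 x2. scl Q (cnt Q x1) x2) a = sweedler H {} I (\<lambda>x1 x2. scl Q (cnt Q (q {} x1)) (q I x2)) x"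
      using sweedler[OF _ _ vs b1, of x] x I by simp
    also have "\<dots> = sweedler H {} I (\<lambda>x1 x2. q I (scl H (cnt H x1) x2)) x"
      using I x by (intro H.sweedler_cong) (auto simp: cnt linear_on_scl[OF lin])
    also have "\<dots> = a" unfolding x by (rule H.sweedler_cnt_left[OF I x(2) lin[OF I]])
    finally show "sweedler Q {} I (\<lambda>x1 x2. scl Q (cnt Q x1) x2) a = a" .
    have "sweedler Q I {} (\<lambda>x1 x2. scl Q (cnt Q x2) x1) a = sweedler H I {} (\<lambda>x1 x2. scl Q (cnt Q (q {} x2)) (q I x1)) x"
      using sweedler[OF _ _ vs b2, of x] x I by simp
    also have "\<dots> = sweedler H I {} (\<lambda>x1 x2. q I (scl H (cnt H x2) x1)) x"
      using I x by (intro H.sweedler_cong) (auto simp: cnt linear_on_scl[OF lin])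
    also have "\<dots> = a" unfolding x by (rule H.sweedler_cnt_right[OF I x(2) lin[OF I]])
    finally show "sweedler Q I {} (\<lambda>x1 x2. scl Q (cnt Q x2) x1) a = a" .
  qed (fact cop_clo cop_lin cnt_lin)+
  have bim: "species_bimonoid Q"
  proof (intro species_bimonoid.intro species_bimonoid_axioms.intro mon com)
    fix S T S' T' :: "'l set" and a b
    assume d: "disj S T" "disj S' T'" "S \<union> T = S' \<union> T'" and "a \<in> spc Q S" "b \<in> spc Q T"
    then obtain x y where xy: "a = q S x" "b = q T y" "x \<in> spc H S" "y \<in> spc H T" using spc[of S] spc[of T] d by auto
    have dp: "disj (S \<inter> S') (S \<inter> T')" "disj (T \<inter> S') (T \<inter> T')" "disj (S \<inter> S') (T \<inter> S')" "disj (S \<inter> T') (T \<inter> T')" using d by auto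
    have un: "S \<inter> S' \<union> S \<inter> T' = S" "T \<inter> S' \<union> T \<inter> T' = T" "S \<inter> S' \<union> T \<inter> S' = S'" "S \<inter> T' \<union> T \<inter> T' = T'" using d by auto
    note vf = vector_space_fscale
    let ?T = "\<lambda>f1 f2 g1 g2. tensor (scl Q) (scl Q) (mul Q (S \<inter> S') (T \<inter> S') f1 g1) (mul Q (S \<inter> T') (T \<inter> T') f2 g2)"
    have b1: "bilinear_on (scl Q) (scl Q) fscale (spc Q (T \<inter> S')) (spc Q (T \<inter> T')) (?T f1 f2)"
      if "f1 \<in> spc Q (S \<inter> S')" "f2 \<in> spc Q (S \<inter> T')" for f1 f2
      by (rule bilinear_on_comp[OF bilinear_on_tensor[where V = UNIV and W = UNIV] Q.mul_linear_right[OF dp(3) that(1)] Q.mul_linear_right[OF dp(4) that(2)]]) auto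
    have b2: "bilinear_on (scl Q) (scl Q) fscale (spc Q (S \<inter> S')) (spc Q (S \<inter> T')) (\<lambda>f1 f2. ?T f1 f2 g1 g2)"
      if "g1 \<in> spc Q (T \<inter> S')" "g2 \<in> spc Q (T \<inter> T')" for g1 g2
      by (rule bilinear_on_comp[OF bilinear_on_tensor[where V = UNIV and W = UNIV] Q.mul_linear_left[OF dp(3) that(1)] Q.mul_linear_left[OF dp(4) that(2)]]) auto
    have bT: "b \<in> spc Q T" using xy clo d by auto
    have b3: "bilinear_on (scl Q) (scl Q) fscale (spc Q (S \<inter> S')) (spc Q (S \<inter> T')) (\<lambda>f1 f2. sweedler Q (T \<inter> S') (T \<inter> T') (?T f1 f2) b)"
      using bT by (intro bilinear_onI' sw_lin_fun[OF dp(2) _ vf] bilinear_on_left[OF b2] bilinear_on_right[OF b2]) (simp_all add: un)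
    have b4: "bilinear_on (scl H) (scl H) fscale (spc H S') (spc H T') (\<lambda>x1 x2. tensor (scl Q) (scl Q) (q S' x1) (q T' x2))"
      using d by (intro bilinear_on_comp[OF bilinear_on_tensor[where V = UNIV and W = UNIV]] lin) auto
    have "cop Q S' T' (mul Q S T a b) = sweedler H S' T' (\<lambda>x1 x2. tensor (scl Q) (scl Q) (q S' x1) (q T' x2)) (mul H S T x y)"
      using xy mul[OF d(1) xy(3,4)] cop[OF d(2)] H.mul_closed[OF d(1) xy(3,4)] d(3) by simp
    also have "\<dots> = sweedler H (S \<inter> S') (S \<inter> T') (\<lambda>x1 x2. sweedler H (T \<inter> S') (T \<inter> T') (\<lambda>y1 y2.
        tensor (scl Q) (scl Q) (q S' (mul H (S \<inter> S') (T \<inter> S') x1 y1)) (q T' (mul H (S \<inter> T') (T \<inter> T') x2 y2))) y) x"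
      by (rule H.sweedler_mul[OF d xy(3,4) vf b4])
    also have "\<dots> = sweedler H (S \<inter> S') (S \<inter> T') (\<lambda>x1 x2. sweedler H (T \<inter> S') (T \<inter> T') (\<lambda>y1 y2.
        ?T (q (S \<inter> S') x1) (q (S \<inter> T') x2) (q (T \<inter> S') y1) (q (T \<inter> T') y2)) y) x"
      using xy mul[OF dp(3)] mul[OF dp(4)] unfolding un by (intro H.sweedler_cong dp) (auto simp: un)
    also have "\<dots> = sweedler H (S \<inter> S') (S \<inter> T') (\<lambda>x1 x2. sweedler Q (T \<inter> S') (T \<inter> T')
        (?T (q (S \<inter> S') x1) (q (S \<inter> T') x2)) b) x"
    proof (rule H.sweedler_cong[OF dp(1)])
      fix x1 x2 assume h: "x1 \<in> spc H (S \<inter> S')" "x2 \<in> spc H (S \<inter> T')"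
      have "q (S \<inter> S') x1 \<in> spc Q (S \<inter> S')" "q (S \<inter> T') x2 \<in> spc Q (S \<inter> T')" using h clo dp by auto
      from sweedler[OF dp(2) _ vf b1[OF this], of y]
      show "sweedler H (T \<inter> S') (T \<inter> T') (\<lambda>y1 y2. ?T (q (S \<inter> S') x1) (q (S \<inter> T') x2) (q (T \<inter> S') y1) (q (T \<inter> T') y2)) y
        = sweedler Q (T \<inter> S') (T \<inter> T') (?T (q (S \<inter> S') x1) (q (S \<inter> T') x2)) b"
        using xy by (simp add: un)
    qed (use xy un in simp)
    also have "\<dots> = sweedler Q (S \<inter> S') (S \<inter> T') (\<lambda>f1 f2. sweedler Q (T \<inter> S') (T \<inter> T') (?T f1 f2) b) a"
      using sweedler[OF dp(1) _ vf b3, of x] xy by (simp add: un)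
    finally show "cop Q S' T' (mul Q S T a b) = sweedler Q (S \<inter> S') (S \<inter> T') (\<lambda>f1 f2. sweedler Q (T \<inter> S') (T \<inter> T') (?T f1 f2) b) a" .
  next
    have b: "bilinear_on (scl H) (scl H) fscale (spc H {}) (spc H {}) (\<lambda>x1 x2. tensor (scl Q) (scl Q) (q {} x1) (q {} x2))"
      by (intro bilinear_on_comp[OF bilinear_on_tensor[where V = UNIV and W = UNIV]] lin) auto
    show "cop Q {} {} (unt Q) = tensor (scl Q) (scl Q) (unt Q) (unt Q)"
      using cop[of "{}" "{}" "unt H"] H.sweedler_unt[OF vector_space_fscale b] by (simp add: unt H.unt_closed)
    show "cnt Q (unt Q) = 1" by (simp add: unt cnt H.unt_closed H.cnt_unt)
    fix a b assume "a \<in> spc Q {}" "b \<in> spc Q {}"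
    then obtain x y where xy: "a = q {} x" "b = q {} y" "x \<in> spc H {}" "y \<in> spc H {}" using spc[of "{}"] by auto
    show "cnt Q (mul Q {} {} a b) = cnt Q a * cnt Q b"
      using xy mul[of "{}" "{}" x y] H.mul_closed[of "{}" "{}" x y] by (simp add: cnt H.cnt_mul)
  qed
  interpret Q: species_bimonoid Q by (rule bim)
  show ?thesis
    by unfold_locales (simp_all add: clo lin act mul unt cop cnt)
qed

section \<open>Quotients by an ideal, and coideals\<close>

lemma linear_on_image_subspace:
  assumes "vector_space s1" "vector_space s2" "module.subspace s1 V" "linear_on s1 s2 V f"
  shows "module.subspace s2 (f ` V)"
proof -
  interpret v1: vector_space s1 by fact
  interpret v2: vector_space s2 by fact
  show ?thesis
    unfolding v2.subspace_def
  proof (intro conjI ballI allI)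
    show "0 \<in> f ` V" using linear_on_zero[OF assms(4)] v1.subspace_0[OF assms(3)] by (metis image_eqI)
    show "x + y \<in> f ` V" if "x \<in> f ` V" "y \<in> f ` V" for x y
      using that linear_on_add[OF assms(4)] v1.subspace_add[OF assms(3)] by (auto simp: image_iff) metis
    show "s2 c x \<in> f ` V" if "x \<in> f ` V" for c x
      using that linear_on_scl[OF assms(4)] v1.subspace_scale[OF assms(3)] by (auto simp: image_iff) metis
  qed
qed

lemma (in tens) TS_0: "0 \<in> TS"
  using module.subspace_0[OF vector_space_fscale[folded module_iff_vector_space] subspace_TS] .

lemma (in tens) TL_0:
  assumes "vector_space s3" "bilinear_on s1 s2 s3 V W F"
  shows "TL F 0 = 0"
  by (rule linear_on_zero[OF TL_linear[OF assms] TS_0])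

lemma fscale_0: "fscale (c :: 'k::field) 0 = 0"
  by (simp add: fscale_def fun_eq_iff zero_fun_apply)

lemma qclass_add: "qclass s U (x + y) = qclass s U x + qclass s U y"
  and qclass_scl: "qclass s U (s c x) = fscale c (qclass s U x)"
  by (auto simp: qclass_def fun_eq_iff Vector_Spaces.linear_iff fscale_def plus_fun_apply)

lemma linear_on_qclass: "linear_on s fscale V (qclass s U)"
  by (simp add: linear_on_def qclass_add qclass_scl)

locale quotient_monoid = species_monoid H for H :: "('k::field, 'l, 'v::ab_group_add) hopf_data" +
  fixes J :: "'l set \<Rightarrow> 'v set"
  assumes ideal: "monoid_ideal H J"
begin

abbreviation "q I \<equiv> qclass (scl H) (J I)"
abbreviation "Q \<equiv> quotient H J"

lemma q_eq: "finite I \<Longrightarrow> q I x = q I y \<longleftrightarrow> x - y \<in> J I"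
  by (rule qclass_eq_iff[OF ambient monoid_idealD(2)[OF ideal]])

lemma scl_Q: "scl Q = fscale" and spc_Q: "spc Q I = q I ` spc H I"
  by (simp_all add: quotient_def)

lemma representative:
  assumes "finite I" "x \<in> spc H I"
  shows "representative H J I (q I x) \<in> spc H I" "representative H J I (q I x) - x \<in> J I"
  using someI_ex[of "\<lambda>y. y \<in> spc H I \<and> q I y = q I x"] assms
  unfolding representative_def[symmetric] by (auto simp: q_eq[symmetric])

lemma act_Q:
  assumes "finite I" "inj_on \<sigma> I" "x \<in> spc H I"
  shows "act Q \<sigma> I (q I x) = q (\<sigma> ` I) (act H \<sigma> I x)"
proof -
  let ?r = "representative H J I (q I x)"
  note r = representative[OF assms(1,3)]
  have "act H \<sigma> I ?r - act H \<sigma> I x = act H \<sigma> I (?r - x)"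
    using linear_on_diff[OF ambient subspace[OF assms(1)] act_linear[OF assms(1,2)] r(1) assms(3)] by simp
  then show ?thesis
    using monoid_idealD(3)[OF ideal assms(1,2) r(2)] assms(1) by (simp add: quotient_def q_eq)
qed

lemma mul_Q:
  assumes "disj S T" "x \<in> spc H S" "y \<in> spc H T"
  shows "mul Q S T (q S x) (q T y) = q (S \<union> T) (mul H S T x y)"
proof -
  have fin: "finite S" "finite T" "finite (S \<union> T)" using assms by auto
  let ?x = "representative H J S (q S x)"
  let ?y = "representative H J T (q T y)"
  note x = representative[OF fin(1) assms(2)] and y = representative[OF fin(2) assms(3)]
  have "mul H S T ?x ?y - mul H S T x y = mul H S T (?x - x) ?y + mul H S T x (?y - y)"
    using linear_on_diff[OF ambient subspace[OF fin(1)] mul_linear_left[OF assms(1) y(1)] x(1) assms(2)]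
      linear_on_diff[OF ambient subspace[OF fin(2)] mul_linear_right[OF assms(1,2)] y(1) assms(3)] by simp
  also have "\<dots> \<in> J (S \<union> T)"
    using monoid_idealD(4)[OF ideal assms(1,2) y(2)] monoid_idealD(5)[OF ideal assms(1) x(2) y(1)]
      amb.subspace_add[OF monoid_idealD(2)[OF ideal fin(3)]] by blast
  finally show ?thesis using fin by (simp add: quotient_def q_eq)
qed

lemma Q_linear:
  assumes "linear_on (scl H) s (spc H I) (\<lambda>x. g (q I x))"
  shows "linear_on fscale s (spc Q I) g"
  using assms unfolding spc_Q
  by (auto simp: linear_on_def qclass_add[symmetric] qclass_scl[symmetric])

lemma Q_mul_linear:
  assumes st: "disj S T"
  shows "y \<in> spc H T \<Longrightarrow> linear_on fscale fscale (spc Q S) (\<lambda>a. mul Q S T a (q T y))"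
    "x \<in> spc H S \<Longrightarrow> linear_on fscale fscale (spc Q T) (\<lambda>a. mul Q S T (q S x) a)"
proof -
  show "linear_on fscale fscale (spc Q S) (\<lambda>a. mul Q S T a (q T y))" if y: "y \<in> spc H T"
  proof (rule Q_linear)
    have "linear_on (scl H) fscale (spc H S) (\<lambda>x. q (S \<union> T) (mul H S T x y))"
      by (rule linear_on_comp[OF mul_linear_left[OF st y] mul_closed[OF st _ y] linear_on_qclass])
    then show "linear_on (scl H) fscale (spc H S) (\<lambda>x. mul Q S T (q S x) (q T y))"
      using st y by (simp add: linear_on_def mul_Q spc_add spc_scl)
  qed
  show "linear_on fscale fscale (spc Q T) (\<lambda>a. mul Q S T (q S x) a)" if x: "x \<in> spc H S"
  proof (rule Q_linear)
    have "linear_on (scl H) fscale (spc H T) (\<lambda>y. q (S \<union> T) (mul H S T x y))"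
      by (rule linear_on_comp[OF mul_linear_right[OF st x] mul_closed[OF st x] linear_on_qclass])
    then show "linear_on (scl H) fscale (spc H T) (\<lambda>y. mul Q S T (q S x) (q T y))"
      using st x by (simp add: linear_on_def mul_Q spc_add spc_scl)
  qed
qed

lemma Q_act_linear: "finite I \<Longrightarrow> inj_on \<sigma> I \<Longrightarrow> linear_on fscale fscale (spc Q I) (act Q \<sigma> I)"
  using linear_on_comp[OF act_linear[of I \<sigma>] act_closed[of I \<sigma>] linear_on_qclass[of "scl H" _ "J (\<sigma> ` I)"]]
  by (intro Q_linear) (simp add: linear_on_def act_Q spc_add spc_scl)

lemma tens_Q: "disj S T \<Longrightarrow> tens fscale fscale (spc Q S) (spc Q T)"
  unfolding tens_def spc_Q
  by (auto intro!: vector_space_fscale linear_on_image_subspace[OF ambient vector_space_fscale] linear_on_qclass subspace)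

end

text \<open>The coproduct of \<open>x\<close> lies in the kernel of the tensor square of the
  projection, that is, in \<open>J \<otimes> H + H \<otimes> J\<close>, for every decomposition of
  \<open>I\<close>. It is phrased for a single element so that the elements satisfying it can be
  shown to form an ideal.\<close>

definition coideal :: "('k::field, 'l, 'v::ab_group_add) hopf_data \<Rightarrow> ('l set \<Rightarrow> 'v set) \<Rightarrow> 'l set \<Rightarrow> 'v \<Rightarrow> bool" where
  "coideal H J I x \<longleftrightarrow> (\<forall>S T. disj S T \<and> S \<union> T = I \<longrightarrow>
     sweedler H S T (\<lambda>x1 x2. tensor fscale fscale (qclass (scl H) (J S) x1) (qclass (scl H) (J T) x2)) x = 0)"

locale quotient_bimonoid = quotient_monoid H J + species_bimonoid H for H J
begin

lemma qq_bilinear: "bilinear_on (scl H) (scl H) fscale V W (\<lambda>x1 x2. tensor fscale fscale (q S x1) (q T x2))"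
  by (simp add: bilinear_on_def linear_on_def qclass_add qclass_scl tensor_simps)

lemma quotient_hom:
  assumes J: "\<And>I x. finite I \<Longrightarrow> x \<in> J I \<Longrightarrow> coideal H J I x" and J0: "\<And>x. x \<in> J {} \<Longrightarrow> cnt H x = 0"
  shows "bimonoid_hom H Q q"
proof (rule bimonoid_image)
  show "cop Q S T (q (S \<union> T) x) = sweedler H S T (\<lambda>x1 x2. tensor (scl Q) (scl Q) (q S x1) (q T x2)) x"
    if st: "disj S T" and x: "x \<in> spc H (S \<union> T)" for S T x
  proof -
    let ?r = "representative H J (S \<union> T) (q (S \<union> T) x)"
    have fin: "finite (S \<union> T)" using st by simp
    note r = representative[OF fin x]
    have "sweedler H S T (\<lambda>x1 x2. tensor fscale fscale (q S x1) (q T x2)) (?r - x) = 0"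
      using J[OF fin r(2)] st by (simp add: coideal_def)
    then show ?thesis
      using linear_on_diff[OF ambient subspace[OF fin] sweedler_linear[OF st vector_space_fscale qq_bilinear] r(1) x]
      by (simp add: quotient_def)
  qed
  show "cnt Q (q {} x) = cnt H x" if x: "x \<in> spc H {}" for x
  proof -
    let ?r = "representative H J {} (q {} x)"
    have fin: "finite {}" by simp
    note r = representative[OF fin x]
    show ?thesis
      using linear_on_diff[OF ambient subspace[OF fin] cnt_linear r(1) x] J0[OF r(2)] by (simp add: quotient_def)
  qed
  show "unt Q = q {} (unt H)" by (simp add: quotient_def)
qed (simp_all add: species_bimonoid_axioms scl_Q vector_space_fscale spc_Q linear_on_qclass act_Q mul_Q)

text \<open>The bilinear map \<open>?G\<close> multiplies two classes by the Sweedler factors of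
  \<open>g\<close>. The projected coproduct of the product \<open>f g\<close> is the lift of
  \<open>?G\<close> applied to the projected coproduct of \<open>f\<close>, which is 0.\<close>

lemma coideal_mul_left:
  assumes d: "disj I L" and f: "f \<in> spc H I" "coideal H J I f" and g: "g \<in> spc H L"
  shows "coideal H J (I \<union> L) (mul H I L f g)"
  unfolding coideal_def
proof (intro allI impI)
  fix S T :: "'b set" assume *: "disj S T \<and> S \<union> T = I \<union> L"
  then have st: "disj S T" "I \<union> L = S \<union> T" by auto
  have dp: "disj (I \<inter> S) (I \<inter> T)" "disj (L \<inter> S) (L \<inter> T)" "disj (I \<inter> S) (L \<inter> S)" "disj (I \<inter> T) (L \<inter> T)" using d st by auto
  have un: "I \<inter> S \<union> I \<inter> T = I" "L \<inter> S \<union> L \<inter> T = L" "I \<inter> S \<union> L \<inter> S = S" "I \<inter> T \<union> L \<inter> T = T" using st by auto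
  note vf = vector_space_fscale
  let ?G = "\<lambda>a b. sweedler H (L \<inter> S) (L \<inter> T) (\<lambda>g1 g2. tensor fscale fscale (mul Q (I \<inter> S) (L \<inter> S) a (q (L \<inter> S) g1)) (mul Q (I \<inter> T) (L \<inter> T) b (q (L \<inter> T) g2))) g"
  have G: "bilinear_on fscale fscale fscale (spc Q (I \<inter> S)) (spc Q (I \<inter> T)) ?G"
    using g un
    by (intro bilinear_onI' sweedler_linear_fun[OF dp(2) _ vf] bilinear_on_left[OF bilinear_on_tensor[where V = UNIV and W = UNIV], THEN [3] linear_on_comp]
       bilinear_on_right[OF bilinear_on_tensor[where V = UNIV and W = UNIV], THEN [3] linear_on_comp] Q_mul_linear dp) auto
  have "sweedler H S T (\<lambda>x1 x2. tensor fscale fscale (q S x1) (q T x2)) (mul H I L f g) =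
    sweedler H (I \<inter> S) (I \<inter> T) (\<lambda>f1 f2. sweedler H (L \<inter> S) (L \<inter> T) (\<lambda>g1 g2.
       tensor fscale fscale (q S (mul H (I \<inter> S) (L \<inter> S) f1 g1)) (q T (mul H (I \<inter> T) (L \<inter> T) f2 g2))) g) f"
    by (rule sweedler_mul[OF d st f(1) g vf qq_bilinear])
  also have "\<dots> = sweedler H (I \<inter> S) (I \<inter> T) (\<lambda>f1 f2. ?G (q (I \<inter> S) f1) (q (I \<inter> T) f2)) f"
    using f g mul_Q[OF dp(3)] mul_Q[OF dp(4)] unfolding un by (intro sweedler_cong dp) (auto simp: un)
  also have "\<dots> = tensor_lift fscale fscale (spc Q (I \<inter> S)) (spc Q (I \<inter> T)) ?G
      (sweedler H (I \<inter> S) (I \<inter> T) (\<lambda>f1 f2. tensor fscale fscale (q (I \<inter> S) f1) (q (I \<inter> T) f2)) f)"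
    by (rule lift_sweedler[OF dp(1) _ vf tens_Q[OF dp(1)] G, symmetric]) (use f un in \<open>auto simp: spc_Q\<close>)
  also have "\<dots> = tensor_lift fscale fscale (spc Q (I \<inter> S)) (spc Q (I \<inter> T)) ?G 0"
  proof -
    have "sweedler H (I \<inter> S) (I \<inter> T) (\<lambda>f1 f2. tensor fscale fscale (q (I \<inter> S) f1) (q (I \<inter> T) f2)) f = 0"
      using f(2) dp(1) un(1) unfolding coideal_def by blast
    then show ?thesis by simp
  qed
  also have "\<dots> = 0"
    by (rule tens.TL_0[OF tens_Q[OF dp(1)] vf G])
  finally show "sweedler H S T (\<lambda>x1 x2. tensor fscale fscale (q S x1) (q T x2)) (mul H I L f g) = 0" .
qed

text \<open>The mirror image of the previous argument, with one more step: the expansion now sums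
  over the factors of \<open>g\<close> first, and the two sums are exchanged to bring the coproduct
  of \<open>f\<close> to the outside.\<close>

lemma coideal_mul_right:
  assumes d: "disj L I" and f: "f \<in> spc H I" "coideal H J I f" and g: "g \<in> spc H L"
  shows "coideal H J (L \<union> I) (mul H L I g f)"
  unfolding coideal_def
proof (intro allI impI)
  fix S T :: "'b set" assume *: "disj S T \<and> S \<union> T = L \<union> I"
  then have st: "disj S T" "L \<union> I = S \<union> T" by auto
  have dp: "disj (I \<inter> S) (I \<inter> T)" "disj (L \<inter> S) (L \<inter> T)" "disj (L \<inter> S) (I \<inter> S)" "disj (L \<inter> T) (I \<inter> T)" using d st by auto
  have un: "I \<inter> S \<union> I \<inter> T = I" "L \<inter> S \<union> L \<inter> T = L" "L \<inter> S \<union> I \<inter> S = S" "L \<inter> T \<union> I \<inter> T = T" using st by auto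
  note vf = vector_space_fscale
  let ?G = "\<lambda>a b. sweedler H (L \<inter> S) (L \<inter> T) (\<lambda>g1 g2. tensor fscale fscale (mul Q (L \<inter> S) (I \<inter> S) (q (L \<inter> S) g1) a) (mul Q (L \<inter> T) (I \<inter> T) (q (L \<inter> T) g2) b)) g"
  have G: "bilinear_on fscale fscale fscale (spc Q (I \<inter> S)) (spc Q (I \<inter> T)) ?G"
    using g un
    by (intro bilinear_onI' sweedler_linear_fun[OF dp(2) _ vf] bilinear_on_left[OF bilinear_on_tensor[where V = UNIV and W = UNIV], THEN [3] linear_on_comp]
       bilinear_on_right[OF bilinear_on_tensor[where V = UNIV and W = UNIV], THEN [3] linear_on_comp] Q_mul_linear dp) auto
  have "sweedler H S T (\<lambda>x1 x2. tensor fscale fscale (q S x1) (q T x2)) (mul H L I g f) =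
    sweedler H (L \<inter> S) (L \<inter> T) (\<lambda>g1 g2. sweedler H (I \<inter> S) (I \<inter> T) (\<lambda>f1 f2.
       tensor fscale fscale (q S (mul H (L \<inter> S) (I \<inter> S) g1 f1)) (q T (mul H (L \<inter> T) (I \<inter> T) g2 f2))) f) g"
    by (rule sweedler_mul[OF d st g f(1) vf qq_bilinear])
  also have "\<dots> = sweedler H (L \<inter> S) (L \<inter> T) (\<lambda>g1 g2. sweedler H (I \<inter> S) (I \<inter> T) (\<lambda>f1 f2.
       tensor fscale fscale (mul Q (L \<inter> S) (I \<inter> S) (q (L \<inter> S) g1) (q (I \<inter> S) f1)) (mul Q (L \<inter> T) (I \<inter> T) (q (L \<inter> T) g2) (q (I \<inter> T) f2))) f) g"
    using f g mul_Q[OF dp(3)] mul_Q[OF dp(4)] unfolding un by (intro sweedler_cong dp) (auto simp: un)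
  also have "\<dots> = sweedler H (I \<inter> S) (I \<inter> T) (\<lambda>f1 f2. ?G (q (I \<inter> S) f1) (q (I \<inter> T) f2)) f"
    by (rule sweedler_swap)
  also have "\<dots> = tensor_lift fscale fscale (spc Q (I \<inter> S)) (spc Q (I \<inter> T)) ?G
      (sweedler H (I \<inter> S) (I \<inter> T) (\<lambda>f1 f2. tensor fscale fscale (q (I \<inter> S) f1) (q (I \<inter> T) f2)) f)"
    by (rule lift_sweedler[OF dp(1) _ vf tens_Q[OF dp(1)] G, symmetric]) (use f un in \<open>auto simp: spc_Q\<close>)
  also have "\<dots> = tensor_lift fscale fscale (spc Q (I \<inter> S)) (spc Q (I \<inter> T)) ?G 0"
  proof -
    have "sweedler H (I \<inter> S) (I \<inter> T) (\<lambda>f1 f2. tensor fscale fscale (q (I \<inter> S) f1) (q (I \<inter> T) f2)) f = 0"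
      using f(2) dp(1) un(1) unfolding coideal_def by blast
    then show ?thesis by simp
  qed
  also have "\<dots> = 0"
    by (rule tens.TL_0[OF tens_Q[OF dp(1)] vf G])
  finally show "sweedler H S T (\<lambda>x1 x2. tensor fscale fscale (q S x1) (q T x2)) (mul H L I g f) = 0" .
qed

lemma coideal_act:
  assumes I: "finite I" and \<sigma>: "inj_on \<sigma> I" and f: "f \<in> spc H I" "coideal H J I f"
  shows "coideal H J (\<sigma> ` I) (act H \<sigma> I f)"
  unfolding coideal_def
proof (intro allI impI)
  fix S' T' :: "'b set" assume *: "disj S' T' \<and> S' \<union> T' = \<sigma> ` I"
  \<comment> \<open>The given decomposition is one of the image of \<open>I\<close>. Pulled back
    along the bijection it decomposes \<open>I\<close>, where the hypothesis on \<open>f\<close>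
    applies.\<close>
  define S T where "S = I \<inter> \<sigma> -` S'" and "T = I \<inter> \<sigma> -` T'"
  have "S' \<subseteq> \<sigma> ` I" "T' \<subseteq> \<sigma> ` I" using * by blast+
  then have S': "S' = \<sigma> ` S" and T': "T' = \<sigma> ` T" by (auto simp: S_def T_def)
  have st: "disj S T" "S \<union> T = I" using * I by (auto simp: S_def T_def)
  have inj: "inj_on \<sigma> S" "inj_on \<sigma> T" using \<sigma> st by (auto intro: inj_on_subset)
  note vf = vector_space_fscale
  let ?G = "\<lambda>a b. tensor fscale fscale (act Q \<sigma> S a) (act Q \<sigma> T b)"
  have G: "bilinear_on fscale fscale fscale (spc Q S) (spc Q T) ?G"
    using st inj by (intro bilinear_on_comp[OF bilinear_on_tensor[where V = UNIV and W = UNIV] Q_act_linear Q_act_linear]) auto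
  have "sweedler H (\<sigma> ` S) (\<sigma> ` T) (\<lambda>x1 x2. tensor fscale fscale (q (\<sigma> ` S) x1) (q (\<sigma> ` T) x2)) (act H \<sigma> (S \<union> T) f) =
    sweedler H S T (\<lambda>x1 x2. tensor fscale fscale (q (\<sigma> ` S) (act H \<sigma> S x1)) (q (\<sigma> ` T) (act H \<sigma> T x2))) f"
    by (rule sweedler_natural[OF st(1) _ _ vf qq_bilinear]) (use f \<sigma> st in auto)
  also have "\<dots> = sweedler H S T (\<lambda>x1 x2. ?G (q S x1) (q T x2)) f"
    using st f inj by (intro sweedler_cong) (auto simp: act_Q)
  also have "\<dots> = tensor_lift fscale fscale (spc Q S) (spc Q T) ?G (sweedler H S T (\<lambda>x1 x2. tensor fscale fscale (q S x1) (q T x2)) f)"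
    by (rule lift_sweedler[OF st(1) _ vf tens_Q[OF st(1)] G, symmetric]) (use f st in \<open>auto simp: spc_Q\<close>)
  also have "\<dots> = tensor_lift fscale fscale (spc Q S) (spc Q T) ?G 0"
  proof -
    have "sweedler H S T (\<lambda>x1 x2. tensor fscale fscale (q S x1) (q T x2)) f = 0"
      using f(2) st unfolding coideal_def by blast
    then show ?thesis by simp
  qed
  also have "\<dots> = 0"
    by (rule tens.TL_0[OF tens_Q[OF st(1)] vf G])
  finally show "sweedler H S' T' (\<lambda>x1 x2. tensor fscale fscale (q S' x1) (q T' x2)) (act H \<sigma> I f) = 0"
    by (simp add: S' T' st(2))
qed

text \<open>With \<open>J\<close> itself the ideal generated by some set, this reduces the coideal
  property of all of \<open>J\<close> to that of the generators.\<close>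

lemma monoid_ideal_coideal: "monoid_ideal H (\<lambda>I. {x\<in>spc H I. coideal H J I x})"
proof (rule monoid_idealI[OF species_monoid_axioms])
  fix I :: "'b set" assume I: "finite I"
  have lin: "linear_on (scl H) fscale (spc H I) (sweedler H S T (\<lambda>x1 x2. tensor fscale fscale (q S x1) (q T x2)))"
    if "disj S T" "S \<union> T = I" for S T
    using sweedler_linear[OF that(1) vector_space_fscale qq_bilinear] that(2) by simp
  show "amb.subspace {x \<in> spc H I. coideal H J I x}"
    unfolding amb.subspace_def coideal_def using I
    by (auto simp: spc_0 spc_add spc_scl linear_on_zero[OF lin] linear_on_add[OF lin] linear_on_scl[OF lin] fscale_0)
qed (auto simp: act_closed mul_closed coideal_act coideal_mul_left coideal_mul_right)

end

section \<open>Morphisms out of a Cauchy product\<close>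

text \<open>The exchange of the two middle factors of a fourfold product. Commutation is asked of
  the pair \<open>c\<close>, \<open>y\<close> alone, so that it applies in a noncommutative
  target.\<close>

lemma (in species_monoid) mul_interchange:
  assumes d: "disj U V" "disj U W" "disj U Z" "disj V W" "disj V Z" "disj W Z"
    and x: "x \<in> spc H U" "c \<in> spc H V" "y \<in> spc H W" "e \<in> spc H Z"
    and comm: "mul H V W c y = mul H W V y c"
  shows "mul H (U \<union> V) (W \<union> Z) (mul H U V x c) (mul H W Z y e) = mul H (U \<union> W) (V \<union> Z) (mul H U W x y) (mul H V Z c e)"
proof -
  have d': "disj U (W \<union> Z)" "disj V (W \<union> Z)" "disj U (V \<union> Z)" "disj W (V \<union> Z)" "disj W V" using d by auto
  have "mul H (U \<union> V) (W \<union> Z) (mul H U V x c) (mul H W Z y e) = mul H U (V \<union> (W \<union> Z)) x (mul H V (W \<union> Z) c (mul H W Z y e))"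
    by (rule mul_assoc[OF d(1) d'(1,2) x(1,2) mul_closed[OF d(6) x(3,4)]])
  also have "mul H V (W \<union> Z) c (mul H W Z y e) = mul H (V \<union> W) Z (mul H V W c y) e"
    by (rule mul_assoc[OF d(4-6) x(2-4), symmetric])
  also have "\<dots> = mul H (W \<union> V) Z (mul H W V y c) e" by (simp add: comm Un_commute)
  also have "\<dots> = mul H W (V \<union> Z) y (mul H V Z c e)"
    by (rule mul_assoc[OF d'(5) d(6,5) x(3,2,4)])
  also have "mul H U (V \<union> (W \<union> Z)) x (mul H W (V \<union> Z) y (mul H V Z c e)) = mul H (U \<union> W) (V \<union> Z) (mul H U W x y) (mul H V Z c e)"
    using mul_assoc[OF d(2) d'(3,4) x(1,3) mul_closed[OF d(5) x(2,4)]] by (simp add: Un_left_commute)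
  finally show ?thesis .
qed

lemma (in species) act_empty: "x \<in> spc P {} \<Longrightarrow> act P \<sigma> {} x = x"
  using act_cong[of "{}" \<sigma> id x] act_id[of "{}" x] by simp

text \<open>Two morphisms with commuting images extend to
  \<open>x \<otimes> y \<mapsto> f(x) g(y)\<close> on the Cauchy product. It has three uses below:
  the inclusions between the products at different levels, the extension of \<open>\<pi>\<close>
  linearly over the right factor, and \<open>\<Phi>\<close>.\<close>

locale monoid_pairing = bimonoid_pair H K + f: monoid_hom H R f + g: monoid_hom K R g
  for H :: "('k::field, 'l, 'v::ab_group_add) hopf_data" and K :: "('k, 'l, 'w::ab_group_add) hopf_data"
    and R :: "('k, 'l, 'r::ab_group_add) hopf_data" and f g +
  assumes commute: "disj S T \<Longrightarrow> x \<in> spc H S \<Longrightarrow> y \<in> spc K T \<Longrightarrow> mul R S T (f S x) (g T y) = mul R T S (g T y) (f S x)"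
begin

definition pair :: "'l set \<Rightarrow> ('l set \<Rightarrow> ('k, 'v, 'w) tensor) \<Rightarrow> 'r" where
  "pair I F = (\<Sum>U\<in>Pow I. lift2 H K U (I - U) (\<lambda>x y. mul R U (I - U) (f U x) (g (I - U) y)) (F U))"

lemma disj_compl: "finite I \<Longrightarrow> U \<subseteq> I \<Longrightarrow> disj U (I - U)"
  by (auto intro: finite_subset)

lemma pair_bilinear:
  assumes "finite I" "U \<subseteq> I"
  shows "bilinear_on (scl H) (scl K) (scl R) (spc H U) (spc K (I - U)) (\<lambda>x y. mul R U (I - U) (f U x) (g (I - U) y))"
  using disj_compl[OF assms]
  by (intro bilinear_on_comp[OF f.K.mul_bilinear f.linear g.linear] f.closed g.closed) auto

lemma pair_linear: "finite I \<Longrightarrow> linear_on cs (scl R) (spc A I) (pair I)"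
  unfolding pair_def
  by (intro linear_on_setsum f.K.ambient linear_on_component_lift pair_bilinear) auto

lemma pair_pure:
  assumes I: "finite I" and U: "U \<subseteq> I" and xy: "x \<in> spc H U" "y \<in> spc K (I - U)"
  shows "pair I (pure U x y) = mul R U (I - U) (f U x) (g (I - U) y)"
proof -
  have "pair I (pure U x y) = (\<Sum>V\<in>Pow I. if V = U then mul R U (I - U) (f U x) (g (I - U) y) else 0)"
    unfolding pair_def
  proof (rule sum.cong[OF refl])
    fix V assume "V \<in> Pow I"
    then have V: "V \<subseteq> I" by simp
    show "lift2 H K V (I - V) (\<lambda>x y. mul R V (I - V) (f V x) (g (I - V) y)) (pure U x y V) = (if V = U then mul R U (I - U) (f U x) (g (I - U) y) else 0)"
      using lift_pure[OF I U V f.K.ambient pair_bilinear[OF I V] xy] by auto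
  qed
  then show ?thesis using I U by simp
qed

lemma pair_closed:
  assumes I: "finite I" and F: "F \<in> spc A I"
  shows "pair I F \<in> spc R I"
proof (rule A_closedI[OF I pair_linear[OF I] f.K.ambient f.K.subspace[OF I] _ F])
  fix U x y assume 1: "U \<subseteq> I" "x \<in> spc H U" "y \<in> spc K (I - U)"
  have "U \<union> (I - U) = I" using 1 by auto
  then show "pair I (pure U x y) \<in> spc R I"
    unfolding pair_pure[OF I 1] using f.K.mul_closed[OF disj_compl[OF I 1(1)] f.closed g.closed] 1 disj_compl[OF I 1(1)] by auto
qed

lemma pair_hom: "monoid_hom A R pair"
proof (intro monoid_hom.intro monoid_hom_axioms.intro A_species_monoid f.K.species_monoid_axioms; (unfold scl_A)?)
  fix I :: "'l set" assume I: "finite I"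
  show "linear_on cs (scl R) (spc A I) (pair I)" by (rule pair_linear[OF I])
  show "pair I F \<in> spc R I" if "F \<in> spc A I" for F by (rule pair_closed[OF I that])
  fix \<sigma> :: "'l \<Rightarrow> 'l" and F assume \<sigma>: "inj_on \<sigma> I" and F: "F \<in> spc A I"
  show "pair (\<sigma> ` I) (act A \<sigma> I F) = act R \<sigma> I (pair I F)"
  proof (rule A_eqI[OF I linear_on_comp[OF A_act_linear[OF I \<sigma>] A_act_closed[OF I \<sigma>] pair_linear] linear_on_comp[OF pair_linear[OF I] pair_closed[OF I] f.K.act_linear[OF I \<sigma>]] _ F])
    fix U x y assume 1: "U \<subseteq> I" "x \<in> spc H U" "y \<in> spc K (I - U)"
    note d = disj_compl[OF I 1(1)]
    have e: "\<sigma> ` I - \<sigma> ` U = \<sigma> ` (I - U)" "U \<union> (I - U) = I" using 1(1) \<sigma> by (auto simp: inj_on_image_set_diff[of \<sigma> I])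
    have i: "inj_on \<sigma> U" "inj_on \<sigma> (I - U)" using \<sigma> 1(1) by (auto intro: inj_on_subset)
    have c: "act H \<sigma> U x \<in> spc H (\<sigma> ` U)" "act K \<sigma> (I - U) y \<in> spc K (\<sigma> ` I - \<sigma> ` U)"
      unfolding e using d 1 i by (auto intro: H.act_closed K.act_closed)
    show "pair (\<sigma> ` I) (act A \<sigma> I (pure U x y)) = act R \<sigma> I (pair I (pure U x y))"
      unfolding act_pure[OF I \<sigma> 1] pair_pure[OF I 1] pair_pure[OF finite_imageI[OF I] image_mono[OF 1(1)] c] e
      using f.K.mul_natural[OF d, of \<sigma> "f U x" "g (I - U) y"] d \<sigma> e i 1
      by (simp add: f.natural g.natural f.closed g.closed)
  qed (use I in auto)
next
  show "pair {} (unt A) = unt R"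
    unfolding unt_A using pair_pure[of "{}" "{}" "unt H" "unt K"] f.K.mul_unt_left[of "{}" "unt R"]
    by (simp add: H.unt_closed K.unt_closed f.unt g.unt f.K.unt_closed)
next
  fix I J :: "'l set" and F G assume d: "disj I J" and F: "F \<in> spc A I" and G: "G \<in> spc A J"
  have fin: "finite I" "finite J" "finite (I \<union> J)" using d by auto
  show "pair (I \<union> J) (mul A I J F G) = mul R I J (pair I F) (pair J G)"
  proof (rule A_eqI2[where F = "\<lambda>F G. pair (I \<union> J) (mul A I J F G)" and G = "\<lambda>F G. mul R I J (pair I F) (pair J G)", OF fin(1,2) _ _ _ F G])
    show "bilinear_on cs cs (scl R) (spc A I) (spc A J) (\<lambda>F G. pair (I \<union> J) (mul A I J F G))"
      by (rule bilinear_on_comp_out[OF A_mul_bilinear[OF d] A_mul_closed[OF d] pair_linear[OF fin(3)]])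
    show "bilinear_on cs cs (scl R) (spc A I) (spc A J) (\<lambda>F G. mul R I J (pair I F) (pair J G))"
      using fin by (intro bilinear_on_comp[OF f.K.mul_bilinear[OF d]] pair_linear pair_closed)
    fix U x y V x' y'
    assume 1: "U \<subseteq> I" "x \<in> spc H U" "y \<in> spc K (I - U)" and 2: "V \<subseteq> J" "x' \<in> spc H V" "y' \<in> spc K (J - V)"
    note m = mul_parts_closed[OF d 1(1) 2(1) 1(2,3) 2(2,3)]
    have dd: "disj U V" "disj (I - U) (J - V)" by (rule disj_parts[OF d 1(1) 2(1)])+
    have d2: "disj U (I - U)" "disj V (J - V)" using disj_compl fin 1 2 by blast+
    have d3: "disj U (J - V)" "disj V (I - U)" using d 1(1) 2(1) dd by auto
    have e: "U \<union> (I - U) = I" "V \<union> (J - V) = J" using 1 2 by auto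
    have c: "f U x \<in> spc R U" "f V x' \<in> spc R V" "g (I - U) y \<in> spc R (I - U)" "g (J - V) y' \<in> spc R (J - V)"
      using 1 2 dd by (auto intro: f.closed g.closed)
    have "pair (I \<union> J) (mul A I J (pure U x y) (pure V x' y')) =
      mul R (U \<union> V) ((I - U) \<union> (J - V)) (mul R U V (f U x) (f V x')) (mul R (I - U) (J - V) (g (I - U) y) (g (J - V) y'))"
      unfolding mul_pure[OF d 1(1) 2(1) 1(2,3) 2(2,3)] pair_pure[OF fin(3) Un_mono[OF 1(1) 2(1)] m] Diff_Un_disj[OF d 1(1) 2(1)]
        f.mul[OF dd(1) 1(2) 2(2)] g.mul[OF dd(2) 1(3) 2(3)] ..
    also have "\<dots> = mul R I J (mul R U (I - U) (f U x) (g (I - U) y)) (mul R V (J - V) (f V x') (g (J - V) y'))"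
      using f.K.mul_interchange[OF dd(1) d2(1) d3 d2(2) dd(2) c commute[OF d3(2) 2(2) 1(3)]] unfolding e .
    also have "\<dots> = mul R I J (pair I (pure U x y)) (pair J (pure V x' y'))"
      unfolding pair_pure[OF fin(1) 1] pair_pure[OF fin(2) 2] ..
    finally show "pair (I \<union> J) (mul A I J (pure U x y) (pure V x' y')) = mul R I J (pair I (pure U x y)) (pair J (pure V x' y'))" .
  qed
qed

end

locale bimonoid_pairing = monoid_pairing H K R f g + f: bimonoid_hom H R f + g: bimonoid_hom K R g for H K R f g
begin

text \<open>The bimonoid axiom in \<open>R\<close> for the product \<open>f(x) g(y)\<close>, cutting
  \<open>U\<close> and its complement by \<open>S\<close> and \<open>T\<close>, yields the same four
  degrees as the coproduct of the pure tensor. The morphism property of \<open>f\<close> and of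
  \<open>g\<close> then matches the terms.\<close>

lemma pair_bimonoid_hom: "bimonoid_hom A R pair"
proof -
  interpret p: monoid_hom A R pair by (rule pair_hom)
  interpret A: species_bimonoid A by (rule A_bimonoid)
  note vf = vector_space_fscale
  show ?thesis
  proof (intro bimonoid_hom.intro bimonoid_hom_axioms.intro pair_hom A_bimonoid f.K.species_bimonoid_axioms)
    fix S T :: "'b set" and F assume st: "disj S T" and F: "F \<in> spc A (S \<union> T)"
    have fin: "finite S" "finite T" "finite (S \<union> T)" using st by auto
    have b: "bilinear_on cs cs fscale (spc A S) (spc A T) (\<lambda>x1 x2. tensor (scl R) (scl R) (pair S x1) (pair T x2))"
      using fin by (intro bilinear_on_comp[OF bilinear_on_tensor[where V = UNIV and W = UNIV]] pair_linear) auto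
    show "cop R S T (pair (S \<union> T) F) = sweedler A S T (\<lambda>x1 x2. tensor (scl R) (scl R) (pair S x1) (pair T x2)) F"
    proof (rule A_eqI[OF fin(3) linear_on_comp[OF pair_linear[OF fin(3)] p.closed[OF fin(3)] f.K.cop_linear[OF st]] A_sweedler_linear[OF st vf b] _ F])
      fix U x y assume 1: "U \<subseteq> S \<union> T" "x \<in> spc H U" "y \<in> spc K (S \<union> T - U)"
      note dU = disj_compl[OF fin(3) 1(1)]
      note p = parts[OF st 1(1)]
      have xy: "x \<in> spc H (U \<inter> S \<union> U \<inter> T)" "y \<in> spc K ((S - U) \<union> (T - U))" unfolding p by (rule 1)+
      have e: "U \<union> (S \<union> T - U) = S \<union> T" "(S \<union> T - U) \<inter> S = S - U" "(S \<union> T - U) \<inter> T = T - U" using 1(1) by auto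
      have dp: "disj (U \<inter> S) (S - U)" "disj (U \<inter> T) (T - U)" using fin by auto
      have e2: "U \<inter> S \<union> (S - U) = S" "U \<inter> T \<union> (T - U) = T" by auto
      have e3: "S - U \<inter> S = S - U" "T - U \<inter> T = T - U" by auto
      let ?T = "\<lambda>a1 a2 b1 b2. tensor (scl R) (scl R) (mul R (U \<inter> S) (S - U) a1 b1) (mul R (U \<inter> T) (T - U) a2 b2)"
      have q: "bilinear_on (scl R) (scl R) fscale (spc R (S - U)) (spc R (T - U)) (?T a1 a2)"
        if "a1 \<in> spc R (U \<inter> S)" "a2 \<in> spc R (U \<inter> T)" for a1 a2
        by (rule bilinear_on_comp[OF bilinear_on_tensor[where V = UNIV and W = UNIV] f.K.mul_linear_right[OF dp(1) that(1)] f.K.mul_linear_right[OF dp(2) that(2)]]) auto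
      have q': "bilinear_on (scl R) (scl R) fscale (spc R (U \<inter> S)) (spc R (U \<inter> T)) (\<lambda>a1 a2. ?T a1 a2 b1 b2)"
        if "b1 \<in> spc R (S - U)" "b2 \<in> spc R (T - U)" for b1 b2
        by (rule bilinear_on_comp[OF bilinear_on_tensor[where V = UNIV and W = UNIV] f.K.mul_linear_left[OF dp(1) that(1)] f.K.mul_linear_left[OF dp(2) that(2)]]) auto
      have gy: "g (S \<union> T - U) y \<in> spc R (S - U \<union> (T - U))" using 1 fin g.closed unfolding p by auto
      have q2: "bilinear_on (scl R) (scl R) fscale (spc R (U \<inter> S)) (spc R (U \<inter> T)) (\<lambda>a1 a2. sweedler R (S - U) (T - U) (?T a1 a2) (g (S \<union> T - U) y))"
        by (intro bilinear_onI' f.K.sweedler_linear_fun[OF p(2) gy vf] bilinear_on_left[OF q'] bilinear_on_right[OF q'])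
      have "cop R S T (pair (S \<union> T) (pure U x y)) =
        sweedler R (U \<inter> S) (U \<inter> T) (\<lambda>a1 a2. sweedler R (S - U) (T - U) (?T a1 a2) (g (S \<union> T - U) y)) (f U x)"
        unfolding pair_pure[OF fin(3) 1] using f.K.cop_mul[OF dU st e(1) f.closed g.closed] 1 dU unfolding e by simp
      also have "\<dots> = sweedler H (U \<inter> S) (U \<inter> T) (\<lambda>x1 x2. sweedler R (S - U) (T - U) (?T (f (U \<inter> S) x1) (f (U \<inter> T) x2)) (g (S \<union> T - U) y)) x"
        using f.sweedler[OF p(1) xy(1) vf q2] unfolding p .
      also have "\<dots> = sw2 (U \<inter> S) (U \<inter> T) (S - U) (T - U) (\<lambda>x1 x2 y1 y2. ?T (f (U \<inter> S) x1) (f (U \<inter> T) x2) (g (S - U) y1) (g (T - U) y2)) x y"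
        unfolding sw2_def
      proof (rule H.sweedler_cong[OF p(1) xy(1)])
        fix x1 x2 assume h: "x1 \<in> spc H (U \<inter> S)" "x2 \<in> spc H (U \<inter> T)"
        show "sweedler R (S - U) (T - U) (?T (f (U \<inter> S) x1) (f (U \<inter> T) x2)) (g (S \<union> T - U) y) =
          sweedler K (S - U) (T - U) (\<lambda>y1 y2. ?T (f (U \<inter> S) x1) (f (U \<inter> T) x2) (g (S - U) y1) (g (T - U) y2)) y"
          using g.sweedler[OF p(2) xy(2) vf q[OF f.closed[OF _ h(1)] f.closed[OF _ h(2)]]] fin unfolding p by auto
      qed
      also have "\<dots> = sw2 (U \<inter> S) (U \<inter> T) (S - U) (T - U) (\<lambda>x1 x2 y1 y2. tensor (scl R) (scl R) (pair S (pure (U \<inter> S) x1 y1)) (pair T (pure (U \<inter> T) x2 y2))) x y"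
        using pair_pure[OF fin(1) Int_lower2[of U], unfolded e3] pair_pure[OF fin(2) Int_lower2[of U], unfolded e3]
        by (intro sw2_cong[OF p(1,2) xy]) simp
      also have "\<dots> = sweedler A S T (\<lambda>x1 x2. tensor (scl R) (scl R) (pair S x1) (pair T x2)) (pure U x y)"
        by (rule sweedler_pure[OF st 1 vf b, symmetric])
      finally show "cop R S T (pair (S \<union> T) (pure U x y)) = sweedler A S T (\<lambda>x1 x2. tensor (scl R) (scl R) (pair S x1) (pair T x2)) (pure U x y)" .
    qed
  next
    fix F assume F: "F \<in> spc A {}"
    show "cnt R (pair {} F) = cnt A F"
    proof (rule A_eqI[of "{}", OF _ _ A_cnt_linear _ F])
      have fe: "finite {}" by simp
      show "linear_on cs (*) (spc A {}) (\<lambda>F. cnt R (pair {} F))"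
        by (rule linear_on_comp[OF pair_linear[OF fe] p.closed[OF fe] f.K.cnt_linear])
      fix U x y assume 1: "U \<subseteq> {}" "x \<in> spc H U" "y \<in> spc K ({} - U)"
      then have [simp]: "U = {}" by auto
      show "cnt R (pair {} (pure U x y)) = cnt A (pure U x y)"
        using 1 pair_pure[of "{}" "{}" x y] by (simp add: f.K.cnt_mul f.closed g.closed f.cnt g.cnt cnt_pure)
    qed simp
  qed
qed

end

section \<open>The two factors as subobjects of the Cauchy product\<close>

context bimonoid_pair
begin

abbreviation "left I x \<equiv> pure I x (unt K)"
abbreviation "right I y \<equiv> pure {} (unt H) y"

lemma left_closed: "finite I \<Longrightarrow> x \<in> spc H I \<Longrightarrow> left I x \<in> spc A I"
  and right_closed: "finite I \<Longrightarrow> y \<in> spc K I \<Longrightarrow> right I y \<in> spc A I"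
  by (simp_all add: pure_closed K.unt_closed H.unt_closed)

lemma left_right:
  assumes "disj S T" "x \<in> spc H S" "y \<in> spc K T"
  shows "mul A S T (left S x) (right T y) = pure S x y" "mul A T S (right T y) (left S x) = pure S x y"
proof -
  have d: "disj T S" using assms by auto
  show "mul A S T (left S x) (right T y) = pure S x y"
    using mul_pure[OF assms(1), of S "{}" x "unt K" "unt H" y] assms
    by (simp add: H.unt_closed K.unt_closed H.mul_unt_right K.mul_unt_left)
  show "mul A T S (right T y) (left S x) = pure S x y"
    using mul_pure[OF d, of "{}" S "unt H" y x "unt K"] assms
    by (simp add: H.unt_closed K.unt_closed H.mul_unt_left K.mul_unt_right)
qed

text \<open>The two embedded factors generate the product, which is how relations between single
  left and right factors propagate to all pure tensors.\<close>

lemma pure_split: "finite I \<Longrightarrow> U \<subseteq> I \<Longrightarrow> x \<in> spc H U \<Longrightarrow> y \<in> spc K (I - U) \<Longrightarrow>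
    pure U x y = mul A U (I - U) (left U x) (right (I - U) y)"
  using left_right(1)[of U "I - U" x y] finite_subset[of U I] by auto

lemma left_hom: "bimonoid_hom H A left"
proof -
  interpret A: species_bimonoid A by (rule A_bimonoid)
  show ?thesis
  proof
    show "linear_on (scl H) (scl A) (spc H I) (left I)" for I unfolding scl_A by (rule pure_linear)
    show "left I x \<in> spc A I" if "finite I" "x \<in> spc H I" for I x using that by (rule left_closed)
    show "left (\<sigma> ` I) (act H \<sigma> I x) = act A \<sigma> I (left I x)" if "finite I" "inj_on \<sigma> I" "x \<in> spc H I" for I \<sigma> x
      using that act_pure[of I \<sigma> I x "unt K"] by (simp add: K.unt_closed K.act_empty)
    show "left (S \<union> T) (mul H S T x y) = mul A S T (left S x) (left T y)" if "disj S T" "x \<in> spc H S" "y \<in> spc H T" for S T x y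
      using that mul_pure[of S T S T x "unt K" y "unt K"] by (simp add: K.unt_closed K.mul_unt_left)
    show "left {} (unt H) = unt A" by (simp add: unt_A)
    show "cnt A (left {} x) = cnt H x" if "x \<in> spc H {}" for x
      using that by (simp add: cnt_pure K.unt_closed K.cnt_unt)
    fix S T x assume st: "disj S T" and x: "x \<in> spc H (S \<union> T)"
    have st': "S - (S \<union> T) = {}" "T - (S \<union> T) = {}" "(S \<union> T) \<inter> S = S" "(S \<union> T) \<inter> T = T" by auto
    have q: "quad_on fscale S T {} {} (\<lambda>x1 x2 y1 y2. tensor cs cs (pure S x1 y1) (pure T x2 y2))"
      using quad_pure[OF st bilinear_on_tensor, of "S \<union> T"] unfolding st' .
    have "cop A S T (left (S \<union> T) x) = sw2 S T {} {} (\<lambda>x1 x2 y1 y2. tensor cs cs (pure S x1 y1) (pure T x2 y2)) x (unt K)"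
      using cop_pure[OF st, of "S \<union> T" x "unt K"] x st by (simp add: K.unt_closed st')
    also have "\<dots> = sweedler H S T (\<lambda>x1 x2. tensor (scl A) (scl A) (left S x1) (left T x2)) x"
      unfolding sw2_def scl_A using quad_onD(2)[OF q]
      by (intro H.sweedler_cong[OF st x] K.sweedler_unt[OF vector_space_fscale])
    finally show "cop A S T (left (S \<union> T) x) = sweedler H S T (\<lambda>x1 x2. tensor (scl A) (scl A) (left S x1) (left T x2)) x" .
  qed
qed

lemma right_hom: "bimonoid_hom K A right"
proof -
  interpret A: species_bimonoid A by (rule A_bimonoid)
  show ?thesis
  proof
    show "linear_on (scl K) (scl A) (spc K I) (right I)" for I unfolding scl_A by (rule pure_linear)
    show "right I x \<in> spc A I" if "finite I" "x \<in> spc K I" for I x using that by (rule right_closed)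
    show "right (\<sigma> ` I) (act K \<sigma> I y) = act A \<sigma> I (right I y)" if "finite I" "inj_on \<sigma> I" "y \<in> spc K I" for I \<sigma> y
      using that act_pure[of I \<sigma> "{}" "unt H" y] by (simp add: H.unt_closed H.act_empty)
    show "right (S \<union> T) (mul K S T x y) = mul A S T (right S x) (right T y)" if "disj S T" "x \<in> spc K S" "y \<in> spc K T" for S T x y
      using that mul_pure[of S T "{}" "{}" "unt H" x "unt H" y] by (simp add: H.unt_closed H.mul_unt_left)
    show "right {} (unt K) = unt A" by (simp add: unt_A)
    show "cnt A (right {} y) = cnt K y" if "y \<in> spc K {}" for y
      using that by (simp add: cnt_pure H.unt_closed H.cnt_unt)
    fix S T y assume st: "disj S T" and y: "y \<in> spc K (S \<union> T)"
    have q: "quad_on fscale {} {} S T (\<lambda>x1 x2 y1 y2. tensor cs cs (pure {} x1 y1) (pure {} x2 y2))"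
      using quad_pure[OF st bilinear_on_tensor, of "{}"] by simp
    have "cop A S T (right (S \<union> T) y) = sw2 {} {} S T (\<lambda>x1 x2 y1 y2. tensor cs cs (pure {} x1 y1) (pure {} x2 y2)) (unt H) y"
      using cop_pure[OF st, of "{}" "unt H" y] y st by (simp add: H.unt_closed)
    also have "\<dots> = sweedler K S T (\<lambda>x1 x2. tensor (scl A) (scl A) (right S x1) (right T x2)) y"
      unfolding sw2_def scl_A
      by (rule H.sweedler_unt[OF vector_space_fscale sweedler_K_bilinear[OF st vector_space_fscale q y]])
    finally show "cop A S T (right (S \<union> T) y) = sweedler K S T (\<lambda>x1 x2. tensor (scl A) (scl A) (right S x1) (right T x2)) y" .
  qed
qed

end

lemma sub_inclusion_hom:
  assumes "species_bimonoid d" "species_bimonoid (d\<lparr>spc := D\<rparr>)" "\<And>I. finite I \<Longrightarrow> D I \<subseteq> spc d I"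
  shows "bimonoid_hom (d\<lparr>spc := D\<rparr>) d (\<lambda>I x. x)"
proof -
  interpret d: species_bimonoid d by fact
  interpret e: species_bimonoid "d\<lparr>spc := D\<rparr>" by fact
  show ?thesis
  proof
    show "cop d S T x = sweedler (d\<lparr>spc := D\<rparr>) S T (\<lambda>x1 x2. tensor (scl d) (scl d) x1 x2) x"
      if "disj S T" "x \<in> spc (d\<lparr>spc := D\<rparr>) (S \<union> T)" for S T x
      using e.sweedler_tensor[OF that] by simp
  qed (use assms(3) in \<open>auto simp: linear_on_def\<close>)
qed

text \<open>For an element of a subcomonoid the Sweedler factors may be taken in the subcomonoid,
  even when the sum is formed in \<open>H\<close>. This is where the choice of representation behind
  \<open>sweedler\<close> is seen to be immaterial.\<close>

lemma sweedler_sub: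
  assumes H: "species_comonoid H" and Q: "species_comonoid (H\<lparr>spc := Q\<rparr>)" "\<And>I. finite I \<Longrightarrow> Q I \<subseteq> spc H I"
    and st: "disj S T" and x: "x \<in> Q (S \<union> T)" and s: "vector_space s" and F: "bilinear_on (scl H) (scl H) s (spc H S) (spc H T) F"
  shows "sweedler H S T F x = sweedler (H\<lparr>spc := Q\<rparr>) S T F x"
proof -
  interpret H: species_comonoid H by fact
  interpret Q: species_comonoid "H\<lparr>spc := Q\<rparr>" by fact
  have "tensor_lift (scl H) (scl H) (spc H S) (spc H T) F (cop H S T x) = tensor_lift (scl H) (scl H) (Q S) (Q T) F (cop H S T x)"
    using Q.tens[OF st] Q.cop_closed[OF st, of x] x st Q(2)
    by (intro tensor_lift_mono[OF _ H.tens[OF st] _ _ _ s F]) auto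
  then show ?thesis by (simp add: sweedler_def)
qed

section \<open>One step of the interpolating family\<close>

lemma plus_fun_zero: "f x = 0 \<Longrightarrow> g x = 0 \<Longrightarrow> (f + g) x = (0 :: 'a::monoid_add)"
  by (simp add: plus_fun_apply)

text \<open>The condition \<open>F I = 0\<close> says that all left factors in \<open>F\<close> have
  degree strictly inside \<open>I\<close>. Multiplication by a right factor does not change the left
  degrees.\<close>

lemma (in bimonoid_pair) lower_mul:
  assumes d: "disj I T" and F: "F \<in> spc A I" "F I = 0" and y: "y \<in> spc K T" and W: "\<not> W \<subset> I"
  shows "mul A I T F (right T y) W = 0"
proof -
  have fin: "finite I" "finite T" using d by auto
  note lin = A_mul_linear_left[OF d right_closed[OF fin(2) y]]
  show ?thesis
    using fin(1) F(1)
  proof (induction rule: A_induct_supp[where X = "- {I}"])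
    case zero
    show ?case unfolding linear_on_zero[OF lin cs.subspace_0[OF subspace_A[OF fin(1)]]] by (rule zero_fun_apply)
  next
    case (add f g)
    then show ?case unfolding linear_on_add[OF lin add(1,2)] by (intro plus_fun_zero) auto
  next
    case (pure U x y')
    then have "mul A I T (pure U x y') (right T y) = pure U x (mul K (I - U) T y' y)"
      using mul_pure[OF d, of U "{}" x y' "unt H" y] y finite_subset[OF pure(2) fin(1)]
      by (simp add: H.unt_closed H.mul_unt_right)
    moreover have "W \<noteq> U" using W pure by blast
    ultimately show ?case by (simp add: pure_def summand_other)
  qed (use F(2) in auto)
qed

lemma (in bimonoid_pair) lower_subspace:
  assumes "finite I" shows "module.subspace cs {F\<in>spc A I. F W = 0}"
  unfolding cs.subspace_def using subspace_A[OF assms]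
  by (auto simp: cs.subspace_0 cs.subspace_add cs.subspace_scale plus_fun_apply zero_fun_apply fscale_0)

text \<open>Multiplication by a left factor of degree \<open>T\<close> adds \<open>T\<close> to
  every left degree, so terms below \<open>I\<close> become terms below \<open>I \<union> T\<close>.
  Thus lower terms stay lower under multiplication on either side by elements of
  \<open>b\<close>.\<close>

lemma (in bimonoid_pair) lower_left:
  assumes d: "disj I T" and F: "F \<in> spc A I" "F I = 0" and y: "y \<in> spc H T"
  shows "mul A I T F (left T y) (I \<union> T) = 0" "mul A T I (left T y) F (T \<union> I) = 0"
proof -
  have fin: "finite I" "finite T" and d': "disj T I" using d by auto
  note lin = A_mul_linear_left[OF d left_closed[OF fin(2) y]] A_mul_linear_right[OF d' left_closed[OF fin(2) y]]
  note z = cs.subspace_0[OF subspace_A[OF fin(1)]]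
  have "mul A I T F (left T y) (I \<union> T) = 0 \<and> mul A T I (left T y) F (T \<union> I) = 0"
    using fin(1) F(1)
  proof (induction rule: A_induct_supp[where X = "- {I}"])
    case zero
    show ?case unfolding linear_on_zero[OF lin(1) z] linear_on_zero[OF lin(2) z] by (intro conjI zero_fun_apply)
  next
    case (add f g)
    then show ?case unfolding linear_on_add[OF lin(1) add(1,2)] linear_on_add[OF lin(2) add(1,2)] by (intro conjI plus_fun_zero) auto
  next
    case (pure U x y')
    have "mul A I T (pure U x y') (left T y) = pure (U \<union> T) (mul H U T x y) (mul K (I - U) {} y' (unt K))"
      using mul_pure[OF d, of U T x y' y "unt K"] y pure by (simp add: K.unt_closed)
    moreover have "mul A T I (left T y) (pure U x y') = pure (T \<union> U) (mul H T U y x) (mul K {} (I - U) (unt K) y')"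
      using mul_pure[OF d', of T U y "unt K" x y'] y pure by (simp add: K.unt_closed)
    moreover have "I \<union> T \<noteq> U \<union> T" "T \<union> I \<noteq> T \<union> U" using d pure by auto
    ultimately show ?case by (simp add: pure_def summand_other)
  qed (use F(2) in auto)
  then show "mul A I T F (left T y) (I \<union> T) = 0" "mul A T I (left T y) F (T \<union> I) = 0" by auto
qed

lemma (in bimonoid_pair) lower_act:
  assumes I: "finite I" and \<sigma>: "inj_on \<sigma> I" and F: "F \<in> spc A I" "F I = 0"
  shows "act A \<sigma> I F (\<sigma> ` I) = 0"
  using I F(1)
proof (induction rule: A_induct_supp[where X = "- {I}"])
  case zero
  show ?case unfolding linear_on_zero[OF A_act_linear[OF I \<sigma>] cs.subspace_0[OF subspace_A[OF I]]] by (rule zero_fun_apply)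
next
  case (add f g)
  then show ?case unfolding linear_on_add[OF A_act_linear[OF I \<sigma>] add(1,2)] by (intro plus_fun_zero) auto
next
  case (pure U x y)
  moreover have "\<sigma> ` I \<noteq> \<sigma> ` U" using \<sigma> pure by (auto simp: inj_on_image_eq_iff)
  ultimately show ?case by (simp add: act_pure[OF I \<sigma>]) (simp add: pure_def summand_other)
qed (use F(2) in auto)

text \<open>One fixed level: \<open>P\<close> stands for \<open>b\<^sub>(\<^sub>r\<^sub>)\<close>
  and \<open>E\<close> for \<open>d\<^sub>(\<^sub>r\<^sub>)\<close>. The prefix \<open>r\<close>
  refers to \<open>b \<cdot> d\<^sub>(\<^sub>r\<^sub>)\<close> and \<open>f\<close> to the full
  \<open>b \<cdot> d\<close>; both are made of the same tensors, so elements can be compared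
  directly.\<close>

locale interp_level = r: bimonoid_pair b "d\<lparr>spc := E\<rparr>" + f: bimonoid_pair b d + p: bimonoid_hom b d \<pi>
  for b :: "('k::field, 'l, 'v::ab_group_add) hopf_data" and d :: "('k, 'l, 'w::ab_group_add) hopf_data" and E \<pi> +
  fixes P :: "'l set \<Rightarrow> 'v set"
  assumes E: "finite I \<Longrightarrow> E I \<subseteq> spc d I"
    and connected: "connected_unit b"
    and comm: "commutative_monoid d"
    and P_sub: "subspecies b P" and P_comonoid: "species_comonoid (b\<lparr>spc := P\<rparr>)"
    and \<pi>P: "finite I \<Longrightarrow> x \<in> P I \<Longrightarrow> \<pi> I x \<in> E I"
begin

lemma pure_eq: "r.pure U x y = f.pure U x y"
  by (simp add: r.pure_def f.pure_def)

lemma left_incl: "left_incl b d I x = r.left I x"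
  and right_incl: "right_incl b d I y = r.right I y"
  by (simp_all add: left_incl_def right_incl_def r.pure_def)

definition gens where
  "gens I = {left_incl b d I x - right_incl b d I (\<pi> I x) | x. x \<in> positive_part P I}"

abbreviation "N \<equiv> ideal_generated r.A gens"

lemma P_closed: "finite I \<Longrightarrow> P I \<subseteq> spc b I"
  by (rule subspeciesD(1)[OF P_sub])

lemma positive_P: "finite I \<Longrightarrow> positive_part P I \<subseteq> P I"
  using module.subspace_0[OF r.H.ambient[folded module_iff_vector_space] subspeciesD(2)[OF P_sub]]
  by (auto simp: positive_part_def)

interpretation A: species_bimonoid r.A by (rule r.A_bimonoid)
interpretation left: bimonoid_hom b r.A r.left by (rule r.left_hom)
interpretation right: bimonoid_hom "d\<lparr>spc := E\<rparr>" r.A r.right by (rule r.right_hom)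

lemma gen_closed:
  assumes "finite I" "x \<in> P I"
  shows "r.left I x - r.right I (\<pi> I x) \<in> spc r.A I"
  using left.closed[OF assms(1), of x] right.closed[OF assms(1), of "\<pi> I x"] P_closed[OF assms(1)] \<pi>P[OF assms] assms
  by (auto intro!: A.spc_diff)

lemma N_ideal: "monoid_ideal r.A N"
  by (rule A.monoid_ideal_generated) (use positive_P gen_closed in \<open>auto simp: gens_def left_incl right_incl\<close>)

sublocale n: quotient_bimonoid r.A N
  by (intro quotient_bimonoid.intro quotient_monoid.intro quotient_monoid_axioms.intro N_ideal r.A_bimonoid A.species_monoid_axioms)

lemma \<pi>_unt_multiple:
  assumes "x \<in> spc b {}"
  shows "r.left {} x = r.right {} (\<pi> {} x)"
proof -
  have x: "x = scl b (cnt b x) (unt b)" using connected assms by (simp add: connected_unit_def)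
  then have "\<pi> {} x = scl d (cnt b x) (\<pi> {} (unt b))"
    using linear_on_scl[OF p.linear r.H.unt_closed, of "cnt b x"] by simp
  then have "r.right {} (\<pi> {} x) = r.cs (cnt b x) (r.right {} (unt d))"
    using r.pure_simps(4)[of "{}" "unt b" "cnt b x" "unt d"] by (simp add: p.unt)
  moreover have "r.left {} x = r.cs (cnt b x) (r.left {} (unt b))"
    by (subst x) (rule r.pure_simps)
  ultimately show ?thesis by simp
qed

text \<open>In degree \<open>\<emptyset>\<close> elements of \<open>b\<close> are multiples of the
  unit and the difference is already 0. So the relation holds for all of \<open>P\<close>, in
  particular for Sweedler factors of degree \<open>\<emptyset>\<close>, although only the positive
  part enters the generators.\<close>

lemma N_gen:
  assumes I: "finite I" and x: "x \<in> P I"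
  shows "r.left I x - r.right I (\<pi> I x) \<in> N I"
proof (cases "I = {}")
  case True
  then have "r.left I x - r.right I (\<pi> I x) = 0" using \<pi>_unt_multiple x P_closed[of "{}"] by auto
  then show ?thesis using A.amb.subspace_0[OF monoid_idealD(2)[OF N_ideal I]] by simp
next
  case False
  then show ?thesis using x ideal_generated_base[OF I, of gens r.A] by (auto simp: gens_def positive_part_def left_incl right_incl)
qed

text \<open>A union of sets is empty only if both are, so the family that is 0 on
  \<open>\<emptyset>\<close> and everything elsewhere is an ideal, and it contains the generators.
  Hence the counit vanishes on \<open>N {}\<close> and descends to the quotient.\<close>

lemma N_empty: "N {} = {0}"
proof -
  let ?J = "\<lambda>I. if I = {} then {0} else spc r.A I"
  have "monoid_ideal r.A ?J"
    by (rule monoid_idealI[OF A.species_monoid_axioms])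
      (auto simp: A.spc_0 A.amb.subspace_single_0 A.subspace A.act_0 A.act_closed A.mul_closed A.mul_0_left A.mul_0_right split: if_splits)
  then have "N {} \<subseteq> ?J {}"
  proof (rule ideal_generated_least)
    fix I :: "'l set" assume I: "finite I"
    show "gens I \<subseteq> ?J I"
    proof (cases "I = {}")
      case True
      have "\<pi> {} 0 = 0" by (rule linear_on_zero[OF p.linear]) (auto simp: r.H.spc_0)
      then show ?thesis using True by (auto simp: gens_def positive_part_def left_incl right_incl r.pure_simps)
    next
      case False
      then show ?thesis using positive_P[OF I] gen_closed[OF I] by (auto simp: gens_def left_incl right_incl)
    qed
  qed
  then show ?thesis using A.amb.subspace_0[OF monoid_idealD(2)[OF N_ideal, of "{}"]] by auto
qed

text \<open>Both Sweedler factors of \<open>x\<close> can be taken in the subcomonoid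
  \<open>P\<close>, and there \<open>r.left\<close> and \<open>r.right\<close> composed with
  \<open>\<pi>\<close> agree modulo \<open>N\<close>. So the coproducts of the two halves of the
  generator coincide after projection.\<close>

lemma gen_coideal:
  assumes I: "finite I" and x: "x \<in> P I"
  shows "coideal r.A N I (r.left I x - r.right I (\<pi> I x))"
  unfolding coideal_def
proof (intro allI impI)
  fix S T :: "'l set" assume "disj S T \<and> S \<union> T = I"
  then have st: "disj S T" and un: "S \<union> T = I" by auto
  note vf = vector_space_fscale
  let ?F = "\<lambda>x1 x2. tensor fscale fscale (n.q S x1) (n.q T x2)"
  have xb: "x \<in> spc b (S \<union> T)" "x \<in> P (S \<union> T)" "\<pi> (S \<union> T) x \<in> E (S \<union> T)" using x P_closed[OF I] \<pi>P[OF I x] un by auto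
  have lx: "r.left I x \<in> spc r.A I" "r.right I (\<pi> I x) \<in> spc r.A I"
    using left.closed[OF I] right.closed[OF I] xb un by auto
  have bl: "bilinear_on (scl b) (scl b) fscale V W (\<lambda>x1 x2. ?F (r.left S x1) (r.left T x2))" for V W
    by (auto simp: bilinear_on_def linear_on_def r.pure_simps qclass_add qclass_scl tensor_simps qclass_scl[of r.cs] r.scl_A)
  have br: "bilinear_on (scl d) (scl d) fscale V W (\<lambda>x1 x2. ?F (r.right S x1) (r.right T x2))" for V W
    using r.pure_simps(4) by (auto simp: bilinear_on_def linear_on_def r.pure_simps qclass_add qclass_scl tensor_simps qclass_scl[of r.cs] r.scl_A)
  have 1: "sweedler r.A S T ?F (r.left I x) = sweedler b S T (\<lambda>x1 x2. ?F (r.left S x1) (r.left T x2)) x"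
    using left.sweedler[OF st xb(1) vf n.qq_bilinear] un by simp
  have "sweedler r.A S T ?F (r.right I (\<pi> I x)) = sweedler (d\<lparr>spc := E\<rparr>) S T (\<lambda>x1 x2. ?F (r.right S x1) (r.right T x2)) (\<pi> I x)"
    using right.sweedler[OF st _ vf n.qq_bilinear, of "\<pi> I x"] un xb by simp
  \<comment> \<open>Two changes of ambient comonoid: from \<open>E\<close> to \<open>d\<close>,
    because \<open>\<pi>\<close> is a morphism into \<open>d\<close>, and after pulling back along
    \<open>\<pi>\<close> from \<open>b\<close> to \<open>P\<close>, where the relations of
    \<open>N\<close> are available.\<close>
  also have "\<dots> = sweedler d S T (\<lambda>x1 x2. ?F (r.right S x1) (r.right T x2)) (\<pi> (S \<union> T) x)"
    using sweedler_sub[OF f.K.species_comonoid_axioms r.K.species_comonoid_axioms E st xb(3) vf br] un by simp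
  also have "\<dots> = sweedler b S T (\<lambda>x1 x2. ?F (r.right S (\<pi> S x1)) (r.right T (\<pi> T x2))) x"
    by (rule p.sweedler[OF st xb(1) vf br])
  also have "\<dots> = sweedler (b\<lparr>spc := P\<rparr>) S T (\<lambda>x1 x2. ?F (r.right S (\<pi> S x1)) (r.right T (\<pi> T x2))) x"
    by (rule sweedler_sub[OF r.H.species_comonoid_axioms P_comonoid P_closed st xb(2) vf p.bilinear[OF st br]])
  also have "\<dots> = sweedler (b\<lparr>spc := P\<rparr>) S T (\<lambda>x1 x2. ?F (r.left S x1) (r.left T x2)) x"
  proof (rule species_comonoid.sweedler_cong[OF P_comonoid st])
    fix x1 x2 assume h: "x1 \<in> spc (b\<lparr>spc := P\<rparr>) S" "x2 \<in> spc (b\<lparr>spc := P\<rparr>) T"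
    have "n.q S (r.left S x1) = n.q S (r.right S (\<pi> S x1))" "n.q T (r.left T x2) = n.q T (r.right T (\<pi> T x2))"
      using h st by (auto simp: n.q_eq intro!: N_gen[simplified])
    then show "?F (r.right S (\<pi> S x1)) (r.right T (\<pi> T x2)) = ?F (r.left S x1) (r.left T x2)" by simp
  qed (use xb in simp)
  also have "\<dots> = sweedler b S T (\<lambda>x1 x2. ?F (r.left S x1) (r.left T x2)) x"
    by (rule sweedler_sub[OF r.H.species_comonoid_axioms P_comonoid P_closed st xb(2) vf bl, symmetric])
  finally have "sweedler r.A S T ?F (r.left I x) = sweedler r.A S T ?F (r.right I (\<pi> I x))" using 1 by simp
  then show "sweedler r.A S T ?F (r.left I x - r.right I (\<pi> I x)) = 0"
    using linear_on_diff[OF A.ambient A.subspace[OF I] A.sweedler_linear[OF st vf n.qq_bilinear, unfolded un] lx] by simp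
qed

lemma N_coideal: "finite I \<Longrightarrow> x \<in> N I \<Longrightarrow> coideal r.A N I x"
proof -
  assume I: "finite I" and x: "x \<in> N I"
  have "N I \<subseteq> {x\<in>spc r.A I. coideal r.A N I x}"
  proof (rule ideal_generated_least[OF n.monoid_ideal_coideal])
    fix I :: "'l set" assume I: "finite I"
    show "gens I \<subseteq> {x\<in>spc r.A I. coideal r.A N I x}"
      using positive_P[OF I] gen_closed[OF I] gen_coideal[OF I] by (auto simp: gens_def left_incl right_incl)
  qed
  with x show ?thesis by auto
qed

lemma quotient_hom: "bimonoid_hom r.A (quotient r.A N) n.q"
  by (rule n.quotient_hom[OF N_coideal]) (auto simp: N_empty linear_on_zero[OF A.cnt_linear A.spc_0])

section \<open>The extension of \<open>\<pi>\<close> to the product\<close>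

lemma E_hom: "bimonoid_hom (d\<lparr>spc := E\<rparr>) d (\<lambda>I x. x)"
  by (rule sub_inclusion_hom[OF f.K.species_bimonoid_axioms r.K.species_bimonoid_axioms E])

sublocale m: bimonoid_pairing b "d\<lparr>spc := E\<rparr>" d \<pi> "\<lambda>I x. x"
proof -
  interpret e: bimonoid_hom "d\<lparr>spc := E\<rparr>" d "\<lambda>I x. x" by (rule E_hom)
  show "bimonoid_pairing b (d\<lparr>spc := E\<rparr>) d \<pi> (\<lambda>I x. x)"
  proof
    fix S T :: "'l set" and x y assume st: "disj S T" and x: "x \<in> spc b S" and y: "y \<in> spc (d\<lparr>spc := E\<rparr>) T"
    show "mul d S T (\<pi> S x) y = mul d T S y (\<pi> S x)"
      using comm[unfolded commutative_monoid_def, rule_format, of S T "\<pi> S x" y] st p.closed[of S x] x y E[of T] by auto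
  qed
qed

lemma m_hom: "bimonoid_hom r.A d m.pair"
  by (rule m.pair_bimonoid_hom)

lemma m_left: "finite I \<Longrightarrow> x \<in> spc b I \<Longrightarrow> m.pair I (r.left I x) = \<pi> I x"
  using m.pair_pure[of I I x "unt d"] r.K.unt_closed by (simp add: f.K.mul_unt_right p.closed)

lemma m_right: "finite I \<Longrightarrow> y \<in> E I \<Longrightarrow> m.pair I (r.right I y) = y"
  using m.pair_pure[of I "{}" "unt b" y] r.H.unt_closed E[of I] by (auto simp: f.K.mul_unt_left p.unt)

text \<open>Both halves of a generator have the image \<open>\<pi>(x)\<close>. Together with
  \<open>m_right\<close> this shows that the right factor embeds into the quotient, as the
  identification of \<open>\<one> \<cdot> d\<^sub>(\<^sub>r\<^sub>)\<close> with a subspecies of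
  \<open>d\<close> presupposes.\<close>

lemma m_N:
  assumes I: "finite I" and x: "x \<in> N I"
  shows "m.pair I x = 0"
proof -
  interpret mm: bimonoid_hom r.A d m.pair by (rule m_hom)
  have "N I \<subseteq> {x\<in>spc r.A I. m.pair I x \<in> {0}}"
  proof (rule ideal_generated_least[OF mm.monoid_ideal_preimage[OF f.K.monoid_ideal_zero]])
    fix I :: "'l set" assume I: "finite I"
    show "gens I \<subseteq> {x\<in>spc r.A I. m.pair I x \<in> {0}}"
    proof
      fix z assume "z \<in> gens I"
      then obtain x where x: "x \<in> P I" "z = r.left I x - r.right I (\<pi> I x)"
        using positive_P[OF I] by (auto simp: gens_def left_incl right_incl)
      have xb: "x \<in> spc b I" "\<pi> I x \<in> E I" using x P_closed[OF I] \<pi>P[OF I] by auto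
      have "m.pair I z = m.pair I (r.left I x) - m.pair I (r.right I (\<pi> I x))"
        unfolding x using left.closed[OF I xb(1)] right.closed[OF I] xb(2)
        by (intro linear_on_diff[OF A.ambient A.subspace[OF I] mm.linear[OF I]]) auto
      then show "z \<in> {x\<in>spc r.A I. m.pair I x \<in> {0}}"
        using x gen_closed[OF I x(1)] m_left[OF I xb(1)] m_right[OF I xb(2)] by simp
    qed
  qed
  then show ?thesis using x by auto
qed

text \<open>If \<open>P\<close> is all of \<open>b\<close> on the subsets of \<open>I\<close>, every
  left factor can be traded for its image under \<open>\<pi>\<close>, so nothing but the right
  factor survives in the quotient. This is the situation in degree \<open>I\<close> from some level
  on.\<close>

lemma q_eq_right:
  assumes I: "finite I" and PI: "\<And>U. U \<subseteq> I \<Longrightarrow> P U = spc b U" and F: "F \<in> spc r.A I"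
  shows "n.q I F = n.q I (r.right I (m.pair I F))"
proof (rule r.A_eqI[OF I _ _ _ F])
  show "linear_on r.cs fscale (spc r.A I) (n.q I)" using linear_on_qclass[of r.cs] by (simp add: r.scl_A)
  show "linear_on r.cs fscale (spc r.A I) (\<lambda>F. n.q I (r.right I (m.pair I F)))"
    using m.pair_linear[OF I] r.pure_simps[simplified]
    by (auto simp: linear_on_def qclass_add qclass_scl[of r.cs] r.scl_A)
  fix U x y assume 1: "U \<subseteq> I" "x \<in> spc b U" "y \<in> spc (d\<lparr>spc := E\<rparr>) (I - U)"
  have dU: "disj U (I - U)" "U \<union> (I - U) = I" using 1 I by (auto intro: finite_subset)
  have x: "x \<in> P U" using 1 PI by auto
  have \<pi>x: "\<pi> U x \<in> E U" using \<pi>P x dU by auto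
  have lr: "r.left U x \<in> spc r.A U" "r.right U (\<pi> U x) \<in> spc r.A U" "r.right (I - U) y \<in> spc r.A (I - U)"
    using left.closed right.closed dU 1 \<pi>x by auto
  have "r.pure U x y - r.right I (mul d U (I - U) (\<pi> U x) y) =
    mul r.A U (I - U) (r.left U x) (r.right (I - U) y) - mul r.A U (I - U) (r.right U (\<pi> U x)) (r.right (I - U) y)"
    using r.pure_split[OF I 1] right.mul[OF dU(1), of "\<pi> U x" y] \<pi>x 1 dU by simp
  also have "\<dots> = mul r.A U (I - U) (r.left U x - r.right U (\<pi> U x)) (r.right (I - U) y)"
    using dU(1) by (intro linear_on_diff[OF A.ambient A.subspace A.mul_linear_left[OF dU(1) lr(3)] lr(1,2), symmetric]) auto
  also have "\<dots> \<in> N (U \<union> (I - U))"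
    using dU by (intro monoid_idealD(5)[OF N_ideal dU(1) N_gen[OF _ x] lr(3)]) auto
  finally show "n.q I (r.pure U x y) = n.q I (r.right I (m.pair I (r.pure U x y)))"
    using I dU by (simp add: n.q_eq m.pair_pure[OF I 1])
qed

end

subsection \<open>The underlying species of the quotient\<close>

text \<open>Left and right factors of a Cauchy product always commute, and right factors commute
  with each other because \<open>K\<close> is commutative. Centrality provides the commuting images
  from which \<open>\<Phi>\<close> is built as a pairing.\<close>

lemma (in bimonoid_pair) right_central:
  assumes K: "commutative_monoid K" and d: "disj S T" and F: "F \<in> spc A S" and y: "y \<in> spc K T"
  shows "mul A S T F (right T y) = mul A T S (right T y) F"
proof -
  have fin: "finite S" "finite T" and d': "disj T S" using d by auto
  note ry = right_closed[OF fin(2) y]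
  show ?thesis
  proof (rule A_eqI[OF fin(1) A_mul_linear_left[OF d ry] A_mul_linear_right[OF d' ry] _ F])
    fix U x y' assume 1: "U \<subseteq> S" "x \<in> spc H U" "y' \<in> spc K (S - U)"
    have fU: "finite U" using 1 fin finite_subset by blast
    have "mul K (S - U) T y' y = mul K T (S - U) y y'"
      using K[unfolded commutative_monoid_def, rule_format, of "S - U" T y' y] 1 y d by auto
    then show "mul A S T (pure U x y') (right T y) = mul A T S (right T y) (pure U x y')"
      using mul_pure[OF d, of U "{}" x y' "unt H" y] mul_pure[OF d', of "{}" U "unt H" y x y'] 1 y fU
      by (simp add: H.unt_closed H.mul_unt_left H.mul_unt_right)
  qed
qed

lemma cauchy_space_mono:
  assumes "\<And>S. S \<subseteq> I \<Longrightarrow> p S \<subseteq> p' S" "\<And>S. S \<subseteq> I \<Longrightarrow> q (I - S) \<subseteq> q' (I - S)"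
  shows "cauchy_space s1 s2 p q I \<subseteq> cauchy_space s1 s2 p' q' I"
proof
  fix F assume F: "F \<in> cauchy_space s1 s2 p q I"
  have "F S \<in> tensor_space s1 s2 (p' S) (q' (I - S))" if "S \<subseteq> I" for S
    using F that tensor_space_mono[OF assms(1)[OF that] assms(2)[OF that], of s1 s2]
    unfolding cauchy_space_def by (auto split: if_splits)
  moreover have "F S = 0" if "\<not> S \<subseteq> I" for S
    using F that unfolding cauchy_space_def by (auto split: if_splits)
  ultimately show "F \<in> cauchy_space s1 s2 p' q' I" unfolding cauchy_space_def by simp
qed

section \<open>The unitriangular map \<open>\<Phi>\<close>, and the complement in the
  quotient\<close>

context interp_level
begin

abbreviation "J \<equiv> ideal_generated b (positive_part P)"

lemma J_ideal: "monoid_ideal b J"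
  by (rule r.H.monoid_ideal_generated) (use positive_P P_closed in blast)

lemma P_J: "finite U \<Longrightarrow> U \<noteq> {} \<Longrightarrow> P U \<subseteq> J U"
  using ideal_generated_base[of U "positive_part P" b] by (simp add: positive_part_def)

interpretation fA: species_bimonoid f.A by (rule f.A_bimonoid)
interpretation fleft: bimonoid_hom b f.A f.left by (rule f.left_hom)
interpretation fright: bimonoid_hom d f.A f.right by (rule f.right_hom)

text \<open>
  \<open>\<Phi>\<close> extends \<open>x \<mapsto> \<Sum> x\<^sub>1 \<otimes> \<pi>(x\<^sub>2)\<close> linearly over \<open>d\<close>. It is unitriangular for the grading by the
  size of the left factor, and it sends a generator \<open>x \<otimes> 1 - 1 \<otimes> \<pi>(x)\<close> of \<open>N\<close> to
  \<open>\<Sum> (x\<^sub>1 - \<epsilon>(x\<^sub>1)) \<otimes> \<pi>(x\<^sub>2)\<close>, an element of \<open>J \<cdot> d\<close>.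
\<close>

definition \<Phi>\<^sub>b :: "'l set \<Rightarrow> 'v \<Rightarrow> 'l set \<Rightarrow> ('k, 'v, 'w) tensor" where
  "\<Phi>\<^sub>b I x = (\<Sum>U\<in>Pow I. sweedler b U (I - U) (\<lambda>x1 x2. f.pure U x1 (\<pi> (I - U) x2)) x)"

lemma pure_\<pi>_bilinear: "finite T \<Longrightarrow> bilinear_on (scl b) (scl b) r.cs V (spc b T) (\<lambda>x1 x2. f.pure U x1 (\<pi> T x2))"
  using p.linear[of T] by (auto simp: bilinear_on_def linear_on_def f.pure_simps)

lemma pure_\<pi>_closed: "finite I \<Longrightarrow> U \<subseteq> I \<Longrightarrow> x1 \<in> spc b U \<Longrightarrow> x2 \<in> spc b (I - U) \<Longrightarrow> f.pure U x1 (\<pi> (I - U) x2) \<in> spc f.A I"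
  by (intro f.pure_closed p.closed) auto

lemma split: "finite I \<Longrightarrow> U \<subseteq> I \<Longrightarrow> disj U (I - U)" "U \<subseteq> I \<Longrightarrow> U \<union> (I - U) = I"
  by (auto intro: finite_subset)

lemma \<Phi>\<^sub>b_term_closed: "finite I \<Longrightarrow> U \<subseteq> I \<Longrightarrow> x \<in> spc b I \<Longrightarrow> sweedler b U (I - U) (\<lambda>x1 x2. f.pure U x1 (\<pi> (I - U) x2)) x \<in> spc f.A I"
  by (rule r.H.sweedler_closed[OF split(1) _ vector_space_cauchy_scale f.subspace_A pure_\<pi>_closed]) (simp_all add: split(2) del: Un_Diff_cancel)

lemma \<Phi>\<^sub>b_closed: "finite I \<Longrightarrow> x \<in> spc b I \<Longrightarrow> \<Phi>\<^sub>b I x \<in> spc f.A I"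
  unfolding \<Phi>\<^sub>b_def by (intro fA.spc_sum \<Phi>\<^sub>b_term_closed) auto

lemma \<Phi>\<^sub>b_linear: "finite I \<Longrightarrow> linear_on (scl b) r.cs (spc b I) (\<Phi>\<^sub>b I)"
  unfolding \<Phi>\<^sub>b_def
proof (rule linear_on_setsum[OF vector_space_cauchy_scale])
  fix U assume I: "finite I" and "U \<in> Pow I"
  then have U: "U \<subseteq> I" by simp
  show "linear_on (scl b) r.cs (spc b I) (sweedler b U (I - U) (\<lambda>x1 x2. f.pure U x1 (\<pi> (I - U) x2)))"
    using r.H.sweedler_linear[OF split(1)[OF I U] vector_space_cauchy_scale pure_\<pi>_bilinear] I split(2)[OF U] by simp
qed

lemma \<Phi>\<^sub>b_natural:
  assumes I: "finite I" and \<sigma>: "inj_on \<sigma> I" and x: "x \<in> spc b I"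
  shows "\<Phi>\<^sub>b (\<sigma> ` I) (act b \<sigma> I x) = act f.A \<sigma> I (\<Phi>\<^sub>b I x)"
proof -
  let ?t = "\<lambda>U. sweedler b U (I - U) (\<lambda>x1 x2. f.pure U x1 (\<pi> (I - U) x2))"
  have im: "Pow (\<sigma> ` I) = (`) \<sigma> ` Pow I" by (simp add: image_Pow_surj)
  have "\<Phi>\<^sub>b (\<sigma> ` I) (act b \<sigma> I x) = (\<Sum>U\<in>Pow I. sweedler b (\<sigma> ` U) (\<sigma> ` I - \<sigma> ` U)
      (\<lambda>x1 x2. f.pure (\<sigma> ` U) x1 (\<pi> (\<sigma> ` I - \<sigma> ` U) x2)) (act b \<sigma> I x))"
    unfolding \<Phi>\<^sub>b_def im using sum.reindex[OF inj_on_image_Pow[OF \<sigma>]] by simp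
  also have "\<dots> = (\<Sum>U\<in>Pow I. act f.A \<sigma> I (?t U x))"
  proof (rule sum.cong[OF refl])
    fix U assume "U \<in> Pow I"
    then have U: "U \<subseteq> I" by simp
    note s = split(1)[OF I U] split(2)[OF U]
    have i: "inj_on \<sigma> U" "inj_on \<sigma> (I - U)" "inj_on \<sigma> (U \<union> (I - U))" using \<sigma> U s by (auto intro: inj_on_subset)
    have e: "\<sigma> ` I - \<sigma> ` U = \<sigma> ` (I - U)" using \<sigma> U by (simp add: inj_on_image_set_diff[of \<sigma> I])
    have xx: "x \<in> spc b (U \<union> (I - U))" using x s by simp
    have "sweedler b (\<sigma> ` U) (\<sigma> ` (I - U)) (\<lambda>x1 x2. f.pure (\<sigma> ` U) x1 (\<pi> (\<sigma> ` (I - U)) x2)) (act b \<sigma> (U \<union> (I - U)) x) =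
      sweedler b U (I - U) (\<lambda>x1 x2. f.pure (\<sigma> ` U) (act b \<sigma> U x1) (\<pi> (\<sigma> ` (I - U)) (act b \<sigma> (I - U) x2))) x"
      using I by (intro r.H.sweedler_natural[OF s(1) xx i(3) vector_space_cauchy_scale pure_\<pi>_bilinear]) auto
    also have "\<dots> = sweedler b U (I - U) (\<lambda>x1 x2. act f.A \<sigma> I (f.pure U x1 (\<pi> (I - U) x2))) x"
    proof (rule r.H.sweedler_cong[OF s(1) xx])
      fix x1 x2 assume h: "x1 \<in> spc b U" "x2 \<in> spc b (I - U)"
      show "f.pure (\<sigma> ` U) (act b \<sigma> U x1) (\<pi> (\<sigma> ` (I - U)) (act b \<sigma> (I - U) x2)) = act f.A \<sigma> I (f.pure U x1 (\<pi> (I - U) x2))"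
        using f.act_pure[OF I \<sigma> U h(1) p.closed[OF _ h(2)]] p.natural[OF _ i(2) h(2)] I by simp
    qed
    also have "\<dots> = act f.A \<sigma> I (?t U x)"
      by (rule r.H.sweedler_hom[OF s(1) xx vector_space_cauchy_scale f.subspace_A[OF I] pure_\<pi>_closed[OF I U] f.A_act_linear[OF I \<sigma>], symmetric])
    finally show "sweedler b (\<sigma> ` U) (\<sigma> ` I - \<sigma> ` U) (\<lambda>x1 x2. f.pure (\<sigma> ` U) x1 (\<pi> (\<sigma> ` I - \<sigma> ` U) x2)) (act b \<sigma> I x) = act f.A \<sigma> I (?t U x)"
      unfolding e s(2) .
  qed
  also have "\<dots> = act f.A \<sigma> I (\<Phi>\<^sub>b I x)"
    unfolding \<Phi>\<^sub>b_def using x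
    by (intro linear_on_sum[OF vector_space_cauchy_scale f.subspace_A[OF I] f.A_act_linear[OF I \<sigma>], symmetric] \<Phi>\<^sub>b_term_closed[OF I]) auto
  finally show ?thesis .
qed

text \<open>A subset \<open>W\<close> of \<open>I \<union> L\<close> is a pair of subsets
  \<open>I \<inter> W\<close> and \<open>L \<inter> W\<close>. The bimonoid axiom splits the summand
  at \<open>W\<close> accordingly, and multiplicativity of \<open>\<pi>\<close> recombines the right
  factors.\<close>

lemma \<Phi>\<^sub>b_mul:
  assumes d: "disj I L" and x: "x \<in> spc b I" and y: "y \<in> spc b L"
  shows "\<Phi>\<^sub>b (I \<union> L) (mul b I L x y) = mul f.A I L (\<Phi>\<^sub>b I x) (\<Phi>\<^sub>b L y)"
proof -
  have I: "finite I" and L: "finite L" and IL: "finite (I \<union> L)" using d by auto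
  note vc = vector_space_cauchy_scale
  let ?t = "\<lambda>U x. sweedler b U (I - U) (\<lambda>x1 x2. f.pure U x1 (\<pi> (I - U) x2)) x"
  let ?u = "\<lambda>V y. sweedler b V (L - V) (\<lambda>y1 y2. f.pure V y1 (\<pi> (L - V) y2)) y"
  \<comment> \<open>The common value of the summand at \<open>U \<union> V\<close> on the left and
    of the product of the summands at \<open>U\<close> and at \<open>V\<close> on the right.\<close>
  define A where "A U V = sweedler b U (I - U) (\<lambda>x1 x2. sweedler b V (L - V) (\<lambda>y1 y2.
     f.pure (U \<union> V) (mul b U V x1 y1) (mul d (I - U) (L - V) (\<pi> (I - U) x2) (\<pi> (L - V) y2))) y) x" for U V
  have "\<Phi>\<^sub>b (I \<union> L) (mul b I L x y) = (\<Sum>W\<in>Pow (I \<union> L). A (I \<inter> W) (L \<inter> W))"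
    unfolding \<Phi>\<^sub>b_def
  proof (rule sum.cong[OF refl])
    fix W assume "W \<in> Pow (I \<union> L)"
    then have W: "W \<subseteq> I \<union> L" by simp
    note s = split(1)[OF IL W] split(2)[OF W]
    have e: "I \<inter> (I \<union> L - W) = I - I \<inter> W" "L \<inter> (I \<union> L - W) = L - L \<inter> W" "I \<inter> W \<union> L \<inter> W = W" using W by auto
    have e2: "(I - I \<inter> W) \<union> (L - L \<inter> W) = I \<union> L - W" by auto
    have dd: "disj (I \<inter> W) (I - I \<inter> W)" "disj (L \<inter> W) (L - L \<inter> W)" "disj (I - I \<inter> W) (L - L \<inter> W)" using d by auto
    have "sweedler b W (I \<union> L - W) (\<lambda>x1 x2. f.pure W x1 (\<pi> (I \<union> L - W) x2)) (mul b I L x y) =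
      sweedler b (I \<inter> W) (I - I \<inter> W) (\<lambda>x1 x2. sweedler b (L \<inter> W) (L - L \<inter> W) (\<lambda>y1 y2.
        f.pure W (mul b (I \<inter> W) (L \<inter> W) x1 y1) (\<pi> (I \<union> L - W) (mul b (I - I \<inter> W) (L - L \<inter> W) x2 y2))) y) x"
      using r.H.sweedler_mul[OF d s(1) s(2)[symmetric] x y vc pure_\<pi>_bilinear] IL unfolding e by auto
    also have "\<dots> = A (I \<inter> W) (L \<inter> W)"
      unfolding A_def e
    proof (intro r.H.sweedler_cong dd)
      fix x1 x2 y1 y2 assume h: "x2 \<in> spc b (I - I \<inter> W)" "y2 \<in> spc b (L - L \<inter> W)"
      show "f.pure W (mul b (I \<inter> W) (L \<inter> W) x1 y1) (\<pi> (I \<union> L - W) (mul b (I - I \<inter> W) (L - L \<inter> W) x2 y2)) =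
        f.pure W (mul b (I \<inter> W) (L \<inter> W) x1 y1) (mul d (I - I \<inter> W) (L - L \<inter> W) (\<pi> (I - I \<inter> W) x2) (\<pi> (L - L \<inter> W) y2))"
        using p.mul[OF dd(3) h] unfolding e2 by simp
    qed (use x y in \<open>simp_all add: Int_Diff_Un\<close>)
    finally show "sweedler b W (I \<union> L - W) (\<lambda>x1 x2. f.pure W x1 (\<pi> (I \<union> L - W) x2)) (mul b I L x y) = A (I \<inter> W) (L \<inter> W)" .
  qed
  also have "\<dots> = (\<Sum>(U, V)\<in>Pow I \<times> Pow L. A U V)"
    by (rule sum.reindex_bij_witness[of _ "\<lambda>(U, V). U \<union> V" "\<lambda>W. (I \<inter> W, L \<inter> W)"]) (use d in auto)
  also have "\<dots> = (\<Sum>U\<in>Pow I. \<Sum>V\<in>Pow L. A U V)" by (rule sum.cartesian_product[symmetric])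
  also have "\<dots> = (\<Sum>U\<in>Pow I. \<Sum>V\<in>Pow L. mul f.A I L (?t U x) (?u V y))"
  proof (intro sum.cong refl)
    fix U V assume "U \<in> Pow I" "V \<in> Pow L"
    then have U: "U \<subseteq> I" and V: "V \<subseteq> L" by auto
    note sU = split(1)[OF I U] split(2)[OF U] and sV = split(1)[OF L V] split(2)[OF V]
    have xx: "x \<in> spc b (U \<union> (I - U))" and yy: "y \<in> spc b (V \<union> (L - V))" using x y sU sV by auto
    have "mul f.A I L (?t U x) (?u V y) = sweedler b U (I - U) (\<lambda>x1 x2. mul f.A I L (f.pure U x1 (\<pi> (I - U) x2)) (?u V y)) x"
      by (rule r.H.sweedler_hom[OF sU(1) xx vc f.subspace_A[OF I] pure_\<pi>_closed[OF I U] f.A_mul_linear_left[OF d \<Phi>\<^sub>b_term_closed[OF L V y]]])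
    also have "\<dots> = A U V"
      unfolding A_def
    proof (rule r.H.sweedler_cong[OF sU(1) xx])
      fix x1 x2 assume h: "x1 \<in> spc b U" "x2 \<in> spc b (I - U)"
      have "mul f.A I L (f.pure U x1 (\<pi> (I - U) x2)) (?u V y) = sweedler b V (L - V) (\<lambda>y1 y2. mul f.A I L (f.pure U x1 (\<pi> (I - U) x2)) (f.pure V y1 (\<pi> (L - V) y2))) y"
        by (rule r.H.sweedler_hom[OF sV(1) yy vc f.subspace_A[OF L] pure_\<pi>_closed[OF L V] f.A_mul_linear_right[OF d pure_\<pi>_closed[OF I U h]]])
      also have "\<dots> = sweedler b V (L - V) (\<lambda>y1 y2. f.pure (U \<union> V) (mul b U V x1 y1) (mul d (I - U) (L - V) (\<pi> (I - U) x2) (\<pi> (L - V) y2))) y"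
        using f.mul_pure[OF d U V h(1) p.closed[OF _ h(2)] _ p.closed] sU sV by (intro r.H.sweedler_cong[OF sV(1) yy]) auto
      finally show "mul f.A I L (f.pure U x1 (\<pi> (I - U) x2)) (?u V y) =
         sweedler b V (L - V) (\<lambda>y1 y2. f.pure (U \<union> V) (mul b U V x1 y1) (mul d (I - U) (L - V) (\<pi> (I - U) x2) (\<pi> (L - V) y2))) y" .
    qed
    finally show "A U V = mul f.A I L (?t U x) (?u V y)" ..
  qed
  also have "\<dots> = (\<Sum>U\<in>Pow I. mul f.A I L (?t U x) (\<Phi>\<^sub>b L y))"
    unfolding \<Phi>\<^sub>b_def[of L]
    using \<Phi>\<^sub>b_term_closed[OF L _ y] \<Phi>\<^sub>b_term_closed[OF I _ x]
    by (intro sum.cong refl linear_on_sum[OF vc f.subspace_A[OF L] f.A_mul_linear_right[OF d], symmetric]) auto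
  also have "\<dots> = mul f.A I L (\<Phi>\<^sub>b I x) (\<Phi>\<^sub>b L y)"
    unfolding \<Phi>\<^sub>b_def[of I]
    using \<Phi>\<^sub>b_term_closed[OF I _ x]
    by (intro linear_on_sum[OF vc f.subspace_A[OF I] f.A_mul_linear_left[OF d \<Phi>\<^sub>b_closed[OF L y]], symmetric]) auto
  finally show ?thesis .
qed

lemma \<Phi>\<^sub>b_hom: "monoid_hom b f.A \<Phi>\<^sub>b"
proof
  show "\<Phi>\<^sub>b {} (unt b) = unt f.A"
    using r.H.sweedler_unt[OF vector_space_cauchy_scale pure_\<pi>_bilinear[of "{}" "spc b {}" "{}"]]
    by (simp add: \<Phi>\<^sub>b_def p.unt f.unt_A)
qed (auto simp: \<Phi>\<^sub>b_closed \<Phi>\<^sub>b_linear[folded f.scl_A] \<Phi>\<^sub>b_natural \<Phi>\<^sub>b_mul)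

sublocale \<Phi>: monoid_pairing b "d\<lparr>spc := E\<rparr>" f.A \<Phi>\<^sub>b f.right
proof -
  interpret P: monoid_hom b f.A \<Phi>\<^sub>b by (rule \<Phi>\<^sub>b_hom)
  interpret e: bimonoid_hom "d\<lparr>spc := E\<rparr>" f.A f.right
    using bimonoid_hom_comp[OF E_hom f.right_hom] .
  show "monoid_pairing b (d\<lparr>spc := E\<rparr>) f.A \<Phi>\<^sub>b f.right"
  proof
    fix S T :: "'l set" and x y assume st: "disj S T" and x: "x \<in> spc b S" and y: "y \<in> spc (d\<lparr>spc := E\<rparr>) T"
    show "mul f.A S T (\<Phi>\<^sub>b S x) (f.right T y) = mul f.A T S (f.right T y) (\<Phi>\<^sub>b S x)"
      using st x y E[of T] by (intro f.right_central[OF comm st] \<Phi>\<^sub>b_closed) auto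
  qed
qed

text \<open>The summand \<open>U = I\<close> is \<open>x \<otimes> \<pi>(1)\<close>, by
  connectedness, and \<open>\<pi>\<close> preserves the unit. All other summands have a left factor
  of strictly smaller degree.\<close>

lemma \<Phi>\<^sub>b_top:
  assumes I: "finite I" and x: "x \<in> spc b I"
  shows "\<Phi>\<^sub>b I x - f.left I x \<in> {F\<in>spc f.A I. F I = 0}"
proof -
  let ?t = "\<lambda>U. sweedler b U (I - U) (\<lambda>x1 x2. f.pure U x1 (\<pi> (I - U) x2)) x"
  have "?t I = f.left I x"
    using r.H.sweedler_connected_right[OF connected I x vector_space_cauchy_scale pure_\<pi>_bilinear[of "{}"]] by (simp add: p.unt)
  then have "\<Phi>\<^sub>b I x - f.left I x = (\<Sum>U\<in>Pow I - {I}. ?t U)"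
    unfolding \<Phi>\<^sub>b_def using I by (subst sum.remove[of _ I]) auto
  also have "\<dots> \<in> {F\<in>spc f.A I. F I = 0}"
  proof (rule r.cs.subspace_sum[OF f.lower_subspace[OF I]])
    fix U assume "U \<in> Pow I - {I}"
    then have U: "U \<subseteq> I" "U \<noteq> I" by auto
    show "?t U \<in> {F\<in>spc f.A I. F I = 0}"
    proof (rule r.H.sweedler_closed[OF split(1)[OF I U(1)] _ vector_space_cauchy_scale f.lower_subspace[OF I]])
      show "f.pure U x1 (\<pi> (I - U) x2) \<in> {F \<in> spc f.A I. F I = 0}" if "x1 \<in> spc b U" "x2 \<in> spc b (I - U)" for x1 x2
        using pure_\<pi>_closed[OF I U(1) that] U(2) by (simp add: f.pure_def summand_other)
    qed (use x split(2)[OF U(1)] in simp)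
  qed
  finally show ?thesis .
qed

text \<open>The correction to \<open>left U x\<close> consists of terms with left degree strictly
  inside \<open>U\<close>, and multiplying by the right factor \<open>y\<close> keeps them there. A
  component at any other \<open>W\<close> is therefore unchanged.\<close>

lemma \<Phi>_pure:
  assumes I: "finite I" and U: "U \<subseteq> I" and x: "x \<in> spc b U" and y: "y \<in> E (I - U)" and W: "\<not> W \<subset> U"
  shows "\<Phi>.pair I (r.pure U x y) W = r.pure U x y W"
proof -
  have d: "disj U (I - U)" by (rule split(1)[OF I U])
  have yd: "y \<in> spc d (I - U)" using y E I by auto
  let ?G = "\<Phi>\<^sub>b U x - f.left U x"
  have G: "?G \<in> spc f.A U" "?G U = 0" using \<Phi>\<^sub>b_top[OF _ x] d by auto
  note lx = fleft.closed[OF _ x] and lin = f.A_mul_linear_left[OF d f.right_closed[OF _ yd]]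
  have "\<Phi>.pair I (r.pure U x y) = mul f.A U (I - U) (?G + f.left U x) (f.right (I - U) y)"
    using \<Phi>.pair_pure[OF I U x, of y] y by simp
  also have "\<dots> = mul f.A U (I - U) ?G (f.right (I - U) y) + f.pure U x y"
    using linear_on_add[OF lin G(1) lx] d I f.pure_split[OF I U x yd] by simp
  finally have "\<Phi>.pair I (r.pure U x y) = mul f.A U (I - U) ?G (f.right (I - U) y) + f.pure U x y" .
  then have "\<Phi>.pair I (r.pure U x y) W = mul f.A U (I - U) ?G (f.right (I - U) y) W + f.pure U x y W"
    by (simp only: plus_fun_apply)
  then show ?thesis
    unfolding f.lower_mul[OF d G yd W] by (simp add: pure_eq)
qed

text \<open>The leading component survives: with no component of \<open>F\<close> strictly above
  \<open>W\<close>, no other component can contribute a correction at \<open>W\<close>.\<close>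

lemma \<Phi>_top:
  assumes I: "finite I" and F: "F \<in> spc r.A I" and W: "\<And>V. W \<subset> V \<Longrightarrow> F V = 0"
  shows "\<Phi>.pair I F W = F W"
  using I F
proof (induction rule: r.A_induct_supp[where X = "{V. \<not> W \<subset> V}"])
  case zero
  show ?case unfolding linear_on_zero[OF \<Phi>.pair_linear[OF I] r.cs.subspace_0[OF r.subspace_A[OF I]]] ..
next
  case (add f g)
  have "(\<Phi>.pair I f + \<Phi>.pair I g) W = (f + g) W" unfolding plus_fun_apply using add by simp
  then show ?case by (simp only: linear_on_add[OF \<Phi>.pair_linear[OF I] add(1,2)])
next
  case (pure U x y)
  then show ?case by (intro \<Phi>_pure[OF I]) auto
qed (use W in auto)

lemma J_d_ideal: "monoid_ideal f.A (cauchy_space (scl b) (scl d) J (spc d))"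
proof -
  note JD = monoid_idealD[OF J_ideal]
  have sJ: "species (b\<lparr>spc := J\<rparr>)" using J_ideal by (simp add: monoid_ideal_def subspecies_def)
  \<comment> \<open>The species \<open>J \<cdot> d\<close>, consisting of the same tensors as a part
    of \<open>b \<cdot> d\<close>. The ideal property is thereby reduced to pure tensors with left
    factor in \<open>J\<close>, where it is the ideal property of \<open>J\<close>.\<close>
  interpret j: species_pair "b\<lparr>spc := J\<rparr>" d
    by (intro species_pair.intro sJ f.K.species_axioms)
  have spc_j: "spc (cauchy (b\<lparr>spc := J\<rparr>) d) = cauchy_space (scl b) (scl d) J (spc d)" by (simp add: j.spc_A)
  have pj: "j.pure U x y = f.pure U x y" for U x y by (simp add: j.pure_def f.pure_def)
  note j = j.subspace_A[unfolded spc_j] j.A_closedI[unfolded spc_j pj, simplified] j.pure_closed[unfolded spc_j pj, simplified]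
  have sub: "cauchy_space (scl b) (scl d) J (spc d) I \<subseteq> spc f.A I" if "finite I" for I
    unfolding f.spc_A by (rule cauchy_space_mono) (use JD(1) finite_subset[OF _ that] in blast)+
  show ?thesis
  proof (rule monoid_idealI[OF fA.species_monoid_axioms])
    show "module.subspace (scl f.A) (cauchy_space (scl b) (scl d) J (spc d) I)" if "finite I" for I
      unfolding f.scl_A by (rule j(1)[OF that])
    show "act f.A \<sigma> I F \<in> cauchy_space (scl b) (scl d) J (spc d) (\<sigma> ` I)"
      if I: "finite I" and \<sigma>: "inj_on \<sigma> I" and F: "F \<in> cauchy_space (scl b) (scl d) J (spc d) I" for I \<sigma> F
    proof (rule j(2)[OF I linear_on_mono[OF f.A_act_linear[OF I \<sigma>] sub[OF I]] vector_space_cauchy_scale j(1)[OF finite_imageI[OF I]] _ F])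
      fix U x y assume 1: "U \<subseteq> I" "x \<in> J U" "y \<in> spc d (I - U)"
      note s = split(1)[OF I 1(1)]
      have i: "inj_on \<sigma> U" "inj_on \<sigma> (I - U)" using \<sigma> 1(1) by (auto intro: inj_on_subset)
      have e: "\<sigma> ` I - \<sigma> ` U = \<sigma> ` (I - U)" using \<sigma> 1(1) by (simp add: inj_on_image_set_diff[of \<sigma> I])
      have "x \<in> spc b U" using 1 JD(1) s by auto
      then show "act f.A \<sigma> I (f.pure U x y) \<in> cauchy_space (scl b) (scl d) J (spc d) (\<sigma> ` I)"
        using f.act_pure[OF I \<sigma> 1(1) _ 1(3)] 1 I s i JD(3)[OF _ i(1) 1(2)] f.K.act_closed[OF _ i(2) 1(3)]
        by (auto intro!: j(3) simp: e)
    qed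
    show "mul f.A S T F G \<in> cauchy_space (scl b) (scl d) J (spc d) (S \<union> T)"
      if st: "disj S T" and F: "F \<in> spc f.A S" and G: "G \<in> cauchy_space (scl b) (scl d) J (spc d) T" for S T F G
    proof -
      have fin: "finite S" "finite T" "finite (S \<union> T)" using st by auto
      have Gf: "G \<in> spc f.A T" using G sub fin by auto
      note jc = vector_space_cauchy_scale j(1)[OF fin(3)]
      show ?thesis
      proof (rule f.A_closedI[OF fin(1) f.A_mul_linear_left[OF st Gf] jc _ F])
        fix U x y assume 1: "U \<subseteq> S" "x \<in> spc b U" "y \<in> spc d (S - U)"
        note lin = f.A_mul_linear_right[OF st f.pure_closed[OF fin(1) 1]]
        show "mul f.A S T (f.pure U x y) G \<in> cauchy_space (scl b) (scl d) J (spc d) (S \<union> T)"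
        proof (rule j(2)[OF fin(2) linear_on_mono[OF lin sub[OF fin(2)]] jc _ G])
          fix V x' y' assume 2: "V \<subseteq> T" "x' \<in> J V" "y' \<in> spc d (T - V)"
          have x': "x' \<in> spc b V" using 2 JD(1) fin finite_subset by blast
          show "mul f.A S T (f.pure U x y) (f.pure V x' y') \<in> cauchy_space (scl b) (scl d) J (spc d) (S \<union> T)"
            unfolding f.mul_pure[OF st 1(1) 2(1) 1(2,3) x' 2(3)]
            using 1 2 f.mul_parts_closed(2)[OF st 1(1) 2(1) 1(2,3) x' 2(3)]
            by (intro j(3) fin(3) JD(4) f.disj_parts(1)[OF st]) auto
        qed
      qed
    qed
    show "mul f.A S T F G \<in> cauchy_space (scl b) (scl d) J (spc d) (S \<union> T)"
      if st: "disj S T" and F: "F \<in> cauchy_space (scl b) (scl d) J (spc d) S" and G: "G \<in> spc f.A T" for S T F G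
    proof -
      have fin: "finite S" "finite T" "finite (S \<union> T)" using st by auto
      have Ff: "F \<in> spc f.A S" using F sub fin by auto
      note jc = vector_space_cauchy_scale j(1)[OF fin(3)]
      show ?thesis
      proof (rule f.A_closedI[OF fin(2) f.A_mul_linear_right[OF st Ff] jc _ G])
        fix V x' y' assume 1: "V \<subseteq> T" "x' \<in> spc b V" "y' \<in> spc d (T - V)"
        note lin = f.A_mul_linear_left[OF st f.pure_closed[OF fin(2) 1]]
        show "mul f.A S T F (f.pure V x' y') \<in> cauchy_space (scl b) (scl d) J (spc d) (S \<union> T)"
        proof (rule j(2)[OF fin(1) linear_on_mono[OF lin sub[OF fin(1)]] jc _ F])
          fix U x y assume 2: "U \<subseteq> S" "x \<in> J U" "y \<in> spc d (S - U)"
          have x: "x \<in> spc b U" using 2 JD(1) fin finite_subset by blast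
          show "mul f.A S T (f.pure U x y) (f.pure V x' y') \<in> cauchy_space (scl b) (scl d) J (spc d) (S \<union> T)"
            unfolding f.mul_pure[OF st 2(1) 1(1) x 2(3) 1(2,3)]
            using 1 2 f.mul_parts_closed(2)[OF st 2(1) 1(1) x 2(3) 1(2,3)]
            by (intro j(3) fin(3) JD(5) f.disj_parts(1)[OF st]) auto
        qed
      qed
    qed
  qed (rule sub)
qed

text \<open>The summand \<open>U = \<emptyset>\<close> is exactly the subtracted term. In every
  other summand the first Sweedler factor lies in \<open>P U\<close> with \<open>U\<close> nonempty,
  since \<open>P\<close> is a subcomonoid, and hence in \<open>J U\<close>.\<close>

lemma \<Phi>_gen:
  assumes I: "finite I" and x: "x \<in> P I"
  shows "\<Phi>\<^sub>b I x - f.right I (\<pi> I x) \<in> cauchy_space (scl b) (scl d) J (spc d) I"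
proof -
  note Jd = monoid_idealD[OF J_d_ideal, unfolded f.scl_A]
  note JD = monoid_idealD[OF J_ideal]
  let ?t = "\<lambda>U. sweedler b U (I - U) (\<lambda>x1 x2. f.pure U x1 (\<pi> (I - U) x2)) x"
  have xb: "x \<in> spc b I" using x P_closed[OF I] by auto
  have "?t {} = f.right I (\<pi> I x)"
    using r.H.sweedler_connected_left[OF connected I xb vector_space_cauchy_scale pure_\<pi>_bilinear[OF I]] by simp
  then have "\<Phi>\<^sub>b I x - f.right I (\<pi> I x) = (\<Sum>U\<in>Pow I - {{}}. ?t U)"
    unfolding \<Phi>\<^sub>b_def using I by (subst sum.remove[of _ "{}"]) auto
  also have "\<dots> \<in> cauchy_space (scl b) (scl d) J (spc d) I"
  proof (rule r.cs.subspace_sum[OF Jd(2)[OF I]])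
    fix U assume "U \<in> Pow I - {{}}"
    then have U: "U \<subseteq> I" "U \<noteq> {}" by auto
    note s = split(1)[OF I U(1)] split(2)[OF U(1)]
    have xx: "x \<in> P (U \<union> (I - U))" using x s by simp
    have "?t U = sweedler (b\<lparr>spc := P\<rparr>) U (I - U) (\<lambda>x1 x2. f.pure U x1 (\<pi> (I - U) x2)) x"
      using I by (intro sweedler_sub[OF r.H.species_comonoid_axioms P_comonoid P_closed s(1) xx vector_space_cauchy_scale pure_\<pi>_bilinear]) auto
    also have "\<dots> \<in> cauchy_space (scl b) (scl d) J (spc d) I"
    proof (rule species_comonoid.sweedler_closed[OF P_comonoid s(1) _ vector_space_cauchy_scale Jd(2)[OF I]])
      fix x1 x2 assume h: "x1 \<in> spc (b\<lparr>spc := P\<rparr>) U" "x2 \<in> spc (b\<lparr>spc := P\<rparr>) (I - U)"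
      have h1: "x1 \<in> J U" using h(1) P_J[OF _ U(2)] s by auto
      have h2: "\<pi> (I - U) x2 \<in> spc d (I - U)" using h(2) P_closed[of "I - U"] s by (auto intro: p.closed)
      interpret j: species_pair "b\<lparr>spc := J\<rparr>" d
        using J_ideal by (intro species_pair.intro f.K.species_axioms) (simp add: monoid_ideal_def subspecies_def)
      show "f.pure U x1 (\<pi> (I - U) x2) \<in> cauchy_space (scl b) (scl d) J (spc d) I"
        using j.pure_closed[OF I U(1), of x1 "\<pi> (I - U) x2"] h1 h2 by (simp add: j.spc_A j.pure_def f.pure_def)
    qed (use xx in simp)
    finally show "?t U \<in> cauchy_space (scl b) (scl d) J (spc d) I" .
  qed
  finally show ?thesis .
qed

lemma \<Phi>_N:
  assumes I: "finite I" and F: "F \<in> N I"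
  shows "\<Phi>.pair I F \<in> cauchy_space (scl b) (scl d) J (spc d) I"
proof -
  interpret P: monoid_hom r.A f.A \<Phi>.pair by (rule \<Phi>.pair_hom)
  have "N I \<subseteq> {F\<in>spc r.A I. \<Phi>.pair I F \<in> cauchy_space (scl b) (scl d) J (spc d) I}"
  proof (rule ideal_generated_least[OF P.monoid_ideal_preimage[OF J_d_ideal]])
    fix I :: "'l set" assume I: "finite I"
    show "gens I \<subseteq> {F\<in>spc r.A I. \<Phi>.pair I F \<in> cauchy_space (scl b) (scl d) J (spc d) I}"
    proof
      fix z assume "z \<in> gens I"
      then obtain x where x: "x \<in> P I" "z = r.left I x - r.right I (\<pi> I x)"
        using positive_P[OF I] by (auto simp: gens_def left_incl right_incl)
      have xb: "x \<in> spc b I" and \<pi>x: "\<pi> I x \<in> E I" using x P_closed[OF I] \<pi>P[OF I] by auto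
      have u: "unt d \<in> E {}" using r.K.unt_closed by simp
      have "\<Phi>.pair I (r.left I x) = mul f.A I {} (\<Phi>\<^sub>b I x) (unt f.A)"
        using \<Phi>.pair_pure[OF I, of I x "unt d"] xb u by (simp add: f.unt_A)
      then have 1: "\<Phi>.pair I (r.left I x) = \<Phi>\<^sub>b I x" using fA.mul_unt_right[OF I \<Phi>\<^sub>b_closed[OF I xb]] by simp
      have \<pi>d: "f.right I (\<pi> I x) \<in> spc f.A I" using \<pi>x E[OF I] I by (intro fright.closed) auto
      have "\<Phi>.pair I (r.right I (\<pi> I x)) = mul f.A {} I (unt f.A) (f.right I (\<pi> I x))"
        using \<Phi>.pair_pure[OF I, of "{}" "unt b" "\<pi> I x"] \<pi>x r.H.unt_closed \<Phi>.f.unt by simp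
      then have 2: "\<Phi>.pair I (r.right I (\<pi> I x)) = f.right I (\<pi> I x)" using fA.mul_unt_left[OF I \<pi>d] by simp
      have "\<Phi>.pair I z = \<Phi>.pair I (r.left I x) - \<Phi>.pair I (r.right I (\<pi> I x))"
        unfolding x using xb \<pi>x I u
        by (intro linear_on_diff[OF _ _ \<Phi>.pair_linear[OF I]] r.pure_closed r.H.unt_closed r.subspace_A vector_space_cauchy_scale) auto
      then show "z \<in> {F\<in>spc r.A I. \<Phi>.pair I F \<in> cauchy_space (scl b) (scl d) J (spc d) I}"
        using x(2) gen_closed[OF I x(1)] \<Phi>_gen[OF I x(1)] 1 2 by simp
    qed
  qed
  then show ?thesis using F by auto
qed

text \<open>Take \<open>W\<close> maximal in the support of \<open>F\<close>. Unitriangularity gives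
  \<open>\<Phi>(F)\<close> the same component at \<open>W\<close> as \<open>F\<close>; this
  component then lies in \<open>J \<otimes> d\<close> as well as in \<open>C \<otimes> d\<close>,
  and so is 0.\<close>

lemma complement_disjoint:
  assumes C: "subspecies b C" and CJ: "\<And>U. finite U \<Longrightarrow> C U \<inter> J U = {0}"
    and I: "finite I" and F: "F \<in> cauchy_space (scl b) (scl d) C E I" "F \<in> N I"
  shows "F = 0"
proof (rule ccontr)
  assume "F \<noteq> 0"
  have FA: "F \<in> spc r.A I" using F(2) monoid_idealD(1)[OF N_ideal I] by blast
  have comp: "F V \<in> tensor_space (scl b) (scl d) (C V) (E (I - V))" if "V \<subseteq> I" for V
    using F(1) that by (auto simp: cauchy_space_def split: if_splits)
  let ?S = "{V\<in>Pow I. F V \<noteq> 0}"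
  have "\<exists>V. F V \<noteq> 0"
  proof (rule ccontr)
    assume "\<not> (\<exists>V. F V \<noteq> 0)"
    then have "F = 0" by (intro ext) (simp add: zero_fun_apply)
    then show False using \<open>F \<noteq> 0\<close> by simp
  qed
  then have "?S \<noteq> {}" using r.component_0[OF FA] by blast
  moreover have "finite ?S" using I by simp
  ultimately have "\<exists>W\<in>?S. \<forall>V\<in>?S. W \<subseteq> V \<longrightarrow> W = V" by (intro finite_has_maximal)
  then obtain W where W: "W \<in> ?S" "\<And>V. V \<in> ?S \<Longrightarrow> W \<subseteq> V \<Longrightarrow> W = V" by auto
  have top: "F V = 0" if "W \<subset> V" for V
    using W(2)[of V] that r.component_0[OF FA, of V] by blast
  have WI: "W \<subseteq> I" and fW: "finite W" using W(1) I finite_subset by auto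
  have "F W \<in> tensor_space (scl b) (scl d) (J W) (spc d (I - W))"
  proof -
    have "\<Phi>.pair I F W \<in> tensor_space (scl b) (scl d) (J W) (spc d (I - W))"
      using \<Phi>_N[OF I F(2)] WI unfolding cauchy_space_def by (auto split: if_splits)
    moreover have "\<Phi>.pair I F W = F W" by (rule \<Phi>_top[OF I FA]) (rule top)
    ultimately show ?thesis by simp
  qed
  \<comment> \<open>The right factor is enlarged from \<open>E\<close> to \<open>d\<close>, as the
    values of \<open>\<Phi>\<close> are only known to lie in the larger product.\<close>
  moreover have "F W \<in> tensor_space (scl b) (scl d) (C W) (spc d (I - W))"
    using comp[OF WI] tensor_space_mono[of "C W" "C W" "E (I - W)" "spc d (I - W)" "scl b" "scl d"] E[of "I - W"] I by blast
  ultimately have "F W = 0"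
    using tensor_space_disjoint[OF r.H.ambient f.K.ambient subspeciesD(2)[OF C fW] monoid_idealD(2)[OF J_ideal fW] f.K.subspace CJ[OF fW]] I by blast
  then show False using W(1) by blast
qed

text \<open>Modulo \<open>N\<close>, an element of \<open>J\<close> used as a left factor can be
  replaced by lower terms. The elements of \<open>b\<close> with this property form an ideal,
  because lower terms stay lower under multiplication, and it contains the positive part of
  \<open>P\<close>, where the lower term is \<open>right (\<pi> x)\<close>.\<close>

lemma left_J:
  assumes U: "finite U" and x: "x \<in> J U"
  shows "\<exists>i\<in>N U. r.left U x - i \<in> {F\<in>spc r.A U. F U = 0}"
proof -
  interpret A: species_bimonoid r.A by (rule r.A_bimonoid)
  interpret left: bimonoid_hom b r.A r.left by (rule r.left_hom)
  note ND = monoid_idealD[OF N_ideal, unfolded r.scl_A]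
  let ?L = "\<lambda>U. {F\<in>spc r.A U. F U = 0}"
  note L = r.lower_subspace
  let ?X = "\<lambda>U. {x\<in>spc b U. \<exists>i\<in>N U. r.left U x - i \<in> ?L U}"
  have "monoid_ideal b ?X"
  proof (rule monoid_idealI[OF r.H.species_monoid_axioms])
    fix I :: "'l set" assume I: "finite I"
    show "module.subspace (scl b) (?X I)"
      unfolding r.H.amb.subspace_def
    proof (intro conjI ballI allI)
      show "0 \<in> ?X I" using r.H.spc_0[OF I] r.cs.subspace_0[OF ND(2)[OF I]] r.cs.subspace_0[OF L[OF I]]
        by (auto simp: r.pure_simps intro!: bexI[of _ 0])
      show "x + y \<in> ?X I" if xy: "x \<in> ?X I" "y \<in> ?X I" for x y
      proof -
        obtain i j where ij: "i \<in> N I" "j \<in> N I" "r.left I x - i \<in> ?L I" "r.left I y - j \<in> ?L I" using xy by blast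
        have "r.left I (x + y) - (i + j) = (r.left I x - i) + (r.left I y - j)" by (simp add: r.pure_simps)
        also have "\<dots> \<in> ?L I" by (rule r.cs.subspace_add[OF L[OF I] ij(3,4)])
        finally show ?thesis using xy I r.H.spc_add r.cs.subspace_add[OF ND(2)[OF I] ij(1,2)] by blast
      qed
      show "scl b c x \<in> ?X I" if x: "x \<in> ?X I" for c x
      proof -
        obtain i where i: "i \<in> N I" "r.left I x - i \<in> ?L I" using x by blast
        have "r.left I (scl b c x) - r.cs c i = r.cs c (r.left I x - i)"
          unfolding r.pure_simps r.cs.scale_right_diff_distrib ..
        also have "\<dots> \<in> ?L I" by (rule r.cs.subspace_scale[OF L[OF I] i(2)])
        finally show ?thesis using x I r.H.spc_scl r.cs.subspace_scale[OF ND(2)[OF I] i(1)] by blast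
      qed
    qed
  next
    fix I :: "'l set" and \<sigma> :: "'l \<Rightarrow> 'l" and x assume I: "finite I" and \<sigma>: "inj_on \<sigma> I" and x: "x \<in> ?X I"
    obtain i where i: "i \<in> N I" "r.left I x - i \<in> ?L I" using x by blast
    have "r.left (\<sigma> ` I) (act b \<sigma> I x) - act r.A \<sigma> I i = act r.A \<sigma> I (r.left I x - i)"
      using left.natural[OF I \<sigma>, of x] x ND(1)[OF I] i(1) left.closed[OF I, of x]
      by (subst linear_on_diff[OF vector_space_cauchy_scale r.subspace_A[OF I] r.A_act_linear[OF I \<sigma>]]) auto
    also have "\<dots> \<in> ?L (\<sigma> ` I)" using i(2) r.lower_act[OF I \<sigma>] r.A_act_closed[OF I \<sigma>] by blast
    finally show "act b \<sigma> I x \<in> ?X (\<sigma> ` I)" using x r.H.act_closed[OF I \<sigma>] ND(3)[OF I \<sigma> i(1)] by blast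
  next
    fix S T :: "'l set" and x y assume st: "disj S T" and x: "x \<in> spc b S" and y: "y \<in> ?X T"
    have ts: "disj T S" and T: "finite T" using st by auto
    obtain i where i: "i \<in> N T" "r.left T y - i \<in> ?L T" using y by blast
    have lx: "r.left S x \<in> spc r.A S" using st x by (intro left.closed) auto
    have "r.left (S \<union> T) (mul b S T x y) - mul r.A S T (r.left S x) i = mul r.A S T (r.left S x) (r.left T y - i)"
      using left.mul[OF st x, of y] y ND(1)[OF T] i(1) left.closed[OF T, of y]
      by (subst linear_on_diff[OF vector_space_cauchy_scale r.subspace_A[OF T] r.A_mul_linear_right[OF st lx]]) auto
    also have "\<dots> \<in> ?L (S \<union> T)" using i(2) r.lower_left(2)[OF ts _ _ x] r.A_mul_closed[OF st lx] by blast
    finally show "mul b S T x y \<in> ?X (S \<union> T)" using r.H.mul_closed[OF st x] y ND(4)[OF st lx i(1)] by blast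
  next
    fix S T :: "'l set" and x y assume st: "disj S T" and x: "x \<in> ?X S" and y: "y \<in> spc b T"
    have S: "finite S" using st by auto
    obtain i where i: "i \<in> N S" "r.left S x - i \<in> ?L S" using x by blast
    have ly: "r.left T y \<in> spc r.A T" using st y by (intro left.closed) auto
    have "r.left (S \<union> T) (mul b S T x y) - mul r.A S T i (r.left T y) = mul r.A S T (r.left S x - i) (r.left T y)"
      using left.mul[OF st _ y, of x] x ND(1)[OF S] i(1) left.closed[OF S, of x]
      by (subst linear_on_diff[OF vector_space_cauchy_scale r.subspace_A[OF S] r.A_mul_linear_left[OF st ly]]) auto
    also have "\<dots> \<in> ?L (S \<union> T)" using i(2) r.lower_left(1)[OF st _ _ y] r.A_mul_closed[OF st _ ly] by blast
    finally show "mul b S T x y \<in> ?X (S \<union> T)" using r.H.mul_closed[OF st _ y] x ND(5)[OF st i(1) ly] by blast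
  qed auto
  then have "J U \<subseteq> ?X U"
  proof (rule ideal_generated_least)
    fix I :: "'l set" assume I: "finite I"
    show "positive_part P I \<subseteq> ?X I"
    proof
      fix x assume x: "x \<in> positive_part P I"
      show "x \<in> ?X I"
      proof (cases "I = {}")
        case True
        then show ?thesis using x r.H.spc_0[OF I] r.cs.subspace_0[OF ND(2)[OF I]] r.cs.subspace_0[OF L[OF I]]
          by (auto simp: positive_part_def r.pure_simps intro!: bexI[of _ 0])
      next
        case False
        have xP: "x \<in> P I" using x positive_P[OF I] by auto
        have "r.right I (\<pi> I x) \<in> ?L I"
          using False r.right_closed[OF I, of "\<pi> I x"] \<pi>P[OF I xP] by (simp add: r.pure_def summand_other)
        then show ?thesis using xP P_closed[OF I] N_gen[OF I xP] by (intro CollectI conjI bexI[of _ "r.left I x - r.right I (\<pi> I x)"]) auto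
      qed
    qed
  qed
  then show ?thesis using x by blast
qed

text \<open>Split a left factor as \<open>x = c + j\<close>. The part with \<open>c\<close> already
  lies in \<open>C \<cdot> E\<close>, and \<open>left_J\<close> trades the part with
  \<open>j\<close> for terms of smaller left degree, so induction on the size of the left degrees
  terminates.\<close>

lemma complement_spans:
  assumes C: "subspecies b C" and CJ: "\<And>U. finite U \<Longrightarrow> {x + y | x y. x \<in> C U \<and> y \<in> J U} = spc b U"
    and I: "finite I" and F: "F \<in> spc r.A I"
  shows "F \<in> {x + y | x y. x \<in> cauchy_space (scl b) (scl d) C E I \<and> y \<in> N I}"
proof -
  interpret A: species_bimonoid r.A by (rule r.A_bimonoid)
  have sC: "species (b\<lparr>spc := C\<rparr>)" using C by (simp add: subspecies_def)
  interpret c: species_pair "b\<lparr>spc := C\<rparr>" "d\<lparr>spc := E\<rparr>"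
    by (intro species_pair.intro sC r.K.species_axioms)
  have spc_c: "spc (cauchy (b\<lparr>spc := C\<rparr>) (d\<lparr>spc := E\<rparr>)) = cauchy_space (scl b) (scl d) C E" by (simp add: c.spc_A)
  have pc: "c.pure U x y = r.pure U x y" for U x y by (simp add: c.pure_def r.pure_def)
  note ND = monoid_idealD[OF N_ideal, unfolded r.scl_A]
  let ?CE = "cauchy_space (scl b) (scl d) C E I"
  have sCE: "module.subspace r.cs ?CE" using c.subspace_A[OF I] by (simp add: spc_c)
  let ?V = "{x + y | x y. x \<in> ?CE \<and> y \<in> N I}"
  have V: "module.subspace r.cs ?V" by (rule r.cs.subspace_sums[OF sCE ND(2)[OF I]])
  have CV: "x \<in> ?V" if "x \<in> ?CE" for x
    using that r.cs.subspace_0[OF ND(2)[OF I]] by (intro CollectI exI[of _ x] exI[of _ 0]) simp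
  have NV: "x \<in> ?V" if "x \<in> N I" for x
    using that r.cs.subspace_0[OF sCE] by (intro CollectI exI[of _ 0] exI[of _ x]) simp
  \<comment> \<open>The number \<open>n\<close> is a strict bound for the sizes of the left degrees
    in \<open>F\<close>, which makes \<open>n = 0\<close> the case \<open>F = 0\<close>.\<close>
  have "F \<in> ?V" if "F \<in> spc r.A I" "\<And>U. n \<le> card U \<Longrightarrow> F U = 0" for n F
    using that
  proof (induction n arbitrary: F)
    case 0
    then have "F = 0" by (intro ext) (simp add: zero_fun_apply)
    then show ?case using r.cs.subspace_0[OF V] by simp
  next
    case (Suc n)
    show ?case
      using I Suc.prems(1)
    proof (induction rule: r.A_induct_supp[where X = "{U. card U \<le> n}"])
      case (supp U)
      then show ?case using Suc.prems(2) by auto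
    next
      case zero
      show ?case by (rule r.cs.subspace_0[OF V])
    next
      case (add f g)
      then show ?case using r.cs.subspace_add[OF V] by blast
    next
      case (pure U x y)
      have fU: "finite U" using pure I finite_subset by blast
      have d: "disj U (I - U)" "U \<union> (I - U) = I" using split[of I U] pure I by auto
      obtain c j where cj: "x = c + j" "c \<in> C U" "j \<in> J U" using CJ[OF fU] pure by blast
      have jb: "j \<in> spc b U" using cj monoid_idealD(1)[OF J_ideal fU] by blast
      have 1: "r.pure U c y \<in> ?V"
        using CV c.pure_closed[OF I pure(2), of c y] cj pure by (simp add: spc_c pc)
      obtain i where i: "i \<in> N U" "r.left U j - i \<in> {F\<in>spc r.A U. F U = 0}" using left_J[OF fU cj(3)] by blast
      define l where "l = r.left U j - i"
      have l: "l \<in> spc r.A U" "l U = 0" and lj: "r.left U j = i + l" using i by (auto simp: l_def)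
      have iA: "i \<in> spc r.A U" using i ND(1)[OF fU] by blast
      have ry: "r.right (I - U) y \<in> spc r.A (I - U)" using pure d by (intro r.right_closed) auto
      have "r.pure U j y = mul r.A U (I - U) i (r.right (I - U) y) + mul r.A U (I - U) l (r.right (I - U) y)"
        using r.pure_split[OF I pure(2) jb pure(4)] linear_on_add[OF r.A_mul_linear_left[OF d(1) ry] iA l(1)] lj by simp
      moreover have "mul r.A U (I - U) i (r.right (I - U) y) \<in> ?V"
        using NV ND(5)[OF d(1) i(1) ry] d(2) by simp
      \<comment> \<open>The term \<open>l\<close> lies strictly below \<open>U\<close>, and the
        right factor \<open>y\<close> does not raise left degrees. As \<open>U\<close> has at most
        \<open>n\<close> elements, the outer induction hypothesis applies.\<close>
      moreover have "mul r.A U (I - U) l (r.right (I - U) y) \<in> ?V"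
      proof (rule Suc.IH)
        show "mul r.A U (I - U) l (r.right (I - U) y) \<in> spc r.A I" using r.A_mul_closed[OF d(1) l(1) ry] d(2) by simp
        fix W :: "'l set" assume "n \<le> card W"
        then have "\<not> W \<subset> U" using psubset_card_mono[OF fU, of W] pure(1) by auto
        then show "mul r.A U (I - U) l (r.right (I - U) y) W = 0"
          by (rule r.lower_mul[OF d(1) l pure(4)])
      qed
      ultimately have "r.pure U j y \<in> ?V" using r.cs.subspace_add[OF V] by simp
      then show ?case using 1 r.cs.subspace_add[OF V] cj(1) by (simp add: r.pure_simps)
    qed
  qed
  \<comment> \<open>No subset of \<open>I\<close> has more than \<open>card I\<close> elements, so
    this strict bound holds for every \<open>F\<close>.\<close>
  from this[OF F, of "Suc (card I)"] show ?thesis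
    using r.component_0[OF F] card_mono[OF I] by (meson not_less_eq_eq)
qed

lemma complement_bij:
  assumes C: "subspecies b C" "\<And>U. finite U \<Longrightarrow> C U \<inter> J U = {0}"
      "\<And>U. finite U \<Longrightarrow> {x + y | x y. x \<in> C U \<and> y \<in> J U} = spc b U"
    and I: "finite I"
  shows "bij_betw (n.q I) (cauchy_space (scl b) (scl d) C E I) (n.q I ` spc r.A I)"
proof -
  have sC: "species (b\<lparr>spc := C\<rparr>)" using C(1) by (simp add: subspecies_def)
  interpret c: species_pair "b\<lparr>spc := C\<rparr>" "d\<lparr>spc := E\<rparr>"
    by (intro species_pair.intro sC r.K.species_axioms)
  let ?CE = "cauchy_space (scl b) (scl d) C E I"
  have sCE: "module.subspace r.cs ?CE" using c.subspace_A[OF I] by (simp add: c.spc_A)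
  have sub: "?CE \<subseteq> spc r.A I"
    unfolding r.spc_A using subspeciesD(1)[OF C(1)] finite_subset[OF _ I]
    by simp (rule cauchy_space_mono; blast)
  show ?thesis
    unfolding bij_betw_def
  proof
    show "inj_on (n.q I) ?CE"
    proof (rule inj_onI)
      fix F G assume FG: "F \<in> ?CE" "G \<in> ?CE" "n.q I F = n.q I G"
      have "F - G \<in> N I" using FG(3) n.q_eq[OF I] by blast
      then have "F - G = 0"
        using complement_disjoint[OF C(1,2) I r.cs.subspace_diff[OF sCE FG(1,2)]] by blast
      then show "F = G" by simp
    qed
    show "n.q I ` ?CE = n.q I ` spc r.A I"
    proof
      show "n.q I ` spc r.A I \<subseteq> n.q I ` ?CE"
      proof
        fix z assume "z \<in> n.q I ` spc r.A I"
        then obtain F where F: "F \<in> spc r.A I" "z = n.q I F" by blast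
        obtain x y where xy: "F = x + y" "x \<in> ?CE" "y \<in> N I" using complement_spans[OF C(1,3) I F(1)] by blast
        then have "n.q I F = n.q I x" using n.q_eq[OF I, of F x] by simp
        then show "z \<in> n.q I ` ?CE" using F xy by blast
      qed
    qed (use sub in blast)
  qed
qed

end

section \<open>The interpolating family\<close>

lemma connected_unit_image:
  assumes "bimonoid_hom H Q q" "spc Q {} = q {} ` spc H {}" "connected_unit H"
  shows "connected_unit Q"
proof -
  interpret bimonoid_hom H Q q by fact
  show ?thesis
    unfolding connected_unit_def
  proof
    fix a assume "a \<in> spc Q {}"
    then obtain x where x: "x \<in> spc H {}" "a = q {} x" using assms(2) by auto
    have "q {} (scl H (cnt H x) (unt H)) = scl Q (cnt H x) (q {} (unt H))"
      by (rule linear_on_scl[OF linear H.unt_closed]) simp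
    moreover have "scl H (cnt H x) (unt H) = x" using assms(3) x by (simp add: connected_unit_def)
    moreover have "cnt Q a = cnt H x" using x cnt by simp
    ultimately show "a = scl Q (cnt Q a) (unt Q)" using x(2) by (simp only: unt)
  qed
qed

lemma hopf_morphism_closed: "hopf_morphism H K f \<Longrightarrow> finite I \<Longrightarrow> x \<in> spc H I \<Longrightarrow> f I x \<in> spc K I"
  by (auto simp: hopf_morphism_def species_morphism_def)

lemma submonoidI:
  assumes "species_monoid H" "subspecies H M" "unt H \<in> M {}"
    "\<And>S T x y. disj S T \<Longrightarrow> x \<in> M S \<Longrightarrow> y \<in> M T \<Longrightarrow> mul H S T x y \<in> M (S \<union> T)"
  shows "submonoid H M"
proof -
  interpret species_monoid H by fact
  note sub = subspeciesD(1)[OF assms(2), THEN subsetD]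
  have "species_monoid (H\<lparr>spc := M\<rparr>)"
  proof (intro species_monoid.intro species_monoid_axioms.intro)
    show "species (H\<lparr>spc := M\<rparr>)" using assms(2) by (simp add: subspecies_def)
    fix S T :: "'b set" assume st: "disj S T"
    show "bilinear_on (scl (H\<lparr>spc := M\<rparr>)) (scl (H\<lparr>spc := M\<rparr>)) (scl (H\<lparr>spc := M\<rparr>)) (spc (H\<lparr>spc := M\<rparr>) S) (spc (H\<lparr>spc := M\<rparr>) T) (mul (H\<lparr>spc := M\<rparr>) S T)"
      using bilinear_on_mono[OF mul_bilinear[OF st] subspeciesD(1)[OF assms(2)] subspeciesD(1)[OF assms(2)]] st by simp
  qed (simp_all add: assms(3,4) sub mul_natural mul_assoc mul_unt_left mul_unt_right)
  then show ?thesis using assms(2) by (simp add: submonoid_def)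
qed

lemma submonoid_generated_least:
  assumes "submonoid H M" "\<And>K. finite K \<Longrightarrow> G K \<subseteq> M K"
  shows "submonoid_generated H G I \<subseteq> M I"
  using assms unfolding submonoid_generated_def by blast

lemma linear_on_preimage_subspace:
  assumes "vector_space s1" "vector_space s2" "module.subspace s1 V" "module.subspace s2 W" "linear_on s1 s2 V f"
  shows "module.subspace s1 {x\<in>V. f x \<in> W}"
proof -
  interpret v1: vector_space s1 by fact
  interpret v2: vector_space s2 by fact
  have "0 \<in> V" by (rule v1.subspace_0[OF assms(3)])
  then show ?thesis
    using assms(3-5) linear_on_zero[OF assms(5)] unfolding v1.subspace_def v2.subspace_def linear_on_def by simp
qed

section \<open>The standing data and its levels\<close>

locale interp_data =
  fixes b :: "('k::field, 'l, 'v::ab_group_add) hopf_data"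
    and d :: "('k, 'l, 'w::ab_group_add) hopf_data"
    and \<pi> :: "'l set \<Rightarrow> 'v \<Rightarrow> 'w"
    and B :: "nat \<Rightarrow> 'l set \<Rightarrow> 'v set"
    and D :: "nat \<Rightarrow> 'l set \<Rightarrow> 'w set"
    and \<zeta> :: "nat \<Rightarrow> 'l set \<Rightarrow> ((('l set \<Rightarrow> ('k, 'v, 'w) tensor) \<Rightarrow> 'k) \<Rightarrow> 'k) \<Rightarrow> 'l set \<Rightarrow> ('k, 'v, 'w) tensor"
  assumes hopf: "hopf_monoid b" "hopf_monoid d"
    and conn: "connected_species b" "connected_species d"
    and comm: "commutative_monoid d"
    and pi: "hopf_morphism b d \<pi>" "\<And>I. finite I \<Longrightarrow> \<pi> I ` spc b I = spc d I"
    and filt_b: "\<And>r. r \<ge> 1 \<Longrightarrow> subcomonoid b (B r)"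
      "\<And>r I. r \<ge> 1 \<Longrightarrow> finite I \<Longrightarrow> B r I \<subseteq> B (Suc r) I"
      "\<And>n. \<exists>r0. \<forall>r>r0. \<forall>I. finite I \<and> card I \<le> n \<longrightarrow> B r I = spc b I"
      "\<And>I. finite I \<Longrightarrow> positive_part (B 1) I = {0}"
    and filt_d: "\<And>r. r \<ge> 1 \<Longrightarrow> hopf_submonoid d (D r)"
      "\<And>I. finite I \<Longrightarrow> D 1 I = unit_part d I"
      "\<And>r I. r \<ge> 1 \<Longrightarrow> finite I \<Longrightarrow> D r I \<subseteq> D (Suc r) I"
      "\<And>n. \<exists>r0. \<forall>r>r0. \<forall>I. finite I \<and> card I \<le> n \<longrightarrow> D r I = spc d I"
    and pi_filt: "\<And>r I. r \<ge> 1 \<Longrightarrow> finite I \<Longrightarrow> \<pi> I ` B r I \<subseteq> D r I"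
    and sect: "\<And>r. r \<ge> 1 \<Longrightarrow> linear_section (interp_product b d D r) (interp b d \<pi> B D r) (interp_proj b d \<pi> B D r) (\<zeta> r)"
begin

abbreviation "A \<equiv> interp_product b d D"
abbreviation "c \<equiv> interp b d \<pi> B D"
abbreviation "\<theta> \<equiv> interp_proj b d \<pi> B D"
abbreviation "N \<equiv> interp_ideal b d \<pi> B D"

sublocale b: species_bimonoid b using hopf by (simp add: hopf_monoid_def)
sublocale d: species_bimonoid d using hopf by (simp add: hopf_monoid_def)
sublocale p: bimonoid_hom b d \<pi> by (rule bimonoid_hom_of_hopf_morphism[OF pi(1)])

lemma D_bimonoid: "r \<ge> 1 \<Longrightarrow> species_bimonoid (d\<lparr>spc := D r\<rparr>)"
  using filt_d(1) by (simp add: hopf_submonoid_def hopf_monoid_def)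

lemma D_closed: "r \<ge> 1 \<Longrightarrow> finite I \<Longrightarrow> D r I \<subseteq> spc d I"
  using filt_d(1)[of r] subspeciesD(1)[of d "D r" I] by (simp add: hopf_submonoid_def)

lemma level: "r \<ge> 1 \<Longrightarrow> interp_level b d (D r) \<pi> (B r)"
  unfolding interp_level_def interp_level_axioms_def bimonoid_pair_def species_pair_def
  using D_bimonoid[of r] filt_b(1)[of r] pi_filt[of r] D_closed[of r] comm b.connected_unitI[OF conn(1)]
    species_monoid.axioms(1)[OF species_bimonoid.axioms(1)[OF D_bimonoid]]
  by (auto simp: subcomonoid_def b.species_axioms d.species_axioms b.species_bimonoid_axioms d.species_bimonoid_axioms
      p.bimonoid_hom_axioms)

lemma pair_level: "r \<ge> 1 \<Longrightarrow> bimonoid_pair b (d\<lparr>spc := D r\<rparr>)"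
  by (rule interp_level.axioms(1)[OF level])

lemma A_eq: "A r = cauchy b (d\<lparr>spc := D r\<rparr>)"
  by (simp add: interp_product_def)

lemma N_eq: "r \<ge> 1 \<Longrightarrow> N r = ideal_generated (cauchy b (d\<lparr>spc := D r\<rparr>)) (interp_level.gens b d \<pi> (B r))"
  unfolding interp_ideal_def A_eq
  by (intro arg_cong2[of _ _ _ _ ideal_generated] refl ext interp_level.gens_def[OF level, symmetric])

lemma c_eq: "r \<ge> 1 \<Longrightarrow> c r = quotient (cauchy b (d\<lparr>spc := D r\<rparr>)) (ideal_generated (cauchy b (d\<lparr>spc := D r\<rparr>)) (interp_level.gens b d \<pi> (B r)))"
  by (simp add: interp_def N_eq A_eq)

lemma \<theta>_eq: "r \<ge> 1 \<Longrightarrow> \<theta> r I = qclass (scl (cauchy b (d\<lparr>spc := D r\<rparr>))) (ideal_generated (cauchy b (d\<lparr>spc := D r\<rparr>)) (interp_level.gens b d \<pi> (B r)) I)"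
  by (simp add: interp_proj_def N_eq A_eq)

lemma \<theta>_hom: "r \<ge> 1 \<Longrightarrow> bimonoid_hom (A r) (c r) (\<theta> r)"
  using bimonoid_hom_cong[OF interp_level.quotient_hom[OF level]] by (simp add: A_eq c_eq \<theta>_eq)

lemma spc_c: "r \<ge> 1 \<Longrightarrow> spc (c r) I = \<theta> r I ` spc (A r) I"
  by (simp add: A_eq c_eq \<theta>_eq quotient_def)

lemma \<theta>_eq_iff:
  assumes "r \<ge> 1" "finite I"
  shows "\<theta> r I x = \<theta> r I y \<longleftrightarrow> x - y \<in> N r I"
proof -
  interpret l: interp_level b d "D r" \<pi> "B r" by (rule level[OF assms(1)])
  show ?thesis unfolding \<theta>_eq[OF assms(1)] N_eq[OF assms(1)] by (rule l.n.q_eq[OF assms(2)])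
qed

lemma A_bimonoid: "r \<ge> 1 \<Longrightarrow> species_bimonoid (A r)"
  using bimonoid_pair.A_bimonoid[OF pair_level] by (simp add: A_eq)

lemma A_connected: "r \<ge> 1 \<Longrightarrow> connected_unit (A r)"
proof -
  assume r: "r \<ge> 1"
  have "connected_unit (d\<lparr>spc := D r\<rparr>)"
    using d.connected_unitI[OF conn(2)] D_closed[OF r, of "{}"] by (auto simp: connected_unit_def)
  then show ?thesis
    using bimonoid_pair.A_connected[OF pair_level[OF r] b.connected_unitI[OF conn(1)]] by (simp add: A_eq)
qed

lemma A_hopf: "r \<ge> 1 \<Longrightarrow> hopf_monoid (A r)"
  by (rule species_bimonoid.connected_hopf_monoid[OF A_bimonoid A_connected])

lemma c_hopf:
  assumes r: "r \<ge> 1"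
  shows "hopf_monoid (c r)"
proof -
  interpret bimonoid_hom "A r" "c r" "\<theta> r" by (rule \<theta>_hom[OF r])
  show ?thesis
    by (rule K.connected_hopf_monoid[OF connected_unit_image[OF \<theta>_hom[OF r] spc_c[OF r] A_connected[OF r]]])
qed

lemma left_hom: "r \<ge> 1 \<Longrightarrow> bimonoid_hom b (A r) (left_incl b d)"
proof -
  assume r: "r \<ge> 1"
  interpret l: interp_level b d "D r" \<pi> "B r" by (rule level[OF r])
  show ?thesis using l.r.left_hom by (simp add: A_eq l.left_incl[abs_def])
qed

lemma right_hom: "r \<ge> 1 \<Longrightarrow> bimonoid_hom (d\<lparr>spc := D r\<rparr>) (A r) (right_incl b d)"
proof -
  assume r: "r \<ge> 1"
  interpret l: interp_level b d "D r" \<pi> "B r" by (rule level[OF r])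
  show ?thesis using l.r.right_hom by (simp add: A_eq l.right_incl[abs_def])
qed

section \<open>Passage between levels and the carrying maps\<close>

lemma B_mono:
  assumes "1 \<le> r" "r \<le> s" "finite I"
  shows "B r I \<subseteq> B s I"
  using assms(2)
proof (induction s rule: dec_induct)
  case (step n)
  then show ?case using filt_b(2)[of n I] assms by auto
qed simp

lemma D_mono:
  assumes "1 \<le> r" "r \<le> s" "finite I"
  shows "D r I \<subseteq> D s I"
  using assms(2)
proof (induction s rule: dec_induct)
  case (step n)
  then show ?case using filt_d(3)[of n I] assms by auto
qed simp

text \<open>The operations of \<open>A r\<close> and \<open>A s\<close> are different functions,
  since each lift refers to its own right factor. The pairing of \<open>S.left\<close> with the
  restriction of \<open>S.right\<close> is a morphism, and it fixes pure tensors, so it is the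
  inclusion.\<close>

lemma inclusion_hom:
  assumes r: "1 \<le> r" and rs: "r \<le> s"
  shows "bimonoid_hom (A r) (A s) (\<lambda>I x. x)"
proof -
  have s: "1 \<le> s" using r rs by simp
  interpret R: bimonoid_pair b "d\<lparr>spc := D r\<rparr>" by (rule pair_level[OF r])
  interpret S: bimonoid_pair b "d\<lparr>spc := D s\<rparr>" by (rule pair_level[OF s])
  have pure: "R.pure U x y = S.pure U x y" for U x y by (simp add: R.pure_def S.pure_def)
  interpret l: bimonoid_hom b S.A S.left by (rule S.left_hom)
  have "bimonoid_hom (d\<lparr>spc := D r\<rparr>) (d\<lparr>spc := D s\<rparr>) (\<lambda>I x. x)"
    using sub_inclusion_hom[of "d\<lparr>spc := D s\<rparr>" "D r"] D_bimonoid[OF s] D_bimonoid[OF r] D_mono[OF r rs] by simp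
  from bimonoid_hom_comp[OF this S.right_hom]
  interpret g: bimonoid_hom "d\<lparr>spc := D r\<rparr>" S.A S.right .
  interpret m: bimonoid_pairing b "d\<lparr>spc := D r\<rparr>" S.A S.left S.right
  proof
    show "mul S.A U T (S.left U x) (S.right T y) = mul S.A T U (S.right T y) (S.left U x)"
      if "disj U T" "x \<in> spc b U" "y \<in> spc (d\<lparr>spc := D r\<rparr>) T" for U T x y
      using S.left_right[of U T x y] that D_mono[OF r rs, of T] by auto
  qed
  have "m.pair I F = F" if I: "finite I" and F: "F \<in> spc R.A I" for I F
  proof (rule R.A_eqI[OF I m.pair_linear[OF I] _ _ F])
    fix U x y assume 1: "U \<subseteq> I" "x \<in> spc b U" "y \<in> spc (d\<lparr>spc := D r\<rparr>) (I - U)"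
    have "y \<in> spc (d\<lparr>spc := D s\<rparr>) (I - U)" using 1 D_mono[OF r rs, of "I - U"] I by auto
    then show "m.pair I (R.pure U x y) = R.pure U x y"
      using m.pair_pure[OF I 1] S.pure_split[OF I 1(1,2)] by (simp add: pure)
  qed (simp add: linear_on_def S.scl_A)
  then show ?thesis unfolding A_eq by (intro bimonoid_hom_cong[OF m.pair_bimonoid_hom]) auto
qed

text \<open>The elements of \<open>A r\<close> that lie in \<open>N s\<close> form an ideal of
  \<open>A r\<close>. It contains the generators at level \<open>r\<close>, because the filtration
  of \<open>b\<close> is increasing.\<close>

lemma N_mono:
  assumes r: "1 \<le> r" and rs: "r \<le> s" and I: "finite I"
  shows "N r I \<subseteq> N s I"
proof -
  have s: "1 \<le> s" using r rs by simp
  interpret R: interp_level b d "D r" \<pi> "B r" by (rule level[OF r])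
  interpret S: interp_level b d "D s" \<pi> "B s" by (rule level[OF s])
  interpret i: bimonoid_hom R.r.A S.r.A "\<lambda>I x. x" using inclusion_hom[OF r rs] by (simp add: A_eq)
  have "R.N I \<subseteq> {F\<in>spc R.r.A I. F \<in> S.N I}"
  proof (rule ideal_generated_least[OF i.monoid_ideal_preimage[OF S.N_ideal]])
    fix I :: "'l set" assume I: "finite I"
    have "R.gens I \<subseteq> spc R.r.A I"
      using R.positive_P[OF I] R.gen_closed[OF I] by (auto simp: R.gens_def R.left_incl R.right_incl)
    moreover have "R.gens I \<subseteq> S.gens I"
      unfolding R.gens_def S.gens_def using B_mono[OF r rs I] by (auto simp: positive_part_def)
    ultimately show "R.gens I \<subseteq> {F\<in>spc R.r.A I. F \<in> S.N I}"
      using ideal_generated_base[OF I, of S.gens] by blast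
  qed
  then show ?thesis unfolding N_eq[OF r] N_eq[OF s] by blast
qed

lemma \<theta>_hom': "1 \<le> r \<Longrightarrow> r \<le> s \<Longrightarrow> bimonoid_hom (A r) (c s) (\<theta> s)"
  using bimonoid_hom_comp[OF inclusion_hom \<theta>_hom] by simp

text \<open>Two representatives of a class at level \<open>r\<close> differ by an element of
  \<open>N r\<close>, which lies in \<open>N s\<close>; so the section leaves no trace. In effect a
  transition map keeps the element of the product and reads its class at the higher level.\<close>

lemma transition_\<theta>:
  assumes r: "1 \<le> r" and rs: "r \<le> s" and I: "finite I" and x: "x \<in> spc (A r) I"
  shows "transition \<theta> \<zeta> r s I (\<theta> r I x) = \<theta> s I x"
proof -
  have "\<theta> r I x \<in> spc (c r) I" using spc_c[OF r] x by simp
  then have "\<theta> r I (\<zeta> r I (\<theta> r I x)) = \<theta> r I x"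
    using sect[OF r] I by (simp add: linear_section_def)
  then have "\<zeta> r I (\<theta> r I x) - x \<in> N s I"
    using \<theta>_eq_iff[OF r I] N_mono[OF r rs I] by blast
  then show ?thesis using r rs \<theta>_eq_iff[of s I] I by (simp add: transition_def)
qed

lemma transitions_\<theta>:
  assumes r: "1 \<le> r" and I: "finite I" and x: "x \<in> spc (A r) I"
  shows "transitions \<theta> \<zeta> r n I (\<theta> r I x) = \<theta> (r + n) I x"
proof (induction n)
  case (Suc n)
  interpret i: bimonoid_hom "A r" "A (r + n)" "\<lambda>I x. x" using r by (intro inclusion_hom) auto
  have "x \<in> spc (A (r + n)) I" using i.closed[OF I x] .
  then show ?case using Suc r transition_\<theta>[of "r + n" "Suc (r + n)" I x] I by simp
qed simp

lemma port_\<theta>: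
  assumes "1 \<le> r" "r \<le> s" "finite I" "x \<in> spc (A r) I"
  shows "port_between \<theta> \<zeta> r s I (\<theta> r I x) = \<theta> s I x"
  using transitions_\<theta>[OF assms(1,3,4), of "s - r"] assms(2) by (simp add: port_between_def)

lemma left_closed: "1 \<le> r \<Longrightarrow> finite I \<Longrightarrow> x \<in> spc b I \<Longrightarrow> left_incl b d I x \<in> spc (A r) I"
  using bimonoid_hom.axioms(1)[OF left_hom] monoid_hom.closed by blast

lemma right_closed: "1 \<le> r \<Longrightarrow> finite I \<Longrightarrow> y \<in> D r I \<Longrightarrow> right_incl b d I y \<in> spc (A r) I"
  using bimonoid_hom.axioms(1)[OF right_hom] monoid_hom.closed by fastforce

lemma port_from_eq: "1 \<le> r \<Longrightarrow> finite I \<Longrightarrow> x \<in> spc b I \<Longrightarrow> port_from b d \<theta> \<zeta> r I x = \<theta> r I (left_incl b d I x)"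
  by (simp add: port_from_def port_\<theta> left_closed)

lemma port_from_hom: "1 \<le> r \<Longrightarrow> bimonoid_hom b (c r) (port_from b d \<theta> \<zeta> r)"
  by (rule bimonoid_hom_cong[OF bimonoid_hom_comp[OF left_hom \<theta>_hom]]) (auto simp: port_from_eq)

lemma port_hom: "1 \<le> r \<Longrightarrow> r \<le> s \<Longrightarrow> bimonoid_hom (c r) (c s) (port_between \<theta> \<zeta> r s)"
  by (rule bimonoid_hom_factor[OF \<theta>_hom spc_c \<theta>_hom']) (auto simp: port_\<theta>)

text \<open>The map \<open>x \<otimes> y \<mapsto> \<pi>(x) y\<close> on \<open>A r\<close>. It will
  turn out to be the infinite composite from level \<open>r\<close> on, precomposed with the
  projection \<open>\<theta> r\<close>.\<close>

definition M :: "nat \<Rightarrow> 'l set \<Rightarrow> ('l set \<Rightarrow> ('k, 'v, 'w) tensor) \<Rightarrow> 'w" where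
  "M r = monoid_pairing.pair b (d\<lparr>spc := D r\<rparr>) d \<pi> (\<lambda>I x. x)"

lemma M_hom: "r \<ge> 1 \<Longrightarrow> bimonoid_hom (A r) d (M r)"
  using interp_level.m_hom[OF level] by (simp add: M_def A_eq)

lemma M_left: "r \<ge> 1 \<Longrightarrow> finite I \<Longrightarrow> x \<in> spc b I \<Longrightarrow> M r I (left_incl b d I x) = \<pi> I x"
  using interp_level.m_left[OF level] interp_level.left_incl[OF level] by (simp add: M_def)

lemma M_right: "r \<ge> 1 \<Longrightarrow> finite I \<Longrightarrow> y \<in> D r I \<Longrightarrow> M r I (right_incl b d I y) = y"
  using interp_level.m_right[OF level] interp_level.right_incl[OF level] by (simp add: M_def)

lemma M_N: "r \<ge> 1 \<Longrightarrow> finite I \<Longrightarrow> x \<in> N r I \<Longrightarrow> M r I x = 0"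
  using interp_level.m_N[OF level] by (simp add: M_def N_eq)

lemma M_\<theta>:
  assumes r: "r \<ge> 1" and I: "finite I" and xy: "x \<in> spc (A r) I" "y \<in> spc (A r) I" "\<theta> r I x = \<theta> r I y"
  shows "M r I x = M r I y"
proof -
  interpret bimonoid_hom "A r" d "M r" by (rule M_hom[OF r])
  have "M r I (x - y) = 0" using xy(3) \<theta>_eq_iff[OF r I] M_N[OF r I] by blast
  then show ?thesis using linear_on_diff[OF H.ambient H.subspace[OF I] linear[OF I] xy(1,2)] by simp
qed

lemma M_mono:
  assumes r: "1 \<le> r" and rs: "r \<le> s" and I: "finite I" and x: "x \<in> spc (A r) I"
  shows "M s I x = M r I x"
proof -
  have s: "1 \<le> s" using r rs by simp
  interpret R: interp_level b d "D r" \<pi> "B r" by (rule level[OF r])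
  interpret S: interp_level b d "D s" \<pi> "B s" by (rule level[OF s])
  interpret m: bimonoid_hom "A r" d "M s"
    using bimonoid_hom_comp[OF inclusion_hom[OF r rs] M_hom[OF s]] .
  interpret n: bimonoid_hom "A r" d "M r" by (rule M_hom[OF r])
  have x': "x \<in> spc R.r.A I" using x by (simp add: A_eq)
  show ?thesis
  proof (rule R.r.A_eqI[OF I _ _ _ x'])
    show "linear_on R.r.cs (scl d) (spc R.r.A I) (M s I)" using m.linear[OF I] by (simp add: A_eq R.r.scl_A)
    show "linear_on R.r.cs (scl d) (spc R.r.A I) (M r I)" using n.linear[OF I] by (simp add: A_eq R.r.scl_A)
    fix U x y assume 1: "U \<subseteq> I" "x \<in> spc b U" "y \<in> spc (d\<lparr>spc := D r\<rparr>) (I - U)"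
    have 2: "y \<in> spc (d\<lparr>spc := D s\<rparr>) (I - U)" using 1 D_mono[OF r rs, of "I - U"] I by auto
    show "M s I (R.r.pure U x y) = M r I (R.r.pure U x y)"
      using R.m.pair_pure[OF I 1] S.m.pair_pure[OF I 1(1,2) 2] by (simp add: M_def R.pure_eq S.pure_eq)
  qed
qed

text \<open>Existence: once \<open>b\<^sub>(\<^sub>i\<^sub>)\<close> and
  \<open>d\<^sub>(\<^sub>i\<^sub>)\<close> are everything up to the size of \<open>I\<close>,
  \<open>q_eq_right\<close> writes the class as that of a right factor, with value
  \<open>M i I x\<close>. Uniqueness: \<open>M i\<close> is constant on classes and returns
  \<open>y\<close> on the right factor \<open>y\<close>. By \<open>M_mono\<close> the value does not
  depend on \<open>i\<close>.\<close>

lemma port_limit_iff: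
  assumes r: "1 \<le> r" and I: "finite I" and x: "x \<in> spc (A r) I"
  shows "port_limit b d D \<theta> \<zeta> r I (\<theta> r I x) y \<longleftrightarrow> y = M r I x"
proof
  assume "port_limit b d D \<theta> \<zeta> r I (\<theta> r I x) y"
  then obtain i0 where i0: "\<And>i. i \<ge> i0 \<Longrightarrow> y \<in> D i I \<and> port_between \<theta> \<zeta> r i I (\<theta> r I x) = \<theta> i I (right_incl b d I y)"
    by (auto simp: port_limit_def eventually_sequentially)
  \<comment> \<open>A level that is late enough for the eventual equality and not below
    \<open>r\<close>, so that \<open>x\<close> also belongs to \<open>A i\<close>.\<close>
  define i where "i = max i0 r"
  have i: "1 \<le> i" "r \<le> i" "i0 \<le> i" using r by (auto simp: i_def)
  interpret i: bimonoid_hom "A r" "A i" "\<lambda>I x. x" by (rule inclusion_hom[OF r i(2)])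
  have y: "y \<in> D i I" "\<theta> i I x = \<theta> i I (right_incl b d I y)" using i0[OF i(3)] port_\<theta>[OF r i(2) I x] by auto
  have "M i I x = M i I (right_incl b d I y)"
    by (rule M_\<theta>[OF i(1) I i.closed[OF I x] right_closed[OF i(1) I y(1)] y(2)])
  then show "y = M r I x" using M_right[OF i(1) I y(1)] M_mono[OF r i(2) I x] by simp
next
  assume y: "y = M r I x"
  obtain r1 where r1: "\<forall>i>r1. \<forall>K. finite K \<and> card K \<le> card I \<longrightarrow> B i K = spc b K" using filt_b(3)[of "card I"] by blast
  obtain r2 where r2: "\<forall>i>r2. \<forall>K. finite K \<and> card K \<le> card I \<longrightarrow> D i K = spc d K" using filt_d(4)[of "card I"] by blast
  show "port_limit b d D \<theta> \<zeta> r I (\<theta> r I x) y"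
    unfolding port_limit_def eventually_sequentially
  \<comment> \<open>Convergence is assumed strictly beyond the bounds \<open>r1\<close> and
    \<open>r2\<close>, hence the successor; the maximum with \<open>r\<close> keeps the composites
    starting at \<open>r\<close> meaningful.\<close>
  proof (intro exI[of _ "max r (Suc (max r1 r2))"] allI impI)
    fix i assume "max r (Suc (max r1 r2)) \<le> i"
    then have i: "1 \<le> i" "r \<le> i" "r1 < i" "r2 < i" using r by auto
    interpret i: bimonoid_hom "A r" "A i" "\<lambda>I x. x" by (rule inclusion_hom[OF r i(2)])
    interpret l: interp_level b d "D i" \<pi> "B i" by (rule level[OF i(1)])
    interpret M: bimonoid_hom "A r" d "M r" by (rule M_hom[OF r])
    have xi: "x \<in> spc l.r.A I" using i.closed[OF I x] by (simp add: A_eq)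
    have "B i U = spc b U" if "U \<subseteq> I" for U
      using r1 i(3) finite_subset[OF that I] card_mono[OF I that] by blast
    then have "\<theta> i I x = \<theta> i I (right_incl b d I (M i I x))"
      using l.q_eq_right[OF I _ xi] unfolding \<theta>_eq[OF i(1)] M_def l.right_incl by blast
    moreover have "y \<in> D i I" using M.closed[OF I x] r2 i(4) I y by auto
    ultimately show "y \<in> D i I \<and> port_between \<theta> \<zeta> r i I (\<theta> r I x) = \<theta> i I (right_incl b d I y)"
      using port_\<theta>[OF r i(2) I x] M_mono[OF r i(2) I x] y by simp
  qed
qed

lemma port_to_eq: "1 \<le> r \<Longrightarrow> finite I \<Longrightarrow> x \<in> spc (A r) I \<Longrightarrow> port_to b d D \<theta> \<zeta> r I (\<theta> r I x) = M r I x"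
  unfolding port_to_def by (rule the_equality) (simp_all add: port_limit_iff)

lemma port_to_hom: "1 \<le> r \<Longrightarrow> bimonoid_hom (c r) d (port_to b d D \<theta> \<zeta> r)"
  by (rule bimonoid_hom_factor[OF \<theta>_hom spc_c M_hom]) (auto simp: port_to_eq)

text \<open>The positive part of \<open>b\<^sub>(\<^sub>1\<^sub>)\<close> is 0, so all generators at
  level 1 vanish.\<close>

lemma N_1: "finite I \<Longrightarrow> N 1 I \<subseteq> {0}"
proof -
  assume I: "finite I"
  interpret l: interp_level b d "D 1" \<pi> "B 1" by (rule level) simp
  have "ideal_generated l.r.A l.gens I \<subseteq> {0}"
  proof (rule ideal_generated_least[OF l.n.monoid_ideal_zero])
    fix I :: "'l set" assume I: "finite I"
    have "\<pi> I 0 = 0" by (rule linear_on_zero[OF p.linear[OF I] b.spc_0[OF I]])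
    then have "x \<in> positive_part (B 1) I \<Longrightarrow> l.r.left I x - l.r.right I (\<pi> I x) = 0" for x
      unfolding filt_b(4)[OF I] by (auto simp only: singleton_iff l.r.pure_simps(5,6) diff_self)
    then show "l.gens I \<subseteq> {0}"
      unfolding l.gens_def l.left_incl l.right_incl by blast
  qed
  then show ?thesis unfolding N_eq[OF order_refl] .
qed

text \<open>No relations are imposed at level 1, so it remains to compare \<open>b\<close> with
  \<open>b \<cdot> d\<^sub>(\<^sub>1\<^sub>)\<close>. As \<open>d\<^sub>(\<^sub>1\<^sub>)\<close> is
  spanned by the unit in degree \<open>\<emptyset>\<close>, a pure tensor vanishes unless its left
  degree is all of \<open>I\<close>, and then the scalar moves to the left.\<close>

lemma port_1_bij:
  assumes I: "finite I"
  shows "bij_betw (port_from b d \<theta> \<zeta> 1 I) (spc b I) (spc (c 1) I)"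
proof -
  have 1: "(1::nat) \<ge> 1" by simp
  interpret l: interp_level b d "D 1" \<pi> "B 1" by (rule level) simp
  have inj: "inj_on (\<theta> 1 I \<circ> left_incl b d I) (spc b I)"
  proof (rule inj_onI)
    fix x y assume xy: "x \<in> spc b I" "y \<in> spc b I" "(\<theta> 1 I \<circ> left_incl b d I) x = (\<theta> 1 I \<circ> left_incl b d I) y"
    have "left_incl b d I x - left_incl b d I y \<in> N 1 I"
      using xy(3) \<theta>_eq_iff[OF 1 I] by simp
    then have "left_incl b d I x - left_incl b d I y = 0" using N_1[OF I] by blast
    then have "left_incl b d I x I = left_incl b d I y I" by simp
    then have e: "tensor (scl b) (scl d) x (unt d) = tensor (scl b) (scl d) y (unt d)"
      by (simp add: left_incl_def summand_same)
    interpret t: tens "scl b" "scl d" "spc b I" "spc d {}"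
      using tens_species[OF b.species_axioms d.species_axioms I, of "{}"] by simp
    \<comment> \<open>Applying the counit to the right factor recovers \<open>z\<close> from
      \<open>z \<otimes> 1\<close>, which gives injectivity.\<close>
    have bil: "bilinear_on (scl b) (scl d) (scl b) (spc b I) (spc d {}) (\<lambda>x y. scl b (cnt d y) x)"
      using d.cnt_linear by (auto simp: bilinear_on_def linear_on_def b.amb.scale_left_distrib b.amb.scale_right_distrib mult.commute)
    have "tensor_lift (scl b) (scl d) (spc b I) (spc d {}) (\<lambda>x y. scl b (cnt d y) x) (tensor (scl b) (scl d) z (unt d)) = z"
      if "z \<in> spc b I" for z
      using t.TL_tensor[OF b.ambient bil that d.unt_closed] unfolding d.cnt_unt b.amb.scale_one .
    from this[OF xy(1), unfolded e] this[OF xy(2)] show "x = y" by (rule trans[OF sym])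
  qed
  have "spc (A 1) I \<subseteq> left_incl b d I ` spc b I"
  proof
    fix F assume "F \<in> spc (A 1) I"
    then have F: "F \<in> spc l.r.A I" by (simp add: A_eq)
    have sub: "module.subspace l.r.cs (l.r.left I ` spc b I)"
      by (rule linear_on_image_subspace[OF b.ambient vector_space_cauchy_scale b.subspace[OF I] l.r.pure_linear(1)])
    have "F \<in> l.r.left I ` spc b I"
    proof (rule l.r.A_closedI[OF I _ vector_space_cauchy_scale sub _ F, where F = "\<lambda>F. F"])
      show "linear_on l.r.cs l.r.cs (spc l.r.A I) (\<lambda>F. F)" by (simp add: linear_on_def)
      fix U x y assume h: "U \<subseteq> I" "x \<in> spc b U" "y \<in> spc (d\<lparr>spc := D 1\<rparr>) (I - U)"
      have y: "y \<in> unit_part d (I - U)" using h(3) filt_d(2)[of "I - U"] I by simp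
      show "l.r.pure U x y \<in> l.r.left I ` spc b I"
      proof (cases "U = I")
        case True
        then obtain k where k: "y = scl d k (unt d)" using y by (auto simp: unit_part_def d.amb.span_singleton)
        have "l.r.pure I x y = l.r.left I (scl b k x)"
          unfolding k l.r.pure_simps using l.r.pure_simps(4)[of I x k "unt d"] by simp
        then show ?thesis using True h b.spc_scl[OF I] by blast
      next
        case False
        then have "y = 0" using y h by (auto simp: unit_part_def split: if_splits)
        then have "l.r.pure U x y = l.r.left I 0" unfolding l.r.pure_simps(5) by (simp only: l.r.pure_simps(6))
        then show ?thesis using b.spc_0[OF I] by blast
      qed
    qed
    then show "F \<in> left_incl b d I ` spc b I" by (simp add: l.left_incl[abs_def])
  qed
  then have "(\<theta> 1 I \<circ> left_incl b d I) ` spc b I = spc (c 1) I"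
    unfolding spc_c[OF 1] comp_def using left_closed[OF 1 I] by blast
  then have B: "bij_betw (\<theta> 1 I \<circ> left_incl b d I) (spc b I) (spc (c 1) I)"
    using inj unfolding bij_betw_def by blast
  show ?thesis
    by (rule bij_betw_cong[THEN iffD2, OF _ B]) (simp only: port_from_eq[OF 1 I] comp_apply)
qed

text \<open>The elements of \<open>d\<^sub>(\<^sub>s\<^sub>)\<close> whose class is also the class
  of some left factor form a submonoid. It contains \<open>\<pi>(b\<^sub>(\<^sub>s\<^sub>))\<close>
  by the relations, hence all of \<open>d\<^sub>(\<^sub>s\<^sub>)\<close> when these elements
  generate. The class of \<open>x \<otimes> y\<close> is then a product of two classes coming from
  \<open>b\<close>.\<close>

lemma port_from_surj:
  assumes s: "1 \<le> s" and gen: "\<And>I. finite I \<Longrightarrow> D s I = submonoid_generated d (\<lambda>K. \<pi> K ` B s K) I" and I: "finite I"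
  shows "port_from b d \<theta> \<zeta> s I ` spc b I = spc (c s) I"
proof -
  interpret l: interp_level b d "D s" \<pi> "B s" by (rule level[OF s])
  define g where "g I x = \<theta> s I (left_incl b d I x)" for I x
  define h where "h I y = \<theta> s I (right_incl b d I y)" for I y
  interpret t: bimonoid_hom "A s" "c s" "\<theta> s" by (rule \<theta>_hom[OF s])
  interpret g: bimonoid_hom b "c s" g unfolding g_def[abs_def] by (rule bimonoid_hom_comp[OF left_hom[OF s] \<theta>_hom[OF s]])
  interpret h: bimonoid_hom "d\<lparr>spc := D s\<rparr>" "c s" h unfolding h_def[abs_def] by (rule bimonoid_hom_comp[OF right_hom[OF s] \<theta>_hom[OF s]])
  let ?M = "\<lambda>I. {y\<in>D s I. h I y \<in> g I ` spc b I}"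
  have sub: "module.subspace (scl (c s)) (g I ` spc b I)" if "finite I" for I
    by (rule linear_on_image_subspace[OF b.ambient t.K.ambient b.subspace[OF that] g.linear[OF that]])
  have "submonoid d ?M"
  proof (rule submonoidI[OF d.species_monoid_axioms subspeciesI[OF d.species_axioms]])
    show "unt d \<in> ?M {}" using h.unt g.unt b.unt_closed l.r.K.unt_closed by (auto intro!: image_eqI[of _ _ "unt b"])
    fix S T :: "'l set" and y z assume st: "disj S T" and y: "y \<in> ?M S" and z: "z \<in> ?M T"
    obtain x x' where x: "h S y = g S x" "x \<in> spc b S" "h T z = g T x'" "x' \<in> spc b T" using y z by auto
    have "h (S \<union> T) (mul d S T y z) = g (S \<union> T) (mul b S T x x')"
      using h.mul[OF st, of y z] g.mul[OF st x(2,4)] x y z by simp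
    then show "mul d S T y z \<in> ?M (S \<union> T)"
      using b.mul_closed[OF st x(2,4)] l.r.K.mul_closed[OF st, of y z] y z by auto
  next
    fix I :: "'l set" assume I: "finite I"
    show "?M I \<subseteq> spc d I" using D_closed[OF s I] by blast
    show "module.subspace (scl d) (?M I)"
      using linear_on_preimage_subspace[OF d.ambient t.K.ambient l.r.K.subspace[OF I, simplified] sub[OF I], of "h I"] h.linear[OF I] by simp
    fix \<sigma> :: "'l \<Rightarrow> 'l" and y assume \<sigma>: "inj_on \<sigma> I" and y: "y \<in> ?M I"
    obtain x where x: "h I y = g I x" "x \<in> spc b I" using y by auto
    have "h (\<sigma> ` I) (act d \<sigma> I y) = g (\<sigma> ` I) (act b \<sigma> I x)"
      using h.natural[OF I \<sigma>, of y] g.natural[OF I \<sigma> x(2)] x y by simp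
    then show "act d \<sigma> I y \<in> ?M (\<sigma> ` I)"
      using b.act_closed[OF I \<sigma> x(2)] l.r.K.act_closed[OF I \<sigma>, of y] y by auto
  qed
  then have gen_M: "submonoid_generated d (\<lambda>K. \<pi> K ` B s K) I \<subseteq> ?M I" for I
  proof (rule submonoid_generated_least)
    fix K :: "'l set" assume K: "finite K"
    show "\<pi> K ` B s K \<subseteq> ?M K"
    proof
      fix y assume "y \<in> \<pi> K ` B s K"
      then obtain x where x: "x \<in> B s K" "y = \<pi> K x" by auto
      have "\<theta> s K (left_incl b d K x) = \<theta> s K (right_incl b d K (\<pi> K x))"
        using l.N_gen[OF K x(1)] \<theta>_eq_iff[OF s K] by (simp add: l.left_incl l.right_incl N_eq[OF s])
      then have "h K y = g K x" using x by (simp add: g_def h_def)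
      then show "y \<in> ?M K"
        using x l.P_closed[OF K] pi_filt[OF s K] by auto
    qed
  qed
  then have DM: "D s I \<subseteq> ?M I" if "finite I" for I
    using gen[OF that] by blast
  have "\<theta> s I F \<in> g I ` spc b I" if F: "F \<in> spc (A s) I" for F
  proof (rule l.r.A_closedI[where F = "\<theta> s I", OF I _ t.K.ambient sub[OF I]])
    show "linear_on l.r.cs (scl (c s)) (spc l.r.A I) (\<theta> s I)" using t.linear[OF I] by (simp add: A_eq l.r.scl_A)
    show "F \<in> spc l.r.A I" using F by (simp add: A_eq)
    fix U x y assume 1: "U \<subseteq> I" "x \<in> spc b U" "y \<in> spc (d\<lparr>spc := D s\<rparr>) (I - U)"
    have st: "disj U (I - U)" "U \<union> (I - U) = I" using 1 I by (auto intro: finite_subset)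
    obtain x' where x': "h (I - U) y = g (I - U) x'" "x' \<in> spc b (I - U)" using DM[of "I - U"] 1 st by auto
    have "\<theta> s I (l.r.pure U x y) = mul (c s) U (I - U) (g U x) (h (I - U) y)"
      using t.mul[OF st(1), of "left_incl b d U x" "right_incl b d (I - U) y"] l.r.pure_split[OF I 1] st 1
        left_closed[OF s _ 1(2)] right_closed[OF s, of "I - U" y]
      by (simp add: g_def h_def A_eq l.left_incl l.right_incl)
    also have "\<dots> = g I (mul b U (I - U) x x')"
      using g.mul[OF st(1) 1(2) x'(2)] st(2) x'(1) by simp
    finally show "\<theta> s I (l.r.pure U x y) \<in> g I ` spc b I"
      using b.mul_closed[OF st(1) 1(2) x'(2)] st(2) by auto
  qed
  moreover have "port_from b d \<theta> \<zeta> s I ` spc b I = g I ` spc b I"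
    using port_from_eq[OF s I] by (simp add: g_def)
  ultimately show ?thesis using g.closed[OF I] by (auto simp: spc_c[OF s])
qed

end

theorem theorem3p8:
  fixes b :: "('k::field_char_0, 'l::infinite, 'v::ab_group_add) hopf_data"
    and d :: "('k, 'l, 'w::ab_group_add) hopf_data"
    and \<pi> :: "'l set \<Rightarrow> 'v \<Rightarrow> 'w"
    and B :: "nat \<Rightarrow> 'l set \<Rightarrow> 'v set"
    and D :: "nat \<Rightarrow> 'l set \<Rightarrow> 'w set"
    and C :: "nat \<Rightarrow> 'l set \<Rightarrow> 'v set"
    and a :: "'l set \<Rightarrow> 'v \<Rightarrow> 'v"
    and \<zeta> :: "nat \<Rightarrow> 'l set \<Rightarrow> ((('l set \<Rightarrow> ('k, 'v, 'w) tensor) \<Rightarrow> 'k) \<Rightarrow> 'k) \<Rightarrow> 'l set \<Rightarrow> ('k, 'v, 'w) tensor"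
  defines "c \<equiv> interp b d \<pi> B D"
    and "\<theta> \<equiv> interp_proj b d \<pi> B D"
  assumes hopf: "hopf_monoid b" "hopf_monoid d"
    and conn: "connected_species b" "connected_species d"
    and comm: "commutative_monoid d"
    and pi: "hopf_morphism b d \<pi>" "\<And>I. finite I \<Longrightarrow> \<pi> I ` spc b I = spc d I"
    and filt_b: "\<And>r. r \<ge> 1 \<Longrightarrow> subcomonoid b (B r)"
      "\<And>I. finite I \<Longrightarrow> unit_part b I \<subseteq> B 1 I"
      "\<And>r I. r \<ge> 1 \<Longrightarrow> finite I \<Longrightarrow> B r I \<subseteq> B (Suc r) I"
      "\<And>n. \<exists>r0. \<forall>r>r0. \<forall>I. finite I \<and> card I \<le> n \<longrightarrow> B r I = spc b I"
      "\<And>I. finite I \<Longrightarrow> positive_part (B 1) I = {0}"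
    and filt_d: "\<And>r. r \<ge> 1 \<Longrightarrow> hopf_submonoid d (D r)"
      "\<And>I. finite I \<Longrightarrow> D 1 I = unit_part d I"
      "\<And>r I. r \<ge> 1 \<Longrightarrow> finite I \<Longrightarrow> D r I \<subseteq> D (Suc r) I"
      "\<And>n. \<exists>r0. \<forall>r>r0. \<forall>I. finite I \<and> card I \<le> n \<longrightarrow> D r I = spc d I"
    and pi_filt: "\<And>r I. r \<ge> 1 \<Longrightarrow> finite I \<Longrightarrow> \<pi> I ` B r I \<subseteq> D r I"
    and compl: "\<And>r. r \<ge> 1 \<Longrightarrow> subspecies b (C r)"
      "\<And>r I. r \<ge> 1 \<Longrightarrow> finite I \<Longrightarrow> C r I \<inter> ideal_generated b (positive_part (B r)) I = {0}"
      "\<And>r I. r \<ge> 1 \<Longrightarrow> finite I \<Longrightarrow>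
         {x + y | x y. x \<in> C r I \<and> y \<in> ideal_generated b (positive_part (B r)) I} = spc b I"
      "\<And>r s I. 1 \<le> r \<Longrightarrow> r < s \<Longrightarrow> finite I \<Longrightarrow> C s I \<subseteq> C r I"
      "\<And>r I. r \<ge> 1 \<Longrightarrow> finite I \<Longrightarrow> unit_part b I \<subseteq> C r I"
    and antip: "antipode b a" "\<And>r I. r \<ge> 1 \<Longrightarrow> finite I \<Longrightarrow> a I ` B r I \<subseteq> B r I"
    and sect: "\<And>r. r \<ge> 1 \<Longrightarrow> linear_section (interp_product b d D r) (c r) (\<theta> r) (\<zeta> r)"
  defines "port_in \<equiv> port_from b d \<theta> \<zeta>"
    and "port \<equiv> port_between \<theta> \<zeta>"
    and "port_out \<equiv> port_to b d D \<theta> \<zeta>"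
  shows
    \<comment> \<open>the quotients are Hopf monoids, with underlying species \<open>b\<^sup>[\<^sup>r\<^sup>] \<cdot> d\<^sub>(\<^sub>r\<^sub>)\<close>\<close>
    "(\<forall>r\<ge>1. hopf_monoid (c r) \<and> hopf_morphism (interp_product b d D r) (c r) (\<theta> r) \<and>
        (\<forall>I. finite I \<longrightarrow>
          bij_betw (\<theta> r I) (cauchy_space (scl b) (scl d) (C r) (D r) I) (spc (c r) I))) \<and>
    \<comment> \<open>the transition maps do not depend on the sections, and the infinite composites exist\<close>
     (\<forall>r s I. 1 \<le> r \<and> r < s \<and> finite I \<longrightarrow> (\<forall>x\<in>spc (interp_product b d D r) I.
        transition \<theta> \<zeta> r s I (\<theta> r I x) = \<theta> s I x)) \<and>
     (\<forall>r I. 1 \<le> r \<and> finite I \<longrightarrow> (\<forall>x\<in>spc (c r) I. \<exists>!y. port_limit b d D \<theta> \<zeta> r I x y)) \<and>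
    \<comment> \<open>all carrying maps are morphisms of Hopf monoids\<close>
     (\<forall>I. finite I \<longrightarrow> bij_betw (port_in 1 I) (spc b I) (spc (c 1) I)) \<and>
     (\<forall>r\<ge>1. hopf_morphism b (c r) (port_in r)) \<and>
     (\<forall>r s. 1 \<le> r \<and> r < s \<longrightarrow> hopf_morphism (c r) (c s) (port r s)) \<and>
     (\<forall>r\<ge>1. hopf_morphism (c r) d (port_out r)) \<and>
    \<comment> \<open>the compositional identities\<close>
     (\<forall>r s I. 1 \<le> r \<and> r < s \<and> finite I \<longrightarrow>
        (\<forall>x\<in>spc b I. port_in s I x = port r s I (port_in r I x)) \<and>
        (\<forall>x\<in>spc (c r) I. port_out r I x = port_out s I (port r s I x))) \<and>
     (\<forall>r s t I. 1 \<le> r \<and> r < s \<and> s < t \<and> finite I \<longrightarrow>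
        (\<forall>x\<in>spc (c r) I. port r t I x = port s t I (port r s I x))) \<and>
     (\<forall>r I. 1 \<le> r \<and> finite I \<longrightarrow> (\<forall>x\<in>spc b I. \<pi> I x = port_out r I (port_in r I x))) \<and>
    \<comment> \<open>surjectivity; onto \<open>c\<^sup>(\<^sup>s\<^sup>)\<close> it requires that \<open>\<pi>(b\<^sub>(\<^sub>s\<^sub>))\<close> generates \<open>d\<^sub>(\<^sub>s\<^sub>)\<close>\<close>
     (\<forall>r I. 1 \<le> r \<and> finite I \<longrightarrow> port_out r I ` spc (c r) I = spc d I) \<and>
     (\<forall>s\<ge>1. (\<forall>I. finite I \<longrightarrow> D s I = submonoid_generated d (\<lambda>K. \<pi> K ` B s K) I) \<longrightarrow>
        (\<forall>I. finite I \<longrightarrow> port_in s I ` spc b I = spc (c s) I \<and>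
          (\<forall>r. 1 \<le> r \<and> r < s \<longrightarrow> port r s I ` spc (c r) I = spc (c s) I)))"
proof -
  interpret interp_data b d \<pi> B D \<zeta>
    by unfold_locales (fact hopf conn comm pi filt_b filt_d pi_filt sect[unfolded c_def \<theta>_def])+
  have hom: "hopf_morphism b (c r) (port_in r)" "hopf_morphism (c r) d (port_out r)" if "1 \<le> r" for r
    using hopf_morphism_of_bimonoid_hom[OF port_from_hom hopf(1) c_hopf] hopf_morphism_of_bimonoid_hom[OF port_to_hom c_hopf hopf(2)] that
    by (simp_all add: c_def \<theta>_def port_in_def port_out_def)
  have port_hom: "hopf_morphism (c r) (c s) (port r s)" if "1 \<le> r" "r < s" for r s
    using hopf_morphism_of_bimonoid_hom[OF port_hom c_hopf c_hopf] that by (simp add: c_def \<theta>_def port_def)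
  \<comment> \<open>Every element of \<open>c r\<close> is a class \<open>\<theta> r I x\<close>. On
    classes the three kinds of carrying maps have these closed forms, from which the compositional
    identities can be read off.\<close>
  have in_eq: "port_in r I x = \<theta> r I (left_incl b d I x)" if "1 \<le> r" "finite I" "x \<in> spc b I" for r I x
    using port_from_eq that by (simp add: port_in_def \<theta>_def)
  have port_eq: "port r s I (\<theta> r I x) = \<theta> s I x" if "1 \<le> r" "r \<le> s" "finite I" "x \<in> spc (A r) I" for r s I x
    using port_\<theta> that by (simp add: port_def \<theta>_def)
  have out_eq: "port_out r I (\<theta> r I x) = M r I x" if "1 \<le> r" "finite I" "x \<in> spc (A r) I" for r I x
    using port_to_eq that by (simp add: port_out_def \<theta>_def)
  have c: "spc (c r) I = \<theta> r I ` spc (A r) I" if "1 \<le> r" for r I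
    using spc_c that by (simp add: c_def \<theta>_def)
  have up: "x \<in> spc (A s) I" if "1 \<le> r" "r \<le> s" "finite I" "x \<in> spc (A r) I" for r s I x
    using monoid_hom.closed[OF bimonoid_hom.axioms(1)[OF inclusion_hom]] that by blast
  have out_in: "\<pi> I x = port_out r I (port_in r I x)" if "1 \<le> r" "finite I" "x \<in> spc b I" for r I x
    using that by (simp add: in_eq out_eq left_closed M_left)
  have f1: "hopf_monoid (c r) \<and> hopf_morphism (A r) (c r) (\<theta> r) \<and>
    (\<forall>I. finite I \<longrightarrow> bij_betw (\<theta> r I) (cauchy_space (scl b) (scl d) (C r) (D r) I) (spc (c r) I))" if r: "1 \<le> r" for r
  proof -
    interpret l: interp_level b d "D r" \<pi> "B r" by (rule level[OF r])
    have "bij_betw (\<theta> r I) (cauchy_space (scl b) (scl d) (C r) (D r) I) (spc (c r) I)" if I: "finite I" for I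
      using l.complement_bij[OF compl(1)[OF r] compl(2)[OF r] compl(3)[OF r] I] r
      unfolding c[OF r] by (simp add: \<theta>_def \<theta>_eq A_eq)
    then show ?thesis
      using c_hopf[OF r] hopf_morphism_of_bimonoid_hom[OF \<theta>_hom[OF r] A_hopf[OF r] c_hopf[OF r]] by (simp add: c_def \<theta>_def)
  qed
  have f2: "transition \<theta> \<zeta> r s I (\<theta> r I x) = \<theta> s I x" if "1 \<le> r \<and> r < s \<and> finite I" "x \<in> spc (A r) I" for r s I x
    using transition_\<theta> that by (simp add: \<theta>_def)
  have f3: "\<exists>!y. port_limit b d D \<theta> \<zeta> r I x y" if "1 \<le> r \<and> finite I" "x \<in> spc (c r) I" for r I x
    using port_limit_iff that c by (auto simp: \<theta>_def)
  have f4: "bij_betw (port_in 1 I) (spc b I) (spc (c 1) I)" if "finite I" for I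
    using port_1_bij[OF that] by (simp add: port_in_def c_def \<theta>_def)
  have f8a: "port_in s I x = port r s I (port_in r I x)" if "1 \<le> r \<and> r < s \<and> finite I" "x \<in> spc b I" for r s I x
    using that by (simp add: in_eq port_eq left_closed)
  have f8b: "port_out r I x = port_out s I (port r s I x)" if h: "1 \<le> r \<and> r < s \<and> finite I" "x \<in> spc (c r) I" for r s I x
  proof -
    obtain y where y: "y \<in> spc (A r) I" "x = \<theta> r I y" using h c by auto
    then show ?thesis using h up[of r s I y] M_mono[of r s I y] by (simp add: out_eq port_eq)
  qed
  have f9: "port r t I x = port s t I (port r s I x)" if h: "1 \<le> r \<and> r < s \<and> s < t \<and> finite I" "x \<in> spc (c r) I" for r s t I x
  proof -
    obtain y where y: "y \<in> spc (A r) I" "x = \<theta> r I y" using h c by auto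
    then show ?thesis using h up[of r s I y] by (simp add: port_eq)
  qed
  \<comment> \<open>Surjectivity onto \<open>d\<close> is inherited from \<open>\<pi>\<close>
    through its factorization.\<close>
  have f11: "port_out r I ` spc (c r) I = spc d I" if r: "1 \<le> r \<and> finite I" for r I
  proof
    show "port_out r I ` spc (c r) I \<subseteq> spc d I"
      using hopf_morphism_closed[OF hom(2)] r by blast
    show "spc d I \<subseteq> port_out r I ` spc (c r) I"
    proof
      fix y assume "y \<in> spc d I"
      then obtain x where x: "x \<in> spc b I" "y = \<pi> I x" using pi(2) r by blast
      have "port_in r I x \<in> spc (c r) I"
        using hopf_morphism_closed[OF hom(1)] r x by blast
      then show "y \<in> port_out r I ` spc (c r) I" using out_in r x by blast
    qed
  qed
  have f12: "port_in s I ` spc b I = spc (c s) I \<and> (\<forall>r. 1 \<le> r \<and> r < s \<longrightarrow> port r s I ` spc (c r) I = spc (c s) I)"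
    if s: "1 \<le> s" and gen: "\<forall>I. finite I \<longrightarrow> D s I = submonoid_generated d (\<lambda>K. \<pi> K ` B s K) I" and I: "finite I" for s I
  proof -
    have 1: "port_in s I ` spc b I = spc (c s) I"
      using port_from_surj[OF s _ I] gen by (simp add: port_in_def c_def \<theta>_def)
    \<comment> \<open>The map \<open>port_in s\<close> factors through \<open>port r s\<close>, so
      the latter is onto whenever the former is.\<close>
    have "port r s I ` spc (c r) I = spc (c s) I" if r: "1 \<le> r" "r < s" for r
    proof
      show "port r s I ` spc (c r) I \<subseteq> spc (c s) I"
        using hopf_morphism_closed[OF port_hom[OF r] I] by blast
      show "spc (c s) I \<subseteq> port r s I ` spc (c r) I"
      proof
        fix z assume "z \<in> spc (c s) I"
        then obtain x where x: "x \<in> spc b I" "z = port_in s I x" using 1 by blast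
        have "port_in r I x \<in> spc (c r) I"
          using hopf_morphism_closed[OF hom(1)[OF r(1)] I x(1)] .
        moreover have "z = port r s I (port_in r I x)"
          using x r s I by (simp add: in_eq port_eq left_closed)
        ultimately show "z \<in> port r s I ` spc (c r) I" by blast
      qed
    qed
    then show ?thesis using 1 by blast
  qed
  show ?thesis
  proof (intro conjI, goal_cases)
    case 1 show ?case by (intro allI impI f1)
  next
    case 2 show ?case using f2 by blast
  next
    case 3 show ?case using f3 by blast
  next
    case 4 show ?case using f4 by blast
  next
    case 5 show ?case using hom(1) by blast
  next
    case 6 show ?case using port_hom by blast
  next
    case 7 show ?case using hom(2) by blast
  next
    case 8 show ?case using f8a f8b by blast
  next
    case 9 show ?case using f9 by blast
  next
    case 10 show ?case using out_in by blast
  next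
    case 11 show ?case using f11 by blast
  next
    case 12 show ?case
    proof (intro allI impI, goal_cases)
      case (1 s I)
      then show ?case by (rule f12)
    qed
  qed
qed

end
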